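(* Let $A=(a_{i,j})$ be an $r\times r$ symmetrizable generalized Cartan matrix, and let $\mathcal{S}^{\rm BFZ}$, $\mathcal{S}^{\rm prin}$, $\mathcal{S}^{\rm triv}$ be the seed patterns with initial extended mutation matrices $\binom{B_A}{U_A}$, $\binom{B_A}{I_r}$ and $B_A$ respectively. 1) One has ${\rm Spec}(\mathcal{A}_{\mathbb C}(\mathcal{S}^{\rm BFZ},\emptyset))\cong \mathbb{C}^{2r}$; more precisely $\mathcal{A}_{\mathbb C}(\mathcal{S}^{\rm BFZ},\emptyset)\cong\mathbb{C}[z_1,\ldots,z_{2r}]$ where $(z_1,\ldots,z_r)$ is the initial cluster, $(z_{r+1},\ldots,z_{2r})$ is the cluster of the seed obtained from the initial seed by applying $\mu_r\cdots\mu_2\mu_1$, and the frozen variables are $(p_1,\ldots,p_r)$ with $$p_i(z_1,\ldots,z_{2r})=z_iz_{r+i}-\prod_{j=i+1}^r z_j^{-a_{j,i}}\prod_{j=1}^{i-1}z_{r+j}^{-a_{j,i}},\qquad i\in[1,r].$$ The set of frieze points in $\mathbb{C}^{2r}$ is $\{(z_1,\ldots,z_{2r})\in(\mathbb{Z}_{>0})^{2r}: p_i(z_1,\ldots,z_{2r})>0\ \ \forall\, i\in[1,r]\}$. 2) One has ${\rm Spec}(\mathcal{A}_{\mathbb C}(\mathcal{S}^{\rm prin},\emptyset))\cong V^{\rm prin}$, where $V^{\rm prin}$ is the affine subvariety of $\mathbb{C}^{3r}$ defined in the coordinates $(x_1,x_1',\ldots,x_r,x_r',y_1,\ldots,y_r)$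 by the equations $$x_ix_i'=y_i\prod_{j=1}^{i-1}x_j^{-a_{j,i}}+\prod_{j=i+1}^r x_j^{-a_{j,i}},\qquad i\in[1,r]$$ (here $(x_1,\ldots,x_r)$ corresponds to the initial cluster, $(y_1,\ldots,y_r)$ to the frozen variables, and $x_i'$ to the new cluster variable obtained by mutating the initial seed in direction $i$). The set of frieze points in $V^{\rm prin}$ is $V^{\rm prin}\cap(\mathbb{Z}_{>0})^{3r}$. 3) One has ${\rm Spec}(\mathcal{A}_{\mathbb C}(\mathcal{S}^{\rm triv}))\cong V^{\rm triv}\cong W^{\rm triv}$, where $V^{\rm triv}\subset\mathbb{C}^{2r}$ is defined in the coordinates $(z_1,\ldots,z_{2r})$ by $$z_iz_{r+i}=1+\prod_{j=i+1}^r z_j^{-a_{j,i}}\prod_{j=1}^{i-1}z_{r+j}^{-a_{j,i}},\qquad i\in[1,r]$$ (with $(z_1,\ldots,z_r)$ the initial cluster and $(z_{r+1},\ldots,z_{2r})$ the cluster after $\mu_r\cdots\mu_2\mu_1$), and $W^{\rm triv}\subset\mathbb{C}^{2r}$ is defined in the coordinates $(x_1,x_1',\ldots,x_r,x_r')$ by $$x_ix_i'=\prod_{j=1}^{i-1}x_j^{-a_{j,i}}+\prod_{j=i+1}^r x_j^{-a_{j,i}},\qquad i\in[1,r]$$ (with $(x_1,\ldots,x_r)$ the initial cluster and $x_i'$ the new cluster variable obtained by mutating the initial seed in direction $i$). The sets of $\mathcal{S}^{\rm triv}$-frieze points in $V^{\rm triv}$ and $W^{\rm triv}$ are respectively $V^{\rm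 triv}\cap(\mathbb{Z}_{>0})^{2r}$ and $W^{\rm triv}\cap(\mathbb{Z}_{>0})^{2r}$.
   Context: Notation: $[m,n]$ is the set of integers $k$ with $m\le k\le n$; $[a]_+=\max(a,0)$, applied entrywise to integer matrices. For ${\bf a}=(a_1,\dots,a_n)$ and an integer column vector $L=(l_1,\dots,l_n)^T$, ${\bf a}^L=a_1^{l_1}\cdots a_n^{l_n}$. Cluster algebras of geometric type. Let $\mathbb{F}$ be a field of rational functions over $\mathbb{Q}$ in $r+l$ independent variables. A seed of extended rank $(r,l)$ in $\mathbb F$ is $\Sigma=({\bf u},{\bf p},\widetilde B)$, where ${\bf u}=(u_1,\ldots,u_r)$ and ${\bf p}=(p_1,\ldots,p_l)$ together freely generate $\mathbb{F}$ over $\mathbb{Q}$, and $\widetilde B=\binom{B}{P}=(b_{i,j})$ is an $(r+l)\times r$ integer matrix whose top $r\times r$ part $B$ is skew-symmetrizable ($DB$ is skew-symmetric for some diagonal matrix $D$ with positive integer diagonal entries). With $B_k,P_k$ the $k$th columns of $B,P$, the mutation $\mu_k(\Sigma)=({\bf u}',{\bf p},\widetilde B')$, $k\in[1,r]$, has $u'_j=u_j$ for $j\ne k$, $u_ku_k'={\bf u}^{[B_k]_+}{\bf p}^{[P_k]_+}+{\bf u}^{[-B_k]_+}{\bf p}^{[-P_k]_+}$, and $b'_{i,j}=-b_{i,j}$ if $i=k$ or $j=k$, $b'_{i,j}=b_{i,j}+[b_{i,k}]_+[b_{k,j}]_+-[-b_{i,k}]_+[-b_{k,j}]_+$ otherwise.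 Let $\mathbb{T}_r$ be the $r$-regular tree with edges at each vertex labelled by $[1,r]$. A seed pattern $\mathcal{S}=\{\Sigma_t=({\bf u}_t,{\bf p},\widetilde B_t):t\in\mathbb{T}_r\}$ assigns seeds to vertices so that $\Sigma_{t'}=\mu_k(\Sigma_t)$ whenever $t,t'$ are joined by an edge labelled $k$; it is determined by the seed at one vertex $t_0$ (the initial seed). Entries of the ${\bf u}_t$ are cluster variables, entries of ${\bf p}$ are frozen variables, both are called extended cluster variables. $\mathcal{A}_{\mathbb Z}(\mathcal{S},\emptyset)\subset\mathbb{F}$ is the subring generated by all extended cluster variables, and $\mathcal{A}_{\mathbb C}(\mathcal{S},\emptyset)=\mathcal{A}_{\mathbb Z}(\mathcal{S},\emptyset)\otimes_{\mathbb Z}\mathbb{C}$ (frozen variables are not inverted). When there are no frozen variables one writes $\mathcal{A}_{\mathbb C}(\mathcal{S})$. Symmetrizable generalized Cartan matrix: $a_{i,i}=2$, $a_{i,j}\in\mathbb{Z}_{\le 0}$ for $i\neq j$, $a_{i,j}=0$ iff $a_{j,i}=0$, and $DA$ is symmetric for some diagonal $D$ with positive integer diagonal entries. $B_A$ is the $r\times r$ matrix with $(i,j)$ entry $-a_{i,j}$ if $i<j$, $0$ if $i=j$, $a_{i,j}$ if $i>j$. $U_A$ is the upper triangular $r\times r$ matrix with $1$'s on the diagonal and $(i,j)$ entry $a_{i,j}$ for $i<j$. $I_r$ is the identity matrix. Frieze points: for a finitely generated $\mathcal{A}_{\mathbb C}(\mathcal{S},\emptyset)$ and $V={\rm Spec}(\mathcal{A}_{\mathbb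 C}(\mathcal{S},\emptyset))$ (complex points), $v\in V$ is a($n$ $\mathcal{S}$-)frieze point if every extended cluster variable of $\mathcal{S}$ takes a positive integer value at $v$. Frieze points in the models $\mathbb{C}^{2r},V^{\rm prin},V^{\rm triv},W^{\rm triv}$ are understood via the stated isomorphisms. *)

theory Defs
  imports "HOL-Algebra.Algebraic_Closure_Type" "HOL-Algebra.Generated_Rings" "HOL-Algebra.QuotRing"
    "HOL-Library.Poly_Mapping" "HOL-Library.FuncSet"
    "HOL.Complex"
begin

section \<open>Multivariate polynomials\<close>

text \<open>A polynomial in variables of type \<open>'v\<close> is a finitely supported map from monomials
  (finitely supported exponent maps) to coefficients.\<close>

type_synonym ('v, 'c) mpol = "('v \<Rightarrow>\<^sub>0 nat) \<Rightarrow>\<^sub>0 'c"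

definition mpols :: "'v set \<Rightarrow> ('v, 'c::zero) mpol set" where
  "mpols I = {P. \<forall>m \<in> Poly_Mapping.keys P. Poly_Mapping.keys m \<subseteq> I}"

definition mvar :: "'v \<Rightarrow> ('v, 'c::zero_neq_one) mpol" where
  "mvar i = Poly_Mapping.single (Poly_Mapping.single i 1) 1"

definition mconst :: "'c::zero \<Rightarrow> ('v, 'c) mpol" where
  "mconst c = Poly_Mapping.single 0 c"

text \<open>Evaluation at the point \<open>w\<close>, the coefficients being mapped along \<open>h\<close>.\<close>

definition meval :: "('c::zero \<Rightarrow> 'a::comm_ring_1) \<Rightarrow> ('v \<Rightarrow> 'a) \<Rightarrow> ('v, 'c) mpol \<Rightarrow> 'a" where
  "meval h w P = (\<Sum>m \<in> Poly_Mapping.keys P.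
      h (Poly_Mapping.lookup P m) * (\<Prod>i \<in> Poly_Mapping.keys m. w i ^ Poly_Mapping.lookup m i))"

abbreviation ceval :: "('v \<Rightarrow> complex) \<Rightarrow> ('v, complex) mpol \<Rightarrow> complex" where
  "ceval \<equiv> meval (\<lambda>c. c)"

definition mpol_ring :: "'v set \<Rightarrow> ('v, complex) mpol ring" where
  "mpol_ring I = ring_of_type_algebra \<lparr>carrier := mpols I\<rparr>"

section \<open>Cluster algebras of geometric type\<close>

text \<open>Clusters are indexed by \<open>{1..r}\<close>, frozen variables by \<open>{1..l}\<close>; the extended mutation
  matrix has rows \<open>{1..r+l}\<close> (the last \<open>l\<close> of them belonging to the frozen variables) and
  columns \<open>{1..r}\<close>.  Values outside these ranges play no role.\<close>

record 'f seed =
  cluster :: "nat \<Rightarrow> 'f"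
  frozen :: "nat \<Rightarrow> 'f"
  exmat :: "nat \<Rightarrow> nat \<Rightarrow> int"

text \<open>\<open>F\<close> is a subfield of the ambient field \<open>'f\<close>, given as a set so that its transcendence
  degree may vary with \<open>n\<close>; the second conjunct says that it is the field generated by
  \<open>w 1, \<dots>, w n\<close> over the rationals.\<close>

definition freely_generates :: "nat \<Rightarrow> (nat \<Rightarrow> 'f::field_char_0) \<Rightarrow> 'f set \<Rightarrow> bool" where
  "freely_generates n w F \<longleftrightarrow>
     (\<forall>P \<in> mpols {1..n}. meval of_rat w P = 0 \<longrightarrow> P = 0) \<and>
     F = {meval of_rat w P / meval of_rat w Q | P Q.
            P \<in> mpols {1..n} \<and> Q \<in> mpols {1..n} \<and> Q \<noteq> 0}"

definition extended_cluster :: "nat \<Rightarrow> 'f seed \<Rightarrow> nat \<Rightarrow> 'f" where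
  "extended_cluster r \<Sigma> i = (if i \<le> r then cluster \<Sigma> i else frozen \<Sigma> (i - r))"

definition skew_symmetrizable :: "nat \<Rightarrow> (nat \<Rightarrow> nat \<Rightarrow> int) \<Rightarrow> bool" where
  "skew_symmetrizable r B \<longleftrightarrow>
     (\<exists>D :: nat \<Rightarrow> int. (\<forall>i\<in>{1..r}. D i > 0) \<and>
        (\<forall>i\<in>{1..r}. \<forall>j\<in>{1..r}. D i * B i j = - (D j * B j i)))"

definition is_seed :: "nat \<Rightarrow> nat \<Rightarrow> 'f::field_char_0 set \<Rightarrow> 'f seed \<Rightarrow> bool" where
  "is_seed r l F \<Sigma> \<longleftrightarrow>
     freely_generates (r + l) (extended_cluster r \<Sigma>) F \<and> skew_symmetrizable r (exmat \<Sigma>)"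

definition ppart :: "int \<Rightarrow> int" where
  "ppart a = max a 0"

definition mutate_mat :: "nat \<Rightarrow> (nat \<Rightarrow> nat \<Rightarrow> int) \<Rightarrow> nat \<Rightarrow> nat \<Rightarrow> int" where
  "mutate_mat k b i j =
     (if i = k \<or> j = k then - b i j
      else b i j + ppart (b i k) * ppart (b k j) - ppart (- b i k) * ppart (- b k j))"

definition is_mutation :: "nat \<Rightarrow> nat \<Rightarrow> nat \<Rightarrow> 'f::field_char_0 seed \<Rightarrow> 'f seed \<Rightarrow> bool" where
  "is_mutation r l k \<Sigma> \<Sigma>' \<longleftrightarrow>
     (\<forall>j\<in>{1..r}. j \<noteq> k \<longrightarrow> cluster \<Sigma>' j = cluster \<Sigma> j) \<and>
     cluster \<Sigma> k * cluster \<Sigma>' k =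
       (\<Prod>i=1..r. cluster \<Sigma> i ^ nat (ppart (exmat \<Sigma> i k))) *
       (\<Prod>i=1..l. frozen \<Sigma> i ^ nat (ppart (exmat \<Sigma> (r + i) k))) +
       (\<Prod>i=1..r. cluster \<Sigma> i ^ nat (ppart (- exmat \<Sigma> i k))) *
       (\<Prod>i=1..l. frozen \<Sigma> i ^ nat (ppart (- exmat \<Sigma> (r + i) k))) \<and>
     (\<forall>i\<in>{1..l}. frozen \<Sigma>' i = frozen \<Sigma> i) \<and>
     (\<forall>i\<in>{1..r+l}. \<forall>j\<in>{1..r}. exmat \<Sigma>' i j = mutate_mat k (exmat \<Sigma>) i j)"

text \<open>The \<open>r\<close>-regular tree: its vertices are the words over \<open>{1..r}\<close> without two equal
  consecutive letters, and the edge labelled \<open>k\<close> at \<open>t\<close> leads to \<open>tree_step k t\<close>.\<close>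

definition tree_vertices :: "nat \<Rightarrow> nat list set" where
  "tree_vertices r = {t. set t \<subseteq> {1..r} \<and> successively (\<noteq>) t}"

definition tree_step :: "nat \<Rightarrow> nat list \<Rightarrow> nat list" where
  "tree_step k t = (if t \<noteq> [] \<and> last t = k then butlast t else t @ [k])"

definition seed_pattern ::
    "nat \<Rightarrow> nat \<Rightarrow> 'f::field_char_0 set \<Rightarrow> (nat list \<Rightarrow> 'f seed) \<Rightarrow> bool" where
  "seed_pattern r l F S \<longleftrightarrow>
     (\<forall>t \<in> tree_vertices r. is_seed r l F (S t)) \<and>
     (\<forall>t \<in> tree_vertices r. \<forall>k\<in>{1..r}. is_mutation r l k (S t) (S (tree_step k t)))"

definition ext_cluster_vars :: "nat \<Rightarrow> nat \<Rightarrow> (nat list \<Rightarrow> 'f seed) \<Rightarrow> 'f set" where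
  "ext_cluster_vars r l S =
     {cluster (S t) i | t i. t \<in> tree_vertices r \<and> i \<in> {1..r}} \<union>
     {frozen (S t) i | t i. t \<in> tree_vertices r \<and> i \<in> {1..l}}"

definition cluster_algebra_Z ::
    "nat \<Rightarrow> nat \<Rightarrow> (nat list \<Rightarrow> 'f::field_char_0 seed) \<Rightarrow> 'f ring" where
  "cluster_algebra_Z r l S =
     ring_of_type_algebra
       \<lparr>carrier := generate_ring ring_of_type_algebra (ext_cluster_vars r l S)\<rparr>"

section \<open>Tensor products of commutative rings over the integers\<close>

text \<open>The free abelian group on \<open>R \<times> S\<close> with the multiplication extending
  \<open>(a, b) (c, d) = (a c, b d)\<close>.  The bilinearity relations are stable under multiplication by the
  basis elements, so the ideal they generate is the subgroup they generate, and the
  quotient is the usual tensor product.\<close>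

definition pair_ring :: "('a, 'm) ring_scheme \<Rightarrow> ('b, 'n) ring_scheme \<Rightarrow> ('a \<times> 'b \<Rightarrow>\<^sub>0 int) ring" where
  "pair_ring R S =
     \<lparr>carrier = {f. Poly_Mapping.keys f \<subseteq> carrier R \<times> carrier S},
      monoid.mult = (\<lambda>f g. \<Sum>x \<in> Poly_Mapping.keys f. \<Sum>y \<in> Poly_Mapping.keys g.
         Poly_Mapping.single (fst x \<otimes>\<^bsub>R\<^esub> fst y, snd x \<otimes>\<^bsub>S\<^esub> snd y)
           (Poly_Mapping.lookup f x * Poly_Mapping.lookup g y)),
      one = Poly_Mapping.single (\<one>\<^bsub>R\<^esub>, \<one>\<^bsub>S\<^esub>) 1,
      zero = 0,
      add = (+)\<rparr>"

definition bilinear_rels ::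
    "('a, 'm) ring_scheme \<Rightarrow> ('b, 'n) ring_scheme \<Rightarrow> ('a \<times> 'b \<Rightarrow>\<^sub>0 int) set" where
  "bilinear_rels R S =
     {Poly_Mapping.single (a \<oplus>\<^bsub>R\<^esub> a', b) 1 - Poly_Mapping.single (a, b) 1
        - Poly_Mapping.single (a', b) 1
      | a a' b. a \<in> carrier R \<and> a' \<in> carrier R \<and> b \<in> carrier S} \<union>
     {Poly_Mapping.single (a, b \<oplus>\<^bsub>S\<^esub> b') 1 - Poly_Mapping.single (a, b) 1
        - Poly_Mapping.single (a, b') 1
      | a b b'. a \<in> carrier R \<and> b \<in> carrier S \<and> b' \<in> carrier S}"

definition bilinear_ideal ::
    "('a, 'm) ring_scheme \<Rightarrow> ('b, 'n) ring_scheme \<Rightarrow> ('a \<times> 'b \<Rightarrow>\<^sub>0 int) set" where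
  "bilinear_ideal R S = Idl\<^bsub>pair_ring R S\<^esub> (bilinear_rels R S)"

definition tensor_ring ::
    "('a, 'm) ring_scheme \<Rightarrow> ('b, 'n) ring_scheme \<Rightarrow> ('a \<times> 'b \<Rightarrow>\<^sub>0 int) set ring" where
  "tensor_ring R S = pair_ring R S Quot bilinear_ideal R S"

definition pure_tensor ::
    "('a, 'm) ring_scheme \<Rightarrow> ('b, 'n) ring_scheme \<Rightarrow> 'a \<Rightarrow> 'b \<Rightarrow> ('a \<times> 'b \<Rightarrow>\<^sub>0 int) set" where
  "pure_tensor R S a b = bilinear_ideal R S +>\<^bsub>pair_ring R S\<^esub> Poly_Mapping.single (a, b) 1"

section \<open>Complex algebras, their spectra, and affine varieties\<close>

text \<open>A complex algebra is a ring together with its structure map from the complex numbers.\<close>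

definition calg_iso ::
    "('a, 'm) ring_scheme \<Rightarrow> (complex \<Rightarrow> 'a) \<Rightarrow> ('b, 'n) ring_scheme \<Rightarrow> (complex \<Rightarrow> 'b) \<Rightarrow> ('a \<Rightarrow> 'b) set"
  where
  "calg_iso R \<rho> S \<sigma> = {h \<in> ring_iso R S. \<forall>c. h (\<rho> c) = \<sigma> c}"

text \<open>The complex points of \<open>Spec R\<close>.\<close>

definition spec_points :: "('a, 'm) ring_scheme \<Rightarrow> (complex \<Rightarrow> 'a) \<Rightarrow> ('a \<Rightarrow> complex) set" where
  "spec_points R \<rho> =
     {v \<in> ring_hom R ring_of_type_algebra. v \<in> extensional (carrier R) \<and> (\<forall>c. v (\<rho> c) = c)}"

abbreviation affine_space :: "'v set \<Rightarrow> ('v \<Rightarrow> complex) set" where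
  "affine_space I \<equiv> I \<rightarrow>\<^sub>E UNIV"

definition zero_locus :: "'v set \<Rightarrow> ('v, complex) mpol set \<Rightarrow> ('v \<Rightarrow> complex) set" where
  "zero_locus I E = {v \<in> affine_space I. \<forall>P \<in> E. ceval v P = 0}"

definition vanishing_ideal :: "'v set \<Rightarrow> ('v \<Rightarrow> complex) set \<Rightarrow> ('v, complex) mpol set" where
  "vanishing_ideal I V = {P \<in> mpols I. \<forall>v \<in> V. ceval v P = 0}"

definition coord_ring :: "'v set \<Rightarrow> ('v \<Rightarrow> complex) set \<Rightarrow> ('v, complex) mpol set ring" where
  "coord_ring I V = mpol_ring I Quot vanishing_ideal I V"

definition restr :: "'v set \<Rightarrow> ('v \<Rightarrow> complex) set \<Rightarrow> ('v, complex) mpol \<Rightarrow> ('v, complex) mpol set" where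
  "restr I V P = vanishing_ideal I V +>\<^bsub>mpol_ring I\<^esub> P"

definition varieties_isomorphic ::
    "'v set \<Rightarrow> ('v \<Rightarrow> complex) set \<Rightarrow> 'w set \<Rightarrow> ('w \<Rightarrow> complex) set \<Rightarrow> bool" where
  "varieties_isomorphic I V J W \<longleftrightarrow>
     (\<exists>f g. (\<forall>j\<in>J. f j \<in> mpols I) \<and> (\<forall>i\<in>I. g i \<in> mpols J) \<and>
        (\<forall>v\<in>V. (\<lambda>j\<in>J. ceval v (f j)) \<in> W \<and> (\<lambda>i\<in>I. ceval (\<lambda>j\<in>J. ceval v (f j)) (g i)) = v) \<and>
        (\<forall>w\<in>W. (\<lambda>i\<in>I. ceval w (g i)) \<in> V \<and> (\<lambda>j\<in>J. ceval (\<lambda>i\<in>I. ceval w (g i)) (f j)) = w))"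

section \<open>The complex cluster algebra and frieze points\<close>

definition cluster_algebra_C ::
    "nat \<Rightarrow> nat \<Rightarrow> (nat list \<Rightarrow> 'f::field_char_0 seed) \<Rightarrow> ('f \<times> complex \<Rightarrow>\<^sub>0 int) set ring" where
  "cluster_algebra_C r l S = tensor_ring (cluster_algebra_Z r l S) ring_of_type_algebra"

definition scalar_C ::
    "nat \<Rightarrow> nat \<Rightarrow> (nat list \<Rightarrow> 'f::field_char_0 seed) \<Rightarrow> complex \<Rightarrow> ('f \<times> complex \<Rightarrow>\<^sub>0 int) set" where
  "scalar_C r l S c = pure_tensor (cluster_algebra_Z r l S) ring_of_type_algebra 1 c"

definition elem_C ::
    "nat \<Rightarrow> nat \<Rightarrow> (nat list \<Rightarrow> 'f::field_char_0 seed) \<Rightarrow> 'f \<Rightarrow> ('f \<times> complex \<Rightarrow>\<^sub>0 int) set" where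
  "elem_C r l S x = pure_tensor (cluster_algebra_Z r l S) ring_of_type_algebra x 1"

definition pos_ints :: "complex set" where
  "pos_ints = {of_int n | n. n > 0}"

definition frieze_points ::
    "nat \<Rightarrow> nat \<Rightarrow> (nat list \<Rightarrow> 'f::field_char_0 seed) \<Rightarrow> (('f \<times> complex \<Rightarrow>\<^sub>0 int) set \<Rightarrow> complex) set"
  where
  "frieze_points r l S =
     {v \<in> spec_points (cluster_algebra_C r l S) (scalar_C r l S).
        \<forall>x \<in> ext_cluster_vars r l S. v (elem_C r l S x) \<in> pos_ints}"

text \<open>If \<open>\<Phi>\<close> is an isomorphism onto the complex cluster algebra from the coordinate ring of a
  subvariety of \<open>affine_space I\<close>, with coordinate functions \<open>crd i\<close>, then the point \<open>v\<close> of the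
  spectrum corresponds to the point of the variety with coordinates \<open>v (\<Phi> (crd i))\<close>.\<close>

definition frieze_points_in_model ::
    "nat \<Rightarrow> nat \<Rightarrow> (nat list \<Rightarrow> 'f::field_char_0 seed) \<Rightarrow> 'v set \<Rightarrow> ('v \<Rightarrow> 'a) \<Rightarrow>
     ('a \<Rightarrow> ('f \<times> complex \<Rightarrow>\<^sub>0 int) set) \<Rightarrow> ('v \<Rightarrow> complex) set" where
  "frieze_points_in_model r l S I crd \<Phi> = (\<lambda>v. \<lambda>i\<in>I. v (\<Phi> (crd i))) ` frieze_points r l S"

section \<open>Data attached to a symmetrizable generalized Cartan matrix\<close>

definition symmetrizable_GCM :: "nat \<Rightarrow> (nat \<Rightarrow> nat \<Rightarrow> int) \<Rightarrow> bool" where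
  "symmetrizable_GCM r A \<longleftrightarrow>
     (\<forall>i\<in>{1..r}. A i i = 2) \<and>
     (\<forall>i\<in>{1..r}. \<forall>j\<in>{1..r}. i \<noteq> j \<longrightarrow> A i j \<le> 0) \<and>
     (\<forall>i\<in>{1..r}. \<forall>j\<in>{1..r}. A i j = 0 \<longleftrightarrow> A j i = 0) \<and>
     (\<exists>D :: nat \<Rightarrow> int. (\<forall>i\<in>{1..r}. D i > 0) \<and>
        (\<forall>i\<in>{1..r}. \<forall>j\<in>{1..r}. D i * A i j = D j * A j i))"

definition B_mat :: "(nat \<Rightarrow> nat \<Rightarrow> int) \<Rightarrow> nat \<Rightarrow> nat \<Rightarrow> int" where
  "B_mat A i j = (if i < j then - A i j else if i = j then 0 else A i j)"

definition U_mat :: "(nat \<Rightarrow> nat \<Rightarrow> int) \<Rightarrow> nat \<Rightarrow> nat \<Rightarrow> int" where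
  "U_mat A i j = (if i < j then A i j else if i = j then 1 else 0)"

definition I_mat :: "nat \<Rightarrow> nat \<Rightarrow> int" where
  "I_mat i j = (if i = j then 1 else 0)"

definition stack_mat :: "nat \<Rightarrow> (nat \<Rightarrow> nat \<Rightarrow> int) \<Rightarrow> (nat \<Rightarrow> nat \<Rightarrow> int) \<Rightarrow> nat \<Rightarrow> nat \<Rightarrow> int" where
  "stack_mat r B P i j = (if i \<le> r then B i j else P (i - r) j)"

definition has_exmat :: "nat \<Rightarrow> nat \<Rightarrow> 'f seed \<Rightarrow> (nat \<Rightarrow> nat \<Rightarrow> int) \<Rightarrow> bool" where
  "has_exmat r l \<Sigma> M \<longleftrightarrow> (\<forall>i\<in>{1..r+l}. \<forall>j\<in>{1..r}. exmat \<Sigma> i j = M i j)"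

text \<open>The vertex reached from \<open>t0\<close> along edges labelled \<open>1, 2, \<dots>, r\<close> in this order, so that
  its seed is obtained by applying first the mutation in direction 1 and last the one in
  direction \<open>r\<close>.\<close>

definition coxeter_vertex :: "nat \<Rightarrow> nat list \<Rightarrow> nat list" where
  "coxeter_vertex r t0 = fold tree_step [1..<Suc r] t0"

definition bfz_monomial :: "nat \<Rightarrow> (nat \<Rightarrow> nat \<Rightarrow> int) \<Rightarrow> nat \<Rightarrow> (nat, complex) mpol" where
  "bfz_monomial r A i =
     (\<Prod>j=i+1..r. mvar j ^ nat (- A j i)) * (\<Prod>j=1..<i. mvar (r + j) ^ nat (- A j i))"

definition bfz_poly :: "nat \<Rightarrow> (nat \<Rightarrow> nat \<Rightarrow> int) \<Rightarrow> nat \<Rightarrow> (nat, complex) mpol" where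
  "bfz_poly r A i = mvar i * mvar (r + i) - bfz_monomial r A i"

definition V_triv_eqs :: "nat \<Rightarrow> (nat \<Rightarrow> nat \<Rightarrow> int) \<Rightarrow> (nat, complex) mpol set" where
  "V_triv_eqs r A = {mvar i * mvar (r + i) - (1 + bfz_monomial r A i) | i. i \<in> {1..r}}"

text \<open>The coordinates \<open>x\<^sub>i\<close>, \<open>x'\<^sub>i\<close> and \<open>y\<^sub>i\<close>.\<close>

datatype coord = Xc nat | Xc' nat | Yc nat

definition prin_coords :: "nat \<Rightarrow> coord set" where
  "prin_coords r = Xc ` {1..r} \<union> Xc' ` {1..r} \<union> Yc ` {1..r}"

definition W_triv_coords :: "nat \<Rightarrow> coord set" where
  "W_triv_coords r = Xc ` {1..r} \<union> Xc' ` {1..r}"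

definition V_prin_eqs :: "nat \<Rightarrow> (nat \<Rightarrow> nat \<Rightarrow> int) \<Rightarrow> (coord, complex) mpol set" where
  "V_prin_eqs r A =
     {mvar (Xc i) * mvar (Xc' i) -
        (mvar (Yc i) * (\<Prod>j=1..<i. mvar (Xc j) ^ nat (- A j i)) +
         (\<Prod>j=i+1..r. mvar (Xc j) ^ nat (- A j i))) | i. i \<in> {1..r}}"

definition W_triv_eqs :: "nat \<Rightarrow> (nat \<Rightarrow> nat \<Rightarrow> int) \<Rightarrow> (coord, complex) mpol set" where
  "W_triv_eqs r A =
     {mvar (Xc i) * mvar (Xc' i) -
        ((\<Prod>j=1..<i. mvar (Xc j) ^ nat (- A j i)) +
         (\<Prod>j=i+1..r. mvar (Xc j) ^ nat (- A j i))) | i. i \<in> {1..r}}"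

definition V_prin :: "nat \<Rightarrow> (nat \<Rightarrow> nat \<Rightarrow> int) \<Rightarrow> (coord \<Rightarrow> complex) set" where
  "V_prin r A = zero_locus (prin_coords r) (V_prin_eqs r A)"

definition V_triv :: "nat \<Rightarrow> (nat \<Rightarrow> nat \<Rightarrow> int) \<Rightarrow> (nat \<Rightarrow> complex) set" where
  "V_triv r A = zero_locus {1..2*r} (V_triv_eqs r A)"

definition W_triv :: "nat \<Rightarrow> (nat \<Rightarrow> nat \<Rightarrow> int) \<Rightarrow> (coord \<Rightarrow> complex) set" where
  "W_triv r A = zero_locus (W_triv_coords r) (W_triv_eqs r A)"

end

(* In a full rank pattern the upper bound, the intersection of the Laurent rings of a seed and of its
   neighbours, is invariant under mutation. This is a rank two statement and follows from the
   coprimality of the exchange polynomials. So every cluster variable lies in the upper bound of the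
   initial seed, and frozen variables do not occur in denominators, as cluster variables are
   subtraction-free.

   For the BFZ matrix the initial cluster and its Coxeter mutation z are algebraically independent,
   and z k is a prime element of the polynomial ring in z. Removing denominators one variable at a
   time, the upper bound is contained in this polynomial ring. Up to the invertible monomial
   substitution by U_mat, principal coefficients are the same case once frozen variables are
   inverted; they are removed from the denominators by means of standard monomials in x, x', y, which
   remain independent at y q = 0. Trivial coefficients are obtained by setting all frozen variables
   to 1.

   The relations among the generators follow from normal forms: a standard polynomial which vanishes
   at all points with positive coordinates is 0, seen by letting one x k after the other tend to 0.
   Being kernels of specializations at positive points, the ideals of relations are radical, and a
   point with positive integer coordinates is a frieze point since positivity propagates along the
   exchange relations. *)
theory Submission
  imports Defs "HOL-Computational_Algebra.Formal_Laurent_Series"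
begin

section \<open>Subrings of commutative rings\<close>

text \<open>With trivial coefficients the exchange matrix \<open>B_mat A\<close> may be singular
  (for \<open>r = 1\<close> it is 0), and then exchange polynomials need not be coprime, so upper
  bounds are out of reach there.

  The equations p i = 1 in the coordinates z have no evident normal form, whereas x i x' i = ... can
  be read as a rewriting rule. The ideal of \<open>V_triv\<close> is therefore understood through
  that of \<open>W_triv\<close>. The substitutions in both directions are found with BFZ
  coefficients, where the z are independent and identities of cluster variables are identities of
  polynomials; they are then reduced modulo p i - 1.

  Up to the tensor product everything is integral and takes place in subsets of a field. Two facts
  bridge the gap to complex points: integral relations are complex combinations of the exchange
  relations, and a point with integer coordinates gives a homomorphism to the integers, so that
  positivity can be propagated by multiplication.\<close>

definition is_subring :: "'a::comm_ring_1 set \<Rightarrow> bool" where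
  "is_subring D \<longleftrightarrow> 1 \<in> D \<and> (\<forall>a\<in>D. \<forall>b\<in>D. a - b \<in> D \<and> a * b \<in> D)"

lemma is_subringI:
  assumes "1 \<in> D" "\<And>a b. a \<in> D \<Longrightarrow> b \<in> D \<Longrightarrow> a - b \<in> D" "\<And>a b. a \<in> D \<Longrightarrow> b \<in> D \<Longrightarrow> a * b \<in> D"
  shows "is_subring D"
  using assms by (auto simp: is_subring_def)

context
  fixes D :: "'a::comm_ring_1 set"
  assumes D: "is_subring D"
begin

lemma sr_one: "1 \<in> D" and sr_diff: "a \<in> D \<Longrightarrow> b \<in> D \<Longrightarrow> a - b \<in> D"
  and sr_mult: "a \<in> D \<Longrightarrow> b \<in> D \<Longrightarrow> a * b \<in> D"
  using D by (auto simp: is_subring_def)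

lemma sr_zero: "0 \<in> D"
  using sr_diff[OF sr_one sr_one] by simp

lemma sr_uminus: "a \<in> D \<Longrightarrow> - a \<in> D"
  using sr_diff[OF sr_zero, of a] by simp

lemma sr_add: "a \<in> D \<Longrightarrow> b \<in> D \<Longrightarrow> a + b \<in> D"
  using sr_diff[of a "- b"] sr_uminus[of b] by simp

lemma sr_power: "a \<in> D \<Longrightarrow> a ^ n \<in> D"
  by (induction n) (auto intro: sr_one sr_mult)

lemma sr_sum: "(\<And>i. i \<in> I \<Longrightarrow> f i \<in> D) \<Longrightarrow> sum f I \<in> D"
  by (induction I rule: infinite_finite_induct) (auto intro: sr_zero sr_add)

lemma sr_prod: "(\<And>i. i \<in> I \<Longrightarrow> f i \<in> D) \<Longrightarrow> prod f I \<in> D"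
  by (induction I rule: infinite_finite_induct) (auto intro: sr_one sr_mult)

lemma sr_of_nat: "of_nat n \<in> D"
  by (induction n) (auto intro: sr_zero sr_add sr_one)

lemma sr_of_int: "of_int n \<in> D"
  by (cases n) (auto intro: sr_of_nat sr_uminus simp del: of_nat_Suc)

end

lemmas sr_closed = sr_one sr_zero sr_diff sr_mult sr_uminus sr_add sr_power sr_sum sr_prod sr_of_int

lemma sr_powi:
  fixes a :: "'a::field"
  assumes "is_subring D" "a \<in> D" "inverse a \<in> D"
  shows "a powi k \<in> D"
  using assms by (auto simp: power_int_def intro: sr_power)

text \<open>Generated over the integers, without further scalars: cluster algebras are such rings,
  and the complex numbers enter only with the tensor product.\<close>

definition gen_ring :: "'a::comm_ring_1 set \<Rightarrow> 'a set" where
  "gen_ring G = \<Inter> {D. is_subring D \<and> G \<subseteq> D}"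

abbreviation ext_ring :: "nat \<Rightarrow> nat \<Rightarrow> (nat list \<Rightarrow> 'f::field_char_0 seed) \<Rightarrow> 'f set" where
  "ext_ring r l S \<equiv> gen_ring (ext_cluster_vars r l S)"

lemma gen_ring_sr: "is_subring (gen_ring G)"
  by (auto simp: gen_ring_def is_subring_def)

lemmas gr_closed = sr_closed[OF gen_ring_sr]

lemma gr_incl: "x \<in> G \<Longrightarrow> x \<in> gen_ring G"
  by (auto simp: gen_ring_def)

lemma gen_ring_least: "is_subring D \<Longrightarrow> G \<subseteq> D \<Longrightarrow> gen_ring G \<subseteq> D"
  by (auto simp: gen_ring_def)

lemma gen_ring_mono: "G \<subseteq> H \<Longrightarrow> gen_ring G \<subseteq> gen_ring H"
  by (rule gen_ring_least[OF gen_ring_sr]) (auto intro: gr_incl)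

text \<open>A specialization of Laurent polynomials is a total function in HOL but respects the ring
  operations only where its denominators stay invertible. Hence the domain \<open>D\<close> is a
  parameter, and values outside \<open>D\<close> are arbitrary.\<close>

definition hom_on :: "'a::comm_ring_1 set \<Rightarrow> ('a \<Rightarrow> 'b::comm_ring_1) \<Rightarrow> bool" where
  "hom_on D f \<longleftrightarrow> is_subring D \<and> f 1 = 1 \<and>
     (\<forall>a\<in>D. \<forall>b\<in>D. f (a + b) = f a + f b \<and> f (a * b) = f a * f b)"

context
  fixes D :: "'a::comm_ring_1 set" and f :: "'a \<Rightarrow> 'b::comm_ring_1"
  assumes f: "hom_on D f"
begin

lemma hom_on_subring: "is_subring D" and hom_on_one: "f 1 = 1"
  and hom_on_add: "a \<in> D \<Longrightarrow> b \<in> D \<Longrightarrow> f (a + b) = f a + f b"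
  and hom_on_mult: "a \<in> D \<Longrightarrow> b \<in> D \<Longrightarrow> f (a * b) = f a * f b"
  using f by (auto simp: hom_on_def)

lemma hom_on_zero: "f 0 = 0"
  using hom_on_add[OF sr_zero[OF hom_on_subring] sr_zero[OF hom_on_subring]] by simp

lemma hom_on_uminus: "a \<in> D \<Longrightarrow> f (- a) = - f a"
  using hom_on_add[OF sr_uminus[OF hom_on_subring, of a], of a] hom_on_zero
  by (simp add: eq_neg_iff_add_eq_0)

lemma hom_on_diff: "a \<in> D \<Longrightarrow> b \<in> D \<Longrightarrow> f (a - b) = f a - f b"
  using hom_on_add[of a "- b"] hom_on_uminus[of b] sr_uminus[OF hom_on_subring, of b] by simp

lemma hom_on_power: "a \<in> D \<Longrightarrow> f (a ^ n) = f a ^ n"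
  by (induction n) (auto simp: hom_on_one hom_on_mult sr_power[OF hom_on_subring])

lemma hom_on_sum: "(\<And>i. i \<in> I \<Longrightarrow> g i \<in> D) \<Longrightarrow> f (sum g I) = (\<Sum>i\<in>I. f (g i))"
  by (induction I rule: infinite_finite_induct) (auto simp: hom_on_zero hom_on_add sr_sum[OF hom_on_subring])

lemma hom_on_prod: "(\<And>i. i \<in> I \<Longrightarrow> g i \<in> D) \<Longrightarrow> f (prod g I) = (\<Prod>i\<in>I. f (g i))"
  by (induction I rule: infinite_finite_induct) (auto simp: hom_on_one hom_on_mult sr_prod[OF hom_on_subring])

lemma hom_on_of_nat: "f (of_nat n) = of_nat n"
  by (induction n) (auto simp: hom_on_zero hom_on_one hom_on_add sr_one[OF hom_on_subring]
      sr_of_nat[OF hom_on_subring])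

lemma hom_on_of_int: "f (of_int n) = of_int n"
  by (cases n) (auto simp: hom_on_of_nat hom_on_uminus sr_of_nat[OF hom_on_subring]
      simp del: of_nat_Suc)

end

lemma hom_on_subset: "hom_on D f \<Longrightarrow> is_subring E \<Longrightarrow> E \<subseteq> D \<Longrightarrow> hom_on E f"
  by (auto simp: hom_on_def)

section \<open>Evaluation of multivariate polynomials\<close>

abbreviation keys :: "('a \<Rightarrow>\<^sub>0 'b::zero) \<Rightarrow> 'a set" where
  "keys \<equiv> Poly_Mapping.keys"

abbreviation lookup :: "('a \<Rightarrow>\<^sub>0 'b::zero) \<Rightarrow> 'a \<Rightarrow> 'b" where
  "lookup \<equiv> Poly_Mapping.lookup"

abbreviation single :: "'a \<Rightarrow> 'b::zero \<Rightarrow> 'a \<Rightarrow>\<^sub>0 'b" where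
  "single \<equiv> Poly_Mapping.single"

definition monom_val :: "('v \<Rightarrow> 'a::comm_ring_1) \<Rightarrow> ('v \<Rightarrow>\<^sub>0 nat) \<Rightarrow> 'a" where
  "monom_val w m = (\<Prod>i \<in> keys m. w i ^ lookup m i)"

lemma monom_val_superset:
  "finite A \<Longrightarrow> keys m \<subseteq> A \<Longrightarrow> monom_val w m = (\<Prod>i\<in>A. w i ^ lookup m i)"
  unfolding monom_val_def by (rule prod.mono_neutral_left) (auto simp: in_keys_iff)

lemma keys_add_nat: "keys (m + m') = keys m \<union> keys (m' :: 'v \<Rightarrow>\<^sub>0 nat)"
  by (auto simp: in_keys_iff lookup_add)

lemma monom_val_add: "monom_val w (m + m') = monom_val w m * monom_val w m'"
proof -
  let ?A = "keys m \<union> keys m'"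
  have "monom_val w m * monom_val w m' =
      (\<Prod>i\<in>?A. w i ^ lookup m i) * (\<Prod>i\<in>?A. w i ^ lookup m' i)"
    by (intro arg_cong2[where f="(*)"] monom_val_superset) auto
  also have "\<dots> = (\<Prod>i\<in>?A. w i ^ lookup (m + m') i)"
    by (simp add: prod.distrib[symmetric] lookup_add power_add)
  also have "\<dots> = monom_val w (m + m')" by (rule monom_val_superset[symmetric]) (auto simp: keys_add_nat)
  finally show ?thesis by simp
qed

lemma monom_val_0 [simp]: "monom_val w 0 = 1"
  by (simp add: monom_val_def)

lemma monom_val_single [simp]: "monom_val w (single i n) = w i ^ n"
  by (simp add: monom_val_def)

lemma mpol_induct [case_names zero single add]:
  fixes P :: "'a \<Rightarrow>\<^sub>0 'b::comm_monoid_add"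
  assumes "Q 0" "\<And>m c. Q (single m c)" "\<And>p q. Q p \<Longrightarrow> Q q \<Longrightarrow> Q (p + q)"
  shows "Q P"
proof (induction P rule: update_induct)
  case const
  then show ?case using assms(1) .
next
  case (update f a b)
  then have "Poly_Mapping.update a b f = f + single a b"
    by (intro poly_mapping_eqI) (auto simp: lookup_update lookup_add lookup_single in_keys_iff when_def)
  then show ?case using assms(2,3) update by simp
qed

lemma mpol_expand:
  fixes P :: "'a \<Rightarrow>\<^sub>0 'b::comm_monoid_add"
  shows "P = (\<Sum>m\<in>keys P. single m (lookup P m))"
  by (intro poly_mapping_eqI) (auto simp: lookup_sum lookup_single when_def in_keys_iff)

definition rh_fun :: "('c::comm_ring_1 \<Rightarrow> 'a::comm_ring_1) \<Rightarrow> bool" where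
  "rh_fun h \<longleftrightarrow> h 1 = 1 \<and> (\<forall>a b. h (a + b) = h a + h b) \<and> (\<forall>a b. h (a * b) = h a * h b)"

lemma rhf_of_int: "rh_fun (of_int :: int \<Rightarrow> 'a::comm_ring_1)"
  and rhf_of_rat: "rh_fun (of_rat :: rat \<Rightarrow> 'b::field_char_0)"
  and rhf_id: "rh_fun (\<lambda>c::'c::comm_ring_1. c)"
  by (auto simp: rh_fun_def of_rat_add of_rat_mult)

lemma meval_superset:
  assumes "finite A" "keys P \<subseteq> A" "h 0 = 0"
  shows "meval h w P = (\<Sum>m\<in>A. h (lookup P m) * monom_val w m)"
  unfolding meval_def monom_val_def[symmetric]
  by (rule sum.mono_neutral_left) (use assms in \<open>auto simp: in_keys_iff\<close>)

context
  fixes h :: "'c::comm_ring_1 \<Rightarrow> 'a::comm_ring_1"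
  assumes h: "rh_fun h"
begin

lemma rhf_zero: "h 0 = 0"
  using h by (metis rh_fun_def add_cancel_right_left)

lemma rhf_add: "h (a + b) = h a + h b" and rhf_mult: "h (a * b) = h a * h b" and rhf_one: "h 1 = 1"
  using h by (auto simp: rh_fun_def)

lemma meval_add: "meval h w (P + Q) = meval h w P + meval h w Q"
proof -
  let ?A = "keys P \<union> keys Q"
  have "meval h w (P + Q) = (\<Sum>m\<in>?A. h (lookup (P + Q) m) * monom_val w m)"
    by (rule meval_superset) (use Poly_Mapping.keys_add[of P Q] in \<open>auto simp: rhf_zero\<close>)
  also have "\<dots> = (\<Sum>m\<in>?A. h (lookup P m) * monom_val w m)
      + (\<Sum>m\<in>?A. h (lookup Q m) * monom_val w m)" by (simp add: lookup_add rhf_add distrib_right sum.distrib)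
  also have "\<dots> = meval h w P + meval h w Q"
    by (intro arg_cong2[where f="(+)"] meval_superset[symmetric]) (auto simp: rhf_zero)
  finally show ?thesis .
qed

lemma meval_single: "meval h w (single m c) = h c * monom_val w m"
  by (cases "c = 0") (auto simp: meval_def monom_val_def rhf_zero)

lemma meval_zero: "meval h w 0 = 0"
  by (simp add: meval_def)

lemma meval_mult: "meval h w (P * Q) = meval h w P * meval h w Q"
proof (induction P rule: mpol_induct)
  case (single m c)
  show ?case by (induction Q rule: mpol_induct)
      (auto simp: meval_zero meval_single mult_single rhf_mult monom_val_add distrib_left meval_add)
qed (auto simp: meval_zero meval_add distrib_right)

lemma meval_one: "meval h w 1 = 1"
  using meval_single[of w 0 1] by (simp add: rhf_one)

lemma meval_mvar: "meval h w (mvar i) = w i"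
  by (simp add: mvar_def meval_single rhf_one)

lemma meval_mconst: "meval h w (mconst c) = h c"
  by (simp add: mconst_def meval_single)

lemma meval_uminus: "meval h w (- P) = - meval h w P"
  using meval_add[of w "- P" P] by (simp add: meval_zero eq_neg_iff_add_eq_0)

lemma meval_diff: "meval h w (P - Q) = meval h w P - meval h w Q"
  using meval_add[of w P "- Q"] by (simp add: meval_uminus)

lemma meval_power: "meval h w (P ^ n) = meval h w P ^ n"
  by (induction n) (auto simp: meval_one meval_mult)

lemma meval_sum: "meval h w (sum f A) = (\<Sum>i\<in>A. meval h w (f i))"
  by (induction A rule: infinite_finite_induct) (auto simp: meval_zero meval_add)

lemma meval_prod: "meval h w (prod f A) = (\<Prod>i\<in>A. meval h w (f i))"
  by (induction A rule: infinite_finite_induct) (auto simp: meval_one meval_mult)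

lemma meval_of_int: "meval h w (of_int n) = of_int n"
proof -
  have "hom_on UNIV (meval h w)" by (auto simp: hom_on_def is_subring_def meval_one meval_add meval_mult)
  then show ?thesis by (rule hom_on_of_int)
qed

end

lemmas meval_simps = meval_add meval_zero meval_mult meval_one meval_mvar meval_mconst
  meval_uminus meval_diff meval_power meval_sum meval_prod meval_of_int
lemmas meval_int_simps [simp] = meval_simps[OF rhf_of_int]
lemmas meval_id_simps [simp] = meval_simps[OF rhf_id]

lemma meval_cong:
  assumes "P \<in> mpols I" "\<And>i. i \<in> I \<Longrightarrow> w i = w' i"
  shows "meval h w P = meval h w' P"
  unfolding meval_def
proof (intro sum.cong refl arg_cong2[where f="(*)"] prod.cong)
  fix m i assume "m \<in> keys P" "i \<in> keys m"
  then have "i \<in> I" using assms(1) by (auto simp: mpols_def)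
  then show "w i ^ lookup m i = w' i ^ lookup m i" using assms(2) by simp
qed

lemma mpols_mono: "I \<subseteq> J \<Longrightarrow> mpols I \<subseteq> mpols J"
  by (auto simp: mpols_def)

lemma single_in_mpols: "keys m \<subseteq> I \<Longrightarrow> single m c \<in> mpols I"
  by (auto simp: mpols_def split: if_splits)

lemma mvar_in_mpols [simp]: "i \<in> I \<Longrightarrow> mvar i \<in> mpols I"
  unfolding mvar_def by (rule single_in_mpols) (auto split: if_splits)

lemma mconst_in_mpols [simp]: "mconst c \<in> mpols I"
  unfolding mconst_def by (rule single_in_mpols) auto

lemma mpols_sr: "is_subring (mpols I :: ('v, 'c::comm_ring_1) mpol set)"
proof (rule is_subringI)
  show "1 \<in> (mpols I :: ('v, 'c) mpol set)"
    using single_in_mpols[of 0 I "1 :: 'c"] by (simp del: single_one add: single_one[symmetric])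
next
  fix P Q :: "('v, 'c) mpol" assume *: "P \<in> mpols I" "Q \<in> mpols I"
  show "P - Q \<in> mpols I" using * keys_diff[of P Q] unfolding mpols_def by blast
  show "P * Q \<in> mpols I" unfolding mpols_def
  proof (intro CollectI ballI)
    fix m assume "m \<in> keys (P * Q)"
    then obtain a b where ab: "a \<in> keys P" "b \<in> keys Q" "m = a + b" using keys_mult[of P Q] by blast
    then show "keys m \<subseteq> I" using * by (auto simp: keys_add_nat mpols_def)
  qed
qed

lemmas mpols_closed = sr_closed[OF mpols_sr]

lemma mpols_single_key:
  assumes "P \<in> mpols I" "m \<in> keys P"
  shows "single m c \<in> mpols I"
  by (rule single_in_mpols) (use assms in \<open>auto simp: mpols_def\<close>)

lemma mpols_induct [consumes 1, case_names zero single add]: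
  fixes P :: "('v, 'c::comm_ring_1) mpol"
  assumes P: "P \<in> mpols I" and 0: "Q 0"
    and s: "\<And>m c. keys m \<subseteq> I \<Longrightarrow> Q (single m c)"
    and a: "\<And>p q. p \<in> mpols I \<Longrightarrow> q \<in> mpols I \<Longrightarrow> Q p \<Longrightarrow> Q q \<Longrightarrow> Q (p + q)"
  shows "Q P"
proof -
  have "Q (\<Sum>m\<in>A. single m (lookup P m))
      \<and> (\<Sum>m\<in>A. single m (lookup P m)) \<in> mpols I"
    if "finite A" "A \<subseteq> keys P" for A using that
  proof (induction A rule: finite_induct)
    case empty
    then show ?case using 0 mpols_closed(2) by auto
  next
    case (insert m A)
    then have m: "keys m \<subseteq> I" using P by (auto simp: mpols_def)
    then have "Q (single m (lookup P m))" "single m (lookup P m) \<in> mpols I" using s single_in_mpols[OF m] by auto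
    then show ?case using insert a by (auto intro!: mpols_closed(6))
  qed
  from this[of "keys P"] show ?thesis using mpol_expand[of P] by auto
qed

lemma meval_in_subring:
  assumes "is_subring D" "P \<in> mpols I" "\<And>c. h c \<in> D" "\<And>i. i \<in> I \<Longrightarrow> w i \<in> D"
  shows "meval h w P \<in> D"
  unfolding meval_def
proof (intro sr_closed[OF assms(1)] assms(3))
  fix m i assume "m \<in> keys P" "i \<in> keys m"
  then show "w i \<in> D" using assms(2,4) by (auto simp: mpols_def)
qed

lemma gen_ring_image_eq: "gen_ring (g ` I) = {meval of_int g P | P. P \<in> mpols I}"
proof
  have "is_subring {meval of_int g P | P. P \<in> mpols I}"
  proof (rule is_subringI)
    show "1 \<in> {meval of_int g P | P. P \<in> mpols I}"
      by (rule CollectI, rule exI[of _ 1]) (auto intro: mpols_closed)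
  next
    fix a b assume "a \<in> {meval of_int g P | P. P \<in> mpols I}" "b \<in> {meval of_int g P | P. P \<in> mpols I}"
    then obtain P Q where *: "a = meval of_int g P" "b = meval of_int g Q" "P \<in> mpols I" "Q \<in> mpols I" by auto
    show "a - b \<in> {meval of_int g P | P. P \<in> mpols I}"
      by (rule CollectI, rule exI[of _ "P - Q"]) (use * in \<open>auto intro: mpols_closed\<close>)
    show "a * b \<in> {meval of_int g P | P. P \<in> mpols I}"
      by (rule CollectI, rule exI[of _ "P * Q"]) (use * in \<open>auto intro: mpols_closed\<close>)
  qed
  moreover have "g ` I \<subseteq> {meval of_int g P | P. P \<in> mpols I}"
  proof
    fix a assume "a \<in> g ` I"
    then obtain i where "i \<in> I" "a = g i" by auto
    then show "a \<in> {meval of_int g P | P. P \<in> mpols I}" by (intro CollectI exI[of _ "mvar i"]) auto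
  qed
  ultimately show "gen_ring (g ` I) \<subseteq> {meval of_int g P | P. P \<in> mpols I}" by (rule gen_ring_least)
  show "{meval of_int g P | P. P \<in> mpols I} \<subseteq> gen_ring (g ` I)"
    by (auto intro!: meval_in_subring[OF gen_ring_sr] gr_closed intro: gr_incl)
qed

lemma hom_on_meval:
  assumes f: "hom_on D f" and "P \<in> mpols I" "\<And>i. i \<in> I \<Longrightarrow> g i \<in> D"
  shows "f (meval of_int g P) = meval of_int (\<lambda>i. f (g i)) P"
proof -
  have D: "is_subring D" by (rule hom_on_subring[OF f])
  have g: "g i \<in> D" if "m \<in> keys P" "i \<in> keys m" for m i using that assms by (auto simp: mpols_def)
  show ?thesis unfolding meval_def
    by (simp add: hom_on_sum[OF f] hom_on_mult[OF f] hom_on_prod[OF f] hom_on_power[OF f] hom_on_of_int[OF f]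
        g sr_closed[OF D] sr_mult[OF D] sr_prod[OF D] sr_power[OF D])
qed

lemma mvar_power: "mvar i ^ n = (single (single i n) 1 :: ('v, 'c::comm_ring_1) mpol)"
  by (induction n) (auto simp: mvar_def mult_single single_add[symmetric])

text \<open>Expansion in powers of one variable. With \<open>mpols_split_unique\<close> it does the
  work of an isomorphism with univariate polynomials over the ring in the other variables.\<close>

lemma mpols_split_var:
  fixes P :: "('v, 'c::comm_ring_1) mpol"
  assumes "P \<in> mpols (insert i I)"
  shows "\<exists>p d. (\<forall>n. p n \<in> mpols (I - {i})) \<and> P = (\<Sum>n\<le>d::nat. p n * mvar i ^ n)"
  using assms
proof (induction P rule: mpols_induct)
  case zero
  show ?case by (rule exI[of _ "\<lambda>_. 0"], rule exI[of _ 0]) (auto intro: mpols_closed)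
next
  case (single m c)
  define n where "n = lookup m i"
  define m' where "m' = m - single i n"
  have m: "m = m' + single i n"
    unfolding m'_def n_def by (intro poly_mapping_eqI) (auto simp: lookup_add lookup_minus lookup_single when_def)
  have "keys m' \<subseteq> I - {i}" using single unfolding m'_def n_def
    by (auto simp: in_keys_iff lookup_minus lookup_single when_def subset_iff split: if_splits)
  then show ?case by (intro exI[of _ "\<lambda>k. if k = n then single m' c else 0"] exI[of _ n])
      (auto simp: mvar_power mult_single m mult_delta_left intro: mpols_closed single_in_mpols)
next
  case (add P Q)
  obtain p d where *: "\<forall>n. p n \<in> mpols (I - {i})" "P = (\<Sum>n\<le>d::nat. p n * mvar i ^ n)"
    using add(3) by (elim exE conjE)
  obtain q e where **: "\<forall>n. q n \<in> mpols (I - {i})" "Q = (\<Sum>n\<le>e::nat. q n * mvar i ^ n)"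
    using add(4) by (elim exE conjE)
  define p' where "p' n = (if n \<le> d then p n else 0)" for n
  define q' where "q' n = (if n \<le> e then q n else 0)" for n
  have "P = (\<Sum>n\<le>max d e. p' n * mvar i ^ n)" unfolding *(2) p'_def by (rule sum.mono_neutral_cong_left) auto
  moreover have "Q = (\<Sum>n\<le>max d e. q' n * mvar i ^ n)"
    unfolding **(2) q'_def by (rule sum.mono_neutral_cong_left) auto
  ultimately have "P + Q = (\<Sum>n\<le>max d e. (p' n + q' n) * mvar i ^ n)" by (simp add: sum.distrib distrib_right)
  moreover have "p' n + q' n \<in> mpols (I - {i})" for n
    using *(1) **(1) by (auto simp: p'_def q'_def intro: mpols_closed)
  ultimately show ?case by (intro exI[of _ "\<lambda>n. p' n + q' n"] exI[of _ "max d e"]) auto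
qed

lemma lookup_mult_single:
  fixes P :: "('v, 'c::comm_ring_1) mpol"
  assumes "i \<notin> keys m" "P \<in> mpols (I - {i})"
  shows "lookup (P * mvar i ^ n) (m + single i k) =
    (if n = k then lookup P m else 0)"
proof -
  have eq: "m' + single i n = m + single i k \<longleftrightarrow> m' = m \<and> n = k"
    if "m' \<in> keys P" for m'
  proof
    assume *: "m' + single i n = m + single i k"
    have "i \<notin> keys m'" using that assms(2) by (auto simp: mpols_def)
    then have "n = k" using arg_cong[OF *, of "\<lambda>f. lookup f i"] assms(1)
      by (auto simp: lookup_add in_keys_iff)
    with * show "m' = m \<and> n = k" by simp
  qed auto
  have "P * mvar i ^ n = (\<Sum>m'\<in>keys P.
      single (m' + single i n) (lookup P m'))"
    by (subst mpol_expand[of P]) (simp add: mvar_power sum_distrib_right mult_single)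
  then have "lookup (P * mvar i ^ n) (m + single i k) =
     (\<Sum>m'\<in>keys P. if m' = m then (if n = k then lookup P m' else 0) else 0)"
    by (auto simp: lookup_sum lookup_single when_def eq intro!: sum.cong)
  then show ?thesis by (auto simp: in_keys_iff)
qed

lemma mpols_split_unique:
  fixes p :: "nat \<Rightarrow> ('v, 'c::comm_ring_1) mpol"
  assumes p: "\<And>n. n \<le> d \<Longrightarrow> p n \<in> mpols (I - {i})" and 0: "(\<Sum>n\<le>d. p n * mvar i ^ n) = 0"
    and k: "k \<le> d"
  shows "p k = 0"
proof (rule poly_mapping_eqI)
  fix m
  show "lookup (p k) m = lookup 0 m"
  proof (cases "i \<in> keys m")
    case True
    then have "m \<notin> keys (p k)" using p[OF k] by (auto simp: mpols_def)
    then show ?thesis by (simp add: in_keys_iff)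
  next
    case False
    have "0 = lookup (\<Sum>n\<le>d. p n * mvar i ^ n) (m + single i k)" by (simp add: 0)
    also have "\<dots> = (\<Sum>n\<le>d. if n = k then lookup (p n) m else 0)"
      unfolding lookup_sum by (intro sum.cong refl) (simp add: lookup_mult_single[OF False p])
    also have "\<dots> = lookup (p k) m" using k by simp
    finally show ?thesis by simp
  qed
qed

text \<open>Induction on the variables: once the others have values in \<open>S\<close>, the
  polynomial in the last one has infinitely many roots, so its coefficients vanish at all such
  values. With \<open>S\<close> the positive reals, equations at positive points become identities
  of polynomials.\<close>

lemma mpols_eq_0_if_vanishing:
  fixes P :: "('v, 'c::comm_ring_1) mpol" and h :: "'c \<Rightarrow> 'a::idom"
  assumes h: "rh_fun h" "\<And>c. h c = 0 \<Longrightarrow> c = 0" and S: "infinite S"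
  assumes "finite I" "P \<in> mpols I" "\<And>w. (\<And>i. i \<in> I \<Longrightarrow> w i \<in> S) \<Longrightarrow> meval h w P = 0"
  shows "P = 0"
  using assms(4-6)
proof (induction I arbitrary: P rule: finite_induct)
  case empty
  note [simp] = meval_simps[OF h(1)]
  have "keys P \<subseteq> {0}" using empty(1) by (auto simp: mpols_def)
  then have P: "P = mconst (lookup P 0)"
    by (subst mpol_expand[of P]) (auto simp: mconst_def subset_singleton_iff in_keys_iff intro!: poly_mapping_eqI)
  have "meval h undefined P = 0" by (rule empty(2)) auto
  then have "h (lookup P 0) = 0" by (subst (asm) P) simp
  then have "lookup P 0 = 0" using h(2) by blast
  then show ?case by (subst P) (simp add: mconst_def)
next
  case (insert i I)
  note [simp] = meval_simps[OF h(1)]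
  obtain p d where p: "\<And>n. p n \<in> mpols (I - {i})" and P: "P = (\<Sum>n\<le>d::nat. p n * mvar i ^ n)"
    using mpols_split_var[OF insert(4)] by blast
  have pI: "p n \<in> mpols I" for n using p[of n] mpols_mono[of "I - {i}" I] by auto
  have "p n = 0" if n: "n \<le> d" for n
  proof (rule insert(3)[OF pI])
    fix w assume w: "\<And>i. i \<in> I \<Longrightarrow> w i \<in> S"
    define q where "q = (\<Sum>n\<le>d. monom (meval h w (p n)) n)"
    have "poly q s = 0" if "s \<in> S" for s
    proof -
      have "meval h (w(i := s)) P = 0" by (rule insert(5)) (use w that in auto)
      moreover have "meval h (w(i := s)) (p n) = meval h w (p n)" for n
        by (rule meval_cong[OF pI]) (use insert(2) in auto)
      ultimately show ?thesis by (simp add: P q_def poly_sum poly_monom)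
    qed
    then have "S \<subseteq> {s. poly q s = 0}" by auto
    then have "q = 0" using S poly_roots_finite finite_subset by blast
    then have "coeff q n = 0" by simp
    then show "meval h w (p n) = 0" using n by (simp add: q_def coeff_sum)
  qed
  then show ?case by (simp add: P)
qed

abbreviation map_coeffs :: "('c::comm_ring_1 \<Rightarrow> 'd::comm_ring_1) \<Rightarrow> ('v, 'c) mpol \<Rightarrow> ('v, 'd) mpol" where
  "map_coeffs \<equiv> Poly_Mapping.map"

abbreviation int_coeffs :: "('v, int) mpol \<Rightarrow> ('v, 'c::comm_ring_1) mpol" where
  "int_coeffs \<equiv> map_coeffs of_int"

context
  fixes h :: "'c::comm_ring_1 \<Rightarrow> 'd::comm_ring_1"
  assumes h: "rh_fun h"
begin

lemma lookup_map_coeffs: "lookup (map_coeffs h P) m = h (lookup P m)"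
  by (simp add: Poly_Mapping.map.rep_eq when_def rhf_zero[OF h])

lemma map_coeffs_add: "map_coeffs h (P + Q) = map_coeffs h P + map_coeffs h Q"
  by (intro poly_mapping_eqI) (simp add: lookup_map_coeffs lookup_add rhf_add[OF h])

lemma map_coeffs_single: "map_coeffs h (single m c) = single m (h c)"
  by (intro poly_mapping_eqI) (simp add: lookup_map_coeffs lookup_single when_def rhf_zero[OF h])

lemma map_coeffs_zero: "map_coeffs h 0 = 0"
  by (intro poly_mapping_eqI) (simp add: lookup_map_coeffs rhf_zero[OF h])

lemma map_coeffs_mult: "map_coeffs h (P * Q) = map_coeffs h P * map_coeffs h Q"
proof (induction P rule: mpol_induct)
  case (single m c)
  show ?case by (induction Q rule: mpol_induct)
      (auto simp: map_coeffs_zero map_coeffs_single mult_single rhf_mult[OF h] distrib_left map_coeffs_add)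
qed (auto simp: map_coeffs_zero map_coeffs_add distrib_right)

lemma map_coeffs_in_mpols: "P \<in> mpols I \<Longrightarrow> map_coeffs h P \<in> mpols I"
proof -
  assume P: "P \<in> mpols I"
  have "keys (map_coeffs h P) \<subseteq> keys P" using rhf_zero[OF h] by (auto simp: lookup_map_coeffs in_keys_iff)
  then show ?thesis using P by (auto simp: mpols_def)
qed

lemma map_coeffs_one: "map_coeffs h 1 = 1"
  using map_coeffs_single[of 0 1] by (simp add: rhf_one[OF h])

lemma hom_on_map_coeffs: "hom_on UNIV (map_coeffs h)"
  by (auto simp: hom_on_def is_subring_def map_coeffs_one map_coeffs_add map_coeffs_mult)

lemma map_coeffs_mvar: "map_coeffs h (mvar i) = mvar i"
  by (simp add: mvar_def map_coeffs_single rhf_one[OF h])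

lemma meval_map_coeffs:
  assumes h': "rh_fun h'"
  shows "meval h' w (map_coeffs h P) = meval (\<lambda>c. h' (h c)) w P"
proof -
  have hh: "rh_fun (\<lambda>c. h' (h c))" using h h' by (auto simp: rh_fun_def)
  show ?thesis by (induction P rule: mpol_induct)
      (simp_all only: map_coeffs_zero map_coeffs_single map_coeffs_add meval_add[OF h']
        meval_add[OF hh] meval_zero[OF h'] meval_zero[OF hh] meval_single[OF h'] meval_single[OF hh])
qed

end

section \<open>Algebraic independence and specialization\<close>

text \<open>Integer coefficients are enough for specialization;
  \<open>freely_generates_aindep\<close> derives this form from independence over the
  rationals.\<close>

definition aindep :: "'v set \<Rightarrow> ('v \<Rightarrow> 'a::comm_ring_1) \<Rightarrow> bool" where
  "aindep I w \<longleftrightarrow> (\<forall>P \<in> mpols I. meval of_int w P = 0 \<longrightarrow> P = 0)"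

lemma aindepD: "aindep I w \<Longrightarrow> P \<in> mpols I \<Longrightarrow> meval of_int w P = 0 \<Longrightarrow> P = 0"
  by (auto simp: aindep_def)

lemma aindep_mono: "aindep I w \<Longrightarrow> J \<subseteq> I \<Longrightarrow> aindep J w"
  using mpols_mono by (fastforce simp: aindep_def)

lemma freely_generates_aindep:
  assumes "freely_generates n w F"
  shows "aindep {1..n} w"
  unfolding aindep_def
proof (intro ballI impI)
  fix P :: "(nat, int) mpol" assume P: "P \<in> mpols {1..n}" "meval of_int w P = 0"
  have "meval of_rat w (int_coeffs P) = meval of_int w P" by (simp add: meval_map_coeffs[OF rhf_of_int rhf_of_rat])
  then have "int_coeffs P = (0 :: (nat, rat) mpol)"
    using assms P map_coeffs_in_mpols[OF rhf_of_int] by (auto simp: freely_generates_def)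
  then have "lookup (int_coeffs P) m = (0 :: rat)" for m by simp
  then show "P = 0" by (intro poly_mapping_eqI) (simp add: lookup_map_coeffs[OF rhf_of_int])
qed

lemma mvar_neq_0: "mvar i \<noteq> (0 :: ('v, 'c::comm_ring_1) mpol)"
  unfolding mvar_def by (metis lookup_single_eq lookup_zero zero_neq_one)

lemma aindep_neq_0: "aindep I w \<Longrightarrow> i \<in> I \<Longrightarrow> w i \<noteq> 0"
  using aindepD[of I w "mvar i"] by (auto simp: mvar_neq_0)

text \<open>\<open>J\<close> collects the variables that may occur in denominators. Upper bounds use
  \<open>J = I\<close>; the rings in which frozen variables stay polynomial use
  \<open>J = {1..r}\<close>.\<close>

definition laurent :: "('v \<Rightarrow> 'a::field) \<Rightarrow> 'v set \<Rightarrow> 'v set \<Rightarrow> 'a set" where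
  "laurent w I J = gen_ring (w ` I \<union> (\<lambda>j. inverse (w j)) ` J)"

lemma laurent_sr: "is_subring (laurent w I J)"
  by (simp add: laurent_def gen_ring_sr)

lemmas lr_closed = sr_closed[OF laurent_sr]

lemma laurent_var: "i \<in> I \<Longrightarrow> w i \<in> laurent w I J"
  and laurent_inverse: "j \<in> J \<Longrightarrow> inverse (w j) \<in> laurent w I J"
  by (auto simp: laurent_def intro: gr_incl)

lemma laurent_mono: "I \<subseteq> I' \<Longrightarrow> J \<subseteq> J' \<Longrightarrow> laurent w I J \<subseteq> laurent w I' J'"
  unfolding laurent_def by (intro gen_ring_mono) auto

lemma laurent_least:
  assumes "is_subring D" "\<And>i. i \<in> I \<Longrightarrow> w i \<in> D" "\<And>j. j \<in> J \<Longrightarrow> inverse (w j) \<in> D"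
  shows "laurent w I J \<subseteq> D"
  unfolding laurent_def by (rule gen_ring_least) (use assms in auto)

lemma laurent_powi: "i \<in> I \<Longrightarrow> i \<in> J \<Longrightarrow> w i powi k \<in> laurent w I J"
  by (intro sr_powi laurent_sr laurent_var laurent_inverse)

lemma meval_in_laurent: "P \<in> mpols I \<Longrightarrow> meval of_int w P \<in> laurent w I J"
  by (rule meval_in_subring[OF laurent_sr]) (auto intro: lr_closed laurent_var)

text \<open>A power of the product of all variables in \<open>J\<close> is a sufficient denominator,
  because fractions with such denominators form a ring that contains the generators.\<close>

lemma laurent_clear:
  fixes w :: "'v \<Rightarrow> 'a::field"
  assumes "finite J" "J \<subseteq> I" "\<And>j. j \<in> J \<Longrightarrow> w j \<noteq> 0" "a \<in> laurent w I J"
  shows "\<exists>P N. P \<in> mpols I \<and> a * (\<Prod>j\<in>J. w j) ^ N = meval of_int w P"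
proof -
  let ?D = "{a. \<exists>P N. P \<in> mpols I \<and> a * (\<Prod>j\<in>J. w j) ^ N = meval of_int w P}"
  define Dp :: "('v, int) mpol" where "Dp = (\<Prod>j\<in>J. mvar j)"
  have Dp: "Dp \<in> mpols I" "meval of_int w Dp = (\<Prod>j\<in>J. w j)"
    using assms(2) by (auto simp: Dp_def intro!: mpols_closed)
  have "laurent w I J \<subseteq> ?D"
  proof (rule laurent_least)
    show "is_subring ?D"
    proof (rule is_subringI)
      show "1 \<in> ?D" by (rule CollectI, rule exI[of _ 1], rule exI[of _ 0]) (auto intro: mpols_closed)
    next
      fix a b assume "a \<in> ?D" "b \<in> ?D"
      then obtain P N Q M where *: "P \<in> mpols I" "a * (\<Prod>j\<in>J. w j) ^ N = meval of_int w P"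
        "Q \<in> mpols I" "b * (\<Prod>j\<in>J. w j) ^ M = meval of_int w Q" by auto
      show "a - b \<in> ?D" by (rule CollectI, rule exI[of _ "P * Dp ^ M - Q * Dp ^ N"], rule exI[of _ "N + M"])
          (simp add: mpols_closed *(1,3) Dp Dp(2) *(2,4)[symmetric] algebra_simps power_add)
      show "a * b \<in> ?D" by (rule CollectI, rule exI[of _ "P * Q"], rule exI[of _ "N + M"])
          (simp add: mpols_closed *(1,3) *(2,4)[symmetric] algebra_simps power_add)
    qed
  next
    fix i assume "i \<in> I"
    then show "w i \<in> ?D" by (intro CollectI exI[of _ "mvar i"] exI[of _ "0 :: nat"]) simp
  next
    fix j assume j: "j \<in> J"
    then have "inverse (w j) * (\<Prod>j\<in>J. w j) = (\<Prod>j\<in>J - {j}. w j)"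
      using assms(1) assms(3)[OF j] by (simp add: prod.remove[OF assms(1) j])
    then show "inverse (w j) \<in> ?D"
      using assms(2) by (intro CollectI exI[of _ "\<Prod>j\<in>J - {j}. mvar j"] exI[of _ "1 :: nat"])
        (auto intro!: mpols_closed)
  qed
  then show ?thesis using assms(4) by auto
qed

text \<open>The universal property of a Laurent ring: independent variables may be sent to any
  values in any field, as long as the inverted ones do not become 0. It is applied with values in
  the reals, in the complex numbers, in another cluster algebra's field, in the same field, and in
  Laurent series, where it produces gradings.\<close>

theorem specialize:
  fixes w :: "'v \<Rightarrow> 'a::field" and \<zeta> :: "'v \<Rightarrow> 'b::field"
  assumes w: "aindep I w" and J: "finite J" "J \<subseteq> I" and \<zeta>: "\<And>j. j \<in> J \<Longrightarrow> \<zeta> j \<noteq> 0"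
  obtains f where "hom_on (laurent w I J) f" "\<And>i. i \<in> I \<Longrightarrow> f (w i) = \<zeta> i"
proof
  define D where "D = (\<Prod>j\<in>J. w j)"
  define E where "E = (\<Prod>j\<in>J. \<zeta> j)"
  define Dp :: "('v, int) mpol" where "Dp = (\<Prod>j\<in>J. mvar j)"
  have Dp: "Dp \<in> mpols I" "meval of_int w Dp = D" "meval of_int \<zeta> Dp = E"
    using J(2) by (auto simp: Dp_def D_def E_def intro!: mpols_closed)
  have E0: "E \<noteq> 0" using J(1) \<zeta> by (auto simp: E_def)
  have w0: "w j \<noteq> 0" if "j \<in> J" for j using aindep_neq_0[OF w] J(2) that by auto
  have D0: "D \<noteq> 0" using J(1) w0 by (auto simp: D_def)
  \<comment> \<open>\<open>R a v\<close> says that some fraction representing \<open>a\<close> takes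
    the value \<open>v\<close> at \<open>\<zeta>\<close>. Two representations of \<open>a\<close>
    give a relation among the \<open>w i\<close>, which is trivial by independence, so
    \<open>v\<close> is unique.\<close>
  define R where "R a v \<longleftrightarrow> (\<exists>P N. P \<in> mpols I \<and> a * D ^ N = meval of_int w P \<and>
      v = meval of_int \<zeta> P / E ^ N)" for a v
  have uniq: "v = v'" if "R a v" "R a v'" for a v v'
  proof -
    obtain P N where P: "P \<in> mpols I" "a * D ^ N = meval of_int w P" "v = meval of_int \<zeta> P / E ^ N"
      using \<open>R a v\<close> unfolding R_def by auto
    obtain Q M where Q: "Q \<in> mpols I" "a * D ^ M = meval of_int w Q" "v' = meval of_int \<zeta> Q / E ^ M"
      using \<open>R a v'\<close> unfolding R_def by auto
    have "P * Dp ^ M - Q * Dp ^ N = 0" by (rule aindepD[OF w]) (auto intro!: mpols_closed P(1) Q(1) Dp(1)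
          simp: P(2)[symmetric] Q(2)[symmetric] Dp(2))
    then have "meval of_int \<zeta> (P * Dp ^ M - Q * Dp ^ N) = 0" by simp
    then show ?thesis using E0 by (simp add: P(3) Q(3) Dp(3) field_simps)
  qed
  have ex: "\<exists>v. R a v" if "a \<in> laurent w I J" for a
    using laurent_clear[OF J w0 that] unfolding R_def D_def by blast
  define f where "f a = (SOME v. R a v)" for a
  have fR: "f a = v" if "R a v" for a v unfolding f_def using uniq someI[of "R a", OF that] that by blast
  have Rf: "R a (f a)" if "a \<in> laurent w I J" for a unfolding f_def by (rule someI_ex[OF ex[OF that]])
  show "f (w i) = \<zeta> i" if "i \<in> I" for i
    by (rule fR, unfold R_def, rule exI[of _ "mvar i"], rule exI[of _ 0]) (use that in simp)
  show "hom_on (laurent w I J) f" unfolding hom_on_def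
  proof (intro conjI ballI)
    show "f 1 = 1" by (rule fR, unfold R_def, rule exI[of _ 1], rule exI[of _ 0]) (simp add: mpols_closed)
  next
    fix a b assume "a \<in> laurent w I J" "b \<in> laurent w I J"
    then obtain P N Q M where *: "P \<in> mpols I" "a * D ^ N = meval of_int w P"
        "f a = meval of_int \<zeta> P / E ^ N"
        "Q \<in> mpols I" "b * D ^ M = meval of_int w Q" "f b = meval of_int \<zeta> Q / E ^ M"
      using Rf unfolding R_def by meson
    show "f (a + b) = f a + f b"
      by (rule fR, unfold R_def, rule exI[of _ "P * Dp ^ M + Q * Dp ^ N"], rule exI[of _ "N + M"])
        (use E0 in \<open>simp add: mpols_closed *(1,4) Dp(1) *(3,6) *(2,5)[symmetric] Dp(2,3) power_add field_simps\<close>)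
    show "f (a * b) = f a * f b" by (rule fR, unfold R_def, rule exI[of _ "P * Q"], rule exI[of _ "N + M"])
        (use E0 in \<open>simp add: mpols_closed *(1,4) *(3,6) *(2,5)[symmetric] power_add field_simps\<close>)
  qed (rule laurent_sr)
qed

section \<open>Transcendental elements over subrings of a field and their fractions\<close>

definition transc_over :: "'a::comm_ring_1 set \<Rightarrow> 'a \<Rightarrow> bool" where
  "transc_over D x \<longleftrightarrow> (\<forall>p. (\<forall>i. coeff p i \<in> D) \<longrightarrow> poly p x = 0 \<longrightarrow> p = 0)"

lemma transc_overD:
  assumes "transc_over D x" "\<And>i. coeff p i \<in> D" "poly p x = 0"
  shows "p = 0"
proof -
  have "(\<forall>i. coeff p i \<in> D) \<longrightarrow> poly p x = 0 \<longrightarrow> p = 0"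
    using assms(1) unfolding transc_over_def by (rule spec)
  then show ?thesis by (simp only: assms(2,3) simp_thms)
qed

definition fractions :: "'a::field set \<Rightarrow> 'a set" where
  "fractions D = {a / b | a b. a \<in> D \<and> b \<in> D \<and> b \<noteq> 0}"

lemma fractions_incl: "is_subring D \<Longrightarrow> a \<in> D \<Longrightarrow> a \<in> fractions D"
  unfolding fractions_def by (rule CollectI, rule exI[of _ a], rule exI[of _ 1]) (auto intro: sr_closed)

lemma fractions_sr:
  assumes D: "is_subring D"
  shows "is_subring (fractions D)"
proof (rule is_subringI)
  show "1 \<in> fractions D" by (intro fractions_incl D sr_one)
next
  fix a b assume "a \<in> fractions D" "b \<in> fractions D"
  then obtain p q s t where *: "a = p / q" "b = s / t" "p \<in> D" "q \<in> D" "s \<in> D" "t \<in> D" "q \<noteq> 0" "t \<noteq> 0"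
    by (auto simp: fractions_def)
  show "a - b \<in> fractions D" unfolding fractions_def
    by (rule CollectI, rule exI[of _ "p * t - s * q"], rule exI[of _ "q * t"])
      (use * in \<open>auto intro!: sr_closed[OF D] simp: field_simps\<close>)
  show "a * b \<in> fractions D" unfolding fractions_def
    by (rule CollectI, rule exI[of _ "p * s"], rule exI[of _ "q * t"])
      (use * in \<open>auto intro!: sr_closed[OF D] simp: field_simps\<close>)
qed

lemma fractions_inverse:
  assumes D: "is_subring D" and "a \<in> fractions D"
  shows "inverse a \<in> fractions D"
proof (cases "a = 0")
  case True
  then show ?thesis using assms by simp
next
  case False
  obtain p q where "a = p / q" "p \<in> D" "q \<in> D" using assms by (auto simp: fractions_def)
  moreover from this have "p \<noteq> 0" "inverse a = q / p" using False by auto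
  ultimately show ?thesis unfolding fractions_def by blast
qed

text \<open>A relation over the fractions becomes one over \<open>D\<close> after multiplication by
  the product of the denominators of its coefficients.\<close>

lemma transc_over_fractions:
  assumes D: "is_subring D" and tr: "transc_over D x"
  shows "transc_over (fractions D) x"
  unfolding transc_over_def
proof (intro allI impI)
  fix p :: "'a poly" assume p: "\<forall>i. coeff p i \<in> fractions D" "poly p x = 0"
  have "\<exists>b. b \<in> D \<and> b \<noteq> 0 \<and> b * coeff p i \<in> D" for i
  proof -
    obtain a b where "coeff p i = a / b" "a \<in> D" "b \<in> D" "b \<noteq> 0"
      using p(1) by (force simp: fractions_def)
    then show ?thesis by (intro exI[of _ b]) auto
  qed
  then obtain b where b: "\<And>i. b i \<in> D" "\<And>i. b i \<noteq> 0" "\<And>i. b i * coeff p i \<in> D" by metis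
  define B where "B = (\<Prod>i\<le>Polynomial.degree p. b i)"
  have B0: "B \<noteq> 0" using b(2) by (simp add: B_def)
  have "coeff (smult B p) i \<in> D" for i
  proof (cases "i \<le> Polynomial.degree p")
    case True
    then have "B * coeff p i = (b i * coeff p i) * (\<Prod>j\<in>{..Polynomial.degree p} - {i}. b j)"
      unfolding B_def by (subst prod.remove[of _ i]) auto
    then show ?thesis unfolding coeff_smult by (simp only:) (intro sr_mult[OF D] sr_prod[OF D] b)
  qed (auto simp: coeff_eq_0 sr_zero[OF D])
  moreover have "poly (smult B p) x = 0" using p(2) by simp
  ultimately have "smult B p = 0" by (rule transc_overD[OF tr])
  then show "p = 0" using B0 by simp
qed

lemma transc_over_mono:
  assumes "transc_over E x" "D \<subseteq> E"
  shows "transc_over D x"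
  unfolding transc_over_def
proof (intro allI impI)
  fix p assume *: "\<forall>i. coeff p i \<in> D" "poly p x = 0"
  show "p = 0"
  proof (rule transc_overD[OF assms(1)])
    fix i show "coeff p i \<in> E" using spec[OF *(1), of i] assms(2) by blast
  qed (rule *(2))
qed

text \<open>Justifies comparing coefficients of the powers of one cluster variable over the fraction
  field of the others, as all rank two arguments do.\<close>

lemma aindep_transcendental:
  fixes w :: "'v \<Rightarrow> 'a::field"
  assumes w: "aindep (insert k I) w" and k: "k \<notin> I"
  shows "transc_over (fractions (gen_ring (w ` I))) (w k)"
proof (rule transc_over_fractions[OF gen_ring_sr], unfold transc_over_def, intro allI impI)
  fix p :: "'a poly" assume p: "\<forall>i. coeff p i \<in> gen_ring (w ` I)" "poly p (w k) = 0"
  then have "\<forall>i. \<exists>P. P \<in> mpols I \<and> coeff p i = meval of_int w P"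
    unfolding gen_ring_image_eq by auto
  then obtain P where P: "\<And>i. P i \<in> mpols I" "\<And>i. coeff p i = meval of_int w (P i)" by metis
  have PI: "P i \<in> mpols (insert k I)" for i using P(1)[of i] mpols_mono[of I "insert k I"] by auto
  have "(\<Sum>n\<le>Polynomial.degree p. P n * mvar k ^ n) = 0"
  proof (rule aindepD[OF w])
    show "(\<Sum>n\<le>Polynomial.degree p. P n * mvar k ^ n) \<in> mpols (insert k I)"
      by (auto intro!: mpols_closed PI)
    show "meval of_int w (\<Sum>n\<le>Polynomial.degree p. P n * mvar k ^ n) = 0"
      using p(2) by (simp add: poly_altdef P(2))
  qed
  then have "P (Polynomial.degree p) = 0"
    by (rule mpols_split_unique[of "Polynomial.degree p" P I k, rotated]) (use P(1) k in auto)
  then have "coeff p (Polynomial.degree p) = 0" by (simp only: P(2) meval_int_simps)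
  then show "p = 0" by (simp only: leading_coeff_0_iff)
qed

section \<open>Coprimality of exchange polynomials\<close>

unbundle fps_syntax

definition fls_term :: "'a::field \<Rightarrow> int \<Rightarrow> 'a fls" where
  "fls_term c k = fls_const c * fls_X_intpow k"

lemma fls_term_nth: "fls_term c k $$ n = (if n = k then c else 0)"
  by (auto simp: fls_term_def)

lemma fls_term_mult: "fls_term c k * fls_term c' k' = fls_term (c * c') (k + k')"
proof -
  have "fls_term c k * fls_term c' k' = fls_const c * fls_const c' * (fls_X_intpow k * fls_X_intpow k')"
    by (simp only: fls_term_def mult_ac)
  then show ?thesis by (simp add: fls_term_def fls_X_intpow_times_fls_X_intpow)
qed

lemma fls_term_diff: "fls_term c k - fls_term c' k = fls_term (c - c') k"
  and fls_term_0 [simp]: "fls_term 0 k = 0"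
  by (auto simp: fls_term_nth intro!: fls_eqI)

lemma fls_term_1: "fls_term 1 0 = 1"
  by (auto simp: fls_term_def)

lemma fls_term_neq_0: "c \<noteq> 0 \<Longrightarrow> fls_term c k \<noteq> 0"
  by (auto simp: fls_term_def)

lemma fls_term_inverse: "c \<noteq> 0 \<Longrightarrow> inverse (fls_term c k) = fls_term (inverse c) (- k)"
  by (rule inverse_unique) (simp add: fls_term_mult fls_term_1)

lemma fls_term_power: "fls_term c k ^ n = fls_term (c ^ n) (int n * k)"
  by (induction n) (auto simp: fls_term_1 fls_term_mult algebra_simps)

lemma fls_term_prod: "(\<Prod>i\<in>A. fls_term (c i) (k i)) = fls_term (\<Prod>i\<in>A. c i) (\<Sum>i\<in>A. k i)"
  by (induction A rule: infinite_finite_induct) (auto simp: fls_term_1 fls_term_mult)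

lemma is_subring_fls_coeffs:
  assumes D: "is_subring D"
  shows "is_subring {F :: 'a::field fls. \<forall>n. F $$ n \<in> D}"
proof (rule is_subringI)
  fix F G :: "'a fls" assume "F \<in> {F. \<forall>n. F $$ n \<in> D}" "G \<in> {F. \<forall>n. F $$ n \<in> D}"
  then show "F - G \<in> {F. \<forall>n. F $$ n \<in> D}" "F * G \<in> {F. \<forall>n. F $$ n \<in> D}"
    using D by (auto simp: fls_times_nth(1) intro!: sr_closed)
qed (use D in \<open>auto intro: sr_closed\<close>)

text \<open>The geometric series. As \<open>d > 0\<close> it is a power series, and its coefficients
  are 0 or powers of \<open>- c\<close>, hence in \<open>D\<close>.\<close>

lemma fls_one_plus_term_inverse:
  assumes D: "is_subring D" and c: "c \<in> D" and d: "d > 0"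
  obtains G :: "'a::field fls" where "(1 + fls_term c d) * G = 1" "\<And>n. G $$ n \<in> D"
proof -
  obtain e where e: "d = int e" "e > 0" using d by (metis pos_int_cases)
  define g where "g = Abs_fps (\<lambda>n. if e dvd n then (- c) ^ (n div e) else 0)"
  have "(1 + fps_const c * fps_X ^ e) * g = 1"
  proof (rule fps_ext)
    fix n
    have "fps_nth ((1 + fps_const c * fps_X ^ e) * g) n = fps_nth g n + c * fps_nth (fps_X ^ e * g) n"
      by (simp add: distrib_right mult.assoc)
    also have "\<dots> = fps_nth g n + c * (if n < e then 0 else fps_nth g (n - e))"
      by (simp add: fps_X_power_mult_nth)
    also have "\<dots> = fps_nth (1 :: 'a fps) n"
    proof (cases "n < e")
      case True
      then show ?thesis using e by (auto simp: g_def dest: dvd_imp_le)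
    next
      case False
      have "e dvd n \<longleftrightarrow> e dvd (n - e)" using False by (simp add: dvd_diff_nat dvd_minus_self)
      moreover have "n div e = Suc ((n - e) div e)" using False e by (simp add: le_div_geq)
      ultimately show ?thesis using False e by (auto simp: g_def)
    qed
    finally show "fps_nth ((1 + fps_const c * fps_X ^ e) * g) n = fps_nth (1 :: 'a fps) n" .
  qed
  then have "fps_to_fls (1 + fps_const c * fps_X ^ e) * fps_to_fls g = 1"
    by (metis fls_times_fps_to_fls fps_one_to_fls)
  moreover have "fps_to_fls (1 + fps_const c * fps_X ^ e) = 1 + fls_term c d"
    by (intro fls_eqI) (auto simp: fls_term_nth e(1) fps_X_power_iff)
  ultimately have "(1 + fls_term c d) * fps_to_fls g = 1" by simp
  moreover have "fps_to_fls g $$ n \<in> D" for n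
    using sr_power[OF D sr_uminus[OF D c]] sr_zero[OF D] by (auto simp: g_def)
  ultimately show thesis by (rule that)
qed

text \<open>The grading of the Laurent polynomial ring by \<open>\<delta>\<close> is realized by the homomorphism
  \<open>w\<^sub>i \<mapsto> w\<^sub>i T\<close> to the power \<open>\<delta> i\<close> into Laurent series in \<open>T\<close>.\<close>

lemma laurent_grading:
  fixes w :: "'v \<Rightarrow> 'a::field" and \<delta> :: "'v \<Rightarrow> int"
  assumes w: "aindep I w" and I: "finite I"
  obtains sp where "hom_on (laurent w I I) sp"
    "\<And>i. i \<in> I \<Longrightarrow> sp (w i) = fls_term (w i) (\<delta> i)"
    "\<And>v. sp (\<Prod>i\<in>I. w i powi v i) = fls_term (\<Prod>i\<in>I. w i powi v i) (\<Sum>i\<in>I. \<delta> i * v i)"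
    "\<And>a. a \<in> laurent w I I \<Longrightarrow> \<exists>K. finite K \<and> a = (\<Sum>k\<in>K. sp a $$ k)"
proof -
  let ?C = "laurent w I I"
  have w0: "w i \<noteq> 0" if "i \<in> I" for i using aindep_neq_0[OF w that] .
  obtain sp where sp: "hom_on ?C sp" "\<And>i. i \<in> I \<Longrightarrow> sp (w i) = fls_term (w i) (\<delta> i)"
    by (rule specialize[OF w I subset_refl, of "\<lambda>i. fls_term (w i) (\<delta> i)"])
      (auto simp: w0 fls_term_neq_0)
  have sp_inv: "sp (inverse (w i)) = fls_term (inverse (w i)) (- \<delta> i)" if i: "i \<in> I" for i
  proof -
    have "sp (w i) * sp (inverse (w i)) = 1"
      using hom_on_mult[OF sp(1) laurent_var[OF i] laurent_inverse[OF i]] w0[OF i] by (simp add: hom_on_one[OF sp(1)])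
    then have "sp (inverse (w i)) = inverse (sp (w i))" by (simp add: inverse_unique)
    then show ?thesis by (simp add: sp(2)[OF i] fls_term_inverse w0 i)
  qed
  have sp_pw: "sp (w i powi k) = fls_term (w i powi k) (\<delta> i * k)" if i: "i \<in> I" for i k
    by (auto simp: power_int_def hom_on_power[OF sp(1)] laurent_var laurent_inverse i sp(2) sp_inv
        fls_term_power mult.commute)
  have sp_prod: "sp (\<Prod>i\<in>I. w i powi v i) = fls_term (\<Prod>i\<in>I. w i powi v i) (\<Sum>i\<in>I. \<delta> i * v i)" for v
    by (subst hom_on_prod[OF sp(1)]) (auto simp: sp_pw laurent_powi fls_term_prod[symmetric])
  \<comment> \<open>Finite sums of homogeneous elements. They form a subring containing the
    generators of \<open>?C\<close>, so every Laurent polynomial has such a decomposition.\<close>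
  define Q where "Q a \<longleftrightarrow> (\<exists>K h. finite K \<and> (\<forall>k. h k \<in> ?C \<and> sp (h k) = fls_term (h k) k) \<and>
      (\<forall>k. k \<notin> K \<longrightarrow> h k = 0) \<and> a = (\<Sum>k\<in>K. h k))" for a
  have Qterm: "Q a" if "a \<in> ?C" "sp a = fls_term a k" for a k unfolding Q_def
    by (rule exI[of _ "{k}"], rule exI[of _ "\<lambda>l. if l = k then a else 0"])
      (use that in \<open>auto simp: hom_on_zero[OF sp(1)] intro: lr_closed\<close>)
  have "is_subring (Collect Q)"
  proof (rule is_subringI)
    show "1 \<in> Collect Q" using Qterm[of 1 0] by (simp add: lr_closed hom_on_one[OF sp(1)] fls_term_1)
  next
    fix a b assume "a \<in> Collect Q" "b \<in> Collect Q"
    then have ab: "Q a" "Q b" by simp_all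
    obtain K h where "finite K" "\<forall>k. h k \<in> ?C \<and> sp (h k) = fls_term (h k) k"
      "\<forall>k. k \<notin> K \<longrightarrow> h k = 0" "a = (\<Sum>k\<in>K. h k)"
      using ab(1) unfolding Q_def by (elim exE conjE)
    then have h: "finite K" "\<And>k. h k \<in> ?C" "\<And>k. sp (h k) = fls_term (h k) k" "\<And>k. k \<notin> K \<Longrightarrow> h k = 0"
        "a = (\<Sum>k\<in>K. h k)" by simp_all
    obtain L g where "finite L" "\<forall>k. g k \<in> ?C \<and> sp (g k) = fls_term (g k) k"
      "\<forall>k. k \<notin> L \<longrightarrow> g k = 0" "b = (\<Sum>k\<in>L. g k)"
      using ab(2) unfolding Q_def by (elim exE conjE)
    then have g: "finite L" "\<And>k. g k \<in> ?C" "\<And>k. sp (g k) = fls_term (g k) k" "\<And>k. k \<notin> L \<Longrightarrow> g k = 0"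
        "b = (\<Sum>k\<in>L. g k)" by simp_all
    have a: "a = (\<Sum>k\<in>K \<union> L. h k)" unfolding h(5) by (rule sum.mono_neutral_left) (use h g in auto)
    have b: "b = (\<Sum>k\<in>K \<union> L. g k)" unfolding g(5) by (rule sum.mono_neutral_left) (use h g in auto)
    show "a - b \<in> Collect Q" unfolding Q_def mem_Collect_eq
      by (rule exI[of _ "K \<union> L"], rule exI[of _ "\<lambda>k. h k - g k"])
        (use h(1-4) g(1-4) in \<open>auto simp: a b sum_subtractf hom_on_diff[OF sp(1)] fls_term_diff intro: lr_closed\<close>)
    \<comment> \<open>\<open>N\<close> contains all degrees that can occur in the product, and the
      convolution \<open>f n\<close> is its component of degree \<open>n\<close>.\<close>
    define N where "N = (\<lambda>(k, l). k + l) ` (K \<times> L)"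
    define f where "f n = (\<Sum>k\<in>K. h k * g (n - k))" for n
    have "finite N" using h(1) g(1) by (simp add: N_def)
    have f: "f n \<in> ?C" "sp (f n) = fls_term (f n) n" for n
    proof -
      show "f n \<in> ?C" unfolding f_def by (intro lr_closed h g)
      have "sp (f n) = (\<Sum>k\<in>K. fls_term (h k * g (n - k)) n)" unfolding f_def
        by (subst hom_on_sum[OF sp(1)]) (auto simp: hom_on_mult[OF sp(1)] h g fls_term_mult intro: lr_closed)
      also have "\<dots> = fls_term (f n) n" by (intro fls_eqI) (simp add: fls_nth_sum fls_term_nth f_def)
      finally show "sp (f n) = fls_term (f n) n" .
    qed
    have "f n = 0" if "n \<notin> N" for n
    proof -
      have "g (n - k) = 0" if "k \<in> K" for k
        by (rule g(4)) (use \<open>n \<notin> N\<close> that in \<open>force simp: N_def\<close>)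
      then show ?thesis by (simp add: f_def)
    qed
    moreover have "a * b = (\<Sum>n\<in>N. f n)"
    proof -
      have "(\<Sum>n\<in>N. g (n - k)) = b" if k: "k \<in> K" for k
      proof -
        have "b = (\<Sum>n\<in>(+) k ` L. g (n - k))" unfolding g(5) by (subst sum.reindex) auto
        also have "\<dots> = (\<Sum>n\<in>N. g (n - k))"
        proof (rule sum.mono_neutral_left)
          show "(+) k ` L \<subseteq> N" using k by (auto simp: N_def)
          show "\<forall>n\<in>N - (+) k ` L. g (n - k) = 0"
          proof
            fix n assume n: "n \<in> N - (+) k ` L"
            have "n - k \<notin> L"
            proof
              assume "n - k \<in> L"
              then have "k + (n - k) \<in> (+) k ` L" by blast
              then show False using n by simp
            qed
            then show "g (n - k) = 0" by (rule g(4))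
          qed
        qed (rule \<open>finite N\<close>)
        finally show ?thesis by simp
      qed
      then have "a * b = (\<Sum>k\<in>K. \<Sum>n\<in>N. h k * g (n - k))"
        by (simp add: h(5) sum_distrib_right sum_distrib_left[symmetric])
      then show ?thesis unfolding f_def by (subst sum.swap) simp
    qed
    ultimately show "a * b \<in> Collect Q" unfolding Q_def mem_Collect_eq using \<open>finite N\<close> f
      by (intro exI[of _ N] exI[of _ f]) auto
  qed
  then have "?C \<subseteq> Collect Q" by (rule laurent_least)
      (use Qterm sp(2) sp_inv laurent_var laurent_inverse in \<open>metis mem_Collect_eq\<close>)+
  have "\<exists>K. finite K \<and> a = (\<Sum>k\<in>K. sp a $$ k)" if a: "a \<in> ?C" for a
  proof -
    have "Q a" using a \<open>?C \<subseteq> Collect Q\<close> by auto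
    then obtain K h where "finite K" "\<forall>k. h k \<in> ?C \<and> sp (h k) = fls_term (h k) k"
      "\<forall>k. k \<notin> K \<longrightarrow> h k = 0" "a = (\<Sum>k\<in>K. h k)"
      unfolding Q_def by (elim exE conjE)
    then have h: "finite K" "\<And>k. h k \<in> ?C" "\<And>k. sp (h k) = fls_term (h k) k"
      "\<And>k. k \<notin> K \<Longrightarrow> h k = 0" "a = (\<Sum>k\<in>K. h k)" by simp_all
    have "sp a = (\<Sum>k\<in>K. fls_term (h k) k)" unfolding h(5) by (subst hom_on_sum[OF sp(1)]) (auto simp: h)
    then have "sp a $$ k = h k" if "k \<in> K" for k using that h(1) by (simp add: fls_nth_sum fls_term_nth)
    then show ?thesis using h by (intro exI[of _ K]) simp
  qed
  with sp sp_prod show thesis by (rule that)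
qed

text \<open>The nonzero minor says that the exponent vectors \<open>v1\<close> and \<open>v2\<close>
  are linearly independent, so there is a grading in which the monomial of \<open>P1\<close> has
  degree 0 and that of \<open>P2\<close> has positive degree. In the Laurent series of this grading
  \<open>P1\<close> is a constant, while \<open>P2\<close>, being 1 plus a term of positive degree,
  has an inverse with coefficients in the Laurent ring. Dividing by its power shows that
  \<open>P1 ^ m\<close> divides every homogeneous component of \<open>a\<close>.\<close>

lemma binomial_coprime:
  fixes w :: "'v \<Rightarrow> 'a::field"
  assumes w: "aindep I w" and I: "finite I"
    and ab: "i \<in> I" "j \<in> I" "v1 i * v2 j - v1 j * v2 i \<noteq> 0"
    and P1: "P1 = 1 + (\<Prod>i\<in>I. w i powi v1 i)" and P2: "P2 = 1 + (\<Prod>i\<in>I. w i powi v2 i)"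
    and a: "a \<in> laurent w I I" and b: "b \<in> laurent w I I"
    and eq: "P1 ^ m * b = P2 ^ n * a"
  shows "\<exists>c \<in> laurent w I I. a = P1 ^ m * c"
proof -
  let ?C = "laurent w I I"
  \<comment> \<open>The weights \<open>\<delta>\<close> are orthogonal to \<open>v1\<close>; the
    sign \<open>s\<close> makes the degree \<open>d\<close> of the second monomial positive.\<close>
  define s where "s = sgn (v1 i * v2 j - v1 j * v2 i)"
  define \<delta> where "\<delta> k = (if k = i then - s * v1 j else if k = j then s * v1 i else 0)" for k
  have "i \<noteq> j" using ab(3) by auto
  have sum_deg: "(\<Sum>k\<in>I. \<delta> k * v k) = s * (v1 i * v j - v1 j * v i)" for v
  proof -
    have "(\<Sum>k\<in>I. \<delta> k * v k) = (\<Sum>k\<in>{i, j}. \<delta> k * v k)"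
      by (rule sum.mono_neutral_right) (use ab I in \<open>auto simp: \<delta>_def\<close>)
    then show ?thesis using \<open>i \<noteq> j\<close> by (simp add: \<delta>_def algebra_simps)
  qed
  obtain sp where sp: "hom_on ?C sp" "\<And>i. i \<in> I \<Longrightarrow> sp (w i) = fls_term (w i) (\<delta> i)"
    "\<And>v. sp (\<Prod>i\<in>I. w i powi v i) = fls_term (\<Prod>i\<in>I. w i powi v i) (\<Sum>i\<in>I. \<delta> i * v i)"
    "\<And>a. a \<in> ?C \<Longrightarrow> \<exists>K. finite K \<and> a = (\<Sum>k\<in>K. sp a $$ k)"
    by (rule laurent_grading[OF w I, of \<delta>]) (rule that)
  have mon: "(\<Prod>i\<in>I. w i powi v i) \<in> ?C" for v by (intro lr_closed laurent_powi)
  define c where "c = (\<Prod>i\<in>I. w i powi v2 i)"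
  define d where "d = s * (v1 i * v2 j - v1 j * v2 i)"
  have "d > 0" using ab(3) by (simp add: d_def s_def sgn_mult_self_eq abs_sgn[symmetric] mult.commute)
  have spP1: "sp P1 = fls_const P1" unfolding P1 by (subst hom_on_add[OF sp(1)])
      (auto simp: lr_closed mon sp(3) hom_on_one[OF sp(1)] sum_deg fls_term_def fls_plus_const intro!: fls_eqI)
  have spP2: "sp P2 = 1 + fls_term c d" unfolding P2 by (subst hom_on_add[OF sp(1)])
      (auto simp: lr_closed mon sp(3) hom_on_one[OF sp(1)] sum_deg c_def d_def)
  have PC: "P1 \<in> ?C" "P2 \<in> ?C" unfolding P1 P2 by (intro lr_closed mon)+
  have nthC: "sp x $$ k \<in> ?C" if "x \<in> ?C" for x k
  proof -
    have "?C \<subseteq> {x \<in> ?C. \<forall>k. sp x $$ k \<in> ?C}"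
    proof (rule laurent_least)
      have F: "is_subring {F :: 'a fls. \<forall>n. F $$ n \<in> ?C}" by (rule is_subring_fls_coeffs[OF laurent_sr])
      show "is_subring {x \<in> ?C. \<forall>k. sp x $$ k \<in> ?C}" using sr_closed[OF F] by (intro is_subringI)
          (auto simp: hom_on_one[OF sp(1)] hom_on_diff[OF sp(1)] hom_on_mult[OF sp(1)] intro: lr_closed)
    next
      fix k assume k: "k \<in> I"
      then show "w k \<in> {x \<in> ?C. \<forall>k. sp x $$ k \<in> ?C}"
        by (auto simp: sp(2) fls_term_nth intro: lr_closed laurent_var)
      have 1: "(\<Prod>i\<in>I. w i powi (if i = k then -1 else 0)) = inverse (w k)"
        using I k by (subst prod.remove[of _ k]) (auto simp: power_int_minus)
      then show "inverse (w k) \<in> {x \<in> ?C. \<forall>k. sp x $$ k \<in> ?C}"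
        using sp(3)[of "\<lambda>i. if i = k then -1 else 0"] k
        by (auto simp: fls_term_nth intro: lr_closed laurent_inverse)
    qed
    then show ?thesis using that by auto
  qed
  obtain G where G: "(1 + fls_term c d) * G = 1" "\<And>n. G $$ n \<in> ?C"
    by (rule fls_one_plus_term_inverse[OF laurent_sr[of w I I], of c d]) (use \<open>d > 0\<close> mon c_def in auto)
  \<comment> \<open>The given equation, read in Laurent series; multiplication by
    \<open>G ^ n\<close> will isolate \<open>sp a\<close>.\<close>
  have E: "fls_const (P1 ^ m) * sp b = (1 + fls_term c d) ^ n * sp a" using arg_cong[OF eq, of sp]
    by (simp add: hom_on_mult[OF sp(1)] hom_on_power[OF sp(1)] PC a b lr_closed spP1 spP2 fls_const_power)
  have "((1 + fls_term c d) * G) ^ n * sp a = G ^ n * ((1 + fls_term c d) ^ n * sp a)"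
    by (simp only: power_mult_distrib mult_ac)
  also have "\<dots> = fls_const (P1 ^ m) * (sp b * G ^ n)" unfolding E[symmetric] by (simp only: mult_ac)
  finally have "((1 + fls_term c d) * G) ^ n * sp a = fls_const (P1 ^ m) * (sp b * G ^ n)" .
  then have "sp a = fls_const (P1 ^ m) * (sp b * G ^ n)" by (simp only: G(1) power_one mult_1)
  then have nth: "sp a $$ k = P1 ^ m * (sp b * G ^ n) $$ k" for k by simp
  have F: "sp b * G ^ n \<in> {F. \<forall>n. F $$ n \<in> ?C}"
    using nthC[OF b] G(2) by (intro sr_closed[OF is_subring_fls_coeffs[OF laurent_sr]]) auto
  obtain K where "finite K" "a = (\<Sum>k\<in>K. sp a $$ k)" using sp(4)[OF a] by auto
  then have "a = P1 ^ m * (\<Sum>k\<in>K. (sp b * G ^ n) $$ k)" by (simp add: nth sum_distrib_left)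
  then show ?thesis using F by (intro bexI) (auto intro: lr_closed)
qed

section \<open>The rank two case of the mutation invariance of upper bounds\<close>

definition polys_over :: "'a::comm_ring_1 set \<Rightarrow> 'a poly set" where
  "polys_over D = {p. \<forall>i. coeff p i \<in> D}"

lemma polys_overD: "p \<in> polys_over D \<Longrightarrow> coeff p i \<in> D"
  by (simp add: polys_over_def)

lemma is_subring_polys_over:
  assumes D: "is_subring D"
  shows "is_subring (polys_over D)"
proof (rule is_subringI)
  show "1 \<in> polys_over D" using sr_one[OF D] sr_zero[OF D] by (simp add: polys_over_def)
next
  fix p q assume *: "p \<in> polys_over D" "q \<in> polys_over D"
  show "p - q \<in> polys_over D" using sr_diff[OF D] * by (simp add: polys_over_def)
  show "p * q \<in> polys_over D" unfolding polys_over_def mem_Collect_eq coeff_mult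
    by (intro allI sr_sum[OF D] sr_mult[OF D] polys_overD *)
qed

lemma monom_in_polys_over: "is_subring D \<Longrightarrow> a \<in> D \<Longrightarrow> monom a n \<in> polys_over D"
  using sr_zero by (auto simp: polys_over_def)

lemma smult_in_polys_over: "is_subring D \<Longrightarrow> a \<in> D \<Longrightarrow> p \<in> polys_over D \<Longrightarrow> smult a p \<in> polys_over D"
  by (auto simp: polys_over_def sr_mult)

lemma poly_in_subring:
  assumes D: "is_subring D" and "p \<in> polys_over E" "E \<subseteq> D" "x \<in> D"
  shows "poly p x \<in> D"
  unfolding poly_altdef
  by (intro sr_sum[OF D] sr_mult[OF D] sr_power[OF D]) (use assms in \<open>auto simp: polys_over_def\<close>)

lemma gen_ring_insert_eq:
  assumes D: "is_subring D"
  shows "gen_ring (D \<union> {x}) = {poly p x | p. p \<in> polys_over D}"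
proof
  note P = is_subring_polys_over[OF D]
  have "is_subring {poly p x | p. p \<in> polys_over D}"
  proof (rule is_subringI)
    have "1 = poly 1 x" by simp
    then show "1 \<in> {poly p x | p. p \<in> polys_over D}" using sr_one[OF P] by blast
  next
    fix a b assume "a \<in> {poly p x | p. p \<in> polys_over D}" "b \<in> {poly p x | p. p \<in> polys_over D}"
    then obtain p q where pq: "a = poly p x" "p \<in> polys_over D" "b = poly q x" "q \<in> polys_over D" by auto
    have "a - b = poly (p - q) x" "a * b = poly (p * q) x" by (simp_all add: pq)
    then show "a - b \<in> {poly p x | p. p \<in> polys_over D}" "a * b \<in> {poly p x | p. p \<in> polys_over D}"
      using sr_diff[OF P pq(2,4)] sr_mult[OF P pq(2,4)] by blast+
  qed
  moreover have "D \<union> {x} \<subseteq> {poly p x | p. p \<in> polys_over D}"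
  proof
    fix a assume a: "a \<in> D \<union> {x}"
    show "a \<in> {poly p x | p. p \<in> polys_over D}"
    proof (cases "a \<in> D")
      case True
      have "a = poly (monom a 0) x" by (simp add: poly_monom)
      then show ?thesis using monom_in_polys_over[OF D True] by blast
    next
      case False
      then have "a = poly (monom 1 1) x" using a by (simp add: poly_monom)
      then show ?thesis using monom_in_polys_over[OF D sr_one[OF D]] by blast
    qed
  qed
  ultimately show "gen_ring (D \<union> {x}) \<subseteq> {poly p x | p. p \<in> polys_over D}" by (rule gen_ring_least)
  show "{poly p x | p. p \<in> polys_over D} \<subseteq> gen_ring (D \<union> {x})"
    by (auto intro!: poly_in_subring[OF gen_ring_sr, of _ D] intro: gr_incl)
qed

lemma gen_ring_laurent_clear:
  fixes x :: "'a::field"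
  assumes D: "is_subring D" and x: "x \<noteq> 0" and f: "f \<in> gen_ring (D \<union> {x, inverse x})"
  obtains p N where "p \<in> polys_over D" "f * x ^ N = poly p x"
proof -
  let ?E = "{f. \<exists>p N. p \<in> polys_over D \<and> f * x ^ N = poly p x}"
  note P = is_subring_polys_over[OF D]
  have "is_subring ?E"
  proof (rule is_subringI)
    show "1 \<in> ?E" by (rule CollectI, rule exI[of _ 1], rule exI[of _ 0]) (simp add: sr_one[OF P])
  next
    fix a b assume "a \<in> ?E" "b \<in> ?E"
    then obtain p N q M where *: "p \<in> polys_over D" "a * x ^ N = poly p x"
      "q \<in> polys_over D" "b * x ^ M = poly q x" by auto
    have mon: "monom 1 k \<in> polys_over D" for k by (rule monom_in_polys_over[OF D sr_one[OF D]])
    have "(a - b) * x ^ (N + M) = a * x ^ N * x ^ M - b * x ^ M * x ^ N" by (simp add: power_add algebra_simps)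
    also have "\<dots> = poly (p * monom 1 M - q * monom 1 N) x" by (simp add: * poly_monom)
    finally show "a - b \<in> ?E" using sr_diff[OF P sr_mult[OF P *(1) mon] sr_mult[OF P *(3) mon]] by blast
    have "(a * b) * x ^ (N + M) = (a * x ^ N) * (b * x ^ M)" by (simp add: power_add algebra_simps)
    also have "\<dots> = poly (p * q) x" by (simp add: *)
    finally show "a * b \<in> ?E" using sr_mult[OF P *(1,3)] by blast
  qed
  moreover have "D \<union> {x, inverse x} \<subseteq> ?E"
  proof
    fix a assume "a \<in> D \<union> {x, inverse x}"
    then consider "a \<in> D" | "a = x" | "a = inverse x" by auto
    then show "a \<in> ?E"
    proof cases
      case 1
      then have "a * x ^ 0 = poly (monom a 0) x" by (simp add: poly_monom)
      then show ?thesis using monom_in_polys_over[OF D 1] by blast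
    next
      case 2
      then have "a * x ^ 0 = poly (monom 1 1) x" by (simp add: poly_monom)
      then show ?thesis using monom_in_polys_over[OF D sr_one[OF D]] by blast
    next
      case 3
      then have "a * x ^ 1 = poly 1 x" using x by simp
      then show ?thesis using sr_one[OF P] by blast
    qed
  qed
  ultimately have "f \<in> ?E" using gen_ring_least[of ?E] f by blast
  then show thesis using that by blast
qed

text \<open>Both hypotheses expand \<open>f\<close> in powers of \<open>x\<close>: the first has
  \<open>coeff a j\<close> at exponent \<open>j - K\<close>, the second has \<open>coeff b i\<close>
  times \<open>P\<close> to the power \<open>i - M\<close> at exponent \<open>M - i\<close>. Since
  \<open>x\<close> is transcendental, the coefficients with \<open>j = K + M - i\<close> agree.
  Factors \<open>P ^ M\<close> and \<open>P ^ i\<close> on the two sides avoid negative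
  exponents.\<close>

lemma exchange_coeffs:
  fixes x P f :: "'a::field"
  assumes G: "is_subring G" and tr: "transc_over G x"
    and x: "x \<noteq> 0" and P: "P \<in> G" "P \<noteq> 0"
    and a: "a \<in> polys_over G" "f * x ^ K = poly a x"
    and b: "b \<in> polys_over G" "f * (P / x) ^ M = poly b (P / x)"
  shows "coeff b i * P ^ i = (if i \<le> K + M then P ^ M * coeff a (K + M - i) else 0)"
proof -
  \<comment> \<open>Makes all exponents of \<open>x\<close> natural numbers, and is at least
    \<open>i\<close>, so that index \<open>i\<close> occurs in the sum even when it exceeds the
    degree of \<open>b\<close>.\<close>
  define d where "d = max (Polynomial.degree b) i"
  have "poly b (P / x) * x ^ d = (\<Sum>j\<le>d. coeff b j * (P / x) ^ j * x ^ d)"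
    unfolding poly_altdef sum_distrib_right by (rule sum.mono_neutral_left) (auto simp: d_def coeff_eq_0)
  also have "\<dots> = (\<Sum>j\<le>d. coeff b j * P ^ j * x ^ (d - j))"
    using x by (intro sum.cong refl) (auto simp: power_divide power_diff)
  finally have b': "poly b (P / x) * x ^ d = (\<Sum>j\<le>d. coeff b j * P ^ j * x ^ (d - j))" .
  define A where "A = smult (P ^ M) a * monom 1 d"
  define B where "B = (\<Sum>j\<le>d. monom (coeff b j * P ^ j) (K + M + d - j))"
  have "A - B = 0"
  proof (rule transc_overD[OF tr])
    have PA: "P ^ M \<in> G" using P(1) by (rule sr_power[OF G])
    have "A - B \<in> polys_over G" unfolding A_def B_def
      by (intro sr_diff[OF is_subring_polys_over[OF G]] sr_mult[OF is_subring_polys_over[OF G]]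
          sr_sum[OF is_subring_polys_over[OF G]] smult_in_polys_over G PA a monom_in_polys_over
          sr_one[OF G] sr_mult[OF G] sr_power[OF G] polys_overD[OF b(1)] P)
    then show "coeff (A - B) n \<in> G" for n by (rule polys_overD)
    have "poly A x = P ^ M * (f * x ^ K) * x ^ d" by (simp add: A_def a(2) poly_monom)
    also have "\<dots> = f * (P / x) ^ M * x ^ (K + M) * x ^ d" using x by (simp add: power_divide power_add)
    also have "\<dots> = x ^ (K + M) * (poly b (P / x) * x ^ d)" by (simp add: b(2))
    also have "\<dots> = (\<Sum>j\<le>d. coeff b j * P ^ j * (x ^ (K + M) * x ^ (d - j)))"
      unfolding b' by (simp add: sum_distrib_left mult_ac)
    also have "\<dots> = poly B x" unfolding B_def poly_sum poly_monom
      by (intro sum.cong refl) (simp add: power_add[symmetric])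
    finally show "poly (A - B) x = 0" by simp
  qed
  then have "coeff A (K + M + d - i) = coeff B (K + M + d - i)" by simp
  moreover have "coeff B (K + M + d - i) = (\<Sum>j\<le>d. if j = i then coeff b j * P ^ j else 0)"
    unfolding B_def coeff_sum by (intro sum.cong refl) (auto simp: d_def)
  then have "coeff B (K + M + d - i) = coeff b i * P ^ i" by (simp add: d_def)
  moreover have "coeff A (K + M + d - i) = (if i \<le> K + M then P ^ M * coeff a (K + M - i) else 0)"
  proof (cases "i \<le> K + M")
    case True
    then have "K + M + d - i = (K + M - i) + d" by simp
    then show ?thesis using True by (simp add: A_def coeff_monom_mult mult.commute[of _ "monom 1 d"])
  next
    case False
    then have "K + M + d - i < d" by (auto simp: d_def)
    then show ?thesis using False by (simp add: A_def coeff_monom_mult mult.commute[of _ "monom 1 d"])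
  qed
  ultimately show ?thesis by simp
qed

text \<open>By \<open>exchange_coeffs\<close>, each coefficient of \<open>f\<close> in powers of
  \<open>P / x\<close> lands in \<open>H\<close> after multiplication by a power of
  \<open>P\<close>, and \<open>sat\<close> cancels that power. The intended case is a polynomial
  ring \<open>H\<close> in a variable that does not divide \<open>P\<close>, with \<open>G\<close>
  its localization at this variable.\<close>

lemma exchange_descent:
  fixes x P f :: "'a::field"
  assumes G: "is_subring G" and H: "is_subring H" "H \<subseteq> G" and tr: "transc_over G x"
    and x: "x \<noteq> 0" and P: "P \<in> H" "P \<noteq> 0"
    and sat: "\<And>a m. a \<in> G \<Longrightarrow> P ^ m * a \<in> H \<Longrightarrow> a \<in> H"
    and f: "f \<in> gen_ring (H \<union> {x, inverse x})" "f \<in> gen_ring (G \<union> {P / x, inverse (P / x)})"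
  shows "f \<in> gen_ring (H \<union> {P / x, inverse (P / x)})"
proof -
  have x': "P / x \<noteq> 0" using x P by simp
  obtain a K where a: "a \<in> polys_over H" "f * x ^ K = poly a x" using gen_ring_laurent_clear[OF H(1) x f(1)] .
  obtain b M where b: "b \<in> polys_over G" "f * (P / x) ^ M = poly b (P / x)"
    using gen_ring_laurent_clear[OF G x' f(2)] .
  have aG: "a \<in> polys_over G" and PG: "P \<in> G" using a(1) P H(2) by (auto simp: polys_over_def)
  have "coeff b i \<in> H" for i
  proof (rule sat)
    show "coeff b i \<in> G" by (rule polys_overD[OF b(1)])
    have "coeff b i * P ^ i \<in> H" unfolding exchange_coeffs[OF G tr x PG P(2) aG a(2) b]
      by (simp add: sr_zero[OF H(1)] sr_mult[OF H(1)] sr_power[OF H(1)] P polys_overD[OF a(1)])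
    then show "P ^ i * coeff b i \<in> H" by (simp only: mult.commute)
  qed
  then have bH: "b \<in> polys_over H" by (simp add: polys_over_def)
  let ?R = "gen_ring (H \<union> {P / x, inverse (P / x)})"
  have "poly b (P / x) \<in> ?R" by (rule poly_in_subring[OF gen_ring_sr bH]) (auto intro: gr_incl)
  then have "f * (P / x) ^ M * inverse (P / x) ^ M \<in> ?R"
    unfolding b(2) by (intro sr_mult[OF gen_ring_sr] sr_power[OF gen_ring_sr]) (auto intro: gr_incl)
  then show ?thesis using x' by (simp add: mult.assoc power_mult_distrib[symmetric])
qed

text \<open>A nonzero constant coefficient means that \<open>x\<close> does not divide
  \<open>poly p x\<close>. If \<open>a\<close> has the numerator \<open>b\<close> over
  \<open>x ^ Suc N\<close>, comparing constant coefficients in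
  \<open>p ^ m * b = q * monom 1 (Suc N)\<close> gives \<open>coeff b 0 = 0\<close>, so one factor
  \<open>x\<close> cancels.\<close>

lemma const_coeff_saturated:
  fixes x :: "'a::field"
  assumes C: "is_subring C" and tr: "transc_over C x" and x: "x \<noteq> 0"
    and p: "p \<in> polys_over C" "coeff p 0 \<noteq> 0"
    and a: "a \<in> gen_ring (C \<union> {x, inverse x})" and pa: "poly p x ^ m * a \<in> gen_ring (C \<union> {x})"
  shows "a \<in> gen_ring (C \<union> {x})"
proof -
  note PC = is_subring_polys_over[OF C]
  obtain q where q: "q \<in> polys_over C" "poly p x ^ m * a = poly q x"
    using pa unfolding gen_ring_insert_eq[OF C] by auto
  have "a \<in> gen_ring (C \<union> {x})" if "b \<in> polys_over C" "a * x ^ N = poly b x" for b N using that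
  proof (induction N arbitrary: b)
    case 0
    then show ?case unfolding gen_ring_insert_eq[OF C] by auto
  next
    case (Suc N)
    have "p ^ m * b - q * monom 1 (Suc N) = 0"
    proof (rule transc_overD[OF tr])
      show "coeff (p ^ m * b - q * monom 1 (Suc N)) i \<in> C" for i by (rule polys_overD)
          (intro sr_diff[OF PC] sr_mult[OF PC] sr_power[OF PC] p q Suc.prems monom_in_polys_over C sr_one[OF C])
      show "poly (p ^ m * b - q * monom 1 (Suc N)) x = 0"
        by (simp add: poly_monom q(2)[symmetric] Suc.prems(2)[symmetric] mult_ac)
    qed
    then have "coeff (p ^ m * b) 0 = coeff (q * monom 1 (Suc N)) 0" by simp
    then have "coeff b 0 = 0" using p(2) by (simp add: coeff_mult_0 mult.commute[of q] coeff_monom_mult coeff_0_power)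
    then obtain b' where b': "b = pCons 0 b'" by (metis coeff_pCons_0 pCons_cases)
    have "coeff b' i = coeff b (Suc i)" for i by (simp add: b')
    then have "b' \<in> polys_over C" using Suc.prems(1) by (auto simp: polys_over_def)
    moreover have "a * x ^ N = poly b' x" using Suc.prems(2) x by (simp add: b' mult_ac)
    ultimately show ?case by (rule Suc.IH)
  qed
  then show ?thesis using gen_ring_laurent_clear[OF C x a] by blast
qed

definition laurent_ext :: "'a::field set \<Rightarrow> 'a \<Rightarrow> 'a set" where
  "laurent_ext D x = gen_ring (D \<union> {x, inverse x})"

abbreviation laurent_ext2 :: "'a::field set \<Rightarrow> 'a \<Rightarrow> 'a \<Rightarrow> 'a set" where
  "laurent_ext2 C x y \<equiv> laurent_ext (laurent_ext C x) y"

text \<open>Induction on the pole order \<open>N\<close> of \<open>f\<close> in \<open>x2\<close>.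
  Membership in the ring of \<open>x1\<close> and \<open>x2'\<close> makes the lowest coefficient
  divisible by \<open>P2 ^ N\<close>, with some quotient \<open>h\<close>. If \<open>h\<close> can
  be replaced modulo \<open>x2\<close> by an element \<open>g\<close> of all four rings, then
  subtracting \<open>x2' ^ N * g\<close> lowers the pole order. The hypothesis \<open>lift\<close>
  provides \<open>g\<close>; linked and unlinked directions verify it in different ways.\<close>

lemma rank_two_upper_bound:
  fixes x1 x2 :: "'a::field"
  assumes C: "is_subring C" and x0: "x1 \<noteq> 0" "x2 \<noteq> 0"
    and tr1: "transc_over (fractions (gen_ring (C \<union> {x2}))) x1"
    and tr2: "transc_over (fractions (gen_ring (C \<union> {x1}))) x2"
    and p1: "p1 \<in> polys_over C" "coeff p1 0 \<noteq> 0" and x1': "x1' = poly p1 x2 / x1" "x1' \<noteq> 0"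
    and P2: "P2 \<in> laurent_ext C x1" "P2 \<noteq> 0" and x2': "x2' = P2 / x2"
    and P2': "P2' \<in> laurent_ext C x1'" "P2' \<noteq> 0" and x2'': "x2'' = P2' / x2"
    and x2'_in: "x2' \<in> laurent_ext2 C x1' x2" "x2' \<in> laurent_ext2 C x1' x2''"
    and lift: "\<And>N p h f. \<lbrakk>f \<in> laurent_ext2 C x1' x2; p \<in> polys_over (laurent_ext C x1); f * x2 ^ N = poly p x2;
        h \<in> laurent_ext C x1; coeff p 0 = P2 ^ N * h\<rbrakk> \<Longrightarrow>
      \<exists>g q. g \<in> laurent_ext2 C x1 x2 \<and> g \<in> laurent_ext2 C x1' x2 \<and> g \<in> laurent_ext2 C x1 x2' \<and> g \<in> laurent_ext2 C x1' x2'' \<and>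
        q \<in> polys_over (laurent_ext C x1) \<and> h - g = x2 * poly q x2"
    and f: "f \<in> laurent_ext2 C x1 x2" "f \<in> laurent_ext2 C x1' x2" "f \<in> laurent_ext2 C x1 x2'"
  shows "f \<in> laurent_ext2 C x1' x2''"
proof -
  have srE: "is_subring (laurent_ext D x)" for D x by (simp add: laurent_ext_def gen_ring_sr)
  have inE: "x \<in> laurent_ext D x" "inverse x \<in> laurent_ext D x" "D \<subseteq> laurent_ext D x" for D x by (auto simp: laurent_ext_def intro: gr_incl)
  have E_least: "laurent_ext D x \<subseteq> R" if "is_subring R" "D \<subseteq> R" "x \<in> R" "inverse x \<in> R" for D x R
    unfolding laurent_ext_def by (rule gen_ring_least) (use that in auto)
  let ?F1 = "fractions (gen_ring (C \<union> {x1}))"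
  have srF1: "is_subring ?F1" by (rule fractions_sr[OF gen_ring_sr])
  have EF1: "laurent_ext C x1 \<subseteq> ?F1" by (rule E_least[OF srF1]) (auto intro!: fractions_incl[OF gen_ring_sr]
        fractions_inverse[OF gen_ring_sr] intro: gr_incl)
  have trE: "transc_over (laurent_ext C x1) x2" by (rule transc_over_mono[OF tr2 EF1])
  have trC: "transc_over C x2" by (rule transc_over_mono[OF trE inE(3)])
  have x20: "x2'' \<noteq> 0" "x2' \<noteq> 0" using x0 P2 P2' x2' x2'' by auto
  have x2_in: "x2 \<in> laurent_ext2 C x1' x2''"
  proof -
    have "x2 = P2' * inverse x2''" using x0 P2' by (simp add: x2'' field_simps)
    then show ?thesis using P2'(1) inE(3)[of "laurent_ext C x1'" x2''] by (auto intro!: sr_mult[OF srE] inE)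
  qed
  have C_in: "C \<subseteq> laurent_ext2 C x y" for x y using inE(3)[of C x] inE(3)[of "laurent_ext C x" y] by blast
  have "f \<in> laurent_ext2 C x1' x2''"
    if "f \<in> laurent_ext2 C x1 x2" "f \<in> laurent_ext2 C x1' x2" "f \<in> laurent_ext2 C x1 x2'"
      "p \<in> polys_over (laurent_ext C x1)" "f * x2 ^ N = poly p x2" for f N p using that
  proof (induction N arbitrary: f p)
    case 0
    \<comment> \<open>The target ring contains \<open>x2\<close>, as
      \<open>P2' * inverse x2''\<close>, but its inverse need not lie there. So an element without
      pole in \<open>x2\<close> has to be descended from coefficients in \<open>?G\<close> to
      coefficients polynomial in \<open>x2\<close>.\<close>
    let ?H = "gen_ring (C \<union> {x2})"
    let ?G = "laurent_ext C x2"
    have HG: "?H \<subseteq> ?G" by (auto simp: laurent_ext_def intro!: gen_ring_mono)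
    have G: "?G \<subseteq> fractions ?H" by (rule E_least[OF fractions_sr[OF gen_ring_sr]])
        (auto intro!: fractions_incl[OF gen_ring_sr] fractions_inverse[OF gen_ring_sr] intro: gr_incl)
    have P1: "poly p1 x2 \<in> ?H" unfolding gen_ring_insert_eq[OF C] using p1(1) by auto
    have "f \<in> laurent_ext ?H x1'" unfolding laurent_ext_def x1'(1)
    proof (rule exchange_descent[of ?G ?H])
      show "is_subring ?G" "is_subring ?H" by (simp_all add: srE gen_ring_sr)
      show "transc_over ?G x1" by (rule transc_over_mono[OF tr1 G])
      show "poly p1 x2 \<noteq> 0" using x1' by auto
      fix a m assume "a \<in> ?G" "poly p1 x2 ^ m * a \<in> ?H"
      then show "a \<in> ?H" unfolding laurent_ext_def by (rule const_coeff_saturated[OF C trC x0(2) p1])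
    next
      have "laurent_ext C x1 \<subseteq> gen_ring (?H \<union> {x1, inverse x1})"
        by (rule E_least[OF gen_ring_sr]) (auto intro: gr_incl)
      then have "poly p x2 \<in> gen_ring (?H \<union> {x1, inverse x1})"
        using 0(4) by (intro poly_in_subring[OF gen_ring_sr, of p "laurent_ext C x1"]) (auto intro: gr_incl)
      then show "f \<in> gen_ring (?H \<union> {x1, inverse x1})" using 0(5) by simp
      have "laurent_ext2 C x1' x2 \<subseteq> gen_ring (?G \<union> {x1', inverse x1'})"
        by (intro E_least gen_ring_sr) (use inE(1,2)[of x2 C] inE(3)[of C x2] in \<open>auto intro: gr_incl\<close>)
      then show "f \<in> gen_ring (?G \<union> {poly p1 x2 / x1, inverse (poly p1 x2 / x1)})"
        using 0(2) by (auto simp: x1'(1))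
    qed (use HG P1 x0 in auto)
    moreover have "laurent_ext ?H x1' \<subseteq> laurent_ext2 C x1' x2''"
    proof (rule E_least[OF srE])
      show "?H \<subseteq> laurent_ext2 C x1' x2''" by (rule gen_ring_least[OF srE]) (use C_in x2_in in auto)
    qed (use inE(1,2)[of x1' C] inE(3)[of "laurent_ext C x1'" x2''] in auto)
    ultimately show ?case by auto
  next
    case (Suc N)
    have x2'P: "x2' = P2 / x2" by (rule x2')
    obtain b M where b: "b \<in> polys_over (laurent_ext C x1)" "f * x2' ^ M = poly b x2'"
      using Suc.prems(3) gen_ring_laurent_clear[OF srE x20(2)] unfolding laurent_ext_def[of "laurent_ext C x1"] by blast
    \<comment> \<open>The top index \<open>Suc N + M\<close> is the one that corresponds to the
      constant coefficient of \<open>p\<close>.\<close>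
    have "coeff b (Suc N + M) * P2 ^ (Suc N + M) = P2 ^ M * coeff p 0"
      using exchange_coeffs[OF srE trE x0(2) P2 Suc.prems(4,5) b[unfolded x2'P], of "Suc N + M"] by simp
    then have "P2 ^ M * coeff p 0 = coeff b (Suc N + M) * P2 ^ (Suc N + M)" by (rule sym)
    also have "\<dots> = P2 ^ M * (P2 ^ Suc N * coeff b (Suc N + M))" by (simp only: power_add mult_ac)
    finally have "P2 ^ M * coeff p 0 = P2 ^ M * (P2 ^ Suc N * coeff b (Suc N + M))" .
    then have p0: "coeff p 0 = P2 ^ Suc N * coeff b (Suc N + M)" using P2(2) by auto
    obtain g q where g: "g \<in> laurent_ext2 C x1 x2" "g \<in> laurent_ext2 C x1' x2" "g \<in> laurent_ext2 C x1 x2'" "g \<in> laurent_ext2 C x1' x2''"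
      "q \<in> polys_over (laurent_ext C x1)" "coeff b (Suc N + M) - g = x2 * poly q x2"
      using lift[OF Suc.prems(2,4,5) polys_overD[OF b(1)] p0] by blast
    \<comment> \<open>The subtracted term has the same lowest coefficient in \<open>x2\<close> as
      \<open>f\<close>, because \<open>x2' * x2 = P2\<close> and \<open>g\<close> agrees modulo
      \<open>x2\<close> with the quotient just found.\<close>
    define f' where "f' = f - x2' ^ Suc N * g"
    obtain p' where p': "p = pCons (coeff p 0) p'" by (metis coeff_pCons_0 pCons_cases)
    have "coeff p' i = coeff p (Suc i)" for i by (subst p') simp
    then have p'_in: "p' \<in> polys_over (laurent_ext C x1)" using Suc.prems(4) by (auto simp: polys_over_def)
    have "x2 * (f' * x2 ^ N) = f * x2 ^ Suc N - (x2' * x2) ^ Suc N * g"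
      by (simp add: f'_def algebra_simps power_mult_distrib)
    also have "x2' * x2 = P2" using x0 by (simp add: x2')
    also have "f * x2 ^ Suc N = coeff p 0 + x2 * poly p' x2" unfolding Suc.prems(5) by (subst p') simp
    also have "coeff p 0 + x2 * poly p' x2 - P2 ^ Suc N * g
        = x2 * poly p' x2 + P2 ^ Suc N * (coeff b (Suc N + M) - g)" unfolding p0 by (simp add: algebra_simps)
    also have "\<dots> = x2 * poly (p' + smult (P2 ^ Suc N) q) x2" unfolding g(6) by (simp add: algebra_simps)
    finally have eq: "f' * x2 ^ N = poly (p' + smult (P2 ^ Suc N) q) x2" using x0 by simp
    have "x2' \<in> laurent_ext2 C x1 x2"
      using P2(1) inE(1,2)[of x2 "laurent_ext C x1"] inE(3)[of "laurent_ext C x1" x2] by (auto simp: x2' divide_inverse intro!: sr_mult[OF srE])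
    then have "f' \<in> laurent_ext2 C x1' x2''" by (intro Suc.IH[OF _ _ _ _ eq])
        (auto simp only: f'_def intro!: sr_diff[OF srE] sr_mult[OF srE] sr_power[OF srE] g x2'_in inE Suc.prems
          sr_add[OF is_subring_polys_over[OF srE]] smult_in_polys_over srE p'_in P2)
    then have "f' + x2' ^ Suc N * g \<in> laurent_ext2 C x1' x2''"
      by (intro sr_add[OF srE] sr_mult[OF srE] sr_power[OF srE] g x2'_in)
    then show ?case by (simp add: f'_def)
  qed
  moreover obtain p N where "p \<in> polys_over (laurent_ext C x1)" "f * x2 ^ N = poly p x2"
    using gen_ring_laurent_clear[OF srE x0(2)] f(1) unfolding laurent_ext_def[of "laurent_ext C x1"] by blast
  ultimately show ?thesis using f by blast
qed

lemma is_subring_laurent_ext: "is_subring (laurent_ext D x)"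
  by (simp add: laurent_ext_def gen_ring_sr)

lemma laurent_ext_in: "x \<in> laurent_ext D x" "inverse x \<in> laurent_ext D x"
  by (auto simp: laurent_ext_def intro: gr_incl)

lemma laurent_ext_base: "a \<in> D \<Longrightarrow> a \<in> laurent_ext D x"
  by (auto simp: laurent_ext_def intro: gr_incl)

lemma polys_over_mono: "p \<in> polys_over D \<Longrightarrow> D \<subseteq> D' \<Longrightarrow> p \<in> polys_over D'"
  by (auto simp: polys_over_def)

lemma poly_minus_const:
  fixes p :: "'a::field poly"
  assumes "p \<in> polys_over C"
  obtains q where "q \<in> polys_over C" "\<And>x. poly p x - coeff p 0 = x * poly q x"
proof -
  obtain q where q: "p = pCons (coeff p 0) q" by (metis coeff_pCons_0 pCons_cases)
  have "coeff q i = coeff p (Suc i)" for i by (subst q) simp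
  then have "q \<in> polys_over C" using assms by (auto simp: polys_over_def)
  moreover have "poly p x - coeff p 0 = x * poly q x" for x by (subst q) simp
  ultimately show thesis by (rule that)
qed

text \<open>As \<open>b > 0\<close>, the product \<open>x1 * x1'\<close> is congruent modulo
  \<open>x2\<close> to the unit \<open>s1\<close>. So \<open>x1' * inverse s1\<close> can stand in
  for \<open>inverse x1\<close> modulo \<open>x2\<close>, which lifts every coefficient into all
  four rings. The unit \<open>e\<close> accounts for the monomial by which the exchange relation
  after mutation differs from its normalized form.\<close>

lemma rank_two_linked:
  fixes x1 x2 :: "'a::field"
  assumes C: "is_subring C" and x0: "x1 \<noteq> 0" "x2 \<noteq> 0" "x1' \<noteq> 0" "x2' \<noteq> 0" "x2'' \<noteq> 0"
    and tr1: "transc_over (fractions (gen_ring (C \<union> {x2}))) x1"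
    and tr2: "transc_over (fractions (gen_ring (C \<union> {x1}))) x2"
    and units: "q1 \<in> C" "s1 \<in> C" "inverse s1 \<in> C" "s1 \<noteq> 0" "q2 \<in> C" "s2 \<in> C"
    and bc: "b > 0"
    and ex1: "x1 * x1' = s1 + q1 * x2 ^ b" and ex2: "x2 * x2' = q2 + s2 * x1 ^ c"
    and ex2': "x2 * x2'' = e * (q2 * x1' ^ c + s2 * s1 ^ c)"
    and e: "e \<in> laurent_ext C x1'" "inverse e \<in> laurent_ext C x1'"
    and f: "f \<in> laurent_ext2 C x1 x2" "f \<in> laurent_ext2 C x1' x2" "f \<in> laurent_ext2 C x1 x2'"
  shows "f \<in> laurent_ext2 C x1' x2''"
proof -
  let ?R = "\<lambda>y z. laurent_ext2 C y z"
  note sr = is_subring_laurent_ext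
  note in1 = laurent_ext_base[OF laurent_ext_in(1)] laurent_ext_base[OF laurent_ext_in(2)] laurent_ext_in
  have CR: "a \<in> ?R y z" if "a \<in> C" for a y z using that by (intro laurent_ext_base)
  define p1 where "p1 = monom s1 0 + monom q1 b"
  have p1: "p1 \<in> polys_over C" "coeff p1 0 = s1" "poly p1 x2 = s1 + q1 * x2 ^ b"
    using bc by (auto simp: p1_def poly_monom intro!: sr_add[OF is_subring_polys_over[OF C]]
        monom_in_polys_over[OF C] units)
  have x1': "x1' = poly p1 x2 / x1" using ex1 x0 by (simp add: p1(3) field_simps)
  define P2 where "P2 = q2 + s2 * x1 ^ c"
  have x2': "x2' = P2 / x2" using ex2 x0 by (simp add: P2_def field_simps)
  have P2: "P2 \<in> laurent_ext C x1" "P2 \<noteq> 0"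
    unfolding P2_def by (intro sr_add[OF sr] sr_mult[OF sr] sr_power[OF sr]
        laurent_ext_in units(5,6)[THEN laurent_ext_base]) (use x0 x2' P2_def in auto)
  define P2' where "P2' = e * (q2 * x1' ^ c + s2 * s1 ^ c)"
  have x2'': "x2'' = P2' / x2" using ex2' x0 by (simp add: P2'_def field_simps)
  have P2': "P2' \<in> laurent_ext C x1'" "P2' \<noteq> 0"
    unfolding P2'_def by (intro sr_add[OF sr] sr_mult[OF sr] sr_power[OF sr] e(1)
        laurent_ext_in units(2,5,6)[THEN laurent_ext_base]) (use x0 x2'' P2'_def in auto)
  have p1R: "poly p1 x2 \<in> ?R y z" if "x2 \<in> ?R y z" for y z
    by (rule poly_in_subring[OF sr p1(1) _ that]) (use CR in auto)
  have x2R3: "x2 \<in> ?R x1 x2'"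
  proof -
    have x2: "x2 = P2 * inverse x2'" using x2' x0 P2 by (simp add: field_simps)
    show ?thesis by (subst x2) (intro sr_mult[OF sr] laurent_ext_base[OF P2(1)] in1)
  qed
  have x2R4: "x2 \<in> ?R x1' x2''"
  proof -
    have x2: "x2 = P2' * inverse x2''" using x2'' x0 P2' by (simp add: field_simps)
    show ?thesis by (subst x2) (intro sr_mult[OF sr] laurent_ext_base[OF P2'(1)] in1)
  qed
  have x1'R: "x1' \<in> ?R x1 z" if "x2 \<in> ?R x1 z" for z
    unfolding x1' divide_inverse by (intro sr_mult[OF sr] p1R that in1)
  have x1R: "x1 \<in> ?R x1' z" if "x2 \<in> ?R x1' z" for z
  proof -
    have x1: "x1 = poly p1 x2 * inverse x1'" using ex1 x0 by (simp add: p1(3) field_simps)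
    show ?thesis by (subst x1) (intro sr_mult[OF sr] p1R[OF that] in1)
  qed
  have P2R: "P2 \<in> ?R y z" if "x1 \<in> ?R y z" for y z
    unfolding P2_def by (intro sr_add[OF sr] sr_mult[OF sr] sr_power[OF sr] CR that units)
  have e0: "e \<noteq> 0" using P2'(2) by (auto simp: P2'_def)
  show ?thesis
  proof (rule rank_two_upper_bound[OF C x0(1,2) tr1 tr2 p1(1) _ x1' x0(3) P2 x2' P2' x2'' _ _ _ f])
    show "coeff p1 0 \<noteq> 0" using p1 units by simp
    show "x2' \<in> ?R x1' x2" unfolding x2' divide_inverse by (intro sr_mult[OF sr] P2R x1R in1)
    show "x2' \<in> ?R x1' x2''"
    proof -
      \<comment> \<open>Writes \<open>(x1 * x1') ^ c\<close> as \<open>s1 ^ c\<close> plus a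
        multiple of \<open>x2\<close>; thereby \<open>x1' ^ c * x2'\<close> is expressed through
        \<open>x2''\<close> and \<open>x2\<close>.\<close>
      have pc: "p1 ^ c \<in> polys_over C" by (rule sr_power[OF is_subring_polys_over[OF C] p1(1)])
      obtain q where q: "q \<in> polys_over C" "\<And>x. poly (p1 ^ c) x - coeff (p1 ^ c) 0 = x * poly q x"
        by (rule poly_minus_const[OF pc]) (rule that)
      have "x1' ^ c * (x2 * x2') = q2 * x1' ^ c + s2 * (x1 * x1') ^ c"
        unfolding ex2 by (simp add: power_mult_distrib algebra_simps)
      also have "(x1 * x1') ^ c = s1 ^ c + x2 * poly q x2"
        using q(2)[of x2] by (simp add: ex1 p1 coeff_0_power diff_eq_eq add.commute)
      also have "q2 * x1' ^ c + s2 * (s1 ^ c + x2 * poly q x2)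
          = inverse e * (x2 * x2'') + s2 * (x2 * poly q x2)" using e0 unfolding ex2' by (simp add: field_simps)
      also have "\<dots> = x2 * (inverse e * x2'' + s2 * poly q x2)" by (simp add: algebra_simps)
      finally have "x1' ^ c * x2' = inverse e * x2'' + s2 * poly q x2" using x0 by simp
      then have x2'_eq: "x2' = inverse x1' ^ c * (inverse e * x2'' + s2 * poly q x2)"
        using x0 by (simp add: field_simps)
      have qR: "poly q x2 \<in> ?R x1' x2''" by (rule poly_in_subring[OF sr q(1) _ x2R4]) (use CR in auto)
      show ?thesis by (subst x2'_eq) (intro sr_add[OF sr] sr_mult[OF sr] sr_power[OF sr] in1 CR[OF units(6)]
            laurent_ext_base[OF e(2)] qR)
    qed
    fix N p h g
    assume h: "h \<in> laurent_ext C x1"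
    obtain a K where a: "a \<in> polys_over C" "h * x1 ^ K = poly a x1"
      using gen_ring_laurent_clear[OF C x0(1)] h unfolding laurent_ext_def by blast
    \<comment> \<open>\<open>h\<close> with \<open>inverse x1\<close> replaced by its substitute
      modulo \<open>x2\<close>; it lies in each of the rings that contain both \<open>x1\<close> and
      \<open>x1'\<close>.\<close>
    define u where "u = poly a x1 * (x1' * inverse s1) ^ K"
    have uR: "u \<in> ?R y z" if "x1 \<in> ?R y z" "x1' \<in> ?R y z" for y z unfolding u_def
      by (intro sr_mult[OF sr] sr_power[OF sr] that CR units poly_in_subring[OF sr a(1)]) (use CR in auto)
    define v where "v = (1 + monom (q1 * inverse s1) b) ^ K"
    have v: "v \<in> polys_over C" unfolding v_def
      by (intro sr_power sr_add sr_one is_subring_polys_over C monom_in_polys_over sr_mult units)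
    obtain q where q: "q \<in> polys_over C" "\<And>x. poly v x - coeff v 0 = x * poly q x"
      by (rule poly_minus_const[OF v]) (rule that)
    have v0: "coeff v 0 = 1" using bc by (simp add: v_def coeff_0_power)
    have "x1 * (x1' * inverse s1) = 1 + q1 * inverse s1 * x2 ^ b" using ex1 units(4) by (simp add: field_simps)
    then have "x1' * inverse s1 = inverse x1 * (1 + q1 * inverse s1 * x2 ^ b)" using x0 by (simp add: field_simps)
    then have "(x1' * inverse s1) ^ K = inverse x1 ^ K * poly v x2" by (simp add: v_def poly_monom power_mult_distrib)
    moreover have "h = poly a x1 * inverse x1 ^ K" using a(2) x0 by (simp add: field_simps)
    ultimately have "h - u = - (poly a x1 * inverse x1 ^ K) * (poly v x2 - 1)" by (simp add: u_def algebra_simps)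
    also have "poly v x2 - 1 = x2 * poly q x2" using q(2)[of x2] by (simp add: v0)
    finally have "h - u = x2 * (- (poly a x1 * inverse x1 ^ K) * poly q x2)" by (simp add: algebra_simps)
    then have "h - u = x2 * poly (smult (- (poly a x1 * inverse x1 ^ K)) q) x2" by simp
    moreover have "smult (- (poly a x1 * inverse x1 ^ K)) q \<in> polys_over (laurent_ext C x1)"
      by (intro smult_in_polys_over sr sr_uminus sr_mult sr_power laurent_ext_in
          poly_in_subring[OF sr a(1)] polys_over_mono[OF q(1)]) (auto intro: laurent_ext_base)
    moreover have "u \<in> ?R x1 x2" "u \<in> ?R x1' x2" "u \<in> ?R x1 x2'" "u \<in> ?R x1' x2''"
      by (intro uR x1R x1'R in1 x2R3 x2R4)+
    ultimately show "\<exists>g q. g \<in> ?R x1 x2 \<and> g \<in> ?R x1' x2 \<and> g \<in> ?R x1 x2' \<and> g \<in> ?R x1' x2'' \<and>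
        q \<in> polys_over (laurent_ext C x1) \<and> h - g = x2 * poly q x2" by blast
  qed
qed

text \<open>Mutation in the first direction does not affect \<open>P2\<close>, hence
  \<open>x2'\<close> in place of \<open>x2''\<close>. Here \<open>h\<close> is its own lift,
  provided it belongs to the Laurent ring of \<open>x1'\<close>. Expanding \<open>P2 ^ N * h\<close>
  in \<open>x1\<close> and in \<open>x1'\<close> shows that \<open>P1 ^ (K - j)\<close> divides
  \<open>P2 ^ N * coeff a j\<close>, and coprimality removes \<open>P2 ^ N\<close>.\<close>

lemma rank_two_unlinked:
  fixes x1 x2 :: "'a::field"
  assumes C: "is_subring C" and x0: "x1 \<noteq> 0" "x2 \<noteq> 0" "x1' \<noteq> 0" "x2' \<noteq> 0"
    and tr1: "transc_over (fractions (gen_ring (C \<union> {x2}))) x1"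
    and tr2: "transc_over (fractions (gen_ring (C \<union> {x1}))) x2"
    and P: "P1 \<in> C" "P2 \<in> C"
    and coprime: "\<And>a b m n. a \<in> C \<Longrightarrow> b \<in> C \<Longrightarrow> P1 ^ m * b = P2 ^ n * a \<Longrightarrow> \<exists>c\<in>C. a = P1 ^ m * c"
    and ex1: "x1 * x1' = P1" and ex2: "x2 * x2' = P2"
    and f: "f \<in> laurent_ext2 C x1 x2" "f \<in> laurent_ext2 C x1' x2" "f \<in> laurent_ext2 C x1 x2'"
  shows "f \<in> laurent_ext2 C x1' x2'"
proof -
  let ?R = "\<lambda>y z. laurent_ext2 C y z"
  note sr = is_subring_laurent_ext
  note in1 = laurent_ext_base[OF laurent_ext_in(1)] laurent_ext_base[OF laurent_ext_in(2)] laurent_ext_in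
  have CR: "a \<in> ?R y z" if "a \<in> C" for a y z using that by (intro laurent_ext_base)
  have P0: "P1 \<noteq> 0" "P2 \<noteq> 0" using ex1 ex2 x0 by auto
  have x1': "x1' = P1 / x1" using ex1 x0 by (simp add: field_simps)
  have x2': "x2' = P2 / x2" using ex2 x0 by (simp add: field_simps)
  let ?G = "gen_ring (C \<union> {x1})"
  note srF = fractions_sr[OF gen_ring_sr[of "C \<union> {x1}"]]
  have CG: "C \<subseteq> fractions ?G" "x1 \<in> fractions ?G"
    by (auto intro!: fractions_incl[OF gen_ring_sr] intro: gr_incl)
  have inv1: "inverse x1 \<in> fractions ?G" by (rule fractions_inverse[OF gen_ring_sr CG(2)])
  have x1'F: "x1' \<in> fractions ?G" unfolding x1' divide_inverse using CG P inv1 by (intro sr_mult[OF srF]) auto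
  have EF: "laurent_ext C x1 \<subseteq> fractions ?G"
    unfolding laurent_ext_def by (rule gen_ring_least[OF srF]) (use CG inv1 in auto)
  have EF': "laurent_ext C x1' \<subseteq> fractions ?G" unfolding laurent_ext_def
    by (rule gen_ring_least[OF srF]) (use CG x1'F fractions_inverse[OF gen_ring_sr x1'F] in auto)
  have trC: "transc_over C x1"
  proof (rule transc_over_mono[OF tr1])
    show "C \<subseteq> fractions (gen_ring (C \<union> {x2}))"
      by (auto intro!: fractions_incl[OF gen_ring_sr] intro: gr_incl)
  qed
  show ?thesis
  proof (rule rank_two_upper_bound[OF C x0(1,2) tr1 tr2, of "[:P1:]" x1' P2 x2' P2, OF _ _ _ x0(3) _ P0(2) x2' _ P0(2) x2' _ _ _ f])
    show "[:P1:] \<in> polys_over C"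
      using P by (auto simp: polys_over_def coeff_pCons sr_zero[OF C] split: nat.splits)
    show "coeff [:P1:] 0 \<noteq> 0" "x1' = poly [:P1:] x2 / x1" using P0 x1' by auto
    show "P2 \<in> laurent_ext C x1" "P2 \<in> laurent_ext C x1'" by (intro laurent_ext_base P)+
    show "x2' \<in> ?R x1' x2" unfolding x2' divide_inverse by (intro sr_mult[OF sr] CR P in1)
    show "x2' \<in> ?R x1' x2'" by (rule in1)
    fix N p h g
    assume g: "g \<in> ?R x1' x2" "p \<in> polys_over (laurent_ext C x1)" "g * x2 ^ N = poly p x2"
      and h: "h \<in> laurent_ext C x1" "coeff p 0 = P2 ^ N * h"
    obtain q M where q: "q \<in> polys_over (laurent_ext C x1')" "g * x2 ^ M = poly q x2"
      using gen_ring_laurent_clear[OF sr x0(2)] g(1) unfolding laurent_ext_def[of _ x2] by blast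
    \<comment> \<open>\<open>p\<close> and \<open>q\<close> expand the same element in
      \<open>x2\<close> over two different rings. Their coefficients agree in a common field, so
      \<open>coeff p 0\<close> lies in the Laurent ring of \<open>x1'\<close>.\<close>
    have "monom 1 M * p - monom 1 N * q = 0"
    proof (rule transc_overD[OF tr2])
      note PF = is_subring_polys_over[OF srF]
      show "coeff (monom 1 M * p - monom 1 N * q) i \<in> fractions ?G" for i
        by (rule polys_overD, intro sr_diff[OF PF] sr_mult[OF PF] monom_in_polys_over srF sr_one[OF srF]
            polys_over_mono[OF g(2) EF] polys_over_mono[OF q(1) EF'])
      show "poly (monom 1 M * p - monom 1 N * q) x2 = 0" by (simp add: poly_monom g(3)[symmetric] q(2)[symmetric])
    qed
    then have "coeff (monom 1 M * p) M = coeff (monom 1 N * q) M" by simp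
    then have "coeff p 0 \<in> laurent_ext C x1'"
      by (auto simp: coeff_monom_mult sr_zero[OF sr] polys_overD[OF q(1)] split: if_splits)
    then have p0: "P2 ^ N * h \<in> laurent_ext C x1'" by (simp add: h)
    obtain a K where a: "a \<in> polys_over C" "h * x1 ^ K = poly a x1"
      using gen_ring_laurent_clear[OF C x0(1)] h(1) unfolding laurent_ext_def by blast
    obtain b L where b: "b \<in> polys_over C" "P2 ^ N * h * (P1 / x1) ^ L = poly b (P1 / x1)"
      using gen_ring_laurent_clear[OF C x0(3)] p0 unfolding laurent_ext_def x1' by blast
    have aN: "smult (P2 ^ N) a \<in> polys_over C" "P2 ^ N * h * x1 ^ K = poly (smult (P2 ^ N) a) x1"
      using a by (auto intro!: smult_in_polys_over C sr_power[OF C] P)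
    have trm: "coeff a j * x1 ^ j * inverse x1 ^ K \<in> laurent_ext C x1'" for j
    proof (cases "j < K")
      case False
      then have "coeff a j * x1 ^ j * inverse x1 ^ K = coeff a j * x1 ^ (j - K)"
        using x0 by (simp add: power_diff field_simps)
      moreover have x1: "x1 = P1 * inverse x1'" using x1' x0 P0 by (simp add: field_simps)
      have "x1 \<in> laurent_ext C x1'" by (subst x1) (intro sr_mult[OF sr] laurent_ext_in laurent_ext_base[OF P(1)])
      ultimately show ?thesis
        by (simp only:) (intro sr_mult[OF sr] sr_power[OF sr] laurent_ext_base[OF polys_overD[OF a(1)]])
    next
      case True
      define i where "i = L + (K - j)"
      have i: "i \<le> K + L" "K + L - i = j" using True by (auto simp: i_def)
      have "coeff b i * P1 ^ i = P1 ^ L * (P2 ^ N * coeff a j)"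
        using exchange_coeffs[OF C trC x0(1) P(1) P0(1) aN b, of i] i by simp
      then have "P1 ^ L * (P1 ^ (K - j) * coeff b i) = P1 ^ L * (P2 ^ N * coeff a j)"
        by (simp add: i_def power_add mult_ac)
      then have "P1 ^ (K - j) * coeff b i = P2 ^ N * coeff a j" using P0 by auto
      from coprime[OF polys_overD[OF a(1)] polys_overD[OF b(1)] this]
      obtain c where c: "c \<in> C" "coeff a j = P1 ^ (K - j) * c" by auto
      have "x1 ^ j * inverse x1 ^ K = inverse x1 ^ (K - j)" using True x0 by (simp add: power_diff field_simps)
      then have "coeff a j * x1 ^ j * inverse x1 ^ K = c * x1' ^ (K - j)"
        by (simp add: c x1' divide_inverse power_mult_distrib mult_ac)
      then show ?thesis
        by (simp only:) (intro sr_mult[OF sr] sr_power[OF sr] laurent_ext_base[OF c(1)] laurent_ext_in)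
    qed
    have "h = poly a x1 * inverse x1 ^ K" using a(2) x0 by (simp add: field_simps)
    also have "\<dots> = (\<Sum>j\<le>Polynomial.degree a. coeff a j * x1 ^ j * inverse x1 ^ K)"
      by (simp add: poly_altdef sum_distrib_right)
    finally have hE': "h \<in> laurent_ext C x1'" using trm by (auto intro: sr_sum[OF sr])
    show "\<exists>g q. g \<in> ?R x1 x2 \<and> g \<in> ?R x1' x2 \<and> g \<in> ?R x1 x2' \<and> g \<in> ?R x1' x2' \<and>
        q \<in> polys_over (laurent_ext C x1) \<and> h - g = x2 * poly q x2" by (rule exI[of _ h], rule exI[of _ 0])
        (use h(1) hE' sr_zero[OF is_subring_polys_over[OF sr]] in \<open>auto dest: laurent_ext_base\<close>)
  qed
qed

section \<open>Seed patterns\<close>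

declare One_nat_def [simp del]

lemma tree_step_in_vertices:
  assumes "t \<in> tree_vertices r" "k \<in> {1..r}"
  shows "tree_step k t \<in> tree_vertices r"
  using assms
  by (cases t rule: rev_cases) (auto simp: tree_vertices_def tree_step_def successively_append_iff)

lemma tree_step_involution:
  assumes "t \<in> tree_vertices r"
  shows "tree_step k (tree_step k t) = t"
proof (cases "t \<noteq> [] \<and> last t = k")
  case True
  then obtain s where s: "t = s @ [k]" by (metis append_butlast_last_id)
  then show ?thesis using assms by (auto simp: tree_vertices_def tree_step_def successively_append_iff)
next
  case False
  then show ?thesis by (auto simp: tree_step_def)
qed

text \<open>Connectedness of the tree: remove the letters of \<open>t0\<close> from the end, then
  append those of \<open>t\<close>. Removing the last letter is a step along its label.\<close>

lemma tree_vertices_induct [consumes 2, case_names base step]: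
  assumes t: "t \<in> tree_vertices r" and t0: "t0 \<in> tree_vertices r" and base: "P t0"
    and step: "\<And>t k. t \<in> tree_vertices r \<Longrightarrow> k \<in> {1..r} \<Longrightarrow> P t \<Longrightarrow> P (tree_step k t)"
  shows "P t"
proof -
  have "t0 \<in> tree_vertices r \<Longrightarrow> P t0 \<Longrightarrow> P []"
  proof (induction t0 rule: rev_induct)
    case (snoc k s)
    have "s \<in> tree_vertices r" "k \<in> {1..r}"
      using snoc.prems(1) by (auto simp: tree_vertices_def successively_append_iff)
    then show ?case using snoc step[of "s @ [k]" k] by (auto simp: tree_step_def)
  qed
  then have P0: "P []" using t0 base by simp
  show "P t" using t
  proof (induction t rule: rev_induct)
    case (snoc k s)
    have s: "s \<in> tree_vertices r" "k \<in> {1..r}" "s \<noteq> [] \<Longrightarrow> last s \<noteq> k"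
      using snoc.prems by (auto simp: tree_vertices_def successively_append_iff)
    then have "tree_step k s = s @ [k]" by (auto simp: tree_step_def)
    then show ?case using step[OF s(1,2) snoc.IH[OF s(1)]] by simp
  qed (rule P0)
qed

text \<open>Linear independence of the \<open>r\<close> columns of a matrix with \<open>n\<close>
  rows.\<close>

definition full_rank :: "nat \<Rightarrow> nat \<Rightarrow> (nat \<Rightarrow> nat \<Rightarrow> int) \<Rightarrow> bool" where
  "full_rank n r b \<longleftrightarrow> (\<forall>c. (\<forall>i\<in>{1..n}. (\<Sum>j=1..r. b i j * c j) = 0) \<longrightarrow> (\<forall>j\<in>{1..r}. c j = (0::int)))"

text \<open>In this form \<open>ppart (b i k)\<close> times row \<open>k\<close> is added to row
  \<open>i\<close> and \<open>ppart (- b k j)\<close> times column \<open>k\<close> to column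
  \<open>j\<close>, operations through which a kernel can be followed.\<close>

lemma mutate_mat_alt:
  "mutate_mat k b i j = (if i = k \<or> j = k then - b i j
     else b i j + ppart (b i k) * b k j + b i k * ppart (- b k j))"
proof -
  have "ppart x * ppart y - ppart (- x) * ppart (- y) = ppart x * y + x * ppart (- y)" for x y
    by (cases "x \<ge> 0"; cases "y \<ge> 0") (auto simp: ppart_def max_def)
  then show ?thesis by (simp add: mutate_mat_def)
qed

text \<open>A kernel vector \<open>c\<close> of the mutated matrix is changed in its entry
  \<open>k\<close> to a kernel vector \<open>d\<close> of the old one, which absorbs the column
  operations. Row \<open>k\<close> of the mutated system says that the old row \<open>k\<close>
  annihilates \<open>c\<close> outside \<open>k\<close>, which disposes of the row
  operations.\<close>

lemma full_rank_mutate: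
  assumes b: "full_rank n r b" and k: "k \<in> {1..r}" "k \<le> n" "b k k = 0"
    and b': "\<And>i j. i \<in> {1..n} \<Longrightarrow> j \<in> {1..r} \<Longrightarrow> b' i j = mutate_mat k b i j"
  shows "full_rank n r b'"
  unfolding full_rank_def
proof (intro allI impI)
  fix c assume c: "\<forall>i\<in>{1..n}. (\<Sum>j=1..r. b' i j * c j) = 0"
  define R where "R = {1..r} - {k}"
  have split: "(\<Sum>j=1..r. f j) = f k + (\<Sum>j\<in>R. f j)" for f :: "nat \<Rightarrow> int"
    unfolding R_def using k(1) by (subst sum.remove[of _ k]) auto
  define d where "d j = (if j = k then (\<Sum>j\<in>R. ppart (- b k j) * c j) - c k else c j)" for j
  have dR: "(\<Sum>j\<in>R. f j * d j) = (\<Sum>j\<in>R. f j * c j)" for f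
    by (intro sum.cong) (auto simp: R_def d_def)
  have kn: "k \<in> {1..n}" using k by auto
  have "(\<Sum>j=1..r. b' k j * c j) = - (\<Sum>j\<in>R. b k j * c j)" unfolding split sum_negf[symmetric]
    using k kn by (auto simp: b' mutate_mat_def R_def intro!: sum.cong)
  then have rowk: "(\<Sum>j\<in>R. b k j * c j) = 0" using c kn by auto
  have "(\<Sum>j=1..r. b i j * d j) = 0" if i: "i \<in> {1..n}" for i
  proof (cases "i = k")
    case True
    show ?thesis unfolding True split dR rowk k(3) by simp
  next
    case False
    have "0 = (\<Sum>j=1..r. b' i j * c j)" by (rule bspec[OF c i, symmetric])
    also have "\<dots> = - b i k * c k + (\<Sum>j\<in>R. (b i j + ppart (b i k) * b k j + b i k * ppart (- b k j)) * c j)"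
      unfolding split using k i False
      by (auto simp: b' mutate_mat_alt R_def intro!: arg_cong2[where f="(+)"] sum.cong)
    also have "\<dots> = - b i k * c k + ((\<Sum>j\<in>R. b i j * c j) + ppart (b i k) * (\<Sum>j\<in>R. b k j * c j)
        + b i k * (\<Sum>j\<in>R. ppart (- b k j) * c j))" by (simp add: sum_distrib_left sum.distrib algebra_simps)
    also have "\<dots> = b i k * d k + (\<Sum>j\<in>R. b i j * c j)" unfolding rowk d_def by (simp add: algebra_simps)
    also have "\<dots> = (\<Sum>j=1..r. b i j * d j)" unfolding split dR by simp
    finally show ?thesis by simp
  qed
  then have d0: "\<forall>j\<in>{1..r}. d j = 0" using b unfolding full_rank_def by blast
  then have R0: "c j = 0" if "j \<in> R" for j using that by (auto simp: R_def d_def split: if_splits)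
  have "d k = 0" using d0 k(1) by blast
  then have "c k = 0" by (simp add: d_def R0)
  then show "\<forall>j\<in>{1..r}. c j = 0" using R0 unfolding R_def by blast
qed

lemma powi_ppart: "a \<ge> 0 \<Longrightarrow> x powi a = x ^ nat a"
  by (simp add: power_int_def)

text \<open>Makes an exchange binomial one of its monomials times 1 plus a Laurent monomial, the
  shape required by \<open>binomial_coprime\<close>.\<close>

lemma prod_powi_ppart:
  fixes w :: "'v \<Rightarrow> 'a::field"
  assumes "\<And>i. i \<in> I \<Longrightarrow> w i \<noteq> 0"
  shows "(\<Prod>i\<in>I. w i ^ nat (ppart (v i))) = (\<Prod>i\<in>I. w i ^ nat (ppart (- v i))) * (\<Prod>i\<in>I. w i powi v i)"
proof -
  have "w i ^ nat (ppart (v i)) = w i ^ nat (ppart (- v i)) * w i powi v i" if "i \<in> I" for i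
    using assms[OF that] by (cases "v i \<ge> 0") (auto simp: ppart_def power_int_def max_def field_simps)
  then show ?thesis by (simp add: prod.distrib[symmetric])
qed

lemma laurent_insert:
  "laurent w (insert a I) (insert a I) = laurent_ext (laurent w I I) (w a)"
proof
  show "laurent w (insert a I) (insert a I) \<subseteq> laurent_ext (laurent w I I) (w a)"
    by (rule laurent_least[OF is_subring_laurent_ext])
      (auto intro: laurent_ext_in laurent_ext_base[OF laurent_var] laurent_ext_base[OF laurent_inverse])
  have "laurent w I I \<subseteq> laurent w (insert a I) (insert a I)" by (rule laurent_mono) auto
  then show "laurent_ext (laurent w I I) (w a) \<subseteq> laurent w (insert a I) (insert a I)"
    unfolding laurent_ext_def by (intro gen_ring_least laurent_sr) (auto intro: laurent_var laurent_inverse)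
qed

lemma laurent_cong:
  assumes "\<And>i. i \<in> I \<Longrightarrow> w i = w' i" "J \<subseteq> I"
  shows "laurent w I J = laurent w' I J"
proof -
  have "w ` I = w' ` I" "(\<lambda>j. inverse (w j)) ` J = (\<lambda>j. inverse (w' j)) ` J"
    using assms by (auto intro!: image_cong)
  then show ?thesis by (simp add: laurent_def)
qed

lemma fractions_closed:
  assumes "is_subring D" "E \<subseteq> fractions D"
  shows "fractions E \<subseteq> fractions D"
proof
  fix x assume "x \<in> fractions E"
  then obtain a b where x: "x = a / b" "a \<in> E" "b \<in> E" by (auto simp: fractions_def[of E])
  then have "a \<in> fractions D" "b \<in> fractions D" using assms(2) by blast+
  then show "x \<in> fractions D" unfolding x divide_inverse
    by (intro sr_mult[OF fractions_sr[OF assms(1)]] fractions_inverse[OF assms(1)])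
qed

lemma aindep_transcendental_laurent:
  assumes w: "aindep (insert a (insert b I)) w" and "a \<noteq> b" "a \<notin> I"
  shows "transc_over (fractions (gen_ring (laurent w I I \<union> {w b}))) (w a)"
proof (rule transc_over_mono[OF aindep_transcendental[OF w]])
  let ?G = "gen_ring (w ` (insert b I))"
  note inc = fractions_incl[OF gen_ring_sr]
  have var: "w i \<in> fractions ?G" if "i \<in> insert b I" for i using that by (intro inc gr_incl) auto
  have "laurent w I I \<subseteq> fractions ?G" by (rule laurent_least[OF fractions_sr[OF gen_ring_sr]])
      (intro var fractions_inverse[OF gen_ring_sr] insertI2; assumption)+
  then show "fractions (gen_ring (laurent w I I \<union> {w b})) \<subseteq> fractions ?G"
    by (intro fractions_closed gen_ring_sr gen_ring_least fractions_sr) (use var[of b] in auto)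
qed (use assms in auto)

text \<open>Implies that the variable \<open>q\<close> does not divide \<open>P\<close>; unlike
  indivisibility, the condition is preserved by sums.\<close>

definition pos_at :: "nat \<Rightarrow> (nat, int) mpol \<Rightarrow> bool" where
  "pos_at q P \<longleftrightarrow> (\<forall>\<zeta> :: nat \<Rightarrow> real. (\<forall>i. i \<noteq> q \<longrightarrow> \<zeta> i > 0) \<and> \<zeta> q = 0 \<longrightarrow> meval of_int \<zeta> P > 0)"

text \<open>The subtraction-free expressions in \<open>w\<close> are quotients of this kind, and those that do not
  vanish and have no pole along \<open>w q = 0\<close> are stable under the exchange relations.\<close>

definition pos_quotient :: "nat set \<Rightarrow> (nat \<Rightarrow> 'a::field) \<Rightarrow> nat \<Rightarrow> 'a \<Rightarrow> bool" where
  "pos_quotient I w q f \<longleftrightarrow> (\<exists>A B. A \<in> mpols I \<and> B \<in> mpols I \<and> pos_at q A \<and> pos_at q B \<and>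
     f * meval of_int w B = meval of_int w A)"

lemma pos_at_neq_0: "pos_at q P \<Longrightarrow> P \<noteq> 0"
proof
  assume "pos_at q P" "P = 0"
  then have "meval of_int (\<lambda>i. if i = q then 0 else 1 :: real) P > 0"
    unfolding pos_at_def by (elim allE[of _ "\<lambda>i. if i = q then 0 else 1 :: real"]) simp
  then show False using \<open>P = 0\<close> by simp
qed

lemma pos_at_closed: "pos_at q 1" "pos_at q P \<Longrightarrow> pos_at q Q \<Longrightarrow> pos_at q (P * Q)"
  "pos_at q P \<Longrightarrow> pos_at q Q \<Longrightarrow> pos_at q (P + Q)" "i \<noteq> q \<Longrightarrow> pos_at q (mvar i)"
  "n > 0 \<Longrightarrow> pos_at q P \<Longrightarrow> pos_at q (P + mvar q ^ n * Q)"
  by (auto simp: pos_at_def zero_power intro!: add_pos_pos)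

context
  fixes I :: "nat set" and w :: "nat \<Rightarrow> 'a::field" and q :: nat
  assumes w: "aindep I w"
begin

lemma pos_at_meval_neq_0: "P \<in> mpols I \<Longrightarrow> pos_at q P \<Longrightarrow> meval of_int w P \<noteq> 0"
  using aindepD[OF w] pos_at_neq_0 by blast

lemma pos_quotient_poly: "P \<in> mpols I \<Longrightarrow> pos_at q P \<Longrightarrow> pos_quotient I w q (meval of_int w P)"
  unfolding pos_quotient_def
  by (rule exI[of _ P], rule exI[of _ 1]) (simp add: pos_at_closed mpols_closed)

lemma pos_quotient_mult:
  assumes "pos_quotient I w q f" "pos_quotient I w q g"
  shows "pos_quotient I w q (f * g)"
proof -
  obtain A B A' B' where *: "A \<in> mpols I" "B \<in> mpols I" "pos_at q A" "pos_at q B"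
     "f * meval of_int w B = meval of_int w A" "A' \<in> mpols I" "B' \<in> mpols I" "pos_at q A'" "pos_at q B'"
     "g * meval of_int w B' = meval of_int w A'" using assms unfolding pos_quotient_def by blast
  show ?thesis unfolding pos_quotient_def by (rule exI[of _ "A * A'"], rule exI[of _ "B * B'"])
      (use * in \<open>simp add: pos_at_closed mpols_closed(4) *(5,10)[symmetric] mult_ac\<close>)
qed

lemma pos_quotient_inverse:
  assumes "pos_quotient I w q f"
  shows "pos_quotient I w q (inverse f)"
proof -
  obtain A B where *: "A \<in> mpols I" "B \<in> mpols I" "pos_at q A" "pos_at q B"
     "f * meval of_int w B = meval of_int w A" using assms unfolding pos_quotient_def by blast
  have "inverse f * meval of_int w A = meval of_int w B"
    using pos_at_meval_neq_0[OF *(1,3)] unfolding *(5)[symmetric] by auto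
  then show ?thesis unfolding pos_quotient_def using * by blast
qed

text \<open>The second form is for exchange binomials in which one monomial contains the variable
  \<open>q\<close>: that term vanishes at \<open>w q = 0\<close> and the other one keeps the sum
  positive.\<close>

lemma pos_quotient_add:
  assumes "pos_quotient I w q f" "pos_quotient I w q g"
  shows "pos_quotient I w q (f + g)" "n > 0 \<Longrightarrow> q \<in> I \<Longrightarrow> pos_quotient I w q (f + w q ^ n * g)"
proof -
  obtain A B A' B' where *: "A \<in> mpols I" "B \<in> mpols I" "pos_at q A" "pos_at q B"
     "f * meval of_int w B = meval of_int w A" "A' \<in> mpols I" "B' \<in> mpols I" "pos_at q A'" "pos_at q B'"
     "g * meval of_int w B' = meval of_int w A'" using assms unfolding pos_quotient_def by blast
  show "pos_quotient I w q (f + g)" unfolding pos_quotient_def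
    by (rule exI[of _ "A * B' + A' * B"], rule exI[of _ "B * B'"])
      (use * in \<open>simp add: pos_at_closed mpols_closed(4,6) *(5,10)[symmetric] algebra_simps\<close>)
  show "pos_quotient I w q (f + w q ^ n * g)" if n: "n > 0" "q \<in> I" unfolding pos_quotient_def
  proof (intro exI conjI)
    show "A * B' + mvar q ^ n * (A' * B) \<in> mpols I" "B * B' \<in> mpols I"
      "pos_at q (A * B' + mvar q ^ n * (A' * B))" "pos_at q (B * B')"
      by (intro mpols_closed mvar_in_mpols pos_at_closed * n)+
  qed (simp add: *(5,10)[symmetric] algebra_simps)
qed

lemma pos_quotient_one: "pos_quotient I w q 1"
  using pos_quotient_poly[of 1] by (simp add: pos_at_closed mpols_closed)

lemma pos_quotient_power: "pos_quotient I w q f \<Longrightarrow> pos_quotient I w q (f ^ n)"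
  by (induction n) (auto intro: pos_quotient_mult pos_quotient_one)

lemma pos_quotient_prod: "(\<And>i. i \<in> A \<Longrightarrow> pos_quotient I w q (f i)) \<Longrightarrow> pos_quotient I w q (prod f A)"
  by (induction A rule: infinite_finite_induct) (auto intro: pos_quotient_mult pos_quotient_one)

text \<open>Let \<open>f\<close> be \<open>A / B\<close> and have the numerator \<open>P\<close>
  over a denominator divisible by \<open>w q\<close>. Then \<open>P * B\<close> is divisible by the
  variable \<open>q\<close>. At points with coordinate \<open>q\<close> equal to 0 and the others
  positive \<open>B\<close> is positive, so \<open>P\<close> vanishes there; hence \<open>q\<close>
  divides \<open>P\<close> and the pole order drops.\<close>

lemma pos_quotient_regular:
  assumes I: "finite I" "J \<subseteq> I" "q \<in> J" and f: "pos_quotient I w q f" "f \<in> laurent w I J"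
  shows "f \<in> laurent w I (J - {q})"
proof -
  have J: "finite J" and qI: "q \<in> I" using I finite_subset by auto
  have w0: "w i \<noteq> 0" if "i \<in> I" for i using aindep_neq_0[OF w that] .
  define D where "D = (\<Prod>j\<in>J - {q}. w j)"
  define Dp :: "(nat, int) mpol" where "Dp = (\<Prod>j\<in>J - {q}. mvar j)"
  have Dp: "Dp \<in> mpols I" "meval of_int w Dp = D" using I by (auto simp: Dp_def D_def intro!: mpols_closed)
  have D0: "D \<noteq> 0" using J I w0 by (auto simp: D_def)
  obtain A B where AB: "A \<in> mpols I" "B \<in> mpols I" "pos_at q A" "pos_at q B"
    "f * meval of_int w B = meval of_int w A" using f(1) unfolding pos_quotient_def by blast
  have "f \<in> laurent w I (J - {q})"
    if "P \<in> mpols I" "f * (w q ^ N * D ^ M) = meval of_int w P" for P N M using that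
  proof (induction N arbitrary: P)
    case 0
    have "inverse D \<in> laurent w I (J - {q})"
      unfolding D_def prod_inversef[symmetric] o_def by (intro lr_closed laurent_inverse)
    then have "meval of_int w P * inverse D ^ M \<in> laurent w I (J - {q})"
      using 0 by (intro lr_closed meval_in_laurent)
    moreover have "meval of_int w P * inverse D ^ M = f"
      unfolding 0(2)[symmetric] using D0 by (simp add: power_inverse)
    ultimately show ?case by simp
  next
    case (Suc N)
    have "A * (mvar q ^ Suc N * Dp ^ M) - P * B = 0"
    proof (rule aindepD[OF w])
      show "A * (mvar q ^ Suc N * Dp ^ M) - P * B \<in> mpols I"
        by (intro mpols_closed AB Dp Suc.prems(1) mvar_in_mpols qI)
      show "meval of_int w (A * (mvar q ^ Suc N * Dp ^ M) - P * B) = 0"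
        by (simp add: AB(5)[symmetric] Dp Suc.prems(2)[symmetric] mult_ac)
    qed
    then have AB': "A * (mvar q ^ Suc N * Dp ^ M) = P * B" by simp
    have insI: "insert q I = I" using qI by auto
    obtain p d where p: "\<And>n. p n \<in> mpols (I - {q})" "P = (\<Sum>n\<le>d::nat. p n * mvar q ^ n)"
      using mpols_split_var[of P q I] Suc.prems(1) insI by auto
    have "p 0 = 0"
    proof (rule mpols_eq_0_if_vanishing[where h = "of_int :: int \<Rightarrow> real" and S = "{0<..}" and I = "I - {q}"])
      fix \<zeta> :: "nat \<Rightarrow> real" assume \<zeta>: "\<And>i. i \<in> I - {q} \<Longrightarrow> \<zeta> i \<in> {0<..}"
      define \<xi> where "\<xi> i = (if i = q then 0 else if i \<in> I then \<zeta> i else 1)" for i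
      have "meval of_int \<xi> P * meval of_int \<xi> B = 0"
        using arg_cong[OF AB', of "meval of_int \<xi>"] by (simp add: \<xi>_def)
      moreover have "meval of_int \<xi> B > 0" using AB(4) \<zeta> unfolding pos_at_def by (auto simp: \<xi>_def)
      ultimately have "meval of_int \<xi> P = 0" by auto
      moreover have "meval of_int \<xi> P = (\<Sum>n\<le>d. if n = 0 then meval of_int \<xi> (p n) else 0)"
        unfolding p(2) by (auto simp: \<xi>_def intro!: sum.cong)
      moreover have "meval of_int \<xi> (p 0) = meval of_int \<zeta> (p 0)"
        by (rule meval_cong[OF p(1)]) (auto simp: \<xi>_def)
      ultimately show "meval of_int \<zeta> (p 0) = 0" by simp
    qed (use I p rhf_of_int in \<open>auto simp: infinite_Ioi\<close>)
    moreover have "P = p 0 + (\<Sum>n<d. p (Suc n) * mvar q ^ n) * mvar q"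
      unfolding p(2) by (simp add: sum.atMost_shift sum_distrib_left sum_distrib_right mult_ac)
    ultimately have "f * (w q ^ Suc N * D ^ M) = meval of_int w (\<Sum>n<d. p (Suc n) * mvar q ^ n) * w q"
      unfolding Suc.prems(2) by simp
    then have "f * (w q ^ N * D ^ M) * w q = meval of_int w (\<Sum>n<d. p (Suc n) * mvar q ^ n) * w q"
      by (simp only: power_Suc mult_ac)
    then have "f * (w q ^ N * D ^ M) = meval of_int w (\<Sum>n<d. p (Suc n) * mvar q ^ n)" using w0[OF qI] by auto
    moreover have "p n \<in> mpols I" for n using p(1)[of n] mpols_mono[of "I - {q}" I] by auto
    then have "(\<Sum>n<d. p (Suc n) * mvar q ^ n) \<in> mpols I" by (intro mpols_closed mvar_in_mpols qI)
    ultimately show ?case by (intro Suc.IH)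
  qed
  moreover obtain P N where "P \<in> mpols I" "f * (\<Prod>j\<in>J. w j) ^ N = meval of_int w P"
    using laurent_clear[OF J I(2) _ f(2)] w0 I(2) by blast
  moreover have "(\<Prod>j\<in>J. w j) ^ N = w q ^ N * D ^ N"
    unfolding D_def using J I by (subst prod.remove[of _ q]) (auto simp: power_mult_distrib)
  ultimately show ?thesis by metis
qed

end

section \<open>Exchange relations, upper bounds and Laurent expansions in a seed pattern\<close>

locale cluster_pattern =
  fixes r l :: nat and F :: "'f::field_char_0 set" and S :: "nat list \<Rightarrow> 'f seed"
  assumes pattern: "seed_pattern r l F S"
begin

definition u :: "nat list \<Rightarrow> nat \<Rightarrow> 'f" where
  "u t = extended_cluster r (S t)"

abbreviation b :: "nat list \<Rightarrow> nat \<Rightarrow> nat \<Rightarrow> int" where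
  "b t \<equiv> exmat (S t)"

abbreviation V :: "nat list set" where
  "V \<equiv> tree_vertices r"

abbreviation I :: "nat set" where
  "I \<equiv> {1..r + l}"

lemma cluster_eq: "i \<in> {1..r} \<Longrightarrow> cluster (S t) i = u t i"
  and frozen_eq: "i \<in> {1..l} \<Longrightarrow> frozen (S t) i = u t (r + i)"
  by (auto simp: u_def extended_cluster_def)

lemma aindep_u: "t \<in> V \<Longrightarrow> aindep I (u t)"
  using pattern freely_generates_aindep unfolding seed_pattern_def is_seed_def u_def by blast

lemma u_neq_0: "t \<in> V \<Longrightarrow> i \<in> I \<Longrightarrow> u t i \<noteq> 0"
  by (rule aindep_neq_0[OF aindep_u])

lemma skew: "t \<in> V \<Longrightarrow> skew_symmetrizable r (b t)"
  using pattern by (auto simp: seed_pattern_def is_seed_def)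

lemma b_diag: "t \<in> V \<Longrightarrow> k \<in> {1..r} \<Longrightarrow> b t k k = 0"
  using skew[of t] unfolding skew_symmetrizable_def by fastforce

lemma b_sgn:
  assumes "t \<in> V" "j \<in> {1..r}" "k \<in> {1..r}"
  shows "sgn (b t j k) = - sgn (b t k j)"
proof -
  obtain D where "\<forall>i\<in>{1..r}. D i > 0" "\<forall>i\<in>{1..r}. \<forall>j\<in>{1..r}. D i * b t i j = - (D j * b t j i)"
    using skew[OF assms(1)] by (auto simp: skew_symmetrizable_def)
  then have "D j > 0" "D k > 0" "D j * b t j k = - (D k * b t k j)" using assms by blast+
  then have "sgn (D j * b t j k) = sgn (- (D k * b t k j))" by (simp only:)
  moreover have "sgn (- x) = - sgn x" for x :: int by (simp add: sgn_if)
  ultimately have "sgn (D j) * sgn (b t j k) = - (sgn (D k) * sgn (b t k j))" by (simp only: sgn_mult)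
  then show ?thesis using \<open>D j > 0\<close> \<open>D k > 0\<close> by simp
qed

lemma prod_split_ext: "(\<Prod>i=1..r. cluster (S t) i ^ e i) * (\<Prod>i=1..l. frozen (S t) i ^ e (r + i)) =
    (\<Prod>i\<in>I. u t i ^ e i)" for e :: "nat \<Rightarrow> nat"
proof -
  have I: "I = {1..r} \<union> (+) r ` {1..l}" by (auto simp: image_iff)
  have "(\<Prod>i\<in>I. u t i ^ e i) = (\<Prod>i\<in>{1..r}. u t i ^ e i) * (\<Prod>i\<in>(+) r ` {1..l}. u t i ^ e i)"
    unfolding I by (rule prod.union_disjoint) auto
  also have "(\<Prod>i\<in>(+) r ` {1..l}. u t i ^ e i) = (\<Prod>i=1..l. u t (r + i) ^ e (r + i))"
    by (subst prod.reindex) auto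
  finally show ?thesis by (auto intro!: arg_cong2[where f="(*)"] prod.cong simp: cluster_eq frozen_eq)
qed

lemma mutation:
  assumes t: "t \<in> V" and k: "k \<in> {1..r}"
  shows u_other: "i \<in> I \<Longrightarrow> i \<noteq> k \<Longrightarrow> u (tree_step k t) i = u t i"
    and exchange: "u t k * u (tree_step k t) k =
      (\<Prod>i\<in>I. u t i ^ nat (ppart (b t i k))) + (\<Prod>i\<in>I. u t i ^ nat (ppart (- b t i k)))"
    and b_step: "i \<in> I \<Longrightarrow> j \<in> {1..r} \<Longrightarrow> b (tree_step k t) i j = mutate_mat k (b t) i j"
proof -
  have m: "is_mutation r l k (S t) (S (tree_step k t))" using pattern t k by (auto simp: seed_pattern_def)
  show "u (tree_step k t) i = u t i" if "i \<in> I" "i \<noteq> k" for i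
  proof (cases "i \<le> r")
    case True
    then show ?thesis using m that by (auto simp: is_mutation_def u_def extended_cluster_def)
  next
    case False
    then have "i - r \<in> {1..l}" using that by auto
    then show ?thesis using m False by (auto simp: is_mutation_def u_def extended_cluster_def)
  qed
  show "u t k * u (tree_step k t) k =
      (\<Prod>i\<in>I. u t i ^ nat (ppart (b t i k))) + (\<Prod>i\<in>I. u t i ^ nat (ppart (- b t i k)))"
    using m k unfolding is_mutation_def prod_split_ext[symmetric] by (simp add: cluster_eq)
  show "b (tree_step k t) i j = mutate_mat k (b t) i j" if "i \<in> I" "j \<in> {1..r}" for i j
    using m that by (auto simp: is_mutation_def)
qed

lemma full_rank_all:
  assumes t0: "t0 \<in> V" "full_rank (r + l) r (b t0)" and t: "t \<in> V"
  shows "full_rank (r + l) r (b t)"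
  using t t0(1)
proof (induction t rule: tree_vertices_induct)
  case base
  then show ?case by (rule t0)
next
  case (step t k)
  then show ?case by (intro full_rank_mutate[OF step(3)]) (auto simp: b_diag b_step)
qed

abbreviation Lt :: "nat list \<Rightarrow> 'f set" where
  "Lt t \<equiv> laurent (u t) I I"

definition upper_bound :: "nat list \<Rightarrow> 'f set" where
  "upper_bound t = {f \<in> Lt t. \<forall>k\<in>{1..r}. f \<in> Lt (tree_step k t)}"

text \<open>Presents the Laurent rings of four seeds over the common ring \<open>C\<close> in the
  variables other than \<open>j\<close> and \<open>k\<close>, which reduces two mutation directions
  to rank two.\<close>

lemma Lt_step:
  assumes t: "t \<in> V" and jk: "j \<in> {1..r}" "k \<in> {1..r}" "j \<noteq> k"
  defines "C \<equiv> laurent (u t) (I - {j, k}) (I - {j, k})"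
  shows "Lt t = laurent_ext2 C (u t j) (u t k)"
    "Lt (tree_step j t) = laurent_ext (laurent_ext C (u (tree_step j t) j)) (u t k)"
    "Lt (tree_step k t) = laurent_ext2 C (u t j) (u (tree_step k t) k)" "Lt (tree_step k (tree_step j t)) =
       laurent_ext (laurent_ext C (u (tree_step j t) j)) (u (tree_step k (tree_step j t)) k)"
proof -
  have I: "I = insert k (insert j (I - {j, k}))" using jk by auto
  have gen: "Lt s = laurent_ext2 C (u s j) (u s k)"
    if "\<And>i. i \<in> I - {j, k} \<Longrightarrow> u s i = u t i" for s
  proof -
    have "C = laurent (u s) (I - {j, k}) (I - {j, k})" unfolding C_def by (rule laurent_cong) (use that in auto)
    then show ?thesis by (subst (1 2) I) (simp only: laurent_insert)
  qed
  have tj: "tree_step j t \<in> V" using t jk by (intro tree_step_in_vertices)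
  show "Lt t = laurent_ext2 C (u t j) (u t k)" by (rule gen) simp
  have kI: "k \<in> I" "j \<in> I" using jk by auto
  show "Lt (tree_step j t) = laurent_ext (laurent_ext C (u (tree_step j t) j)) (u t k)"
    using gen[of "tree_step j t"] u_other[OF t jk(1)] kI jk by auto
  show "Lt (tree_step k t) = laurent_ext2 C (u t j) (u (tree_step k t) k)"
    using gen[of "tree_step k t"] u_other[OF t jk(2)] kI jk by auto
  show "Lt (tree_step k (tree_step j t)) =
       laurent_ext (laurent_ext C (u (tree_step j t) j)) (u (tree_step k (tree_step j t)) k)"
    using gen[of "tree_step k (tree_step j t)"] u_other[OF t jk(1)] u_other[OF tj jk(2)] kI jk by auto
qed

lemma exchange_sgn:
  assumes "t \<in> V" "k \<in> {1..r}" "\<sigma> = 1 \<or> \<sigma> = -1"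
  shows "u t k * u (tree_step k t) k =
      (\<Prod>i\<in>I. u t i ^ nat (ppart (\<sigma> * b t i k))) + (\<Prod>i\<in>I. u t i ^ nat (ppart (- (\<sigma> * b t i k))))"
  using exchange[OF assms(1,2)] assms(3) by (auto simp: add.commute)

text \<open>Two independent columns have a nonzero minor. As the directions are unlinked, rows
  \<open>j\<close> and \<open>k\<close> vanish in both columns, so the minor is found in the
  remaining rows.\<close>

lemma exists_minor:
  assumes t: "t \<in> V" and fr: "full_rank (r + l) r (b t)"
    and jk: "j \<in> {1..r}" "k \<in> {1..r}" "j \<noteq> k" and 0: "b t j k = 0" "b t k j = 0"
  shows "\<exists>a\<in>I - {j, k}. \<exists>a'\<in>I - {j, k}. b t a j * b t a' k - b t a' j * b t a k \<noteq> 0"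
proof (rule ccontr)
  assume "\<not> ?thesis"
  then have minor: "b t a j * b t a' k = b t a' j * b t a k" if "a \<in> I - {j, k}" "a' \<in> I - {j, k}" for a a'
    using that by fastforce
  have rows0: "b t a j = 0" "b t a k = 0" if "a = j \<or> a = k" for a using that 0 b_diag[OF t] jk by auto
  have minorI: "b t a j * b t a' k = b t a' j * b t a k" if "a \<in> I" "a' \<in> I" for a a'
    using minor[of a a'] rows0[of a] rows0[of a'] that by (cases "a = j \<or> a = k"; cases "a' = j \<or> a' = k") auto
  have sum2: "(\<Sum>m=1..r. b t i m * (if m = j then x else if m = k then y else 0)) = b t i j * x + b t i k * y"
    for i x y
  proof -
    have "(\<Sum>m=1..r. b t i m * (if m = j then x else if m = k then y else 0))
        = (\<Sum>m\<in>{j, k}. b t i m * (if m = j then x else if m = k then y else 0))"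
      by (rule sum.mono_neutral_right) (use jk in auto)
    then show ?thesis using jk by simp
  qed
  have fr': "x = 0 \<and> y = 0" if "\<forall>i\<in>I. b t i j * x + b t i k * y = 0" for x y
  proof -
    have *: "\<forall>m\<in>{1..r}. (if m = j then x else if m = k then y else 0) = 0"
      using fr[unfolded full_rank_def, rule_format, of "\<lambda>m. if m = j then x else if m = k then y else 0"]
        that unfolding sum2 by blast
    show ?thesis using bspec[OF * jk(1)] bspec[OF * jk(2)] jk(3) by simp
  qed
  have "\<exists>a\<in>I. b t a j \<noteq> 0" using fr'[of 1 0] by auto
  then obtain a where a: "a \<in> I" "b t a j \<noteq> 0" by auto
  \<comment> \<open>If all minors vanish, the entries of row \<open>a\<close>, swapped and with one
    sign changed, give a relation between the two columns.\<close>
  have "b t a k = 0 \<and> - b t a j = 0" by (rule fr') (use minorI a in \<open>auto simp: algebra_simps\<close>)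
  then show False using a by simp
qed

text \<open>If \<open>b t j k = 0\<close>, both exchange polynomials live in \<open>C\<close> and
  full rank makes them coprime. Otherwise skew-symmetrizability gives \<open>b t j k\<close> and
  \<open>b t k j\<close> opposite signs, and the exchange relations take the shape of the linked
  case.\<close>

lemma laurent_two_steps:
  assumes t: "t \<in> V" and fr: "full_rank (r + l) r (b t)"
    and jk: "j \<in> {1..r}" "k \<in> {1..r}" "j \<noteq> k"
    and f: "f \<in> Lt t" "f \<in> Lt (tree_step j t)" "f \<in> Lt (tree_step k t)"
  shows "f \<in> Lt (tree_step k (tree_step j t))"
proof -
  define J where "J = I - {j, k}"
  define C where "C = laurent (u t) J J"
  define t' where "t' = tree_step j t"
  define t2 where "t2 = tree_step k t"
  define t'' where "t'' = tree_step k t'"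
  define x1 where "x1 = u t j"
  define x2 where "x2 = u t k"
  define x1' where "x1' = u t' j"
  define x2' where "x2' = u t2 k"
  define x2'' where "x2'' = u t'' k"
  note Lt = Lt_step[OF t jk, folded J_def, folded C_def t'_def t2_def, folded t''_def,
      folded x1_def x2_def x1'_def x2'_def x2''_def]
  have V: "t' \<in> V" "t2 \<in> V" "t'' \<in> V"
    using t jk by (simp_all add: t'_def t2_def t''_def tree_step_in_vertices)
  have kI: "k \<in> I" "j \<in> I" using jk by auto
  have I: "I = insert k (insert j J)" "k \<notin> insert j J" "j \<notin> J" "finite J" using jk by (auto simp: J_def)
  have IJ: "J \<subseteq> I" by (auto simp: J_def)
  have x0: "x1 \<noteq> 0" "x2 \<noteq> 0" "x1' \<noteq> 0" "x2' \<noteq> 0" "x2'' \<noteq> 0"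
    using u_neq_0 t V kI by (simp_all add: x1_def x2_def x1'_def x2'_def x2''_def)
  have w0: "u t i \<noteq> 0" if "i \<in> J" for i using u_neq_0[OF t] that IJ by auto
  have C: "is_subring C" by (simp add: C_def laurent_sr)
  have w: "aindep I (u t)" by (rule aindep_u[OF t])
  have wJ: "aindep J (u t)" by (rule aindep_mono[OF w IJ])
  have tr1: "transc_over (fractions (gen_ring (C \<union> {x2}))) x1" unfolding C_def x1_def x2_def
    by (rule aindep_transcendental_laurent) (use w I jk in \<open>auto simp: insert_commute\<close>)
  have tr2: "transc_over (fractions (gen_ring (C \<union> {x1}))) x2" unfolding C_def x1_def x2_def
    by (rule aindep_transcendental_laurent) (use w I jk in auto)
  have mon: "(\<Prod>i\<in>J. u t i ^ e i) \<in> C" for e unfolding C_def by (intro lr_closed laurent_var)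
  have mon_inv: "inverse (\<Prod>i\<in>J. u t i ^ e i) \<in> C" for e
    unfolding C_def prod_inversef[symmetric] power_inverse[symmetric] o_def by (intro lr_closed laurent_inverse)
  have mon0: "(\<Prod>i\<in>J. u t i ^ e i) \<noteq> 0" for e using I w0 by simp
  have u': "u t' i = u t i" if "i \<in> J \<or> i = k" for i
    unfolding t'_def by (rule u_other[OF t jk(1)]) (use that jk in \<open>auto simp: J_def\<close>)
  have prodI: "(\<Prod>i\<in>I. f i) = f k * (f j * (\<Prod>i\<in>J. f i))" for f :: "nat \<Rightarrow> 'f"
    unfolding I(1) using I(2-4) by simp
  have b': "b t' i m = mutate_mat j (b t) i m" if "i \<in> I" "m \<in> {1..r}" for i m
    unfolding t'_def by (rule b_step[OF t jk(1) that])
  define m where "m \<sigma> n = (\<Prod>i\<in>J. u t i ^ nat (ppart (\<sigma> * b t i n)))" for \<sigma> n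
  have mC: "m \<sigma> n \<in> C" "inverse (m \<sigma> n) \<in> C" "m \<sigma> n \<noteq> 0" for \<sigma> n
    by (simp_all add: m_def mon mon_inv mon0)
  have ppart0: "ppart 0 = 0" by (simp add: ppart_def)
  show ?thesis
  proof (cases "b t j k = 0")
    case True
    then have 0: "b t j k = 0" "b t k j = 0" using b_sgn[OF t jk(1,2)] by (auto simp: sgn_0_0)
    have P1: "x1 * x1' = m 1 j + m (-1) j" using exchange_sgn[OF t jk(1), of 1] 0 b_diag[OF t] jk
      by (simp add: prodI ppart0 m_def x1_def x1'_def t'_def)
    have P2: "x2 * x2' = m 1 k + m (-1) k" using exchange_sgn[OF t jk(2), of 1] 0 b_diag[OF t] jk
      by (simp add: prodI ppart0 m_def x2_def x2'_def t2_def)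
    have "b t' i k = b t i k" if "i \<in> J" for i
      using b'[of i k] that IJ jk 0 by (auto simp: mutate_mat_def ppart0 J_def)
    moreover have "b t' j k = 0" "b t' k k = 0" using b'[of j k] b_diag[OF V(1)] jk 0 by (auto simp: mutate_mat_def)
    ultimately have "x2 * x2'' = m 1 k + m (-1) k" using exchange_sgn[OF V(1) jk(2), of 1] u'
      by (simp add: prodI ppart0 m_def x2_def x2''_def t''_def)
    then have x2'': "x2'' = x2'" using P2 x0 by (metis mult_cancel_left)
    have "f \<in> laurent_ext2 C x1' x2'"
    proof (rule rank_two_unlinked[OF C x0(1,2,3,4) tr1 tr2 _ _ _ P1 P2])
      show "m 1 j + m (-1) j \<in> C" "m 1 k + m (-1) k \<in> C" by (intro sr_add[OF C] mC)+
      fix a a' :: 'f and p q :: nat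
      assume a: "a \<in> C" "a' \<in> C" "(m 1 j + m (-1) j) ^ p * a' = (m 1 k + m (-1) k) ^ q * a"
      \<comment> \<open>The exchange polynomials up to units of \<open>C\<close>.\<close>
      define B where "B n = 1 + (\<Prod>i\<in>J. u t i powi b t i n)" for n
      have mB: "m 1 n + m (-1) n = m (-1) n * B n" for n
        using prod_powi_ppart[of J "u t" "\<lambda>i. b t i n"] w0 by (simp add: m_def B_def algebra_simps)
      obtain i i' where minor: "i \<in> J" "i' \<in> J" "b t i j * b t i' k - b t i' j * b t i k \<noteq> 0"
        using exists_minor[OF t fr jk 0, folded J_def] by blast
      have "\<exists>c\<in>laurent (u t) J J. m (-1) k ^ q * a = B j ^ p * c"
      proof (rule binomial_coprime[OF wJ I(4) minor B_def[of j] B_def[of k]])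
        show "m (-1) k ^ q * a \<in> laurent (u t) J J" "m (-1) j ^ p * a' \<in> laurent (u t) J J"
          using a mC C by (auto simp: C_def[symmetric] intro!: sr_mult sr_power)
        show "B j ^ p * (m (-1) j ^ p * a') = B k ^ q * (m (-1) k ^ q * a)"
          using a(3) by (simp add: mB power_mult_distrib mult_ac)
      qed
      then obtain c where c: "c \<in> C" "m (-1) k ^ q * a = B j ^ p * c" by (auto simp: C_def)
      have "a = inverse (m (-1) k) ^ q * (m (-1) k ^ q * a)"
        using mC(3) by (simp add: power_inverse mult.assoc[symmetric])
      also have "\<dots> = inverse (m (-1) k) ^ q * (inverse (m (-1) j) ^ p * m (-1) j ^ p) * B j ^ p * c"
        unfolding c(2) using mC(3) by (simp add: power_inverse)
      also have "\<dots> = (m 1 j + m (-1) j) ^ p * (inverse (m (-1) k) ^ q * inverse (m (-1) j) ^ p * c)"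
        by (simp add: mB power_mult_distrib mult_ac)
      finally show "\<exists>c\<in>C. a = (m 1 j + m (-1) j) ^ p * c"
        by (rule bexI) (intro sr_mult[OF C] sr_power[OF C] mC c)
    qed (use f Lt in \<open>simp_all add: t'_def[symmetric] t2_def[symmetric]\<close>)
    then show ?thesis using Lt(4) by (simp add: x2'' t''_def t'_def)
  next
    case False
    \<comment> \<open>A change of all signs only swaps the two exchange monomials; this choice
      achieves \<open>\<sigma> * b t j k = c\<close> and
      \<open>\<sigma> * b t k j = - d\<close>.\<close>
    define \<sigma> where "\<sigma> = sgn (b t j k)"
    define c where "c = nat \<bar>b t j k\<bar>"
    define d where "d = nat \<bar>b t k j\<bar>"
    have \<sigma>: "\<sigma> = 1 \<or> \<sigma> = -1" using False by (auto simp: \<sigma>_def sgn_if)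
    have \<sigma>j: "\<sigma> * b t j k = int c" by (auto simp: \<sigma>_def c_def sgn_if)
    have "sgn (b t k j) = - \<sigma>" using b_sgn[OF t jk(2,1)] by (simp add: \<sigma>_def)
    then have "\<sigma> = - sgn (b t k j)" by simp
    then have \<sigma>k: "\<sigma> * b t k j = - int d" by (auto simp: d_def sgn_if)
    have "b t k j \<noteq> 0" using b_sgn[OF t jk(1,2)] False by (auto simp: sgn_0_0)
    then have d0: "d > 0" by (simp add: d_def)
    have bjk: "b t j k = \<sigma> * int c" using \<sigma> \<sigma>j by auto
    have pp: "nat (ppart (int c)) = c" "ppart (- int c) = 0" "nat (ppart (int d)) = d" "ppart (- int d) = 0"
      by (auto simp: ppart_def)
    have ex1: "x1 * x1' = m \<sigma> j + m (-\<sigma>) j * x2 ^ d"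
      using exchange_sgn[OF t jk(1) \<sigma>] b_diag[OF t] jk
      by (simp add: prodI ppart0 m_def x1_def x2_def x1'_def t'_def \<sigma>k pp mult_ac)
    have "x2 * x2' = m \<sigma> k * x1 ^ c + m (-\<sigma>) k" using exchange_sgn[OF t jk(2) \<sigma>] b_diag[OF t] jk
      by (simp add: prodI ppart0 m_def x1_def x2_def x2'_def t2_def \<sigma>j pp mult_ac)
    then have ex2: "x2 * x2' = m (-\<sigma>) k + m \<sigma> k * x1 ^ c" by simp
    define m' where "m' s = (\<Prod>i\<in>J. u t i ^ nat (ppart (s * b t' i k)))" for s
    have b'j: "\<sigma> * b t' j k = - int c" "b t' k k = 0"
    proof -
      have "b t' j k = - b t j k" using b'[OF kI(2) jk(2)] by (simp add: mutate_mat_def)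
      then show "\<sigma> * b t' j k = - int c" using \<sigma>j by simp
    qed (rule b_diag[OF V(1) jk(2)])
    have "x2 * x2'' = m' \<sigma> + m' (-\<sigma>) * x1' ^ c" using exchange_sgn[OF V(1) jk(2) \<sigma>] u'
      by (simp add: prodI ppart0 m'_def x2_def x1'_def x2''_def t''_def b'j pp mult_ac)
    also have "m' \<sigma> = m' (-\<sigma>) * (\<Prod>i\<in>J. u t i powi (\<sigma> * b t' i k))"
      using prod_powi_ppart[of J "u t" "\<lambda>i. \<sigma> * b t' i k"] w0 by (simp add: m'_def)
    \<comment> \<open>Mutation in direction \<open>j\<close> adds
      \<open>ppart (\<sigma> * b t i j) * c\<close> to the exponent
      \<open>\<sigma> * b t i k\<close>, and this is the exponent of \<open>u t i\<close> in
      \<open>m \<sigma> j ^ c\<close>.\<close>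
    also have "(\<Prod>i\<in>J. u t i powi (\<sigma> * b t' i k))
        = (\<Prod>i\<in>J. u t i powi (\<sigma> * b t i k) * (u t i ^ nat (ppart (\<sigma> * b t i j))) ^ c)"
    proof (rule prod.cong[OF refl])
      fix i assume i: "i \<in> J"
      have "b t' i k = b t i k + ppart (b t i j) * ppart (b t j k) - ppart (- b t i j) * ppart (- b t j k)"
        using b'[of i k] i IJ jk by (auto simp: mutate_mat_def J_def)
      then have "\<sigma> * b t' i k = \<sigma> * b t i k + ppart (\<sigma> * b t i j) * int c"
        using \<sigma> unfolding bjk by (auto simp: ppart_def algebra_simps)
      then have "u t i powi (\<sigma> * b t' i k)
          = u t i powi (\<sigma> * b t i k) * u t i powi (ppart (\<sigma> * b t i j) * int c)"
        using w0[OF i] by (simp add: power_int_add)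
      also have "u t i powi (ppart (\<sigma> * b t i j) * int c) = (u t i powi ppart (\<sigma> * b t i j)) ^ c"
        by (simp add: power_int_mult)
      also have "u t i powi ppart (\<sigma> * b t i j) = u t i ^ nat (ppart (\<sigma> * b t i j))"
        by (rule powi_ppart) (simp add: ppart_def)
      finally show "u t i powi (\<sigma> * b t' i k)
          = u t i powi (\<sigma> * b t i k) * (u t i ^ nat (ppart (\<sigma> * b t i j))) ^ c" .
    qed
    also have "\<dots> = (\<Prod>i\<in>J. u t i powi (\<sigma> * b t i k)) * m \<sigma> j ^ c"
      by (simp add: prod.distrib m_def prod_power_distrib)
    finally have "x2 * x2'' = m' (-\<sigma>) * ((\<Prod>i\<in>J. u t i powi (\<sigma> * b t i k)) * m \<sigma> j ^ c)
        + m' (-\<sigma>) * x1' ^ c" .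
    moreover have "m \<sigma> k = m (-\<sigma>) k * (\<Prod>i\<in>J. u t i powi (\<sigma> * b t i k))"
      using prod_powi_ppart[of J "u t" "\<lambda>i. \<sigma> * b t i k"] w0 by (simp add: m_def)
    \<comment> \<open>The new relation equals the normalized one up to a quotient of monomials in
      \<open>C\<close>, which is the unit \<open>e\<close> of
      \<open>rank_two_linked\<close>.\<close>
    ultimately have ex2': "x2 * x2'' = m' (-\<sigma>) * inverse (m (-\<sigma>) k) *
        (m (-\<sigma>) k * x1' ^ c + m \<sigma> k * m \<sigma> j ^ c)"
      using mC(3)[of "-\<sigma>" k] by (simp add: field_simps)
    have "m' (-\<sigma>) * inverse (m (-\<sigma>) k) \<in> C" unfolding m'_def by (intro sr_mult[OF C] mC mon)
    moreover have "inverse (m' (-\<sigma>) * inverse (m (-\<sigma>) k)) \<in> C"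
      unfolding inverse_mult_distrib inverse_inverse_eq m'_def by (intro sr_mult[OF C] mC mon_inv)
    ultimately have e: "m' (-\<sigma>) * inverse (m (-\<sigma>) k) \<in> laurent_ext C x1'"
        "inverse (m' (-\<sigma>) * inverse (m (-\<sigma>) k)) \<in> laurent_ext C x1'"
      using laurent_ext_base by blast+
    have "f \<in> laurent_ext2 C x1 x2" using f(1) unfolding Lt .
    moreover have "f \<in> laurent_ext2 C x1' x2" using f(2) unfolding t'_def[symmetric] Lt .
    moreover have "f \<in> laurent_ext2 C x1 x2'" using f(3) unfolding t2_def[symmetric] Lt .
    ultimately have "f \<in> laurent_ext2 C x1' x2''"
      by (rule rank_two_linked[OF C x0 tr1 tr2 mC(1) mC(1) mC(2) mC(3) mC(1) mC(1) d0 ex1 ex2 ex2' e])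
    then show ?thesis using Lt(4) by (simp add: t''_def t'_def)
  qed
qed

lemma upper_bound_step:
  assumes t: "t \<in> V" and fr: "full_rank (r + l) r (b t)" and j: "j \<in> {1..r}" and f: "f \<in> upper_bound t"
  shows "f \<in> upper_bound (tree_step j t)"
proof -
  have "f \<in> Lt (tree_step k (tree_step j t))" if k: "k \<in> {1..r}" for k
  proof (cases "k = j")
    case True
    then show ?thesis using f by (simp add: tree_step_involution[OF t] upper_bound_def)
  next
    case False
    then show ?thesis using f j k by (intro laurent_two_steps[OF t fr]) (auto simp: upper_bound_def)
  qed
  then show ?thesis using f j by (auto simp: upper_bound_def)
qed

lemma u_in_upper_bound:
  assumes t: "t \<in> V" and i: "i \<in> I"
  shows "u t i \<in> upper_bound t"
proof -
  have "u t i \<in> Lt (tree_step k t)" if k: "k \<in> {1..r}" for k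
  proof (cases "i = k")
    case False
    then show ?thesis using u_other[OF t k i] laurent_var[OF i, of "u (tree_step k t)" I] by simp
  next
    case True
    define t' where "t' = tree_step k t"
    have t': "t' \<in> V" "tree_step k t' = t"
      by (simp_all add: t'_def tree_step_in_vertices[OF t k] tree_step_involution[OF t])
    define P where "P = (\<Prod>i\<in>I. u t' i ^ nat (ppart (b t' i k))) + (\<Prod>i\<in>I. u t' i ^ nat (ppart (- b t' i k)))"
    have "u t' k * u t k = P" using exchange[OF t'(1) k] by (simp add: t'(2) P_def)
    moreover have kI: "k \<in> I" using k by auto
    ultimately have "u t k = P * inverse (u t' k)" using u_neq_0[OF t'(1) kI] by (simp add: field_simps)
    moreover have "P \<in> Lt t'" unfolding P_def by (intro lr_closed laurent_var)
    ultimately show ?thesis unfolding True t'_def[symmetric] by (simp add: lr_closed(4) laurent_inverse[OF kI])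
  qed
  then show ?thesis using laurent_var[OF i] by (auto simp: upper_bound_def)
qed

text \<open>The induction moves the vertex of the upper bound: it starts at \<open>t\<close>, where
  the variable belongs to the cluster, and travels to \<open>t0\<close> through seeds of full
  rank.\<close>

theorem cluster_vars_in_upper_bound:
  assumes t0: "t0 \<in> V" "full_rank (r + l) r (b t0)" and t: "t \<in> V" and i: "i \<in> I"
  shows "u t i \<in> upper_bound t0"
  using t0(1) t
proof (induction t0 rule: tree_vertices_induct)
  case base
  then show ?case by (rule u_in_upper_bound[OF t i])
next
  case (step s k)
  then show ?case by (intro upper_bound_step full_rank_all[OF t0])
qed

lemma frozen_const:
  assumes "t0 \<in> V" "t \<in> V" "i \<in> I" "i > r"
  shows "u t i = u t0 i"
  using assms(2,1)
proof (induction t rule: tree_vertices_induct)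
  case (step t k)
  then show ?case using u_other[OF step(1,2) assms(3)] assms(4) by auto
qed simp

lemma pos_quotient_u:
  assumes t0: "t0 \<in> V" and t: "t \<in> V" and q: "q \<in> I" "q > r" and k: "k \<in> {1..r}"
  shows "pos_quotient I (u t0) q (u t k)"
proof -
  note w = aindep_u[OF t0]
  note pq = pos_quotient_mult[OF w] pos_quotient_power[OF w] pos_quotient_prod[OF w] pos_quotient_inverse[OF w]
  have var: "pos_quotient I (u t0) q (u t0 i)" if "i \<in> I" "i \<noteq> q" for i
    using pos_quotient_poly[OF w, of "mvar i" q] that by (simp add: pos_at_closed)
  have "\<forall>k\<in>{1..r}. pos_quotient I (u t0) q (u t k)" using t t0
  proof (induction t rule: tree_vertices_induct)
    case base
    then show ?case using var q by auto
  next
    case (step t k)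
    have p: "pos_quotient I (u t0) q (u t i)" if "i \<in> I - {q}" for i
      using step(3) var[of i] frozen_const[OF t0 step(1)] that by (cases "i \<le> r") auto
    define e e' where "e i = nat (ppart (b t i k))" and "e' i = nat (ppart (- b t i k))" for i
    have ee: "e q = 0 \<or> e' q = 0" by (auto simp: e_def e'_def ppart_def)
    have split: "(\<Prod>i\<in>I. u t i ^ f i) = u t0 q ^ f q * (\<Prod>i\<in>I - {q}. u t i ^ f i)" for f
      using q by (subst prod.remove[of _ q]) (auto simp: frozen_const[OF t0 step(1) q])
    have pf: "pos_quotient I (u t0) q (\<Prod>i\<in>I - {q}. u t i ^ f i)" for f by (intro pq p)
    have "pos_quotient I (u t0) q ((\<Prod>i\<in>I. u t i ^ e i) + (\<Prod>i\<in>I. u t i ^ e' i))" using ee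
    proof
      assume "e q = 0"
      then show ?thesis unfolding split
        using \<open>e q = 0\<close> q(1) pos_quotient_add[OF w pf[of e] pf[of e']] by (cases "e' q = 0") auto
    next
      assume "e' q = 0"
      then show ?thesis unfolding split using \<open>e' q = 0\<close> q(1) pos_quotient_add[OF w pf[of e'] pf[of e]]
        by (cases "e q = 0") (auto simp: add.commute[of _ "\<Prod>i\<in>I - {q}. u t i ^ e' i"])
    qed
    then have ex: "pos_quotient I (u t0) q (u t k * u (tree_step k t) k)"
      unfolding exchange[OF step(1,2)] e_def e'_def .
    have kI: "k \<in> I" "k \<noteq> q" using step(2) q by auto
    have "pos_quotient I (u t0) q (inverse (u t k) * (u t k * u (tree_step k t) k))"
      by (rule pos_quotient_mult[OF w pos_quotient_inverse[OF w p] ex]) (use kI in auto)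
    then have "pos_quotient I (u t0) q (u (tree_step k t) k)"
      using u_neq_0[OF step(1) kI(1)] by (simp add: mult.assoc[symmetric])
    moreover have "pos_quotient I (u t0) q (u (tree_step k t) i)" if "i \<in> {1..r}" "i \<noteq> k" for i
      using u_other[OF step(1,2), of i] step(3) that by auto
    ultimately show ?case by blast
  qed
  then show ?thesis using k by blast
qed

text \<open>The upper bound still allows frozen denominators; \<open>pos_quotient_regular\<close>
  removes them one frozen variable at a time.\<close>

theorem cluster_vars_laurent:
  assumes t0: "t0 \<in> V" "full_rank (r + l) r (b t0)" and t: "t \<in> V" and i: "i \<in> I"
  shows "u t i \<in> laurent (u t0) I {1..r}"
proof (cases "i \<le> r")
  case False
  then show ?thesis using frozen_const[OF t0(1) t i] laurent_var[OF i, of "u t0"] by simp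
next
  case True
  have "u t i \<in> laurent (u t0) I (I - Q)" if "finite Q" "Q \<subseteq> {r+1..r+l}" for Q using that
  proof (induction Q rule: finite_induct)
    case empty
    then show ?case using cluster_vars_in_upper_bound[OF t0 t i] by (simp add: upper_bound_def)
  next
    case (insert q Q)
    have Q: "Q \<subseteq> {r+1..r+l}" and q: "q \<in> I - Q" "q \<in> I" "q > r"
      using insert.prems insert.hyps by auto
    have ir: "i \<in> {1..r}" using True i by simp
    have "u t i \<in> laurent (u t0) I (I - Q - {q})"
      by (rule pos_quotient_regular[OF aindep_u[OF t0(1)] _ Diff_subset q(1)
            pos_quotient_u[OF t0(1) t q(2,3) ir] insert.IH[OF Q]]) simp
    then show ?case by (subst Diff_insert)
  qed
  from this[of "{r+1..r+l}"] have "u t i \<in> laurent (u t0) I (I - {r+1..r+l})" by simp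
  moreover have "I - {r+1..r+l} = {1..r}" by auto
  ultimately show ?thesis by simp
qed

end

section \<open>The algebra generated by the initial cluster and its Coxeter mutation\<close>

definition dvd_cong :: "'a::comm_ring_1 set \<Rightarrow> 'a \<Rightarrow> 'a \<Rightarrow> 'a \<Rightarrow> bool" where
  "dvd_cong D x a b \<longleftrightarrow> a \<in> D \<and> b \<in> D \<and> (\<exists>g\<in>D. a - b = x * g)"

context
  fixes D :: "'a::comm_ring_1 set" and x :: 'a
  assumes D: "is_subring D" and x: "x \<in> D"
begin

lemma dvd_cong_refl: "a \<in> D \<Longrightarrow> dvd_cong D x a a"
  unfolding dvd_cong_def using sr_zero[OF D] by (auto intro!: bexI[of _ 0])

lemma dvd_cong_mult:
  assumes "dvd_cong D x a b" "dvd_cong D x a' b'"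
  shows "dvd_cong D x (a * a') (b * b')"
proof -
  obtain g g' where g: "g \<in> D" "a - b = x * g" "g' \<in> D" "a' - b' = x * g'"
    using assms unfolding dvd_cong_def by auto
  have "a * a' - b * b' = (a - b) * a' + b * (a' - b')" by (simp add: algebra_simps)
  also have "\<dots> = x * (g * a' + b * g')" unfolding g by (simp add: algebra_simps)
  finally show ?thesis using assms g unfolding dvd_cong_def
    by (auto intro!: bexI[of _ "g * a' + b * g'"] sr_add[OF D] sr_mult[OF D])
qed

lemma dvd_cong_power: "dvd_cong D x a b \<Longrightarrow> dvd_cong D x (a ^ n) (b ^ n)"
  by (induction n) (auto intro: dvd_cong_mult dvd_cong_refl sr_one[OF D])

lemma dvd_cong_prod:
  "(\<And>j. j \<in> J \<Longrightarrow> dvd_cong D x (a j) (b j)) \<Longrightarrow> dvd_cong D x (prod a J) (prod b J)"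
  by (induction J rule: infinite_finite_induct) (auto intro: dvd_cong_mult dvd_cong_refl sr_one[OF D])

lemma dvd_cong_prod_power:
  assumes "\<And>j. j \<in> J \<Longrightarrow> a j \<in> D" "\<And>j. j \<in> J \<Longrightarrow> b j \<in> D"
    "\<And>j. j \<in> J \<Longrightarrow> e j > 0 \<Longrightarrow> dvd_cong D x (a j) (b j)"
  shows "dvd_cong D x (\<Prod>j\<in>J. a j ^ e j) (\<Prod>j\<in>J. b j ^ e j)"
proof (rule dvd_cong_prod)
  fix j assume j: "j \<in> J"
  show "dvd_cong D x (a j ^ e j) (b j ^ e j)"
  proof (cases "e j = 0")
    case False
    then show ?thesis using assms(3)[OF j] dvd_cong_power by simp
  qed (simp add: dvd_cong_refl sr_one[OF D])
qed

end

section \<open>Exchange monomials and the Coxeter mutation of the acyclic seed attached to a Cartan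
  matrix\<close>

locale gcm =
  fixes r :: nat and A :: "nat \<Rightarrow> nat \<Rightarrow> int"
  assumes GCM: "symmetrizable_GCM r A"
begin

abbreviation c :: "nat \<Rightarrow> nat \<Rightarrow> nat" where
  "c j k \<equiv> nat (- A j k)"

text \<open>Column \<open>k\<close> of \<open>A\<close>, split at \<open>k\<close>. Because of the
  signs in \<open>B_mat A\<close>, \<open>later\<close> and \<open>earlier\<close> are the cluster
  parts of the two monomials in the initial exchange relation of direction \<open>k\<close>.\<close>

definition later :: "(nat \<Rightarrow> 'a::comm_ring_1) \<Rightarrow> nat \<Rightarrow> 'a" where
  "later w k = (\<Prod>j=k+1..r. w j ^ c j k)"

definition earlier :: "(nat \<Rightarrow> 'a::comm_ring_1) \<Rightarrow> nat \<Rightarrow> 'a" where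
  "earlier w k = (\<Prod>j=1..<k. w j ^ c j k)"

definition bfz_p :: "(nat \<Rightarrow> 'a::comm_ring_1) \<Rightarrow> nat \<Rightarrow> 'a" where
  "bfz_p z i = z i * z (r + i) - later z i * earlier (\<lambda>j. z (r + j)) i"

definition bfz_exchange :: "(nat \<Rightarrow> 'a::comm_ring_1) \<Rightarrow> nat \<Rightarrow> 'a" where
  "bfz_exchange w k = w (r + k) * earlier w k + later w k * earlier (\<lambda>j. w (r + j)) k"

text \<open>The new variables along the mutations \<open>1, ..., r\<close>, solved recursively from
  their exchange relations. Being a formula in an arbitrary \<open>w\<close>, it can be specialized
  independently of any seed pattern; \<open>cox_invariant\<close> identifies it inside the BFZ
  pattern.\<close>

function cox_var :: "(nat \<Rightarrow> 'a::field) \<Rightarrow> nat \<Rightarrow> 'a" where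
  "cox_var w i = (w (r + i) + later w i * (\<Prod>j=1..<i. cox_var w j ^ c j i)) / w i"
  by pat_completeness auto
termination by (relation "measure snd") auto

declare cox_var.simps [simp del]

definition zvar :: "(nat \<Rightarrow> 'a::field) \<Rightarrow> nat \<Rightarrow> 'a" where
  "zvar w i = (if i \<le> r then w i else cox_var w (i - r))"

abbreviation W :: "nat set" where
  "W \<equiv> {1..r + r}"

lemma c_sym: "j \<in> {1..r} \<Longrightarrow> k \<in> {1..r} \<Longrightarrow> j \<noteq> k \<Longrightarrow> c j k > 0 \<longleftrightarrow> c k j > 0"
  using GCM unfolding symmetrizable_GCM_def by (metis int_nat_eq less_le nat_0_iff neg_0_less_iff_less order.order_iff_strict zero_less_nat_eq)

lemma A_nonpos: "j \<in> {1..r} \<Longrightarrow> k \<in> {1..r} \<Longrightarrow> j \<noteq> k \<Longrightarrow> A j k \<le> 0"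
  using GCM unfolding symmetrizable_GCM_def by blast

lemma later_cong: "(\<And>j. k < j \<Longrightarrow> j \<le> r \<Longrightarrow> w j = w' j) \<Longrightarrow> later w k = later w' k"
  and earlier_cong: "(\<And>j. 1 \<le> j \<Longrightarrow> j < k \<Longrightarrow> w j = w' j) \<Longrightarrow> earlier w k = earlier w' k"
  by (auto simp: later_def earlier_def intro!: prod.cong)

lemma later_in:
  assumes "is_subring D" "\<And>j. k < j \<Longrightarrow> j \<le> r \<Longrightarrow> w j \<in> D"
  shows "later w k \<in> D"
  unfolding later_def by (intro sr_prod[OF assms(1)] sr_power[OF assms(1)]) (auto intro: assms(2))

lemma earlier_in:
  assumes "is_subring D" "\<And>j. 1 \<le> j \<Longrightarrow> j < k \<Longrightarrow> w j \<in> D"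
  shows "earlier w k \<in> D"
  unfolding earlier_def by (intro sr_prod[OF assms(1)] sr_power[OF assms(1)]) (auto intro: assms(2))

lemma later_neq_0: "(\<And>j. k < j \<Longrightarrow> j \<le> r \<Longrightarrow> w j \<noteq> 0) \<Longrightarrow> later w k \<noteq> (0::'a::idom)"
  and earlier_neq_0: "(\<And>j. 1 \<le> j \<Longrightarrow> j < k \<Longrightarrow> v j \<noteq> 0) \<Longrightarrow> earlier v k \<noteq> (0::'a::idom)"
  by (auto simp: later_def earlier_def)

lemma hom_later:
  assumes "hom_on D f" "\<And>j. k < j \<Longrightarrow> j \<le> r \<Longrightarrow> w j \<in> D"
  shows "f (later w k) = later (\<lambda>j. f (w j)) k"
  unfolding later_def
  by (subst hom_on_prod[OF assms(1)])
    (auto simp: hom_on_power[OF assms(1)] assms(2) intro!: sr_power[OF hom_on_subring[OF assms(1)]])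

lemma hom_earlier:
  assumes "hom_on D f" "\<And>j. 1 \<le> j \<Longrightarrow> j < k \<Longrightarrow> w j \<in> D"
  shows "f (earlier w k) = earlier (\<lambda>j. f (w j)) k"
  unfolding earlier_def
  by (subst hom_on_prod[OF assms(1)])
    (auto simp: hom_on_power[OF assms(1)] assms(2) intro!: sr_power[OF hom_on_subring[OF assms(1)]])

lemma cox_var_rel:
  assumes "w i \<noteq> 0"
  shows "w i * cox_var w i = w (r + i) + later w i * earlier (cox_var w) i"
  using assms by (subst cox_var.simps) (simp add: earlier_def)

lemma bfz_p_zvar:
  assumes "i \<in> {1..r}" "w i \<noteq> 0"
  shows "bfz_p (zvar w) i = w (r + i)"
proof -
  have "later (zvar w) i = later w i" "earlier (\<lambda>j. zvar w (r + j)) i = earlier (cox_var w) i"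
    by (rule later_cong earlier_cong; simp add: zvar_def)+
  then show ?thesis using assms cox_var_rel[of w i] by (simp add: bfz_p_def zvar_def)
qed

lemma cox_var_in:
  assumes D: "is_subring D" and w: "\<And>j. j \<in> W \<Longrightarrow> w j \<in> D" "\<And>j. j \<in> {1..r} \<Longrightarrow> inverse (w j) \<in> D"
    and i: "i \<in> {1..r}"
  shows "cox_var w i \<in> D"
  using i
proof (induction i rule: less_induct)
  case (less i)
  then show ?case by (subst cox_var.simps, unfold divide_inverse)
      (intro sr_mult[OF D] sr_add[OF D] later_in[OF D] sr_prod[OF D] sr_power[OF D] w less; auto)
qed

lemma hom_cox_var:
  fixes w :: "nat \<Rightarrow> 'a::field" and f :: "'a \<Rightarrow> 'b::field"
  assumes f: "hom_on (laurent w W {1..r}) f" and w: "\<And>i. i \<in> {1..r} \<Longrightarrow> w i \<noteq> 0"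
    and fw: "\<And>i. i \<in> {1..r} \<Longrightarrow> f (w i) \<noteq> 0" and i: "i \<in> {1..r}"
  shows "f (cox_var w i) = cox_var (\<lambda>j. f (w j)) i"
  using i
proof (induction i rule: less_induct)
  case (less i)
  let ?D = "laurent w W {1..r}"
  have D: "is_subring ?D" by (rule laurent_sr)
  have var: "w j \<in> ?D" if "j \<in> W" for j using that by (rule laurent_var)
  have cox: "cox_var w j \<in> ?D" if "j \<in> {1..r}" for j
    by (rule cox_var_in[OF D _ _ that]) (auto intro: var laurent_inverse)
  have iW: "i \<in> W" "r + i \<in> W" using less.prems by auto
  have L: "later w i \<in> ?D" by (rule later_in[OF D]) (use less.prems in \<open>auto intro: var\<close>)
  have E: "earlier (cox_var w) i \<in> ?D" by (rule earlier_in[OF D]) (use less.prems in \<open>auto intro: cox\<close>)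
  have "f (w i) * f (cox_var w i) = f (w i * cox_var w i)"
    by (rule hom_on_mult[OF f, symmetric]) (use var[OF iW(1)] cox[OF less.prems] in auto)
  also have "\<dots> = f (w (r + i)) + f (later w i) * f (earlier (cox_var w) i)"
    unfolding cox_var_rel[of w i, OF w[OF less.prems]]
    by (simp add: hom_on_add[OF f] hom_on_mult[OF f] var[OF iW(2)] L E sr_mult[OF D])
  also have "f (later w i) = later (\<lambda>j. f (w j)) i"
    by (rule hom_later[OF f]) (use less.prems in \<open>auto intro: var\<close>)
  also have "f (earlier (cox_var w) i) = earlier (\<lambda>j. f (cox_var w j)) i"
    by (rule hom_earlier[OF f]) (use less.prems in \<open>auto intro: cox\<close>)
  also have "\<dots> = earlier (cox_var (\<lambda>j. f (w j))) i" by (rule earlier_cong) (use less in auto)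
  also have "f (w (r + i)) + later (\<lambda>j. f (w j)) i * earlier (cox_var (\<lambda>j. f (w j))) i
      = f (w i) * cox_var (\<lambda>j. f (w j)) i" by (rule cox_var_rel[symmetric]) (rule fw[OF less.prems])
  finally show ?case using fw[OF less.prems] by simp
qed

lemma cox_var_bfz:
  fixes z :: "nat \<Rightarrow> 'a::field"
  assumes z: "\<And>i. i \<in> {1..r} \<Longrightarrow> z i \<noteq> 0" and i: "i \<in> {1..r}"
  shows "cox_var (\<lambda>j. if j \<le> r then z j else bfz_p z (j - r)) i = z (r + i)"
  using i
proof (induction i rule: less_induct)
  case (less i)
  let ?w = "\<lambda>j. if j \<le> r then z j else bfz_p z (j - r)"
  have "later ?w i = later z i" by (rule later_cong) simp
  moreover have "earlier (cox_var ?w) i = earlier (\<lambda>j. z (r + j)) i" by (rule earlier_cong) (use less in auto)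
  ultimately have "z i * cox_var ?w i = bfz_p z i + later z i * earlier (\<lambda>j. z (r + j)) i"
    using cox_var_rel[of ?w i] z[OF less.prems] less.prems by simp
  also have "\<dots> = z i * z (r + i)" by (simp add: bfz_p_def)
  finally show ?case using z[OF less.prems] by simp
qed

text \<open>Arbitrary positive values of the \<open>zvar w i\<close> arise from a specialization of
  \<open>w\<close>, the one described by \<open>cox_var_bfz\<close>. A relation among them therefore
  vanishes at all positive points.\<close>

lemma aindep_zvar:
  fixes w :: "nat \<Rightarrow> 'a::field"
  assumes w: "aindep W w"
  shows "aindep W (zvar w)"
  unfolding aindep_def
proof (intro ballI impI)
  fix P :: "(nat, int) mpol" assume P: "P \<in> mpols W" "meval of_int (zvar w) P = 0"
  show "P = 0"
  proof (rule mpols_eq_0_if_vanishing[where h = "of_int :: int \<Rightarrow> real" and S = "{0<..}" and I = W])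
    fix \<zeta> :: "nat \<Rightarrow> real" assume \<zeta>: "\<And>i. i \<in> W \<Longrightarrow> \<zeta> i \<in> {0<..}"
    let ?o = "\<lambda>j. if j \<le> r then \<zeta> j else bfz_p \<zeta> (j - r)"
    have w0: "w i \<noteq> 0" if "i \<in> {1..r}" for i using aindep_neq_0[OF w, of i] that by auto
    have z0: "\<zeta> i \<noteq> 0" if "i \<in> {1..r}" for i using \<zeta>[of i] that by auto
    obtain f where f: "hom_on (laurent w W {1..r}) f" "\<And>i. i \<in> W \<Longrightarrow> f (w i) = ?o i"
      by (rule specialize[OF w, of "{1..r}" ?o]) (use z0 in auto)
    have fz: "f (zvar w i) = \<zeta> i" if i: "i \<in> W" for i
    proof (cases "i \<le> r")
      case True
      then show ?thesis using f(2)[OF i] by (simp add: zvar_def)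
    next
      case False
      then have ir: "i - r \<in> {1..r}" using i by auto
      have "f (cox_var w (i - r)) = cox_var (\<lambda>j. f (w j)) (i - r)"
        by (rule hom_cox_var[OF f(1) w0 _ ir]) (use f(2) z0 in auto)
      also have "\<dots> = cox_var ?o (i - r)"
      proof -
        have "cox_var (\<lambda>j. f (w j)) k = cox_var ?o k" if "k \<in> {1..r}" for k using that
        proof (induction k rule: less_induct)
          case (less k)
          have "later (\<lambda>j. f (w j)) k = later ?o k" by (rule later_cong) (use less.prems f(2) in auto)
          moreover have "(\<Prod>j=1..<k. cox_var (\<lambda>j. f (w j)) j ^ c j k) = (\<Prod>j=1..<k. cox_var ?o j ^ c j k)"
            by (rule prod.cong) (use less in auto)
          ultimately show ?case using f(2)[of k] f(2)[of "r + k"] less.prems by (subst (1 2) cox_var.simps) simp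
        qed
        then show ?thesis using ir by blast
      qed
      also have "\<dots> = \<zeta> (r + (i - r))" by (rule cox_var_bfz[OF z0 ir])
      finally show ?thesis using False by (simp add: zvar_def)
    qed
    have zin: "zvar w i \<in> laurent w W {1..r}" if i: "i \<in> W" for i
    proof (cases "i \<le> r")
      case False
      then have "i - r \<in> {1..r}" using i by auto
      then have "cox_var w (i - r) \<in> laurent w W {1..r}"
        by (intro cox_var_in laurent_sr) (auto intro: laurent_var laurent_inverse)
      then show ?thesis using False by (simp add: zvar_def)
    qed (use i in \<open>auto simp: zvar_def intro: laurent_var\<close>)
    have "0 = f (meval of_int (zvar w) P)" using P(2) hom_on_zero[OF f(1)] by simp
    also have "\<dots> = meval of_int (\<lambda>i. f (zvar w i)) P" by (rule hom_on_meval[OF f(1) P(1) zin])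
    also have "\<dots> = meval of_int \<zeta> P" by (rule meval_cong[OF P(1) fz])
    finally show "meval of_int \<zeta> P = 0" by simp
  qed (use P rhf_of_int in \<open>auto simp: infinite_Ioi\<close>)
qed

lemma zvar_simps: "i \<in> {1..r} \<Longrightarrow> zvar w i = w i" "i \<in> {1..r} \<Longrightarrow> zvar w (r + i) = cox_var w i"
  by (auto simp: zvar_def)

lemma later_dvd:
  assumes D: "is_subring D" and w: "\<And>i. i \<in> {1..r} \<Longrightarrow> w i \<in> D"
    and jk: "j \<in> {1..r}" "k \<in> {1..r}" "j < k" "c j k > 0"
  shows "\<exists>g\<in>D. later w j = w k * g"
proof -
  have "c k j > 0" using c_sym[of j k] jk by auto
  then obtain n where n: "c k j = Suc n" by (metis gr0_implies_Suc)
  have "later w j = w k ^ c k j * (\<Prod>i\<in>{j+1..r} - {k}. w i ^ c i j)"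
    unfolding later_def by (rule prod.remove) (use jk in auto)
  also have "\<dots> = w k * (w k ^ n * (\<Prod>i\<in>{j+1..r} - {k}. w i ^ c i j))" by (simp add: n)
  finally show ?thesis by (rule bexI) (intro sr_mult[OF D] sr_prod[OF D] sr_power[OF D] w; use jk in auto)
qed

lemma earlier_mult: "earlier (\<lambda>j. v j * w j) k = earlier v k * earlier w k"
  by (simp add: earlier_def power_mult_distrib prod.distrib)

text \<open>For \<open>j < k\<close> linked to \<open>k\<close>, the variable \<open>w k\<close>
  divides \<open>later w j\<close>, so the relation defining \<open>cox_var w j\<close> becomes
  \<open>w (r + j) = w j * cox_var w j\<close> modulo \<open>w k\<close>. Indices not linked to
  \<open>k\<close> have exponent 0.\<close>

lemma earlier_coxeter_cong:
  fixes w :: "nat \<Rightarrow> 'a::field"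
  assumes D: "is_subring D" and w0: "\<And>i. i \<in> {1..r} \<Longrightarrow> w i \<noteq> 0"
    and w: "\<And>i. i \<in> {1..r} \<Longrightarrow> w i \<in> D" and p: "\<And>j. 1 \<le> j \<Longrightarrow> j < k \<Longrightarrow> w (r + j) \<in> D"
    and cox: "\<And>j. 1 \<le> j \<Longrightarrow> j < k \<Longrightarrow> cox_var w j \<in> D" and k: "k \<in> {1..r}"
  shows "dvd_cong D (w k) (earlier (\<lambda>j. w (r + j)) k) (earlier w k * earlier (cox_var w) k)"
  unfolding earlier_mult[symmetric] unfolding earlier_def
proof (rule dvd_cong_prod_power[OF D w[OF k]])
  fix j assume "j \<in> {1..<k}"
  then have j: "1 \<le> j" "j < k" "j \<in> {1..r}" using k by auto
  show "w (r + j) \<in> D" "w j * cox_var w j \<in> D" by (intro p cox w j sr_mult[OF D])+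
  assume "c j k > 0"
  then obtain g where g: "g \<in> D" "later w j = w k * g" using later_dvd[where w = w, OF D w j(3) k j(2)] by blast
  have E: "earlier (cox_var w) j \<in> D" by (rule earlier_in[OF D]) (use j cox in auto)
  have "w (r + j) - w j * cox_var w j = w k * (- g * earlier (cox_var w) j)"
    using cox_var_rel[of w j, OF w0[OF j(3)]] g(2) by simp
  moreover have "- g * earlier (cox_var w) j \<in> D" by (intro sr_mult[OF D] sr_uminus[OF D] g E)
  moreover have "w (r + j) \<in> D" "w j * cox_var w j \<in> D" by (intro p cox w j sr_mult[OF D])+
  ultimately show "dvd_cong D (w k) (w (r + j)) (w j * cox_var w j)" unfolding dvd_cong_def by blast
qed

text \<open>By \<open>earlier_coxeter_cong\<close> the binomial is divisible by \<open>w k\<close>.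
  The quotient, which is the mutated variable, is thus a polynomial in the \<open>zvar w i\<close>;
  moreover it is linear in \<open>zvar w (r + k)\<close> with coefficient
  \<open>earlier w k\<close>. The proof of \<open>starfish\<close> relies on both facts.\<close>

lemma bfz_exchange_decomp:
  fixes w :: "nat \<Rightarrow> 'a::field"
  assumes w0: "\<And>i. i \<in> {1..r} \<Longrightarrow> w i \<noteq> 0" and k: "k \<in> {1..r}"
  shows "\<exists>g\<in>gen_ring (zvar w ` (W - {r + k})).
    bfz_exchange w k = w k * (cox_var w k * earlier w k + g)"
proof -
  let ?D = "gen_ring (zvar w ` (W - {r + k}))"
  have D: "is_subring ?D" by (rule gen_ring_sr)
  have z: "zvar w i \<in> ?D" if "i \<in> W" "i \<noteq> r + k" for i using that by (auto intro: gr_incl)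
  have w: "w i \<in> ?D" if "i \<in> {1..r}" for i using z[of i] zvar_simps(1)[of i w] that k by auto
  have cox: "cox_var w j \<in> ?D" if "1 \<le> j" "j < k" for j
    using z[of "r + j"] zvar_simps(2)[of j w] that k by auto
  have p: "w (r + j) \<in> ?D" if "1 \<le> j" "j < k" for j
  proof -
    have jr: "j \<in> {1..r}" using that k by auto
    have "w j * cox_var w j - later w j * earlier (cox_var w) j \<in> ?D"
      by (intro sr_diff[OF D] sr_mult[OF D] w[OF jr] cox[OF that] later_in[OF D] earlier_in[OF D])
        (use w cox that in auto)
    then show ?thesis using cox_var_rel[of w j, OF w0[OF jr]] by simp
  qed
  obtain h where h: "h \<in> ?D" "earlier (\<lambda>j. w (r + j)) k - earlier w k * earlier (cox_var w) k = w k * h"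
    using earlier_coxeter_cong[OF D w0 w p cox k] unfolding dvd_cong_def by blast
  have "bfz_exchange w k = (w (r + k) + later w k * earlier (cox_var w) k) * earlier w k
      + later w k * (earlier (\<lambda>j. w (r + j)) k - earlier w k * earlier (cox_var w) k)"
    by (simp add: bfz_exchange_def algebra_simps)
  also have "\<dots> = w k * (cox_var w k * earlier w k + later w k * h)"
    unfolding h(2) cox_var_rel[of w k, OF w0[OF k], symmetric] by (simp add: algebra_simps)
  finally show ?thesis by (rule bexI) (intro sr_mult[OF D] later_in[OF D] h(1); use w in auto)
qed

lemma cox_var_in_lower_bound:
  fixes w :: "nat \<Rightarrow> 'a::field"
  assumes D: "is_subring D" and w: "\<And>i. i \<in> W \<Longrightarrow> w i \<noteq> 0" "\<And>i. i \<in> W \<Longrightarrow> w i \<in> D"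
    "\<And>i. i \<in> {1..r} \<Longrightarrow> inverse (w (r + i)) \<in> D"
    and w': "\<And>k. k \<in> {1..r} \<Longrightarrow> bfz_exchange w k / w k \<in> D" and j: "j \<in> {1..r}"
  shows "cox_var w j \<in> D"
  using j
proof (induction j rule: less_induct)
  case (less j)
  have wr: "w i \<in> D" "w i \<noteq> 0" "w (r + i) \<in> D" "w (r + i) \<noteq> 0" if "i \<in> {1..r}" for i
    using w(1)[of i] w(2)[of i] w(1)[of "r + i"] w(2)[of "r + i"] that by auto
  note jr = less.prems
  have cox: "cox_var w i \<in> D" if "1 \<le> i" "i < j" for i using less that by auto
  let ?Ep = "earlier (\<lambda>i. w (r + i)) j" and ?Ec = "earlier (cox_var w) j" and ?E = "earlier w j"
  let ?L = "later w j"
  have Ec: "?Ec \<in> D" by (rule earlier_in[OF D cox])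
  obtain h where h: "h \<in> D" "?Ep - ?E * ?Ec = w j * h"
    using earlier_coxeter_cong[OF D wr(2) wr(1) _ cox jr] wr(3) jr unfolding dvd_cong_def by fastforce
  define y where "y = bfz_exchange w j / w j"
  have y: "y \<in> D" "w j * y = w (r + j) * ?E + ?L * ?Ep"
    using wr(2)[OF jr] w'[OF jr] by (simp_all add: y_def bfz_exchange_def)
  have "w j * (?Ec * y + w (r + j) * h) = ?Ec * (w j * y) + w (r + j) * (w j * h)" by (simp add: algebra_simps)
  also have "\<dots> = w (r + j) * (?E * ?Ec) + ?L * ?Ep * ?Ec + w (r + j) * (?Ep - ?E * ?Ec)"
    unfolding h(2)[symmetric] y(2) by (simp add: algebra_simps)
  also have "\<dots> = (w (r + j) + ?L * ?Ec) * ?Ep" by (simp add: algebra_simps)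
  also have "\<dots> = w j * (cox_var w j * ?Ep)"
    unfolding cox_var_rel[of w j, OF wr(2)[OF jr], symmetric] by (simp only: mult.assoc)
  finally have eq: "?Ec * y + w (r + j) * h = cox_var w j * ?Ep" using wr(2)[OF jr] by simp
  have Ep0: "?Ep \<noteq> 0" by (rule earlier_neq_0) (use wr jr in auto)
  have "inverse ?Ep = earlier (\<lambda>i. inverse (w (r + i))) j"
    by (simp add: earlier_def prod_inversef[symmetric] o_def power_inverse)
  also have "\<dots> \<in> D" by (rule earlier_in[OF D]) (use w(3) jr in auto)
  finally have "inverse ?Ep * (?Ec * y + w (r + j) * h) \<in> D"
    by (intro sr_mult[OF D] sr_add[OF D] Ec y(1) jr wr h(1))
  moreover have "inverse ?Ep * (cox_var w j * ?Ep) = cox_var w j" using Ep0 by simp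
  ultimately show ?case unfolding eq by (simp only:)
qed

text \<open>Reduction modulo \<open>z k\<close>, realized as the substitution of 0 with values in
  the same field. Its kernel is generated by \<open>z k\<close> and its target has no zero divisors,
  so \<open>z k\<close> is prime.\<close>

lemma gen_ring_kill_var:
  fixes z :: "nat \<Rightarrow> 'a::field"
  assumes z: "aindep I z" and k: "k \<in> I"
  obtains f where "hom_on (gen_ring (z ` I)) f" "f (z k) = 0" "\<And>i. i \<in> I \<Longrightarrow> i \<noteq> k \<Longrightarrow> f (z i) = z i"
    "\<And>a. a \<in> gen_ring (z ` I) \<Longrightarrow> f a = 0 \<Longrightarrow> \<exists>g\<in>gen_ring (z ` I). a = z k * g"
proof -
  let ?z = "z(k := 0)"
  obtain f where f: "hom_on (laurent z I {}) f" "\<And>i. i \<in> I \<Longrightarrow> f (z i) = ?z i"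
    by (rule specialize[OF z, of "{}" ?z]) auto
  have R: "laurent z I {} = gen_ring (z ` I)" by (simp add: laurent_def)
  have "\<exists>g\<in>gen_ring (z ` I). a = z k * g" if a: "a \<in> gen_ring (z ` I)" "f a = 0" for a
  proof -
    obtain P where P: "P \<in> mpols I" "a = meval of_int z P" using a(1) unfolding gen_ring_image_eq by auto
    have "insert k I = I" using k by auto
    then obtain p d where p: "\<And>n. p n \<in> mpols (I - {k})" "P = (\<Sum>n\<le>d::nat. p n * mvar k ^ n)"
      using mpols_split_var[of P k I] P(1) by auto
    have "0 = meval of_int (\<lambda>i. f (z i)) P" unfolding a(2)[symmetric] P(2)
      by (rule hom_on_meval[OF f(1) P(1)]) (auto intro: laurent_var)
    also have "\<dots> = meval of_int ?z P" by (rule meval_cong[OF P(1) f(2)])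
    also have "\<dots> = (\<Sum>n\<le>d. if n = 0 then meval of_int ?z (p n) else 0)"
      unfolding p(2) by (auto intro!: sum.cong)
    also have "\<dots> = meval of_int ?z (p 0)" by simp
    also have "\<dots> = meval of_int z (p 0)" by (rule meval_cong[OF p(1)]) auto
    finally have 0: "meval of_int z (p 0) = 0" by simp
    have "P = p 0 + (\<Sum>n<d. p (Suc n) * mvar k ^ n) * mvar k"
      unfolding p(2) by (simp add: sum.atMost_shift sum_distrib_left sum_distrib_right mult_ac)
    then have "a = z k * meval of_int z (\<Sum>n<d. p (Suc n) * mvar k ^ n)" unfolding P(2) using 0 by simp
    moreover have "p n \<in> mpols I" for n using p(1)[of n] mpols_mono[of "I - {k}" I] by auto
    then have "(\<Sum>n<d. p (Suc n) * mvar k ^ n) \<in> mpols I" by (intro mpols_closed mvar_in_mpols k)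
    ultimately show ?thesis unfolding gen_ring_image_eq by blast
  qed
  with f k show thesis by (intro that[of f]) (auto simp: R)
qed

text \<open>The variable \<open>z k\<close> is a prime element of the polynomial ring in the \<open>z i\<close> which divides
  none of the other generators of the Laurent ring of the seed adjacent in direction \<open>k\<close>. This
  removes the denominators one variable at a time.\<close>

lemma starfish:
  fixes w :: "nat \<Rightarrow> 'a::field"
  assumes w: "aindep W w" and f: "f \<in> laurent w W {1..r}"
    and fk: "\<And>k. k \<in> {1..r} \<Longrightarrow>
      f \<in> laurent (w(k := bfz_exchange w k / w k)) W W"
  shows "f \<in> gen_ring (zvar w ` W)"
proof -
  let ?R = "gen_ring (zvar w ` W)" and ?z = "zvar w"
  have R: "is_subring ?R" by (rule gen_ring_sr)
  have z: "aindep W ?z" by (rule aindep_zvar[OF w])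
  have zR: "?z i \<in> ?R" if "i \<in> W" for i using that by (auto intro: gr_incl)
  have w0: "w i \<noteq> 0" if "i \<in> W" for i by (rule aindep_neq_0[OF w that])
  have wr0: "w i \<noteq> 0" if "i \<in> {1..r}" for i using w0[of i] that by auto
  have z0: "?z i \<noteq> 0" if "i \<in> W" for i by (rule aindep_neq_0[OF z that])
  have wz: "w i = ?z i" if "i \<in> {1..r}" for i using zvar_simps(1)[OF that, of w] by simp
  have wp: "w (r + i) = bfz_p ?z i" if "i \<in> {1..r}" for i using bfz_p_zvar[OF that, of w] wr0[OF that] by simp
  have pz_in: "bfz_p y i \<in> D" if "is_subring D" "\<And>j. j \<in> W \<Longrightarrow> y j \<in> D" "i \<in> {1..r}" for D y i
    unfolding bfz_p_def
    by (intro sr_diff[OF that(1)] sr_mult[OF that(1)] later_in[OF that(1)] earlier_in[OF that(1)] that(2))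
      (use that(3) in auto)
  have wR: "w i \<in> ?R" if i: "i \<in> W" for i
  proof (cases "i \<le> r")
    case True
    then show ?thesis using wz[of i] zR[OF i] i by simp
  next
    case False
    then have ir: "i - r \<in> {1..r}" "r + (i - r) = i" using i by auto
    then show ?thesis using wp[OF ir(1)] pz_in[OF R zR ir(1)] by simp
  qed
  \<comment> \<open>Cancels the factors \<open>w k\<close> one by one. The element \<open>g\<close>
    has a denominator \<open>m\<close> in the neighbouring Laurent ring that is not killed by
    \<open>h\<close>; since \<open>h\<close> kills the product of \<open>g * w k ^ Suc N\<close>
    with \<open>m\<close>, it kills the first factor, which is then divisible by
    \<open>?z k\<close>.\<close>
  have step: "g \<in> ?R" if k: "k \<in> {1..r}" and g: "g \<in> laurent (w(k := bfz_exchange w k / w k)) W W"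
    "g * w k ^ N \<in> ?R" for g k N
  proof -
    let ?v = "w(k := bfz_exchange w k / w k)"
    have kW: "k \<in> W" "r + k \<in> W" using k by auto
    obtain h where h: "hom_on ?R h" "h (?z k) = 0" "\<And>i. i \<in> W \<Longrightarrow> i \<noteq> k \<Longrightarrow> h (?z i) = ?z i"
      "\<And>a. a \<in> ?R \<Longrightarrow> h a = 0 \<Longrightarrow> \<exists>g\<in>?R. a = ?z k * g"
      by (rule gen_ring_kill_var[OF z kW(1)]) (rule that)
    obtain y where y: "y \<in> gen_ring (?z ` (W - {r + k}))"
      "bfz_exchange w k = w k * (cox_var w k * earlier w k + y)" using bfz_exchange_decomp[of w, OF wr0 k] by blast
    have vk: "?v k = ?z (r + k) * earlier w k + y" using y(2) wr0[OF k] zvar_simps(2)[OF k, of w] by simp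
    have ER: "earlier w k \<in> ?R" by (rule earlier_in[OF R]) (use wR k in auto)
    have yR: "y \<in> ?R" using y(1) gen_ring_mono[of "?z ` (W - {r + k})" "?z ` W"] by auto
    have vR: "?v i \<in> ?R" if "i \<in> W" for i
    proof (cases "i = k")
      case True
      then show ?thesis by (simp only: True vk) (intro sr_add[OF R] sr_mult[OF R] zR kW ER yR)
    qed (use wR that in auto)
    have h_late: "h (later ?z i) = later (\<lambda>j. h (?z j)) i" for i by (rule hom_later[OF h(1)]) (rule zR, auto)
    have h_early: "h (earlier (\<lambda>j. ?z (r + j)) i) = earlier (\<lambda>j. h (?z (r + j))) i" if "i \<in> {1..r}" for i
      by (rule hom_earlier[OF h(1)]) (rule zR, use that in auto)
    have early_same: "earlier (\<lambda>j. h (?z (r + j))) i = earlier (\<lambda>j. ?z (r + j)) i" if "i \<in> {1..r}" for i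
      by (rule earlier_cong) (use h(3) that k in auto)
    have late0: "later ?z i \<noteq> 0" "earlier (\<lambda>j. ?z (r + j)) i \<noteq> 0" if "i \<in> {1..r}" for i
      by (rule later_neq_0 earlier_neq_0; rule z0; use that in auto)+
    \<comment> \<open>For \<open>i = k\<close> the product in \<open>bfz_p\<close> is killed and its
      monomial survives. For \<open>i < k\<close> linked to \<open>k\<close> the monomial contains
      \<open>?z k\<close> and the product survives. In all other cases \<open>?z k\<close> does not
      occur.\<close>
    have hp: "h (w (r + i)) \<noteq> 0" if i: "i \<in> {1..r}" for i
    proof -
      have mem: "later ?z i \<in> ?R" "earlier (\<lambda>j. ?z (r + j)) i \<in> ?R" "?z i \<in> ?R" "?z (r + i) \<in> ?R"
        by (rule later_in[OF R] earlier_in[OF R] zR; use i in \<open>auto intro: zR\<close>)+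
      have iW: "i \<in> W" "r + i \<in> W" "r + i \<noteq> k" using i k by auto
      have "h (w (r + i)) = h (?z i) * h (?z (r + i)) - h (later ?z i) * h (earlier (\<lambda>j. ?z (r + j)) i)"
        unfolding wp[OF i] bfz_p_def by (simp add: hom_on_diff[OF h(1)] hom_on_mult[OF h(1)] mem sr_mult[OF R])
      also have "\<dots> = h (?z i) * ?z (r + i) - later (\<lambda>j. h (?z j)) i * earlier (\<lambda>j. ?z (r + j)) i"
        by (simp only: h_late h_early[OF i] early_same[OF i] h(3)[OF iW(2,3)])
      finally have eq: "h (w (r + i)) = h (?z i) * ?z (r + i) - later (\<lambda>j. h (?z j)) i * earlier (\<lambda>j. ?z (r + j)) i" .
      show ?thesis
      proof (cases "i = k")
        case True
        have "later (\<lambda>j. h (?z j)) i = later ?z i" by (rule later_cong) (use h(3) True in auto)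
        then show ?thesis using eq late0[OF i] True h(2) by simp
      next
        case False
        then have hi: "h (?z i) = ?z i" using h(3) iW by auto
        show ?thesis
        proof (cases "i < k \<and> c k i > 0")
          case True
          then have "later (\<lambda>j. h (?z j)) i = 0"
            unfolding later_def using k h(2) by (intro prod_zero) (auto intro!: bexI[of _ k])
          then show ?thesis using eq hi z0 iW by simp
        next
          case F: False
          have "later (\<lambda>j. h (?z j)) i = later ?z i" unfolding later_def
          proof (rule prod.cong[OF refl])
            fix j assume "j \<in> {i+1..r}"
            then show "h (?z j) ^ c j i = ?z j ^ c j i" using F h(3)[of j] by (cases "j = k") auto
          qed
          then have "h (w (r + i)) = bfz_p ?z i" by (simp only: eq hi bfz_p_def)
          then have "h (w (r + i)) = w (r + i)" by (simp only: wp[OF i])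
          then show ?thesis using w0 iW by simp
        qed
      qed
    qed
    have hv: "h (?v i) \<noteq> 0" if i: "i \<in> W" for i
    proof (cases "i = k")
      case False
      show ?thesis
      proof (cases "i \<le> r")
        case True
        then have "i \<in> {1..r}" using i by auto
        then show ?thesis using False h(3)[OF i False] z0[OF i] wz by simp
      next
        case F: False
        then have "i - r \<in> {1..r}" "r + (i - r) = i" using i by auto
        then show ?thesis using hp[of "i - r"] False by simp
      qed
    next
      case True
      let ?R' = "gen_ring (?z ` (W - {r + k}))"
      have R': "is_subring ?R'" by (rule gen_ring_sr)
      have "?R' \<subseteq> {a \<in> ?R. h a \<in> ?R'}"
      proof (rule gen_ring_least)
        show "is_subring {a \<in> ?R. h a \<in> ?R'}" by (rule is_subringI)
            (auto simp: hom_on_one[OF h(1)] hom_on_diff[OF h(1)] hom_on_mult[OF h(1)]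
              intro: sr_one[OF R] sr_one[OF R'] sr_diff[OF R] sr_diff[OF R'] sr_mult[OF R] sr_mult[OF R'])
        show "?z ` (W - {r + k}) \<subseteq> {a \<in> ?R. h a \<in> ?R'}"
        proof
          fix a assume "a \<in> ?z ` (W - {r + k})"
          then obtain i where "i \<in> W - {r + k}" "a = ?z i" by blast
          then have i: "i \<in> W" "i \<noteq> r + k" "a = ?z i" by simp_all
          have "h a \<in> ?R'" using h(2) h(3)[OF i(1)] i sr_zero[OF R'] by (cases "i = k") (auto intro: gr_incl)
          then show "a \<in> {a \<in> ?R. h a \<in> ?R'}" using zR i by simp
        qed
      qed
      then have hy: "h y \<in> ?R'" using y(1) by auto
      have "h (earlier w k) = earlier (\<lambda>j. h (w j)) k" by (rule hom_earlier[OF h(1)]) (rule wR, use k in auto)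
      also have "\<dots> = earlier w k"
      proof (rule earlier_cong)
        fix j assume j: "1 \<le> j" "j < k"
        then have "j \<in> {1..r}" "j \<in> W" "j \<noteq> k" using k by auto
        then show "h (w j) = w j" using wz[of j] h(3)[of j] by simp
      qed
      finally have hE: "h (earlier w k) = earlier w k" .
      have E': "earlier w k \<in> ?R'"
      proof (rule earlier_in[OF R'])
        fix j assume j: "1 \<le> j" "j < k"
        then have "j \<in> {1..r}" "j \<in> W - {r + k}" using k by auto
        then show "w j \<in> ?R'" using wz[of j] by (auto intro: gr_incl)
      qed
      \<comment> \<open>Modulo \<open>?z k\<close> the mutated variable is linear in the
        transcendental element \<open>?z (r + k)\<close>, with nonzero leading coefficient
        \<open>earlier w k\<close>, and therefore not 0.\<close>
      have tr: "transc_over ?R' (?z (r + k))"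
      proof (rule transc_over_mono)
        have "aindep (insert (r + k) (W - {r + k})) ?z" using z kW(2) by (simp add: insert_absorb)
        then show "transc_over (fractions ?R') (?z (r + k))" by (rule aindep_transcendental) simp
      qed (auto intro!: fractions_incl[OF R'])
      have "h (?v k) = ?z (r + k) * earlier w k + h y" unfolding vk using kW k
        by (simp add: hom_on_add[OF h(1)] hom_on_mult[OF h(1)] sr_mult[OF R] ER zR yR hE h(3))
      moreover have "?z (r + k) * earlier w k + h y \<noteq> 0"
      proof
        assume "?z (r + k) * earlier w k + h y = 0"
        then have "poly [:h y, earlier w k:] (?z (r + k)) = 0" by (simp add: add.commute)
        moreover have "coeff [:h y, earlier w k:] n \<in> ?R'" for n
          using hy E' sr_zero[OF R'] by (auto simp: coeff_pCons split: nat.splits)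
        ultimately have "[:h y, earlier w k:] = 0" by (intro transc_overD[OF tr])
        then have "earlier w k = 0" by simp
        moreover have "earlier w k \<noteq> 0" by (rule earlier_neq_0) (use wr0 k in auto)
        ultimately show False by simp
      qed
      ultimately show ?thesis using True by simp
    qed
    have v0: "?v i \<noteq> 0" if "i \<in> W" for i using hv[OF that] hom_on_zero[OF h(1)] by auto
    obtain P M where P: "P \<in> mpols W" "g * (\<Prod>j\<in>W. ?v j) ^ M = meval of_int ?v P"
      using laurent_clear[of W W ?v g] v0 g(1) by auto
    define m where "m = (\<Prod>j\<in>W. ?v j) ^ M"
    have mR: "m \<in> ?R" unfolding m_def by (intro sr_power[OF R] sr_prod[OF R] vR)
    have pR: "(\<Prod>j\<in>W. ?v j) \<in> ?R" by (rule sr_prod[OF R vR])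
    have "h (\<Prod>j\<in>W. ?v j) = (\<Prod>j\<in>W. h (?v j))" by (rule hom_on_prod[OF h(1) vR])
    also have "\<dots> \<noteq> 0" unfolding prod_zero_iff[OF finite_atLeastAtMost] using hv by blast
    finally have hm: "h m \<noteq> 0" unfolding m_def hom_on_power[OF h(1) pR] by simp
    have gm: "g * m \<in> ?R"
      unfolding m_def P(2) by (rule meval_in_subring[OF R P(1)]) (auto intro: sr_of_int[OF R] vR simp del: fun_upd_apply)
    show ?thesis using g(2)
    proof (induction N)
      case (Suc N)
      have "(g * w k ^ Suc N) * m = ?z k * (w k ^ N * (g * m))" using wz[OF k] by simp
      then have "h ((g * w k ^ Suc N) * m) = h (?z k * (w k ^ N * (g * m)))" by (simp only:)
      moreover have "w k ^ N * (g * m) \<in> ?R" by (intro sr_mult[OF R] sr_power[OF R] gm wR[OF kW(1)])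
      ultimately have "h (g * w k ^ Suc N) * h m = h (?z k) * h (w k ^ N * (g * m))"
        by (simp only: hom_on_mult[OF h(1) Suc.prems mR] hom_on_mult[OF h(1) zR[OF kW(1)]])
      then have "h (g * w k ^ Suc N) = 0" using hm h(2) by simp
      then obtain g' where g': "g' \<in> ?R" "g * w k ^ Suc N = ?z k * g'" using h(4)[OF Suc.prems] by auto
      then have "g * w k ^ N = g'" using wr0[OF k] wz[OF k] by auto
      then show ?case using Suc.IH g'(1) by simp
    qed simp
  qed
  obtain P N where P: "P \<in> mpols W" "f * (\<Prod>j\<in>{1..r}. w j) ^ N = meval of_int w P"
    using laurent_clear[of "{1..r}" W w f] w0 f by auto
  have "f * (\<Prod>j\<in>{1..r}. w j) ^ N \<in> ?R"
    unfolding P(2) by (rule meval_in_subring[OF R P(1)]) (auto intro: sr_of_int[OF R] wR)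
  moreover have "f \<in> ?R" if "f * (\<Prod>j\<in>J. w j) ^ N \<in> ?R" "finite J" "J \<subseteq> {1..r}" for J
    using that(2,1,3)
  proof (induction J rule: finite_induct)
    case (insert k J)
    have k: "k \<in> {1..r}" using insert by auto
    let ?v = "w(k := bfz_exchange w k / w k)"
    have "w j \<in> laurent ?v W W" if "j \<in> J" for j
      using laurent_var[of j W ?v W] insert that by (auto simp: subset_iff split: if_splits)
    then have "f * (\<Prod>j\<in>J. w j) ^ N \<in> laurent ?v W W" by (intro lr_closed fk[OF k])
    moreover have "f * (\<Prod>j\<in>J. w j) ^ N * w k ^ N \<in> ?R"
      using insert by (simp add: power_mult_distrib mult_ac)
    ultimately have "f * (\<Prod>j\<in>J. w j) ^ N \<in> ?R" by (rule step[OF k])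
    then show ?case using insert by auto
  qed simp
  ultimately show ?thesis by blast
qed

end

section \<open>Standard monomials\<close>

context gcm
begin

text \<open>\<open>k\<close> discards the indices up to \<open>k\<close>, as needed in the induction
  on limits. \<open>Y\<close> is the set of indices whose coefficient y remains a variable: all of
  them for principal, none for trivial coefficients, and all but \<open>q\<close> for the reduction
  modulo one coefficient.\<close>

definition coords :: "nat \<Rightarrow> nat set \<Rightarrow> coord set" where
  "coords k Y = Xc ` {k+1..r} \<union> Xc' ` {k+1..r} \<union> Yc ` Y"

definition rhs :: "nat set \<Rightarrow> nat \<Rightarrow> (coord, 'c::comm_ring_1) mpol" where
  "rhs Y i = (if i \<in> Y then mvar (Yc i) else 1) * earlier (\<lambda>j. mvar (Xc j)) i + later (\<lambda>j. mvar (Xc j)) i"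

definition eqn :: "nat set \<Rightarrow> nat \<Rightarrow> (coord, 'c::comm_ring_1) mpol" where
  "eqn Y i = mvar (Xc i) * mvar (Xc' i) - rhs Y i"

definition std_monom :: "(coord \<Rightarrow>\<^sub>0 nat) \<Rightarrow> bool" where
  "std_monom m \<longleftrightarrow> (\<forall>i. lookup m (Xc i) = 0 \<or> lookup m (Xc' i) = 0)"

definition std :: "nat \<Rightarrow> nat set \<Rightarrow> (coord, 'c::comm_ring_1) mpol set" where
  "std k Y = {P \<in> mpols (coords k Y). \<forall>m\<in>keys P. std_monom m}"

text \<open>Measures the rewriting of x i x' i to \<open>rhs Y i\<close>: every rewriting step
  lowers it, because \<open>rhs Y i\<close> contains no x'.\<close>

definition deg' :: "(coord \<Rightarrow>\<^sub>0 nat) \<Rightarrow> nat" where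
  "deg' m = (\<Sum>i=1..r. lookup m (Xc' i))"

lemma rhs_in: "i \<in> {1..r} \<Longrightarrow> rhs Y i \<in> mpols (Xc ` {1..r} \<union> Yc ` Y)"
  unfolding rhs_def
  by (intro mpols_closed later_in[OF mpols_sr] earlier_in[OF mpols_sr]) (auto intro!: mpols_closed)

lemma rhs_in_coords: "i \<in> {1..r} \<Longrightarrow> rhs Y i \<in> mpols (coords 0 Y)"
  using rhs_in[of i Y] mpols_mono[of "Xc ` {1..r} \<union> Yc ` Y" "coords 0 Y"]
  by (auto simp: coords_def)

lemma eqn_in: "i \<in> {1..r} \<Longrightarrow> eqn Y i \<in> mpols (coords 0 Y)"
  unfolding eqn_def by (intro mpols_closed rhs_in_coords) (auto simp: coords_def)

lemma std_add: "P \<in> std k Y \<Longrightarrow> Q \<in> std k Y \<Longrightarrow> P + Q \<in> std k Y"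
  using Poly_Mapping.keys_add[of P Q] mpols_closed(6)[of P "coords k Y" Q] by (auto simp: std_def)

lemma std_zero: "0 \<in> std k Y"
  by (simp add: std_def mpols_closed)

definition reducible :: "nat set \<Rightarrow> (coord, 'c::comm_ring_1) mpol \<Rightarrow> bool" where
  "reducible Y P \<longleftrightarrow> (\<exists>Q G. Q \<in> std 0 Y \<and> (\<forall>i. G i \<in> mpols (coords 0 Y)) \<and> P = Q + (\<Sum>i=1..r. G i * eqn Y i))"

lemma reducible_add:
  assumes "reducible Y P" "reducible Y P'"
  shows "reducible Y (P + P')"
proof -
  obtain Q G where 1: "Q \<in> std 0 Y" "\<forall>i. G i \<in> mpols (coords 0 Y)" "P = Q + (\<Sum>i=1..r. G i * eqn Y i)"
    using assms(1) unfolding reducible_def by blast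
  obtain Q' G' where 2: "Q' \<in> std 0 Y" "\<forall>i. G' i \<in> mpols (coords 0 Y)" "P' = Q' + (\<Sum>i=1..r. G' i * eqn Y i)"
    using assms(2) unfolding reducible_def by blast
  have "P + P' = (Q + Q') + (\<Sum>i=1..r. (G i + G' i) * eqn Y i)"
    unfolding 1 2 by (simp add: distrib_right sum.distrib algebra_simps)
  moreover have "\<forall>i. G i + G' i \<in> mpols (coords 0 Y)" using 1(2) 2(2) mpols_closed(6) by blast
  ultimately show ?thesis unfolding reducible_def
    by (intro exI[of _ "Q + Q'"] exI[of _ "\<lambda>i. G i + G' i"] conjI std_add[OF 1(1) 2(1)])
qed

lemma reducible_std: "P \<in> std 0 Y \<Longrightarrow> reducible Y P"
  unfolding reducible_def by (rule exI[of _ P], rule exI[of _ "\<lambda>_. 0"]) (simp add: mpols_closed)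

lemma reducible_eqn:
  assumes "Q \<in> mpols (coords 0 Y)" "i \<in> {1..r}"
  shows "reducible Y (Q * eqn Y i)"
proof -
  have "(\<Sum>j=1..r. (if j = i then Q else 0) * eqn Y j) = (\<Sum>j=1..r. if j = i then Q * eqn Y j else 0)"
    by (rule sum.cong) auto
  then have "Q * eqn Y i = 0 + (\<Sum>j=1..r. (if j = i then Q else 0) * eqn Y j)" using assms(2) by simp
  moreover have "\<forall>j. (if j = i then Q else 0) \<in> mpols (coords 0 Y)" using assms(1) mpols_closed(2) by auto
  ultimately show ?thesis unfolding reducible_def
    by (intro exI[of _ 0] exI[of _ "\<lambda>j. if j = i then Q else 0"] conjI std_zero)
qed

lemma reducible_sum: "(\<And>i. i \<in> I \<Longrightarrow> reducible Y (f i)) \<Longrightarrow> reducible Y (sum f I)"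
  by (induction I rule: infinite_finite_induct) (auto intro: reducible_add reducible_std std_zero)

lemma reducible_all:
  assumes "P \<in> mpols (coords 0 Y)"
  shows "reducible Y P"
proof -
  have "reducible Y P" if "P \<in> mpols (coords 0 Y)" "\<forall>m\<in>keys P. deg' m \<le> n"
    for P :: "(coord, 'c::comm_ring_1) mpol" and n using that
  proof (induction n arbitrary: P rule: less_induct)
    case (less n)
    have "reducible Y (single m (lookup P m))" if m: "m \<in> keys P" for m
    proof (cases "std_monom m")
      case True
      then show ?thesis
        using mpols_single_key[OF less.prems(1) m] by (intro reducible_std) (auto simp: std_def mpols_closed(2) split: if_splits)
    next
      case False
      let ?a = "lookup P m"
      obtain i where i: "lookup m (Xc i) \<noteq> 0" "lookup m (Xc' i) \<noteq> 0"
        using False by (auto simp: std_monom_def)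
      have "Xc i \<in> coords 0 Y" using less.prems(1) m i(1) unfolding mpols_def subset_iff by (auto simp: in_keys_iff)
      then have ir: "i \<in> {1..r}" by (auto simp: coords_def)
      define e where "e = single (Xc i) 1 + single (Xc' i) (1::nat)"
      define m' where "m' = m - e"
      have mm: "m = m' + e" unfolding m'_def e_def by (intro poly_mapping_eqI)
          (use i in \<open>auto simp: lookup_add lookup_minus lookup_single when_def\<close>)
      have ee: "single e 1 = (mvar (Xc i) * mvar (Xc' i) :: (coord, 'c) mpol)"
        by (simp add: e_def mvar_def mult_single)
      have single: "single m ?a = single m' ?a * eqn Y i + single m' ?a * rhs Y i"
        unfolding eqn_def by (simp add: ee[symmetric] mm mult_single algebra_simps)
      have "keys m' \<subseteq> coords 0 Y"
      proof -
        have "keys m \<subseteq> coords 0 Y" using less.prems(1) m by (simp add: mpols_def)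
        then show ?thesis unfolding mm keys_add_nat by simp
      qed
      then have s: "single m' ?a \<in> mpols (coords 0 Y)" by (rule single_in_mpols)
      have deg_add: "deg' (a + b) = deg' a + deg' b" for a b by (simp add: deg'_def lookup_add sum.distrib)
      have "deg' e = 1"
      proof -
        have "deg' e = (\<Sum>j=1..r. if j = i then 1 else 0)"
          unfolding deg'_def e_def by (rule sum.cong) (auto simp: lookup_add lookup_single)
        then show ?thesis using ir by simp
      qed
      then have dm': "deg' m' < n" using less.prems(2) m deg_add[of m' e] mm by auto
      have "reducible Y (single m' ?a * rhs Y i)"
      proof (rule less.IH[OF dm'])
        show "single m' ?a * rhs Y i \<in> mpols (coords 0 Y)" by (intro mpols_closed s rhs_in_coords ir)
        show "\<forall>k\<in>keys (single m' ?a * rhs Y i). deg' k \<le> deg' m'"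
        proof
          fix k assume "k \<in> keys (single m' ?a * rhs Y i)"
          then obtain b where b: "k = m' + b" "b \<in> keys (rhs Y i :: (coord, 'c) mpol)"
            using keys_mult[of "single m' ?a" "rhs Y i"] by (auto split: if_splits)
          have "keys b \<subseteq> Xc ` {1..r} \<union> Yc ` Y"
            using rhs_in[OF ir, of Y] b(2) unfolding mpols_def by blast
          then have "lookup b (Xc' j) = 0" for j by (auto simp: in_keys_iff subset_iff)
          then show "deg' k \<le> deg' m'" using deg_add[of m' b] b(1) by (simp add: deg'_def)
        qed
      qed
      then show ?thesis unfolding single by (intro reducible_add reducible_eqn s ir)
    qed
    then show ?case by (subst mpol_expand[of P]) (intro reducible_sum)
  qed
  then show ?thesis using assms finite_nat_set_iff_bounded_le[of "deg' ` keys P"] by auto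
qed

text \<open>The exchange relations determine x' from x and y. Where \<open>\<xi> i = 0\<close> the
  division yields 0; points of that kind are evaluated only on polynomials without the coordinates
  \<open>Xc i\<close> and \<open>Xc' i\<close>.\<close>

definition lower_point :: "(nat \<Rightarrow> 'a::field) \<Rightarrow> (nat \<Rightarrow> 'a) \<Rightarrow> coord \<Rightarrow> 'a" where
  "lower_point \<xi> \<eta> v = (case v of Xc i \<Rightarrow> \<xi> i | Yc i \<Rightarrow> \<eta> i
     | Xc' i \<Rightarrow> (\<eta> i * earlier \<xi> i + later \<xi> i) / \<xi> i)"

text \<open>A standard monomial contains at most one of \<open>Xc k\<close> and
  \<open>Xc' k\<close>, so the two exponents combine to one integer, negative for
  \<open>Xc' k\<close>.\<close>

definition signed_power :: "nat \<Rightarrow> int \<Rightarrow> (coord, 'c::comm_ring_1) mpol" where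
  "signed_power k s = (if s \<ge> 0 then mvar (Xc k) ^ nat s else mvar (Xc' k) ^ nat (- s))"

lemma std_split:
  fixes Q :: "(coord, 'c::comm_ring_1) mpol"
  assumes Q: "Q \<in> std k Y" and k: "k < r"
  shows "\<exists>S C. finite S \<and> (\<forall>s. C s \<in> std (k + 1) Y) \<and> Q = (\<Sum>s\<in>S. C s * signed_power (k + 1) s)"
proof -
  let ?a = "Xc (k + 1)" and ?b = "Xc' (k + 1)"
  define sg where "sg m = int (lookup m ?a) - int (lookup m ?b)" for m
  define rest where "rest m = m - single ?a (lookup m ?a)
      - single ?b (lookup m ?b)" for m :: "coord \<Rightarrow>\<^sub>0 nat"
  have lookup_rest: "lookup (rest m) v = (if v = ?a \<or> v = ?b then 0 else lookup m v)" for m v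
    by (auto simp: rest_def lookup_minus lookup_single when_def)
  define C where "C s = (\<Sum>m\<in>{m \<in> keys Q. sg m = s}. single (rest m) (lookup Q m))" for s
  have mon: "single (rest m) c * signed_power (k + 1) (sg m) = (single m c :: (coord, 'c) mpol)"
    if m: "m \<in> keys Q" for m c
  proof -
    have "std_monom m" using m Q by (auto simp: std_def)
    then have "lookup m ?a = 0 \<or> lookup m ?b = 0" unfolding std_monom_def by (rule spec)
    then show ?thesis
    proof (rule disjE)
      assume 1: "lookup m ?a = 0"
      have "m = rest m + single ?b (lookup m ?b)"
        by (intro poly_mapping_eqI) (auto simp: lookup_add lookup_rest lookup_single when_def 1)
      moreover have "signed_power (k + 1) (sg m) = (mvar ?b ^ lookup m ?b :: (coord, 'c) mpol)"
        using 1 by (simp add: signed_power_def sg_def)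
      ultimately show ?thesis by (simp add: mvar_power mult_single)
    next
      assume 2: "lookup m ?b = 0"
      have "m = rest m + single ?a (lookup m ?a)"
        by (intro poly_mapping_eqI) (auto simp: lookup_add lookup_rest lookup_single when_def 2)
      moreover have "signed_power (k + 1) (sg m) = (mvar ?a ^ lookup m ?a :: (coord, 'c) mpol)"
        using 2 by (simp add: signed_power_def sg_def)
      ultimately show ?thesis by (simp add: mvar_power mult_single)
    qed
  qed
  have Cstd: "C s \<in> std (k + 1) Y" for s
  proof -
    have single_std: "single (rest m) c \<in> std (k + 1) Y" if m: "m \<in> keys Q" for m and c :: 'c
    proof -
      have "std_monom m" "keys m \<subseteq> coords k Y" using m Q by (auto simp: std_def mpols_def)
      have "std_monom (rest m)" unfolding std_monom_def
      proof
        fix i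
        have "lookup m (Xc i) = 0 \<or> lookup m (Xc' i) = 0"
          using \<open>std_monom m\<close> unfolding std_monom_def by (rule spec)
        then show "lookup (rest m) (Xc i) = 0 \<or> lookup (rest m) (Xc' i) = 0" by (simp add: lookup_rest)
      qed
      moreover have "keys (rest m) \<subseteq> coords (k + 1) Y"
      proof
        fix v assume "v \<in> keys (rest m)"
        then have "v \<noteq> ?a" "v \<noteq> ?b" "v \<in> keys m"
          by (simp_all add: in_keys_iff lookup_rest split: if_splits)
        then have "v \<in> coords k Y" "v \<noteq> ?a" "v \<noteq> ?b" using \<open>keys m \<subseteq> coords k Y\<close> by blast+
        then show "v \<in> coords (k + 1) Y" by (cases v) (simp_all add: coords_def image_iff)
      qed
      ultimately show ?thesis using single_in_mpols[of "rest m" "coords (k + 1) Y" c] std_zero[of "k + 1" Y]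
        by (cases "c = 0") (simp_all add: std_def)
    qed
    have sum_std: "sum f B \<in> std (k + 1) Y" if "\<And>m. m \<in> B \<Longrightarrow> f m \<in> std (k + 1) Y" for f :: "_ \<Rightarrow> (coord, 'c) mpol" and B
      using that by (induction B rule: infinite_finite_induct) (auto intro: std_add std_zero)
    show ?thesis unfolding C_def by (rule sum_std, rule single_std) simp
  qed
  have "Q = (\<Sum>m\<in>keys Q. single (rest m) (lookup Q m) * signed_power (k + 1) (sg m))"
    by (subst mpol_expand[of Q]) (simp add: mon)
  also have "\<dots> = (\<Sum>s\<in>sg ` keys Q. \<Sum>m\<in>{m \<in> keys Q. sg m = s}.
      single (rest m) (lookup Q m) * signed_power (k + 1) (sg m))" by (rule sum.group[symmetric]) auto
  also have "\<dots> = (\<Sum>s\<in>sg ` keys Q. C s * signed_power (k + 1) s)"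
    unfolding C_def sum_distrib_right by (intro sum.cong refl) auto
  finally show ?thesis using Cstd by (intro exI[of _ "sg ` keys Q"] exI[of _ C]) auto
qed

text \<open>Downward induction from \<open>k = r\<close>, where only the y remain. For the step,
  expand in signed powers of index \<open>k + 1\<close> and let that coordinate x tend to 0 from the
  right. The matching x' grows like the reciprocal, so the term of least signed exponent dominates,
  and its coefficient vanishes on the boundary, where the induction hypothesis applies.
  \<open>\<eta>0\<close> prescribes y outside \<open>Y\<close>: the value 1 serves trivial
  coefficients, the value 0 the reduction modulo one coefficient.\<close>

lemma std_eq_0_if_vanishing:
  fixes Q :: "(coord, complex) mpol"
  assumes "Y \<subseteq> {1..r}" "\<And>i. \<eta>0 i \<ge> 0" "k \<le> r" "Q \<in> std k Y"
    and "\<And>(\<xi> :: nat \<Rightarrow> real) \<eta>. \<lbrakk>\<And>i. i \<le> k \<Longrightarrow> \<xi> i = 0; \<And>i. i > k \<Longrightarrow> \<xi> i > 0; \<And>i. i \<in> Y \<Longrightarrow> \<eta> i > 0;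
        \<And>i. i \<notin> Y \<Longrightarrow> \<eta> i = \<eta>0 i\<rbrakk> \<Longrightarrow> ceval (\<lambda>v. complex_of_real (lower_point \<xi> \<eta> v)) Q = 0"
  shows "Q = 0"
  using assms(3-5)
proof (induction k arbitrary: Q rule: inc_induct)
  case base
  have QY: "Q \<in> mpols (Yc ` Y)" using base(1) by (simp add: std_def coords_def)
  show ?case
  proof (rule mpols_eq_0_if_vanishing[where h = "\<lambda>c::complex. c" and S = "complex_of_real ` {0<..}" and I = "Yc ` Y"])
    show "infinite (complex_of_real ` {0<..})" by (subst finite_image_iff) (auto simp: inj_on_def infinite_Ioi)
    show "finite (Yc ` Y)" using assms(1) finite_subset by blast
    fix w assume w: "\<And>i. i \<in> Yc ` Y \<Longrightarrow> w i \<in> complex_of_real ` {0<..}"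
    then have w': "w (Yc i) = complex_of_real (Re (w (Yc i)))" "Re (w (Yc i)) > 0" if "i \<in> Y" for i
      using that by fastforce+
    \<comment> \<open>Indices beyond \<open>r\<close> are no coordinates; the value 1 there only
      meets the required positivity.\<close>
    define \<xi> where "\<xi> i = (if i \<le> r then 0 else 1 :: real)" for i
    define \<eta> where "\<eta> i = (if i \<in> Y then Re (w (Yc i)) else \<eta>0 i)" for i
    have "ceval (\<lambda>v. complex_of_real (lower_point \<xi> \<eta> v)) Q = 0"
      by (rule base(2)) (use w' in \<open>auto simp: \<xi>_def \<eta>_def\<close>)
    moreover have "ceval (\<lambda>v. complex_of_real (lower_point \<xi> \<eta> v)) Q = ceval w Q"
      by (rule meval_cong[OF QY]) (auto simp: lower_point_def \<eta>_def w'(1)[symmetric])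
    ultimately show "ceval w Q = 0" by simp
  qed (use QY rhf_id in auto)
next
  case (step k)
  obtain S C where SC: "finite S" "\<And>s. C s \<in> std (k + 1) Y" "Q = (\<Sum>s\<in>S. C s * signed_power (k + 1) s)"
    using std_split[OF step.prems(1) step.hyps(2)] by blast
  have "\<forall>s\<in>S. C s = 0"
  proof (rule ccontr)
    assume "\<not> ?thesis"
    then have ne: "{s \<in> S. C s \<noteq> 0} \<noteq> {}" "finite {s \<in> S. C s \<noteq> 0}" using SC(1) by auto
    define m where "m = Min {s \<in> S. C s \<noteq> 0}"
    have m: "m \<in> S" "C m \<noteq> 0" using Min_in[OF ne(2,1)] by (auto simp: m_def)
    have mmin: "C s = 0" if "s \<in> S" "s < m" for s using Min_le[OF ne(2), of s] that unfolding m_def by force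
    have "C m = 0"
    proof (rule step.IH[of "C m"])
      show "C m \<in> std (Suc k) Y" using SC(2)[of m] by (simp only: Suc_eq_plus1)
      fix \<xi> \<eta> :: "nat \<Rightarrow> real" assume \<xi>: "\<And>i. i \<le> Suc k \<Longrightarrow> \<xi> i = 0" "\<And>i. i > Suc k \<Longrightarrow> \<xi> i > 0"
        and \<eta>: "\<And>i. i \<in> Y \<Longrightarrow> \<eta> i > 0" "\<And>i. i \<notin> Y \<Longrightarrow> \<eta> i = \<eta>0 i"
      let ?\<xi> = "\<lambda>t. \<xi>(k + 1 := t)"
      let ?p = "\<lambda>t v. complex_of_real (lower_point (?\<xi> t) \<eta> v)"
      \<comment> \<open>The numerator of x' for index \<open>k + 1\<close>. It does not depend on
        the small coordinate, and it is positive because \<open>later\<close> involves only positive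
        coordinates, although \<open>earlier\<close> may vanish.\<close>
      define R where "R = \<eta> (k + 1) * earlier \<xi> (k + 1) + later \<xi> (k + 1)"
      have "\<eta> (k + 1) \<ge> 0" using \<eta> assms(2) by (metis less_imp_le)
      moreover have "earlier \<xi> (k + 1) \<ge> 0" unfolding earlier_def
        by (intro prod_nonneg ballI zero_le_power) (use \<xi> in auto)
      moreover have "later \<xi> (k + 1) > 0" unfolding later_def
        by (intro prod_pos ballI zero_less_power) (use \<xi> in auto)
      ultimately have R: "R > 0" unfolding R_def by (simp add: add_nonneg_pos)
      have R': "\<eta> (k + 1) * earlier (?\<xi> t) (k + 1) + later (?\<xi> t) (k + 1) = R" for t
        unfolding R_def by (intro arg_cong2[where f="(+)"] arg_cong2[where f="(*)"] earlier_cong later_cong) auto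
      define \<kappa> where "\<kappa> s = (if s \<ge> 0 then 1 else complex_of_real R ^ nat (- s))" for s :: int
      have sp: "ceval (?p t) (signed_power (k + 1) s) = \<kappa> s * complex_of_real t powi s" if "t > 0" for t s
        using that R'[of t]
        by (auto simp: signed_power_def \<kappa>_def lower_point_def power_int_def power_divide divide_inverse
            power_inverse power_mult_distrib)
      \<comment> \<open>After multiplication by \<open>t\<close> to the power \<open>- m\<close>
        only natural exponents are left, since the coefficients below \<open>m\<close> are 0; so the
        limit at 0 exists termwise.\<close>
      have sum0: "(\<Sum>s\<in>S. ceval (?p t) (C s) * \<kappa> s * complex_of_real t ^ nat (s - m)) = 0" if t: "t > 0" for t
      proof -
        have "0 = ceval (?p t) Q"
          by (rule step.prems(2)[symmetric]) (use \<xi> \<eta> t in \<open>auto simp: less_Suc_eq\<close>)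
        also have "\<dots> = (\<Sum>s\<in>S. ceval (?p t) (C s) * \<kappa> s * complex_of_real t powi s)"
          unfolding SC(3) by (simp add: sp[OF t] mult.assoc)
        finally have "0 = complex_of_real t powi (- m) * (\<Sum>s\<in>S. ceval (?p t) (C s) * \<kappa> s * complex_of_real t powi s)"
          by simp
        also have "\<dots> = (\<Sum>s\<in>S. ceval (?p t) (C s) * \<kappa> s * complex_of_real t ^ nat (s - m))"
          unfolding sum_distrib_left
        proof (rule sum.cong[OF refl])
          fix s assume s: "s \<in> S"
          show "complex_of_real t powi (- m) * (ceval (?p t) (C s) * \<kappa> s * complex_of_real t powi s)
              = ceval (?p t) (C s) * \<kappa> s * complex_of_real t ^ nat (s - m)"
          proof (cases "s < m")
            case True
            then show ?thesis using mmin[OF s] by simp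
          next
            case False
            then have "complex_of_real t ^ nat (s - m) = complex_of_real t powi (- m + s)"
              by (simp add: power_int_def)
            also have "\<dots> = complex_of_real t powi (- m) * complex_of_real t powi s"
              using t by (intro power_int_add) auto
            finally show ?thesis by simp
          qed
        qed
        finally show ?thesis by simp
      qed
      have lim_c: "((\<lambda>t. ceval (?p t) (C s)) \<longlongrightarrow> ceval (?p 0) (C s)) (at_right 0)" for s
      proof -
        have lim_\<xi>: "((\<lambda>t. ?\<xi> t j) \<longlongrightarrow> ?\<xi> 0 j) (at_right 0)" for j
          by (cases "j = k + 1") (auto intro: tendsto_ident_at)
        have lim_p: "((\<lambda>t. ?p t v) \<longlongrightarrow> ?p 0 v) (at_right 0)" if "v \<in> coords (k + 1) Y" for v
        proof (cases v)
          case (Xc' i)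
          then have "i > k + 1" using that by (auto simp: coords_def)
          then have "?\<xi> 0 i \<noteq> 0" using \<xi>(2)[of i] by auto
          then show ?thesis unfolding Xc' lower_point_def earlier_def later_def coord.case
            by (intro tendsto_of_real tendsto_divide tendsto_add tendsto_mult tendsto_const tendsto_prod
                tendsto_power lim_\<xi>)
        qed (use lim_\<xi> in \<open>auto simp: lower_point_def simp del: fun_upd_apply intro!: tendsto_intros\<close>)
        have "keys m \<subseteq> coords (k + 1) Y" if "m \<in> keys (C s)" for m
          using SC(2)[of s] that by (auto simp: std_def mpols_def)
        then show ?thesis unfolding meval_def
          by (intro tendsto_sum tendsto_mult tendsto_const tendsto_prod tendsto_power lim_p) blast
      qed
      have "((\<lambda>t. \<Sum>s\<in>S. ceval (?p t) (C s) * \<kappa> s * complex_of_real t ^ nat (s - m)) \<longlongrightarrow>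
          (\<Sum>s\<in>S. ceval (?p 0) (C s) * \<kappa> s * complex_of_real 0 ^ nat (s - m))) (at_right 0)"
        by (intro tendsto_sum tendsto_mult tendsto_const tendsto_power tendsto_of_real lim_c tendsto_ident_at)
      moreover have "((\<lambda>t. \<Sum>s\<in>S. ceval (?p t) (C s) * \<kappa> s * complex_of_real t ^ nat (s - m)) \<longlongrightarrow> 0) (at_right 0)"
        by (rule tendsto_eventually) (auto simp: eventually_at_filter sum0)
      ultimately have "(\<Sum>s\<in>S. ceval (?p 0) (C s) * \<kappa> s * complex_of_real 0 ^ nat (s - m)) = 0"
        by (rule tendsto_unique[OF trivial_limit_at_right_real])
      also have "(\<Sum>s\<in>S. ceval (?p 0) (C s) * \<kappa> s * complex_of_real 0 ^ nat (s - m))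
          = (\<Sum>s\<in>S. if s = m then ceval (?p 0) (C s) * \<kappa> s else 0)"
        using mmin by (intro sum.cong refl) (auto simp: zero_power not_less)
      also have "\<dots> = ceval (?p 0) (C m) * \<kappa> m" using m SC(1) by simp
      finally have "ceval (?p 0) (C m) = 0" using R by (auto simp: \<kappa>_def split: if_splits)
      moreover have "?\<xi> 0 = \<xi>" using \<xi>(1)[of "Suc k"] by (simp add: fun_eq_iff Suc_eq_plus1)
      ultimately show "ceval (\<lambda>v. complex_of_real (lower_point \<xi> \<eta> v)) (C m) = 0" by simp
    qed
    then show False using m by simp
  qed
  then show ?case unfolding SC(3) by simp
qed

lemma eqn_vanishes:
  assumes "i \<in> {1..r}" "\<xi> i \<noteq> 0" "i \<in> Y \<or> \<eta> i = 1"
  shows "ceval (\<lambda>v. complex_of_real (lower_point \<xi> \<eta> v)) (eqn Y i) = 0"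
proof -
  have "ceval (\<lambda>v. complex_of_real (lower_point \<xi> \<eta> v)) (eqn Y i)
      = complex_of_real (\<xi> i * ((\<eta> i * earlier \<xi> i + later \<xi> i) / \<xi> i) - (\<eta> i * earlier \<xi> i + later \<xi> i))"
    using assms(3) by (auto simp: eqn_def rhs_def earlier_def later_def lower_point_def)
  then show ?thesis using assms(2) by simp
qed

theorem vanishing_on_pos_points:
  fixes P :: "(coord, complex) mpol"
  assumes Y: "Y \<subseteq> {1..r}" and P: "P \<in> mpols (coords 0 Y)"
    and vanish: "\<And>\<xi> \<eta> :: nat \<Rightarrow> real. \<lbrakk>\<And>i. \<xi> i > 0; \<And>i. \<eta> i > 0; \<And>i. i \<notin> Y \<Longrightarrow> \<eta> i = 1\<rbrakk> \<Longrightarrow>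
      ceval (\<lambda>v. complex_of_real (lower_point \<xi> \<eta> v)) P = 0"
  shows "\<exists>G. (\<forall>i. G i \<in> mpols (coords 0 Y)) \<and> P = (\<Sum>i=1..r. G i * eqn Y i)"
proof -
  obtain Q G where Q: "Q \<in> std 0 Y" "\<forall>i. G i \<in> mpols (coords 0 Y)" "P = Q + (\<Sum>i=1..r. G i * eqn Y i)"
    using reducible_all[OF P] unfolding reducible_def by blast
  have "Q = 0"
  proof (rule std_eq_0_if_vanishing[OF Y _ _ Q(1), of "\<lambda>_. 1"])
    fix \<xi> \<eta> :: "nat \<Rightarrow> real" assume *: "\<And>i. i \<le> 0 \<Longrightarrow> \<xi> i = 0" "\<And>i. i > 0 \<Longrightarrow> \<xi> i > 0" "\<And>i. i \<in> Y \<Longrightarrow> \<eta> i > 0"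
        "\<And>i. i \<notin> Y \<Longrightarrow> \<eta> i = (1 :: real)"
    \<comment> \<open>Index 0 is no coordinate, but \<open>vanish\<close> asks for positivity there,
      while the induction leaves the value 0.\<close>
    define \<xi>' where "\<xi>' i = (if i = 0 then 1 else \<xi> i)" for i
    have same: "ceval (\<lambda>v. complex_of_real (lower_point \<xi> \<eta> v)) Q = ceval (\<lambda>v. complex_of_real (lower_point \<xi>' \<eta> v)) Q"
    proof (rule meval_cong[of _ "coords 0 Y"])
      show "Q \<in> mpols (coords 0 Y)" using Q(1) by (simp add: std_def)
      have "earlier \<xi> i = earlier \<xi>' i" "later \<xi> i = later \<xi>' i" for i
        by (rule earlier_cong later_cong; simp add: \<xi>'_def)+
      then show "complex_of_real (lower_point \<xi> \<eta> v) = complex_of_real (lower_point \<xi>' \<eta> v)"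
        if "v \<in> coords 0 Y" for v
        using that by (auto simp: lower_point_def coords_def \<xi>'_def split: coord.splits)
    qed
    have \<xi>': "\<xi>' i > 0" for i using *(2)[of i] by (auto simp: \<xi>'_def)
    have \<eta>: "\<eta> i > 0" for i using *(3,4)[of i] by (cases "i \<in> Y") auto
    have "0 = ceval (\<lambda>v. complex_of_real (lower_point \<xi>' \<eta> v)) P"
      by (rule vanish[symmetric]) (use \<xi>' \<eta> * in auto)
    also have "\<dots> = ceval (\<lambda>v. complex_of_real (lower_point \<xi>' \<eta> v)) Q
        + (\<Sum>i=1..r. ceval (\<lambda>v. complex_of_real (lower_point \<xi>' \<eta> v)) (G i) * 0)"
      unfolding Q(3) meval_id_simps
      by (intro arg_cong2[where f="(+)"] sum.cong refl arg_cong2[where f="(*)"] eqn_vanishes)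
        (use \<xi>' *(4) in \<open>auto simp: less_imp_neq[symmetric] order_less_imp_not_eq2\<close>)
    finally show "ceval (\<lambda>v. complex_of_real (lower_point \<xi> \<eta> v)) Q = 0" using same by simp
  qed auto
  then show ?thesis using Q by (intro exI[of _ G]) simp
qed

end

section \<open>The three seed patterns\<close>

context gcm
begin

lemma prod_B_pos: "k \<in> {1..r} \<Longrightarrow> (\<Prod>i=1..r. f i ^ nat (ppart (B_mat A i k))) = (earlier f k :: 'a::comm_ring_1)"
  and prod_B_neg: "k \<in> {1..r} \<Longrightarrow> (\<Prod>i=1..r. f i ^ nat (ppart (- B_mat A i k))) = (later f k :: 'a::comm_ring_1)"
proof -
  assume k: "k \<in> {1..r}"
  have neg: "A i k \<le> 0" if "i \<in> {1..r}" "i \<noteq> k" for i using A_nonpos[OF that(1) k that(2)] .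
  show "(\<Prod>i=1..r. f i ^ nat (ppart (B_mat A i k))) = earlier f k" unfolding earlier_def
    by (rule prod.mono_neutral_cong_right) (use k neg in \<open>auto simp: B_mat_def ppart_def max_def\<close>)
  show "(\<Prod>i=1..r. f i ^ nat (ppart (- B_mat A i k))) = later f k" unfolding later_def
    by (rule prod.mono_neutral_cong_right) (use k neg in \<open>auto simp: B_mat_def ppart_def max_def\<close>)
qed

lemma prod_W: "(\<Prod>i\<in>W. f i) = (\<Prod>i=1..r. f i) * (\<Prod>i=1..r. f (r + i) :: 'a::comm_ring_1)"
proof -
  have "W = {1..r} \<union> (+) r ` {1..r}" by (auto simp: image_iff)
  then have "(\<Prod>i\<in>W. f i) = (\<Prod>i\<in>{1..r}. f i) * (\<Prod>i\<in>(+) r ` {1..r}. f i)"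
    by (simp only:) (rule prod.union_disjoint; auto)
  then show ?thesis by (subst (asm) prod.reindex) auto
qed

lemma full_rank_unitriangular:
  assumes "\<And>i j. i \<in> {1..r} \<Longrightarrow> j \<in> {1..r} \<Longrightarrow> j < i \<Longrightarrow> m (r + i) j = 0" "\<And>i. i \<in> {1..r} \<Longrightarrow> m (r + i) i = 1"
  shows "full_rank (r + r) r m"
  unfolding full_rank_def
proof (intro allI impI)
  fix d assume d: "\<forall>i\<in>W. (\<Sum>j=1..r. m i j * d j) = 0"
  have "d j = 0" if "j \<in> {1..r}" for j using that
  proof (induction "r - j" arbitrary: j rule: less_induct)
    case less
    have "r + j \<in> W" using less.prems by auto
    then have "0 = (\<Sum>i=1..r. m (r + j) i * d i)" using d by auto
    also have "\<dots> = (\<Sum>i=1..r. if i = j then d i else 0)"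
    proof (rule sum.cong[OF refl])
      fix i assume i: "i \<in> {1..r}"
      consider "i < j" | "i = j" | "i > j" by linarith
      then show "m (r + j) i * d i = (if i = j then d i else 0)"
      proof cases
        case 3
        then have "d i = 0" using less i by auto
        then show ?thesis using 3 by simp
      qed (use assms less.prems i in auto)
    qed
    also have "\<dots> = d j" using less.prems by simp
    finally show ?case by simp
  qed
  then show "\<forall>j\<in>{1..r}. d j = 0" by blast
qed

definition prin_exchange :: "(nat \<Rightarrow> 'a::comm_ring_1) \<Rightarrow> nat \<Rightarrow> 'a" where
  "prin_exchange w k = w (r + k) * earlier w k + later w k"

text \<open>The monomials in the principal coefficients which have exchange matrix \<open>U_mat A\<close>.\<close>

function pvar :: "(nat \<Rightarrow> 'a::comm_ring_1) \<Rightarrow> nat \<Rightarrow> 'a" where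
  "pvar w j = w (r + j) * (\<Prod>i=1..<j. pvar w i ^ c i j)"
  by pat_completeness auto
termination by (relation "measure snd") auto

declare pvar.simps [simp del]

lemma pvar_eq: "pvar w j = w (r + j) * earlier (pvar w) j"
  by (subst pvar.simps) (simp add: earlier_def)

text \<open>The change of frozen variables that turns principal coefficients into BFZ coefficients;
  by \<open>bfz_exchange_bfz_coords\<close> the exchange binomials then agree up to a monomial in
  the coefficients.\<close>

definition bfz_coords :: "(nat \<Rightarrow> 'a::comm_ring_1) \<Rightarrow> nat \<Rightarrow> 'a" where
  "bfz_coords w i = (if i \<le> r then w i else pvar w (i - r))"

lemma pvar_in:
  assumes D: "is_subring D" and w: "\<And>j. j \<in> {1..r} \<Longrightarrow> w (r + j) \<in> D" and i: "i \<in> {1..r}"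
  shows "pvar w i \<in> D"
  using i
proof (induction i rule: less_induct)
  case (less i)
  then show ?case by (subst pvar_eq) (intro sr_mult[OF D] earlier_in[OF D] w; auto)
qed

lemma pvar_neq_0:
  assumes w: "\<And>j. j \<in> {1..r} \<Longrightarrow> w (r + j) \<noteq> (0::'a::idom)" and i: "i \<in> {1..r}"
  shows "pvar w i \<noteq> 0"
  using i
proof (induction i rule: less_induct)
  case (less i)
  then show ?case by (subst pvar_eq) (use w in \<open>auto intro!: earlier_neq_0\<close>)
qed

lemma inverse_earlier: "inverse (earlier v k) = earlier (\<lambda>i. inverse (v i) :: 'a::field) k"
  by (simp add: earlier_def prod_inversef[symmetric] o_def power_inverse)

lemma inverse_pvar_in:
  fixes w :: "nat \<Rightarrow> 'a::field"
  assumes D: "is_subring D" and w: "\<And>j. j \<in> {1..r} \<Longrightarrow> inverse (w (r + j)) \<in> D" and i: "i \<in> {1..r}"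
  shows "inverse (pvar w i) \<in> D"
  using i
proof (induction i rule: less_induct)
  case (less i)
  then show ?case by (subst pvar_eq, unfold inverse_mult_distrib inverse_earlier)
      (intro sr_mult[OF D] earlier_in[OF D] w; auto)
qed

lemma bfz_coords_simps: "i \<in> {1..r} \<Longrightarrow> bfz_coords w i = w i" "i \<in> {1..r} \<Longrightarrow> bfz_coords w (r + i) = pvar w i"
  by (auto simp: bfz_coords_def)

lemma bfz_exchange_bfz_coords:
  assumes k: "k \<in> {1..r}"
  shows "bfz_exchange (bfz_coords w) k = earlier (pvar w) k * prin_exchange w k"
proof -
  have e: "earlier (bfz_coords w) k = earlier w k" "later (bfz_coords w) k = later w k"
    "earlier (\<lambda>j. bfz_coords w (r + j)) k = earlier (pvar w) k"
    using k by (auto simp: bfz_coords_def intro!: earlier_cong later_cong)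
  have "bfz_coords w (r + k) = w (r + k) * earlier (pvar w) k" unfolding bfz_coords_simps(2)[OF k] by (rule pvar_eq)
  then show ?thesis unfolding bfz_exchange_def prin_exchange_def e by (simp add: algebra_simps)
qed

lemma aindep_bfz_coords:
  fixes w :: "nat \<Rightarrow> 'a::field"
  assumes w: "aindep W w"
  shows "aindep W (bfz_coords w)"
  unfolding aindep_def
proof (intro ballI impI)
  fix P :: "(nat, int) mpol" assume P: "P \<in> mpols W" "meval of_int (bfz_coords w) P = 0"
  show "P = 0"
  proof (rule mpols_eq_0_if_vanishing[where h = "of_int :: int \<Rightarrow> real" and S = "{0<..}" and I = W])
    fix \<zeta> :: "nat \<Rightarrow> real" assume \<zeta>: "\<And>i. i \<in> W \<Longrightarrow> \<zeta> i \<in> {0<..}"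
    let ?o = "\<lambda>j. if j \<le> r then \<zeta> j else \<zeta> j / earlier (\<lambda>i. \<zeta> (r + i)) (j - r)"
    obtain f where f: "hom_on (laurent w W {}) f" "\<And>i. i \<in> W \<Longrightarrow> f (w i) = ?o i"
      by (rule specialize[OF w, of "{}" ?o]) auto
    let ?D = "laurent w W {}"
    have D: "is_subring ?D" by (rule laurent_sr)
    have pin: "pvar w i \<in> ?D" if "i \<in> {1..r}" for i by (rule pvar_in[OF D _ that]) (auto intro: laurent_var)
    have fp: "f (pvar w i) = \<zeta> (r + i)" if "i \<in> {1..r}" for i using that
    proof (induction i rule: less_induct)
      case (less i)
      have E: "earlier (pvar w) i \<in> ?D" by (rule earlier_in[OF D pin]) (use less.prems in auto)
      have "f (pvar w i) = f (w (r + i)) * f (earlier (pvar w) i)"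
        by (subst pvar_eq, rule hom_on_mult[OF f(1) _ E]) (use less.prems in \<open>auto intro: laurent_var\<close>)
      also have "f (earlier (pvar w) i) = earlier (\<lambda>j. f (pvar w j)) i"
        by (rule hom_earlier[OF f(1) pin]) (use less.prems in auto)
      also have "\<dots> = earlier (\<lambda>i. \<zeta> (r + i)) i" by (rule earlier_cong) (use less in auto)
      finally have "f (pvar w i) = ?o (r + i) * earlier (\<lambda>i. \<zeta> (r + i)) i"
        using f(2)[of "r + i"] less.prems by simp
      moreover have "earlier (\<lambda>i. \<zeta> (r + i)) i \<noteq> 0"
      proof (rule earlier_neq_0)
        fix j assume "1 \<le> j" "j < i"
        then have "r + j \<in> W" using less.prems by auto
        then show "\<zeta> (r + j) \<noteq> 0" using \<zeta> by fastforce
      qed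
      ultimately show ?case using less.prems by simp
    qed
    have fw: "f (bfz_coords w i) = \<zeta> i" "bfz_coords w i \<in> ?D" if i: "i \<in> W" for i
    proof -
      consider "i \<in> {1..r}" | "i - r \<in> {1..r}" "r + (i - r) = i" "\<not> i \<le> r" using i by force
      then have "f (bfz_coords w i) = \<zeta> i \<and> bfz_coords w i \<in> ?D"
      proof cases
        case 1
        then show ?thesis using f(2)[OF i] laurent_var[OF i, of w "{}"] by (simp add: bfz_coords_def)
      next
        case 2
        then show ?thesis using fp[of "i - r"] pin[of "i - r"] by (simp add: bfz_coords_def)
      qed
      then show "f (bfz_coords w i) = \<zeta> i" "bfz_coords w i \<in> ?D" by auto
    qed
    have "0 = f (meval of_int (bfz_coords w) P)" using P(2) hom_on_zero[OF f(1)] by simp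
    also have "\<dots> = meval of_int (\<lambda>i. f (bfz_coords w i)) P" by (rule hom_on_meval[OF f(1) P(1) fw(2)])
    also have "\<dots> = meval of_int \<zeta> P" by (rule meval_cong[OF P(1) fw(1)])
    finally show "meval of_int \<zeta> P = 0" by simp
  qed (use P rhf_of_int in \<open>auto simp: infinite_Ioi\<close>)
qed

end

lemma (in cluster_pattern) ext_cluster_vars_eq:
  "ext_cluster_vars r l S = {u t i | t i. t \<in> V \<and> i \<in> I}"
proof
  show "ext_cluster_vars r l S \<subseteq> {u t i | t i. t \<in> V \<and> i \<in> I}"
    unfolding ext_cluster_vars_def by (fastforce simp: cluster_eq frozen_eq)
  show "{u t i | t i. t \<in> V \<and> i \<in> I} \<subseteq> ext_cluster_vars r l S"
  proof
    fix x assume "x \<in> {u t i | t i. t \<in> V \<and> i \<in> I}"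
    then obtain t i where ti: "x = u t i" "t \<in> V" "i \<in> I" by auto
    show "x \<in> ext_cluster_vars r l S"
    proof (cases "i \<le> r")
      case True
      then have "i \<in> {1..r}" "x = cluster (S t) i" using ti by (auto simp: cluster_eq)
      then show ?thesis using ti(2) by (auto simp: ext_cluster_vars_def)
    next
      case False
      then have il: "i - r \<in> {1..l}" "r + (i - r) = i" using ti by auto
      then have "x = frozen (S t) (i - r)" unfolding ti(1) frozen_eq[OF il(1)] by simp
      then show ?thesis using ti(2) il(1) unfolding ext_cluster_vars_def by blast
    qed
  qed
qed

lemma ext_var_mem: "cluster_pattern r l F S \<Longrightarrow> t \<in> tree_vertices r \<Longrightarrow> i \<in> {1..r + l} \<Longrightarrow>
    cluster_pattern.u r S t i \<in> ext_ring r l S"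
  by (rule gr_incl) (auto simp: cluster_pattern.ext_cluster_vars_eq)

section \<open>The cluster algebra with BFZ coefficients\<close>

locale bfz_pattern = gcm r A + cluster_pattern r r F S
  for r A and F :: "'f::field_char_0 set" and S +
  fixes t0
  assumes t0: "t0 \<in> tree_vertices r"
    and exmat_t0: "has_exmat r r (S t0) (stack_mat r (B_mat A) (U_mat A))"
begin

lemma b_t0: "i \<in> {1..r} \<Longrightarrow> j \<in> {1..r} \<Longrightarrow> b t0 i j = B_mat A i j"
  "i \<in> {1..r} \<Longrightarrow> j \<in> {1..r} \<Longrightarrow> b t0 (r + i) j = U_mat A i j"
  using exmat_t0 by (auto simp: has_exmat_def stack_mat_def)

lemma full_rank_t0: "full_rank (r + r) r (b t0)"
  by (rule full_rank_unitriangular) (auto simp: b_t0 U_mat_def)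

lemma exchange_t0:
  assumes k: "k \<in> {1..r}"
  shows "u t0 k * u (tree_step k t0) k = bfz_exchange (u t0) k"
proof -
  have neg: "A i k \<le> 0" if "i \<in> {1..r}" "i \<noteq> k" for i using A_nonpos[OF that(1) k that(2)] .
  have B: "(\<Prod>i=1..r. u t0 i ^ nat (ppart (s * b t0 i k))) = (\<Prod>i=1..r. u t0 i ^ nat (ppart (s * B_mat A i k)))" for s
    using k by (intro prod.cong) (auto simp: b_t0)
  have "(\<Prod>i=1..r. u t0 (r + i) ^ nat (ppart (b t0 (r + i) k))) = (\<Prod>i=1..r. if i = k then u t0 (r + i) else 1)"
    using k neg by (intro prod.cong) (auto simp: b_t0 U_mat_def ppart_def)
  then have U1: "(\<Prod>i=1..r. u t0 (r + i) ^ nat (ppart (b t0 (r + i) k))) = u t0 (r + k)" using k by simp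
  have U2: "(\<Prod>i=1..r. u t0 (r + i) ^ nat (ppart (- b t0 (r + i) k))) = earlier (\<lambda>j. u t0 (r + j)) k"
    unfolding earlier_def
    by (rule prod.mono_neutral_cong_right) (use k neg in \<open>auto simp: b_t0 U_mat_def ppart_def\<close>)
  show ?thesis unfolding exchange[OF t0 k] prod_W U1 U2
    using B[of 1] B[of "-1"] prod_B_pos[OF k, of "u t0"] prod_B_neg[OF k, of "u t0"]
    by (simp add: bfz_exchange_def mult.commute)
qed

definition cox :: "nat \<Rightarrow> nat list" where
  "cox k = fold tree_step [1..<Suc k] t0"

lemma cox_0: "cox 0 = t0" and cox_Suc: "cox (Suc k) = tree_step (Suc k) (cox k)"
  by (simp_all add: cox_def upt_Suc One_nat_def)

lemma cox_invariant:
  assumes "k \<le> r"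
  shows "cox k \<in> V \<and> (\<forall>i\<in>{1..k}. u (cox k) i = cox_var (u t0) i) \<and>
    (\<forall>i\<in>W. i > k \<longrightarrow> u (cox k) i = u t0 i) \<and>
    (\<forall>j\<in>{k+1..r}. (\<forall>i\<in>{1..k}. b (cox k) i j = A i j \<and> b (cox k) (r + i) j = 0) \<and>
       (\<forall>i\<in>{k+1..r}. b (cox k) i j = B_mat A i j \<and> b (cox k) (r + i) j = U_mat A i j))"
  using assms
proof (induction k)
  case 0
  then show ?case using t0 by (simp add: cox_0 b_t0)
next
  case (Suc k)
  let ?t = "cox k" and ?k = "Suc k"
  have k: "?k \<in> {1..r}" using Suc.prems by auto
  have IH: "?t \<in> V" "\<And>i. i \<in> {1..k} \<Longrightarrow> u ?t i = cox_var (u t0) i"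
    "\<And>i. i \<in> W \<Longrightarrow> i > k \<Longrightarrow> u ?t i = u t0 i"
    "\<And>i j. j \<in> {k+1..r} \<Longrightarrow> i \<in> {1..k} \<Longrightarrow> b ?t i j = A i j"
    "\<And>i j. j \<in> {k+1..r} \<Longrightarrow> i \<in> {1..k} \<Longrightarrow> b ?t (r + i) j = 0"
    "\<And>i j. j \<in> {k+1..r} \<Longrightarrow> i \<in> {k+1..r} \<Longrightarrow> b ?t i j = B_mat A i j"
    "\<And>i j. j \<in> {k+1..r} \<Longrightarrow> i \<in> {k+1..r} \<Longrightarrow> b ?t (r + i) j = U_mat A i j"
    using Suc by auto
  have kk: "?k \<in> {k+1..r}" using k by auto
  have neg: "A i j \<le> 0" if "i \<in> {1..r}" "j \<in> {1..r}" "i \<noteq> j" for i j using A_nonpos[OF that] .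
  have bk: "b ?t i ?k = (if i = ?k then 0 else A i ?k)" if i: "i \<in> {1..r}" for i
  proof -
    consider "i \<in> {1..k}" | "i \<in> {k+1..r}" using i by fastforce
    then show ?thesis by cases (use IH(4)[OF kk, of i] IH(6)[OF kk, of i] in \<open>auto simp: B_mat_def\<close>)
  qed
  have bfk: "b ?t (r + i) ?k = (if i = ?k then 1 else 0)" if i: "i \<in> {1..r}" for i
  proof -
    consider "i \<in> {1..k}" | "i \<in> {k+1..r}" using i by fastforce
    then show ?thesis by cases (use IH(5)[OF kk, of i] IH(7)[OF kk, of i] in \<open>auto simp: U_mat_def\<close>)
  qed
  have step: "u (cox ?k) i = u ?t i" if "i \<in> W" "i \<noteq> ?k" for i
    unfolding cox_Suc by (rule u_other[OF IH(1) k that])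
  have p1: "(\<Prod>i=1..r. u ?t i ^ nat (ppart (b ?t i ?k))) = 1"
    by (rule prod.neutral) (use bk neg[OF _ k] in \<open>auto simp: ppart_def max_def\<close>)
  have "(\<Prod>i=1..r. u ?t (r + i) ^ nat (ppart (b ?t (r + i) ?k))) = (\<Prod>i=1..r. if i = ?k then u ?t (r + i) else 1)"
    by (rule prod.cong) (use bfk in \<open>auto simp: ppart_def\<close>)
  then have p2: "(\<Prod>i=1..r. u ?t (r + i) ^ nat (ppart (b ?t (r + i) ?k))) = u t0 (r + ?k)"
    using k IH(3)[of "r + ?k"] by simp
  have p4: "(\<Prod>i=1..r. u ?t (r + i) ^ nat (ppart (- b ?t (r + i) ?k))) = 1"
    by (rule prod.neutral) (use bfk in \<open>auto simp: ppart_def\<close>)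
  have "(\<Prod>i=1..r. u ?t i ^ nat (ppart (- b ?t i ?k)))
      = (\<Prod>i\<in>{1..<?k} \<union> {?k+1..r}. u ?t i ^ nat (ppart (- b ?t i ?k)))"
    by (rule prod.mono_neutral_right) (use k bk in \<open>auto simp: ppart_def\<close>)
  also have "\<dots> = (\<Prod>i\<in>{1..<?k}. u ?t i ^ nat (ppart (- b ?t i ?k))) * (\<Prod>i\<in>{?k+1..r}. u ?t i ^ nat (ppart (- b ?t i ?k)))"
    by (rule prod.union_disjoint) auto
  also have "(\<Prod>i\<in>{1..<?k}. u ?t i ^ nat (ppart (- b ?t i ?k))) = earlier (cox_var (u t0)) ?k"
    unfolding earlier_def
    by (rule prod.cong) (use k bk neg[OF _ k] IH(2) in \<open>auto simp: ppart_def max_def\<close>)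
  also have "(\<Prod>i\<in>{?k+1..r}. u ?t i ^ nat (ppart (- b ?t i ?k))) = later (u t0) ?k" unfolding later_def
    by (rule prod.cong) (use k bk neg[OF _ k] IH(3) in \<open>auto simp: ppart_def max_def\<close>)
  finally have p3: "(\<Prod>i=1..r. u ?t i ^ nat (ppart (- b ?t i ?k))) = earlier (cox_var (u t0)) ?k * later (u t0) ?k" .
  have uk: "u ?t ?k = u t0 ?k" by (rule IH(3)) (use k in auto)
  have u0: "u t0 ?k \<noteq> 0" by (rule u_neq_0[OF t0]) (use k in auto)
  have "u t0 ?k * u (cox ?k) ?k = u t0 (r + ?k) + later (u t0) ?k * earlier (cox_var (u t0)) ?k"
    using exchange[OF IH(1) k] unfolding prod_W p1 p2 p3 p4 uk cox_Suc[symmetric] by simp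
  also have "\<dots> = u t0 ?k * cox_var (u t0) ?k" by (rule cox_var_rel[of "u t0", OF u0, symmetric])
  finally have new: "u (cox ?k) ?k = cox_var (u t0) ?k" using u0 by simp
  have mut: "b (cox ?k) i j = mutate_mat ?k (b ?t) i j" if "i \<in> W" "j \<in> {1..r}" for i j
    unfolding cox_Suc by (rule b_step[OF IH(1) k that])
  have row: "b ?t ?k j = - A ?k j" "ppart (b ?t ?k j) = - A ?k j" "ppart (- b ?t ?k j) = 0" if "j \<in> {?k+1..r}" for j
    using IH(6)[of j ?k] neg[of ?k j] that k by (auto simp: B_mat_def ppart_def)
  have m1: "b (cox ?k) i j = (if i = ?k then A ?k j else b ?t i j)" if "i \<in> {1..r}" "j \<in> {?k+1..r}" for i j
    using mut[of i j] row[OF that(2)] bk[OF that(1)] neg[OF that(1) k] that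
    by (auto simp: mutate_mat_def ppart_def max_def)
  have m2: "b (cox ?k) (r + i) j = (if i = ?k then 0 else b ?t (r + i) j)" if "i \<in> {1..r}" "j \<in> {?k+1..r}" for i j
    using mut[of "r + i" j] row[OF that(2)] bfk[OF that(1)] that IH(7)[of j ?k] k
    by (auto simp: mutate_mat_def ppart_def U_mat_def)
  have V: "cox ?k \<in> V" unfolding cox_Suc by (rule tree_step_in_vertices[OF IH(1) k])
  have "\<forall>i\<in>{1..?k}. u (cox ?k) i = cox_var (u t0) i"
  proof
    fix i assume i: "i \<in> {1..?k}"
    show "u (cox ?k) i = cox_var (u t0) i" using new step[of i] IH(2)[of i] i k by (cases "i = ?k") auto
  qed
  moreover have "\<forall>i\<in>W. i > ?k \<longrightarrow> u (cox ?k) i = u t0 i" using step IH(3) by auto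
  moreover have "\<forall>j\<in>{?k+1..r}. (\<forall>i\<in>{1..?k}. b (cox ?k) i j = A i j \<and> b (cox ?k) (r + i) j = 0) \<and>
       (\<forall>i\<in>{?k+1..r}. b (cox ?k) i j = B_mat A i j \<and> b (cox ?k) (r + i) j = U_mat A i j)"
  proof (intro ballI conjI)
    fix j i assume j: "j \<in> {?k+1..r}" and i: "i \<in> {1..?k}"
    then have ir: "i \<in> {1..r}" using k by auto
    show "b (cox ?k) i j = A i j" "b (cox ?k) (r + i) j = 0"
      using m1[OF ir j] m2[OF ir j] IH(4)[of j i] IH(5)[of j i] i j by (cases "i = ?k"; auto)+
  next
    fix j i assume j: "j \<in> {?k+1..r}" and i: "i \<in> {?k+1..r}"
    then have ir: "i \<in> {1..r}" using k by auto
    show "b (cox ?k) i j = B_mat A i j" "b (cox ?k) (r + i) j = U_mat A i j"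
      using m1[OF ir j] m2[OF ir j] IH(6)[of j i] IH(7)[of j i] i j by auto
  qed
  ultimately show ?case using V by blast
qed

lemma coxeter_vertex_cox: "coxeter_vertex r t0 = cox r"
  by (simp add: coxeter_vertex_def cox_def)

lemma coxeter_vertex_in: "coxeter_vertex r t0 \<in> V"
  and cluster_coxeter_vertex: "i \<in> {1..r} \<Longrightarrow> u (coxeter_vertex r t0) i = cox_var (u t0) i"
  using cox_invariant[of r] by (auto simp: coxeter_vertex_cox)

lemma zvar_in_algebra:
  assumes "i \<in> W"
  shows "zvar (u t0) i \<in> ext_ring r r S"
proof (cases "i \<le> r")
  case True
  then show ?thesis using assms t0 cluster_pattern_axioms by (auto simp: zvar_def intro!: ext_var_mem)
next
  case False
  then have "i - r \<in> {1..r}" using assms by auto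
  then have "zvar (u t0) i = u (coxeter_vertex r t0) (i - r)"
    using False by (simp add: zvar_def cluster_coxeter_vertex)
  then show ?thesis using assms coxeter_vertex_in cluster_pattern_axioms False by (auto intro!: ext_var_mem)
qed

theorem algebra_eq: "ext_ring r r S = gen_ring (zvar (u t0) ` W)"
proof
  show "gen_ring (zvar (u t0) ` W) \<subseteq> ext_ring r r S"
    by (rule gen_ring_least[OF gen_ring_sr]) (auto intro: zvar_in_algebra)
  have "u t i \<in> gen_ring (zvar (u t0) ` W)" if t: "t \<in> V" and i: "i \<in> W" for t i
  proof (rule starfish[OF aindep_u[OF t0] cluster_vars_laurent[OF t0 full_rank_t0 t i]])
    fix k assume k: "k \<in> {1..r}"
    have "u t i \<in> Lt (tree_step k t0)"
      using cluster_vars_in_upper_bound[OF t0 full_rank_t0 t i] k by (simp add: upper_bound_def)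
    also have "Lt (tree_step k t0) = laurent ((u t0)(k := bfz_exchange (u t0) k / u t0 k)) W W"
    proof (rule laurent_cong)
      fix i assume i: "i \<in> W"
      have "u t0 k \<noteq> 0" by (rule u_neq_0[OF t0]) (use k in auto)
      then show "u (tree_step k t0) i = ((u t0)(k := bfz_exchange (u t0) k / u t0 k)) i"
        using u_other[OF t0 k i] exchange_t0[OF k] by (auto simp: field_simps)
    qed simp
    finally show "u t i \<in> laurent ((u t0)(k := bfz_exchange (u t0) k / u t0 k)) W W" .
  qed
  then show "ext_ring r r S \<subseteq> gen_ring (zvar (u t0) ` W)"
    by (intro gen_ring_least[OF gen_ring_sr]) (auto simp: ext_cluster_vars_eq)
qed

end

context gcm
begin

lemma hom_lower_point:
  fixes w :: "nat \<Rightarrow> 'a::field" and f :: "'a \<Rightarrow> 'b::field"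
  assumes f: "hom_on D f" and w: "\<And>i. i \<in> {1..r} \<Longrightarrow> w i \<in> D" "\<And>i. i \<in> {1..r} \<Longrightarrow> inverse (w i) \<in> D"
    "\<And>i. i \<in> {1..r} \<Longrightarrow> y i \<in> D" "\<And>i. i \<in> {1..r} \<Longrightarrow> w i \<noteq> 0" "\<And>i. i \<in> {1..r} \<Longrightarrow> f (w i) \<noteq> 0"
    and Y: "Y \<subseteq> {1..r}" and v: "v \<in> coords 0 Y"
  shows "lower_point w y v \<in> D" "f (lower_point w y v) = lower_point (\<lambda>i. f (w i)) (\<lambda>i. f (y i)) v"
proof -
  have D: "is_subring D" by (rule hom_on_subring[OF f])
  have "lower_point w y v \<in> D \<and> f (lower_point w y v) = lower_point (\<lambda>i. f (w i)) (\<lambda>i. f (y i)) v"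
  proof (cases v)
    case (Xc' i)
    then have i: "i \<in> {1..r}" using v by (auto simp: coords_def)
    have E: "earlier w i \<in> D" by (rule earlier_in[OF D]) (use w i in auto)
    have L: "later w i \<in> D" by (rule later_in[OF D]) (use w i in auto)
    let ?x = "(y i * earlier w i + later w i) / w i"
    have x: "?x \<in> D" unfolding divide_inverse by (intro sr_mult[OF D] sr_add[OF D] E L w i)
    have "f (w i) * f ?x = f (w i * ?x)" by (rule hom_on_mult[OF f w(1)[OF i] x, symmetric])
    also have "w i * ?x = y i * earlier w i + later w i" using w(4)[OF i] by simp
    also have "f (y i * earlier w i + later w i) = f (y i) * f (earlier w i) + f (later w i)"
      by (simp add: hom_on_add[OF f] hom_on_mult[OF f] sr_mult[OF D] E L w(3)[OF i])
    also have "f (earlier w i) = earlier (\<lambda>i. f (w i)) i" by (rule hom_earlier[OF f]) (use w i in auto)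
    also have "f (later w i) = later (\<lambda>i. f (w i)) i" by (rule hom_later[OF f]) (use w i in auto)
    finally have "f ?x = (f (y i) * earlier (\<lambda>i. f (w i)) i + later (\<lambda>i. f (w i)) i) / f (w i)"
      using w(5)[OF i] by (simp add: field_simps)
    then show ?thesis using x by (simp add: lower_point_def Xc')
  qed (use v Y w in \<open>auto simp: coords_def lower_point_def\<close>)
  then show "lower_point w y v \<in> D" "f (lower_point w y v) = lower_point (\<lambda>i. f (w i)) (\<lambda>i. f (y i)) v"
    by auto
qed

lemma lower_point_cong:
  assumes v: "v \<in> coords 0 Y" and "\<And>i. i \<in> {1..r} \<Longrightarrow> w i = w' i" "\<And>i. i \<in> {1..r} \<Longrightarrow> y i = y' i"
    and Y: "Y \<subseteq> {1..r}"
  shows "lower_point w y v = lower_point w' y' v"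
proof (cases v)
  case (Xc' i)
  then have i: "i \<in> {1..r}" using v by (auto simp: coords_def)
  have "earlier w i = earlier w' i" "later w i = later w' i" by (rule earlier_cong later_cong; use assms i in auto)+
  then show ?thesis using assms i by (simp add: lower_point_def Xc')
qed (use assms in \<open>auto simp: lower_point_def coords_def\<close>)

lemma lower_point_eqn:
  fixes w :: "nat \<Rightarrow> 'a::field"
  assumes "i \<in> {1..r}" "w i \<noteq> 0" "i \<in> Y \<or> y i = 1"
  shows "meval of_int (lower_point w y) (eqn Y i) = 0"
proof -
  have "meval of_int (lower_point w y) (eqn Y i)
      = w i * ((y i * earlier w i + later w i) / w i) - (y i * earlier w i + later w i)"
    using assms(3) by (auto simp: eqn_def rhs_def earlier_def later_def lower_point_def)
  then show ?thesis using assms(2) by simp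
qed

text \<open>Setting \<open>y q = 0\<close> keeps the standard monomials independent, so divisibility by \<open>y q\<close> in the
  Laurent ring can be tested in the lower bound.\<close>

lemma lower_bound_saturated:
  fixes w :: "nat \<Rightarrow> 'a::field"
  assumes w: "aindep W w" and q: "q \<in> {1..r}" and g: "g \<in> laurent w W {1..r}"
    and gq: "g * w (r + q) \<in> gen_ring (lower_point w (\<lambda>i. w (r + i)) ` coords 0 {1..r})"
  shows "g \<in> gen_ring (lower_point w (\<lambda>i. w (r + i)) ` coords 0 {1..r})"
proof -
  let ?y = "\<lambda>i. w (r + i)"
  let ?g = "lower_point w ?y" and ?K = "coords 0 {1..r}" and ?LR = "laurent w W {1..r}"
  have LR: "is_subring ?LR" by (rule laurent_sr)
  have w0: "w i \<noteq> 0" if "i \<in> {1..r}" for i using aindep_neq_0[OF w, of i] that by auto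
  have y0: "?y i \<noteq> 0" if "i \<in> {1..r}" for i using aindep_neq_0[OF w, of "r + i"] that by auto
  have wLR: "w i \<in> ?LR" "inverse (w i) \<in> ?LR" "?y i \<in> ?LR" if "i \<in> {1..r}" for i
    using that by (auto intro: laurent_var laurent_inverse)
  obtain P where P: "P \<in> mpols ?K" "g * ?y q = meval of_int ?g P" using gq unfolding gen_ring_image_eq by auto
  obtain Q G where Q: "Q \<in> std 0 {1..r}" "P = Q + (\<Sum>i=1..r. G i * eqn {1..r} i)"
    using reducible_all[OF P(1)] unfolding reducible_def by blast
  have "(\<Sum>i=1..r. meval of_int ?g (G i) * meval of_int ?g (eqn {1..r} i)) = 0"
    by (rule sum.neutral) (simp add: lower_point_eqn w0)
  then have gQ: "g * ?y q = meval of_int ?g Q" unfolding P(2) Q(2) by simp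
  \<comment> \<open>\<open>Q0\<close> is the part of \<open>Q\<close> free of y with index
    \<open>q\<close>; the rest is divisible by it. It remains to see that \<open>Q0\<close> is
    0.\<close>
  define Q0 where "Q0 = (\<Sum>m\<in>{m \<in> keys Q. lookup m (Yc q) = 0}.
      single m (lookup Q m))"
  define Q1 where "Q1 = (\<Sum>m\<in>{m \<in> keys Q. lookup m (Yc q) \<noteq> 0}.
      single (m - single (Yc q) 1) (lookup Q m))"
  have QK: "keys m \<subseteq> ?K" "std_monom m" if "m \<in> keys Q" for m
    using Q(1) that by (auto simp: std_def mpols_def)
  have "mvar (Yc q) * Q1 = (\<Sum>m\<in>{m \<in> keys Q. lookup m (Yc q) \<noteq> 0}.
      single m (lookup Q m))" unfolding Q1_def sum_distrib_left
  proof (rule sum.cong[OF refl])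
    fix m assume "m \<in> {m \<in> keys Q. lookup m (Yc q) \<noteq> 0}"
    then have m0: "lookup m (Yc q) \<noteq> 0" by simp
    have "single (Yc q) 1 + (m - single (Yc q) 1) = m"
      by (intro poly_mapping_eqI) (use m0 in \<open>auto simp: lookup_add lookup_minus lookup_single when_def\<close>)
    then show "mvar (Yc q) * single (m - single (Yc q) 1) (lookup Q m)
        = single m (lookup Q m)" by (simp add: mvar_def mult_single)
  qed
  moreover have "(\<Sum>m\<in>keys Q. single m (lookup Q m)) = Q0 +
      (\<Sum>m\<in>{m \<in> keys Q. lookup m (Yc q) \<noteq> 0}.
        single m (lookup Q m))" unfolding Q0_def by (subst sum.union_disjoint[symmetric]) (auto intro!: sum.cong)
  ultimately have Q_split: "Q = Q0 + mvar (Yc q) * Q1" using mpol_expand[of Q] by simp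
  have Q1K: "Q1 \<in> mpols ?K" unfolding Q1_def
  proof (rule mpols_closed(8), rule single_in_mpols)
    fix m assume "m \<in> {m \<in> keys Q. lookup m (Yc q) \<noteq> 0}"
    then show "keys (m - single (Yc q) 1) \<subseteq> ?K"
      using QK(1)[of m] by (auto simp: in_keys_iff lookup_minus subset_iff)
  qed
  let ?h = "of_int :: int \<Rightarrow> complex"
  have Q0_std: "map_coeffs ?h Q0 \<in> std 0 ({1..r} - {q})"
  proof -
    have lookup0: "lookup Q0 m = (if lookup m (Yc q) = 0 then lookup Q m else 0)" for m
      unfolding Q0_def lookup_sum lookup_single when_def by (auto simp: sum.delta' in_keys_iff)
    have "std_monom m \<and> keys m \<subseteq> coords 0 ({1..r} - {q})"
      if m: "m \<in> keys (map_coeffs ?h Q0)" for m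
    proof -
      have m': "lookup m (Yc q) = 0" "m \<in> keys Q"
        using m by (auto simp: in_keys_iff lookup_map_coeffs[OF rhf_of_int] lookup0 split: if_splits)
      have "Yc q \<notin> keys m" using m'(1) by (simp add: in_keys_iff)
      moreover have "?K \<subseteq> insert (Yc q) (coords 0 ({1..r} - {q}))" by (auto simp: coords_def)
      ultimately show ?thesis using QK[OF m'(2)] by blast
    qed
    then show ?thesis by (auto simp: std_def mpols_def)
  qed
  \<comment> \<open>Tested at points where y with index \<open>q\<close> is 0: there
    \<open>g * w (r + q)\<close> specializes to 0, because \<open>g\<close> has no frozen
    denominators.\<close>
  have "map_coeffs ?h Q0 = 0"
  proof (rule std_eq_0_if_vanishing[OF _ _ _ Q0_std, of "\<lambda>_. 0"])
    fix \<xi> \<eta> :: "nat \<Rightarrow> real"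
    assume *: "\<And>i. i \<le> 0 \<Longrightarrow> \<xi> i = 0" "\<And>i. 0 < i \<Longrightarrow> 0 < \<xi> i" "\<And>i. i \<in> {1..r} - {q} \<Longrightarrow> 0 < \<eta> i"
      "\<And>i. i \<notin> {1..r} - {q} \<Longrightarrow> \<eta> i = 0"
    let ?o = "\<lambda>i. if i \<le> r then \<xi> i else \<eta> (i - r)"
    obtain f where f: "hom_on ?LR f" "\<And>i. i \<in> W \<Longrightarrow> f (w i) = ?o i"
    proof (rule specialize[OF w, of "{1..r}" ?o])
      show "?o j \<noteq> 0" if "j \<in> {1..r}" for j using *(2)[of j] that by auto
    qed auto
    have fw: "f (w i) = \<xi> i" "f (?y i) = \<eta> i" if "i \<in> {1..r}" for i
      using f(2)[of i] f(2)[of "r + i"] that by auto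
    have fg: "?g v \<in> ?LR" "f (?g v) = lower_point \<xi> \<eta> v" if v: "v \<in> ?K" for v
    proof -
      have f0: "f (w i) \<noteq> 0" if "i \<in> {1..r}" for i using fw(1)[OF that] *(2)[of i] that by auto
      show "?g v \<in> ?LR" by (rule hom_lower_point(1)[OF f(1) wLR(1,2,3) w0 f0 subset_refl v])
      have "f (?g v) = lower_point (\<lambda>i. f (w i)) (\<lambda>i. f (?y i)) v"
        by (rule hom_lower_point(2)[OF f(1) wLR(1,2,3) w0 f0 subset_refl v])
      also have "\<dots> = lower_point \<xi> \<eta> v" by (rule lower_point_cong[OF v fw subset_refl])
      finally show "f (?g v) = lower_point \<xi> \<eta> v" .
    qed
    have QKm: "Q \<in> mpols ?K" using Q(1) by (simp add: std_def)
    have "meval of_int (lower_point \<xi> \<eta>) Q = meval of_int (\<lambda>v. f (?g v)) Q"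
      by (rule meval_cong[OF QKm fg(2)[symmetric]])
    also have "\<dots> = f (g * ?y q)" unfolding gQ by (rule hom_on_meval[OF f(1) QKm fg(1), symmetric])
    also have "\<dots> = f g * \<eta> q" using fw(2)[OF q] by (simp add: hom_on_mult[OF f(1) g wLR(3)[OF q]])
    also have "\<dots> = 0" using *(4)[of q] by simp
    finally have "meval of_int (lower_point \<xi> \<eta>) Q0 = 0"
      using *(4)[of q] by (simp add: Q_split lower_point_def)
    moreover have "meval ?h (\<lambda>v. complex_of_real (lower_point \<xi> \<eta> v)) Q0 = complex_of_real (meval of_int (lower_point \<xi> \<eta>) Q0)"
      by (simp add: meval_def)
    ultimately show "ceval (\<lambda>v. complex_of_real (lower_point \<xi> \<eta> v)) (map_coeffs ?h Q0) = 0"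
      by (simp add: meval_map_coeffs[OF rhf_of_int rhf_id])
  qed auto
  then have "Q0 = 0" by (metis lookup_map_coeffs[OF rhf_of_int] lookup_zero of_int_eq_0_iff poly_mapping_eqI)
  then have "g * ?y q = meval of_int ?g Q1 * ?y q" unfolding gQ by (simp add: Q_split lower_point_def mult.commute)
  then have "g = meval of_int ?g Q1" using y0[OF q] by simp
  then show ?thesis unfolding gen_ring_image_eq using Q1K by blast
qed

end

section \<open>The cluster algebra with principal coefficients\<close>

locale prin_pattern = gcm r A + cluster_pattern r r F S
  for r A and F :: "'f::field_char_0 set" and S +
  fixes t0
  assumes t0: "t0 \<in> tree_vertices r"
    and exmat_t0: "has_exmat r r (S t0) (stack_mat r (B_mat A) I_mat)"
begin

lemma b_t0: "i \<in> {1..r} \<Longrightarrow> j \<in> {1..r} \<Longrightarrow> b t0 i j = B_mat A i j"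
  "i \<in> {1..r} \<Longrightarrow> j \<in> {1..r} \<Longrightarrow> b t0 (r + i) j = I_mat i j"
  using exmat_t0 by (auto simp: has_exmat_def stack_mat_def)

lemma full_rank_t0: "full_rank (r + r) r (b t0)"
  by (rule full_rank_unitriangular) (auto simp: b_t0 I_mat_def)

lemma exchange_t0:
  assumes k: "k \<in> {1..r}"
  shows "u t0 k * u (tree_step k t0) k = prin_exchange (u t0) k"
proof -
  have B: "(\<Prod>i=1..r. u t0 i ^ nat (ppart (s * b t0 i k))) = (\<Prod>i=1..r. u t0 i ^ nat (ppart (s * B_mat A i k)))" for s
    using k by (intro prod.cong) (auto simp: b_t0)
  have "(\<Prod>i=1..r. u t0 (r + i) ^ nat (ppart (b t0 (r + i) k))) = (\<Prod>i=1..r. if i = k then u t0 (r + i) else 1)"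
    using k by (intro prod.cong) (auto simp: b_t0 I_mat_def ppart_def)
  then have U1: "(\<Prod>i=1..r. u t0 (r + i) ^ nat (ppart (b t0 (r + i) k))) = u t0 (r + k)" using k by simp
  have U2: "(\<Prod>i=1..r. u t0 (r + i) ^ nat (ppart (- b t0 (r + i) k))) = 1"
    by (rule prod.neutral) (use k in \<open>auto simp: b_t0 I_mat_def ppart_def\<close>)
  show ?thesis unfolding exchange[OF t0 k] prod_W U1 U2
    using B[of 1] B[of "-1"] prod_B_pos[OF k, of "u t0"] prod_B_neg[OF k, of "u t0"]
    by (simp add: prin_exchange_def mult.commute)
qed

definition gens :: "coord \<Rightarrow> 'f" where
  "gens = lower_point (u t0) (\<lambda>i. u t0 (r + i))"

lemma gens_simps: "gens (Xc i) = u t0 i" "gens (Yc i) = u t0 (r + i)"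
  "i \<in> {1..r} \<Longrightarrow> gens (Xc' i) = u (tree_step i t0) i"
proof -
  assume i: "i \<in> {1..r}"
  have "u t0 i \<noteq> 0" by (rule u_neq_0[OF t0]) (use i in auto)
  then show "gens (Xc' i) = u (tree_step i t0) i"
    using exchange_t0[OF i] by (simp add: gens_def lower_point_def prin_exchange_def field_simps)
qed (auto simp: gens_def lower_point_def)

text \<open>In the coordinates \<open>bfz_coords\<close> the initial seed behaves like a BFZ seed
  once frozen variables are units. There \<open>starfish\<close> places a cluster variable, times a
  frozen monomial, in the polynomial ring of the Coxeter coordinates. By
  \<open>cox_var_in_lower_bound\<close> it belongs to the ring of the generators \<open>gens\<close>
  with the y inverted, and \<open>lower_bound_saturated\<close> removes these inverses.\<close>

theorem algebra_eq: "ext_ring r r S = gen_ring (gens ` coords 0 {1..r})"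
proof
  let ?w = "u t0" and ?w' = "bfz_coords (u t0)" and ?K = "coords 0 {1..r}"
  let ?L = "gen_ring (gens ` ?K)"
  have w: "aindep W ?w" by (rule aindep_u[OF t0])
  have w': "aindep W ?w'" by (rule aindep_bfz_coords[OF w])
  have w0: "?w i \<noteq> 0" if "i \<in> W" for i by (rule aindep_neq_0[OF w that])
  have w'0: "?w' i \<noteq> 0" if "i \<in> W" for i by (rule aindep_neq_0[OF w' that])
  have wr: "?w i \<noteq> 0" "?w (r + i) \<noteq> 0" if "i \<in> {1..r}" for i using w0[of i] w0[of "r + i"] that by auto
  show "gen_ring (gens ` ?K) \<subseteq> ext_ring r r S"
  proof (rule gen_ring_least[OF gen_ring_sr])
    show "gens ` ?K \<subseteq> ext_ring r r S"
      using ext_var_mem[OF cluster_pattern_axioms] t0 tree_step_in_vertices[OF t0]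
      by (auto simp: coords_def gens_simps)
  qed
  have "u t i \<in> ?L" if t: "t \<in> V" and i: "i \<in> W" for t i
  proof -
    let ?f = "u t i"
    have fLR: "?f \<in> laurent ?w W {1..r}" by (rule cluster_vars_laurent[OF t0 full_rank_t0 t i])
    have Winv: "is_subring (laurent ?w' W W)" by (rule laurent_sr)
    \<comment> \<open>The passage from the y to the monomials \<open>pvar\<close> is unitriangular
      on exponents, so a ring with all \<open>pvar\<close> and their inverses contains all y and
      their inverses.\<close>
    have y_in: "?w (r + j) \<in> D \<and> inverse (?w (r + j)) \<in> D"
      if D: "is_subring D" and D1: "\<And>j. j \<in> {1..r} \<Longrightarrow> ?w' (r + j) \<in> D"
        and D2: "\<And>j. j \<in> {1..r} \<Longrightarrow> inverse (?w' (r + j)) \<in> D"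
        and j: "j \<in> {1..r}" for D j
    proof -
      have pvD: "pvar ?w j \<in> D" "inverse (pvar ?w j) \<in> D" if "j \<in> {1..r}" for j
        using D1[OF that] D2[OF that] by (simp_all add: bfz_coords_simps[OF that])
      have pj: "pvar ?w j = ?w (r + j) * earlier (pvar ?w) j" by (rule pvar_eq)
      have E: "earlier (pvar ?w) j \<noteq> 0" by (rule earlier_neq_0, rule pvar_neq_0) (use wr j in auto)
      have ED: "earlier (pvar ?w) j \<in> D" "inverse (earlier (pvar ?w) j) \<in> D"
        unfolding inverse_earlier by (rule earlier_in[OF D]; use pvD j in auto)+
      have "?w (r + j) = pvar ?w j * inverse (earlier (pvar ?w) j)" using E by (subst pj) simp
      moreover have "inverse (?w (r + j)) = inverse (pvar ?w j) * earlier (pvar ?w) j" using E by (subst pj) simp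
      ultimately show ?thesis using sr_mult[OF D pvD(1)[OF j] ED(2)] sr_mult[OF D pvD(2)[OF j] ED(1)] by simp
    qed
    have "laurent ?w W {1..r} \<subseteq> laurent ?w' W W"
    proof (rule laurent_least[OF Winv])
      fix i assume i: "i \<in> W"
      show "?w i \<in> laurent ?w' W W"
      proof (cases "i \<le> r")
        case True
        then show ?thesis using laurent_var[OF i, of ?w' W] by (simp add: bfz_coords_def)
      next
        case False
        then have ir: "i - r \<in> {1..r}" "r + (i - r) = i" using i by auto
        have "?w (r + (i - r)) \<in> laurent ?w' W W"
        proof (rule y_in[OF Winv _ _ ir(1), THEN conjunct1])
          show "?w' (r + j) \<in> laurent ?w' W W" if "j \<in> {1..r}" for j by (rule laurent_var) (use that in auto)
          show "inverse (?w' (r + j)) \<in> laurent ?w' W W" if "j \<in> {1..r}" for j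
            by (rule laurent_inverse) (use that in auto)
        qed
        then show ?thesis using ir(2) by simp
      qed
    next
      fix j assume j: "j \<in> {1..r}"
      then have "j \<in> W" by auto
      then show "inverse (?w j) \<in> laurent ?w' W W"
        using laurent_inverse[of j W ?w' W] j by (simp add: bfz_coords_def)
    qed
    then have "?f \<in> laurent ?w' W W" using fLR by auto
    then obtain P N where P: "P \<in> mpols W" "?f * (\<Prod>j\<in>W. ?w' j) ^ N = meval of_int ?w' P"
      using laurent_clear[of W W ?w' ?f] w'0 by auto
    \<comment> \<open>A frozen monomial that clears the denominators which
      \<open>laurent ?w' W W\<close> admits but \<open>starfish\<close> does not.\<close>
    define q where "q = (\<Prod>j=1..r. ?w' (r + j)) ^ N"
    define x where "x = (\<Prod>j=1..r. ?w' j)"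
    have x0: "x \<noteq> 0" using w'0 by (auto simp: x_def)
    have "?f * q * x ^ N = meval of_int ?w' P"
      unfolding P(2)[symmetric] prod_W q_def x_def by (simp add: power_mult_distrib mult_ac)
    then have "?f * q = meval of_int ?w' P * inverse x ^ N" using x0 by (simp add: field_simps)
    moreover have "inverse x \<in> laurent ?w' W {1..r}"
      unfolding x_def prod_inversef[symmetric] o_def by (intro lr_closed laurent_inverse)
    ultimately have fq: "?f * q \<in> laurent ?w' W {1..r}"
      by (simp only:) (intro lr_closed(4,7) meval_in_laurent[OF P(1)])
    have "?f * q \<in> gen_ring (zvar ?w' ` W)"
    proof (rule starfish[OF w' fq])
      fix k assume k: "k \<in> {1..r}"
      let ?v = "?w'(k := bfz_exchange ?w' k / ?w' k)"
      let ?D = "laurent ?v W W"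
      have D: "is_subring ?D" by (rule laurent_sr)
      have w'D: "?w' i \<in> ?D" "inverse (?w' i) \<in> ?D" if "i \<in> W" "i \<noteq> k" for i
        using laurent_var[OF that(1), of ?v W] laurent_inverse[OF that(1), of ?v W] that(2) by auto
      have xD: "bfz_exchange ?w' k / ?w' k \<in> ?D" "inverse (bfz_exchange ?w' k / ?w' k) \<in> ?D"
        using laurent_var[of k W ?v W] laurent_inverse[of k W ?v W] k by auto
      have w'rD: "?w' (r + j) \<in> ?D" "inverse (?w' (r + j)) \<in> ?D" if "j \<in> {1..r}" for j
        using w'D[of "r + j"] that k by auto
      have E0: "earlier (pvar ?w) k \<noteq> 0" by (rule earlier_neq_0, rule pvar_neq_0) (use wr k in auto)
      have ED: "earlier (pvar ?w) k \<in> ?D" "inverse (earlier (pvar ?w) k) \<in> ?D"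
      proof -
        have pvD: "pvar ?w j \<in> ?D" "inverse (pvar ?w j) \<in> ?D" if "j \<in> {1..r}" for j
          using w'rD[OF that] by (simp_all add: bfz_coords_simps[OF that])
        show "earlier (pvar ?w) k \<in> ?D" "inverse (earlier (pvar ?w) k) \<in> ?D"
          unfolding inverse_earlier by (rule earlier_in[OF D]; use pvD k in auto)+
      qed
      \<comment> \<open>The mutated variables in the two systems of coordinates differ by the unit
        \<open>earlier (pvar ?w) k\<close>, so membership in the neighbouring Laurent ring carries
        over.\<close>
      have uk: "u (tree_step k t0) k = (bfz_exchange ?w' k / ?w' k) * inverse (earlier (pvar ?w) k)"
        using exchange_t0[OF k] E0 wr(1)[OF k]
        unfolding bfz_exchange_bfz_coords[OF k] bfz_coords_simps(1)[OF k] by (simp add: field_simps)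
      have ukD: "u (tree_step k t0) k \<in> ?D" "inverse (u (tree_step k t0) k) \<in> ?D"
        unfolding uk inverse_mult_distrib inverse_inverse_eq by (intro sr_mult[OF D] xD ED)+
      have uD: "u (tree_step k t0) i \<in> ?D \<and> inverse (u (tree_step k t0) i) \<in> ?D" if i: "i \<in> W" for i
      proof (cases "i = k")
        case False
        show ?thesis
        proof (cases "i \<le> r")
          case True
          then show ?thesis using w'D[OF i False] u_other[OF t0 k i False] by (simp add: bfz_coords_def)
        next
          case F: False
          then have "i - r \<in> {1..r}" "r + (i - r) = i" using i by auto
          then show ?thesis using y_in[OF D w'rD, of "i - r"] u_other[OF t0 k i False] by simp
        qed
      qed (use ukD in simp)
      have "?f \<in> Lt (tree_step k t0)"
        using cluster_vars_in_upper_bound[OF t0 full_rank_t0 t i] k by (simp add: upper_bound_def)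
      also have "\<dots> \<subseteq> ?D" by (rule laurent_least[OF D]) (use uD in auto)
      finally have fD: "?f \<in> ?D" .
      have "q \<in> ?D" unfolding q_def by (intro sr_power[OF D] sr_prod[OF D] w'rD)
      with fD show "?f * q \<in> ?D" by (rule sr_mult[OF D])
    qed
    define D where "D = laurent gens ?K (Yc ` {1..r})"
    have D: "is_subring D" unfolding D_def by (rule laurent_sr)
    have gD: "gens v \<in> D" if "v \<in> ?K" for v unfolding D_def by (rule laurent_var[OF that])
    have wD: "?w i \<in> D" "?w (r + i) \<in> D" "inverse (?w (r + i)) \<in> D" "u (tree_step i t0) i \<in> D" if "i \<in> {1..r}" for i
      using gD[of "Xc i"] gD[of "Yc i"] gD[of "Xc' i"] laurent_inverse[of "Yc i" "Yc ` {1..r}" gens ?K] that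
      by (auto simp: coords_def gens_simps D_def)
    have pD: "pvar ?w i \<in> D" "inverse (pvar ?w i) \<in> D" if "i \<in> {1..r}" for i
      by (rule pvar_in[OF D _ that] inverse_pvar_in[OF D _ that], rule wD, assumption)+
    have w'D: "?w' i \<in> D" if "i \<in> W" for i
    proof (cases "i \<le> r")
      case True
      then show ?thesis using wD(1)[of i] that by (simp add: bfz_coords_def)
    next
      case False
      then have "i - r \<in> {1..r}" using that by auto
      then show ?thesis using pD(1)[of "i - r"] False by (simp add: bfz_coords_def)
    qed
    have cD: "cox_var ?w' j \<in> D" if j: "j \<in> {1..r}" for j
    proof (rule cox_var_in_lower_bound[OF D w'0 w'D _ _ j])
      show "inverse (?w' (r + i)) \<in> D" if "i \<in> {1..r}" for i
        using pD(2)[OF that] by (simp add: bfz_coords_simps[OF that])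
      fix k assume k: "k \<in> {1..r}"
      have "earlier (pvar ?w) k \<in> D" by (rule earlier_in[OF D]) (use pD k in auto)
      moreover have "bfz_exchange ?w' k / ?w' k = earlier (pvar ?w) k * u (tree_step k t0) k"
        using exchange_t0[OF k] wr(1)[OF k]
        unfolding bfz_exchange_bfz_coords[OF k] bfz_coords_simps(1)[OF k] by (simp add: field_simps)
      ultimately show "bfz_exchange ?w' k / ?w' k \<in> D" using sr_mult[OF D _ wD(4)[OF k]] by simp
    qed
    have zD: "zvar ?w' i \<in> D" if "i \<in> W" for i
    proof (cases "i \<le> r")
      case False
      then have "i - r \<in> {1..r}" using that by auto
      then show ?thesis using cD[of "i - r"] False by (simp add: zvar_def)
    qed (use w'D[OF that] in \<open>simp add: zvar_def\<close>)
    have "gen_ring (zvar ?w' ` W) \<subseteq> D" by (rule gen_ring_least[OF D]) (use zD in auto)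
    then have "?f * q \<in> D" using \<open>?f * q \<in> gen_ring (zvar ?w' ` W)\<close> by blast
    moreover have "inverse q \<in> D" unfolding q_def power_inverse[symmetric] prod_inversef[symmetric] o_def
      by (intro sr_power[OF D] sr_prod[OF D]) (simp add: bfz_coords_simps pD)
    ultimately have "?f * q * inverse q \<in> D" by (rule sr_mult[OF D])
    moreover have "q \<noteq> 0" using w'0 by (auto simp: q_def)
    ultimately have "?f \<in> D" by (simp add: mult.assoc)
    have "\<exists>P N. P \<in> mpols ?K \<and> ?f * (\<Prod>j\<in>Yc ` {1..r}. gens j) ^ N = meval of_int gens P"
    proof (rule laurent_clear)
      show "?f \<in> laurent gens ?K (Yc ` {1..r})" using \<open>?f \<in> D\<close> by (simp add: D_def)
      show "gens j \<noteq> 0" if "j \<in> Yc ` {1..r}" for j using that wr by (auto simp: gens_simps)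
    qed (auto simp: coords_def)
    then obtain P N where P: "P \<in> mpols ?K" "?f * (\<Prod>j\<in>Yc ` {1..r}. gens j) ^ N = meval of_int gens P"
      by blast
    have "(\<Prod>j\<in>Yc ` {1..r}. gens j) = (\<Prod>j=1..r. ?w (r + j))"
      by (subst prod.reindex) (auto simp: inj_on_def gens_simps)
    then have "?f * (\<Prod>j=1..r. ?w (r + j)) ^ N \<in> ?L" using P unfolding gen_ring_image_eq by auto
    moreover have "?f \<in> ?L" if "?f * (\<Prod>j\<in>J. ?w (r + j)) ^ N \<in> ?L" "finite J" "J \<subseteq> {1..r}" for J
      using that(2,1,3)
    proof (induction J rule: finite_induct)
      case (insert q J)
      have q: "q \<in> {1..r}" and J: "J \<subseteq> {1..r}" using insert by auto
      define g where "g = ?f * (\<Prod>j\<in>J. ?w (r + j)) ^ N"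
      have g: "g * ?w (r + q) ^ N \<in> ?L" using insert by (simp add: g_def power_mult_distrib mult_ac)
      have gLR: "g * ?w (r + q) ^ n \<in> laurent ?w W {1..r}" for n
        unfolding g_def by (intro lr_closed fLR laurent_var) (use J q in auto)
      have "g * ?w (r + q) ^ n \<in> ?L \<Longrightarrow> g \<in> ?L" for n
      proof (induction n)
        case (Suc n)
        have "g * ?w (r + q) ^ n * ?w (r + q) \<in> ?L" using Suc.prems by (simp add: mult_ac)
        then have "g * ?w (r + q) ^ n \<in> ?L" using lower_bound_saturated[OF w q gLR] by (simp add: gens_def)
        then show ?case by (rule Suc.IH)
      qed simp
      then have "g \<in> ?L" using g by blast
      then show ?case using insert J by (auto simp: g_def)
    qed simp
    ultimately show ?thesis by blast
  qed
  then show "ext_ring r r S \<subseteq> gen_ring (gens ` ?K)"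
    by (intro gen_ring_least[OF gen_ring_sr]) (auto simp: ext_cluster_vars_eq)
qed

end

lemma hom_on_gen_ring:
  assumes f: "hom_on D f" and G: "G \<subseteq> D"
  shows "f ` gen_ring G = gen_ring (f ` G)"
proof -
  have 1: "gen_ring G = {meval of_int (\<lambda>x. x) P | P. P \<in> mpols G}"
    using gen_ring_image_eq[of "\<lambda>x. x" G] by simp
  have 2: "f (meval of_int (\<lambda>x. x) P) = meval of_int f P" if "P \<in> mpols G" for P
    by (rule hom_on_meval[OF f that]) (use G in auto)
  show ?thesis unfolding 1 gen_ring_image_eq by (auto simp: 2 intro!: imageI) (metis (mono_tags, lifting) 2 image_eqI mem_Collect_eq)
qed

text \<open>Setting frozen variables to 1 makes sense on all cluster variables through their Laurent
  expansions in the full rank pattern. It respects exchange relations and the cluster rows of the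
  matrices, so induction over the tree carries one pattern to the other; the new variable is
  determined because the exchanged variable of the target is not 0.\<close>

lemma specialize_frozen:
  assumes P: "cluster_pattern r l F S" and T: "cluster_pattern r 0 F' S'"
    and t0: "t0 \<in> tree_vertices r" and fr: "full_rank (r + l) r (exmat (S t0))"
    and eq: "\<And>i j. i \<in> {1..r} \<Longrightarrow> j \<in> {1..r} \<Longrightarrow> exmat (S t0) i j = exmat (S' t0) i j"
  obtains sp where "hom_on (laurent (cluster_pattern.u r S t0) {1..r + l} {1..r}) sp"
    "\<And>i. i \<in> {1..l} \<Longrightarrow> sp (cluster_pattern.u r S t0 (r + i)) = 1"
    "\<And>t i. t \<in> tree_vertices r \<Longrightarrow> i \<in> {1..r} \<Longrightarrow>
       sp (cluster_pattern.u r S t i) = cluster_pattern.u r S' t i" "sp ` ext_ring r l S = ext_ring r 0 S'"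
proof -
  interpret P: cluster_pattern r l F S by (rule P)
  interpret T: cluster_pattern r 0 F' S' by (rule T)
  let ?D = "laurent (P.u t0) {1..r + l} {1..r}"
  have T0: "T.u t i \<noteq> 0" if "t \<in> tree_vertices r" "i \<in> {1..r}" for t i
    by (rule T.u_neq_0) (use that in auto)
  obtain sp where sp: "hom_on ?D sp"
    "\<And>i. i \<in> {1..r + l} \<Longrightarrow> sp (P.u t0 i) = (if i \<le> r then T.u t0 i else 1)"
  proof (rule specialize[OF P.aindep_u[OF t0], of "{1..r}" "\<lambda>i. if i \<le> r then T.u t0 i else 1"])
    show "(if j \<le> r then T.u t0 j else 1) \<noteq> 0" if "j \<in> {1..r}" for j using T0[OF t0 that] by simp
  qed auto
  have uD: "P.u t i \<in> ?D" if "t \<in> tree_vertices r" "i \<in> {1..r + l}" for t i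
    by (rule P.cluster_vars_laurent[OF t0 fr that])
  have frozen: "sp (P.u t i) = 1" if "t \<in> tree_vertices r" "i \<in> {1..r + l}" "i > r" for t i
    using P.frozen_const[OF t0 that] sp(2)[OF that(2)] that(3) by simp
  have main: "(\<forall>i\<in>{1..r}. sp (P.u t i) = T.u t i) \<and>
      (\<forall>i\<in>{1..r}. \<forall>j\<in>{1..r}. exmat (S t) i j = exmat (S' t) i j)" if "t \<in> tree_vertices r" for t
    using that t0
  proof (induction t rule: tree_vertices_induct)
    case base
    then show ?case using sp(2) eq by auto
  next
    case (step t k)
    note t = step(1) and k = step(2)
    have IH: "sp (P.u t i) = T.u t i" "j \<in> {1..r} \<Longrightarrow> exmat (S t) i j = exmat (S' t) i j"
      if "i \<in> {1..r}" for i j using step(3) that by auto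
    have t': "tree_step k t \<in> tree_vertices r" by (rule tree_step_in_vertices[OF t k])
    have M: "sp (\<Prod>i\<in>{1..r + l}. P.u t i ^ nat (ppart (s * exmat (S t) i k))) =
        (\<Prod>i\<in>{1..r + 0}. T.u t i ^ nat (ppart (s * exmat (S' t) i k)))" for s
    proof -
      have "sp (\<Prod>i\<in>{1..r + l}. P.u t i ^ nat (ppart (s * exmat (S t) i k))) =
          (\<Prod>i\<in>{1..r + l}. sp (P.u t i) ^ nat (ppart (s * exmat (S t) i k)))"
        by (subst hom_on_prod[OF sp(1)]) (auto intro!: prod.cong lr_closed(7) uD[OF t] hom_on_power[OF sp(1)])
      also have "\<dots> = (\<Prod>i\<in>{1..r}. sp (P.u t i) ^ nat (ppart (s * exmat (S t) i k)))"
        by (rule prod.mono_neutral_right) (auto simp: frozen[OF t])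
      also have "\<dots> = (\<Prod>i\<in>{1..r + 0}. T.u t i ^ nat (ppart (s * exmat (S' t) i k)))"
        using k by (intro prod.cong) (auto simp: IH)
      finally show ?thesis .
    qed
    have MD: "(\<Prod>i\<in>{1..r + l}. P.u t i ^ nat (ppart (s * exmat (S t) i k))) \<in> ?D" for s
      by (intro lr_closed(7,9) uD[OF t])
    have kI: "k \<in> {1..r + l}" "k \<in> {1..r + 0}" using k by auto
    have "sp (P.u t k) * sp (P.u (tree_step k t) k) = sp (P.u t k * P.u (tree_step k t) k)"
      by (rule hom_on_mult[OF sp(1) uD[OF t kI(1)] uD[OF t' kI(1)], symmetric])
    also have "\<dots> = T.u t k * T.u (tree_step k t) k" unfolding P.exchange[OF t k] T.exchange[OF t k]
      using M[of 1] M[of "-1"] MD[of 1] MD[of "-1"] by (simp add: hom_on_add[OF sp(1)])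
    finally have "sp (P.u (tree_step k t) k) = T.u (tree_step k t) k" using IH(1)[OF k] T0[OF t k] by simp
    moreover have "sp (P.u (tree_step k t) i) = T.u (tree_step k t) i" if "i \<in> {1..r}" "i \<noteq> k" for i
      using P.u_other[OF t k, of i] T.u_other[OF t k, of i] that IH(1)[OF that(1)] by simp
    moreover have "exmat (S (tree_step k t)) i j = exmat (S' (tree_step k t)) i j"
      if "i \<in> {1..r}" "j \<in> {1..r}" for i j
      using P.b_step[OF t k, of i j] T.b_step[OF t k, of i j] that k by (simp add: mutate_mat_def IH)
    ultimately show ?case by blast
  qed
  have ext: "ext_cluster_vars r l S \<subseteq> ?D" unfolding P.ext_cluster_vars_eq using uD by auto
  have "sp ` ext_ring r l S = gen_ring (sp ` ext_cluster_vars r l S)" by (rule hom_on_gen_ring[OF sp(1) ext])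
  also have "\<dots> = ext_ring r 0 S'"
  proof
    have "sp (P.u t i) \<in> ext_ring r 0 S'" if t: "t \<in> tree_vertices r" and i: "i \<in> {1..r + l}" for t i
    proof (cases "i \<le> r")
      case True
      then have "sp (P.u t i) = T.u t i" using main[OF t] i by auto
      moreover have "T.u t i \<in> ext_ring r 0 S'" by (rule ext_var_mem[OF T t]) (use i True in auto)
      ultimately show ?thesis by simp
    next
      case False
      then show ?thesis using frozen[OF t i] by (simp add: gr_closed(1))
    qed
    then show "gen_ring (sp ` ext_cluster_vars r l S) \<subseteq> ext_ring r 0 S'"
      by (intro gen_ring_least[OF gen_ring_sr]) (auto simp: P.ext_cluster_vars_eq)
    have "T.u t i \<in> sp ` ext_cluster_vars r l S" if t: "t \<in> tree_vertices r" and i: "i \<in> {1..r + 0}" for t i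
    proof (rule image_eqI)
      show "T.u t i = sp (P.u t i)" using main[OF t] i by auto
      show "P.u t i \<in> ext_cluster_vars r l S" unfolding P.ext_cluster_vars_eq
        by (intro CollectI exI[of _ t] exI[of _ i]) (use t i in auto)
    qed
    then show "ext_ring r 0 S' \<subseteq> gen_ring (sp ` ext_cluster_vars r l S)"
      unfolding T.ext_cluster_vars_eq by (intro gen_ring_mono) auto
  qed
  finally show ?thesis using that[of sp] sp(1) frozen[OF t0] main by auto
qed

lemma (in gcm) cox_var_cong:
  assumes "\<And>j. j \<in> W \<Longrightarrow> w j = w' j" "i \<in> {1..r}"
  shows "cox_var w i = cox_var w' i"
  using assms(2)
proof (induction i rule: less_induct)
  case (less i)
  have "(\<Prod>j=1..<i. cox_var w j ^ c j i) = (\<Prod>j=1..<i. cox_var w' j ^ c j i)"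
    by (intro prod.cong refl) (use less in auto)
  moreover have "later w i = later w' i" by (rule later_cong) (use assms(1) less.prems in auto)
  moreover have "w i = w' i" "w (r + i) = w' (r + i)" using assms(1)[of i] assms(1)[of "r + i"] less.prems by auto
  ultimately show ?case by (subst (1 2) cox_var.simps) (simp only:)
qed

locale triv_pattern = gcm r A + cluster_pattern r 0 F S
  for r A and F :: "'f::field_char_0 set" and S +
  fixes t0
  assumes t0: "t0 \<in> tree_vertices r" and exmat_t0: "has_exmat r 0 (S t0) (B_mat A)"
begin

text \<open>The initial cluster completed by frozen values 1, so that \<open>cox_var\<close> and
  \<open>zvar\<close> apply to trivial coefficients as they stand.\<close>

definition u1 :: "nat \<Rightarrow> 'f" where
  "u1 i = (if i \<le> r then u t0 i else 1)"

lemma u1_simps: "i \<in> {1..r} \<Longrightarrow> u1 i = u t0 i" "i \<in> {1..r} \<Longrightarrow> u1 (r + i) = 1"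
  "i \<in> W \<Longrightarrow> u1 i \<noteq> 0"
  using u_neq_0[OF t0, of i] by (auto simp: u1_def)

lemma algebra_eq_bfz:
  assumes "bfz_pattern r A F' S' t0"
  shows "ext_ring r 0 S = gen_ring (zvar u1 ` W)"
    "\<And>i. i \<in> {1..r} \<Longrightarrow> zvar u1 (r + i) = u (coxeter_vertex r t0) i"
proof -
  interpret B: bfz_pattern r A F' S' t0 by fact
  obtain sp where sp: "hom_on (laurent (B.u t0) {1..r + r} {1..r}) sp"
    "\<And>i. i \<in> {1..r} \<Longrightarrow> sp (B.u t0 (r + i)) = 1"
    "\<And>t i. t \<in> tree_vertices r \<Longrightarrow> i \<in> {1..r} \<Longrightarrow> sp (B.u t i) = u t i"
    "sp ` ext_ring r r S' = ext_ring r 0 S"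
  proof (rule specialize_frozen[OF B.cluster_pattern_axioms cluster_pattern_axioms t0 B.full_rank_t0])
    show "exmat (S' t0) i j = exmat (S t0) i j" if "i \<in> {1..r}" "j \<in> {1..r}" for i j
      using exmat_t0 B.b_t0[of i j] that by (auto simp: has_exmat_def)
  qed (rule that)
  have B0: "B.u t0 i \<noteq> 0" if "i \<in> {1..r}" for i by (rule B.u_neq_0[OF t0]) (use that in auto)
  have spB: "sp (B.u t0 i) = u1 i" if "i \<in> W" for i
  proof (cases "i \<le> r")
    case True
    then show ?thesis using sp(3)[OF t0, of i] that by (simp add: u1_def)
  next
    case False
    then have "i - r \<in> {1..r}" using that by auto
    then show ?thesis using sp(2)[of "i - r"] False by (simp add: u1_def)
  qed
  have spB0: "sp (B.u t0 i) \<noteq> 0" if "i \<in> {1..r}" for i using spB[of i] u1_simps(3)[of i] that by auto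
  have cox: "sp (cox_var (B.u t0) i) = cox_var u1 i" if "i \<in> {1..r}" for i
  proof -
    have "sp (cox_var (B.u t0) i) = cox_var (\<lambda>j. sp (B.u t0 j)) i"
      by (rule hom_cox_var[OF sp(1) B0 spB0 that])
    also have "\<dots> = cox_var u1 i" by (rule cox_var_cong[OF _ that]) (rule spB)
    finally show ?thesis .
  qed
  show "zvar u1 (r + i) = u (coxeter_vertex r t0) i" if "i \<in> {1..r}" for i
    using cox[OF that] B.cluster_coxeter_vertex[OF that] sp(3)[OF B.coxeter_vertex_in that]
    by (simp only: zvar_simps that)
  have z: "sp (zvar (B.u t0) i) = zvar u1 i" if "i \<in> W" for i
  proof (cases "i \<le> r")
    case False
    then have "i - r \<in> {1..r}" using that by auto
    then show ?thesis using cox[of "i - r"] False by (simp add: zvar_def)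
  qed (use spB[OF that] in \<open>simp add: zvar_def\<close>)
  have "ext_ring r 0 S = sp ` gen_ring (zvar (B.u t0) ` W)" unfolding sp(4)[symmetric] B.algebra_eq ..
  also have "\<dots> = gen_ring (sp ` zvar (B.u t0) ` W)"
  proof (rule hom_on_gen_ring[OF sp(1)])
    have "zvar (B.u t0) i \<in> laurent (B.u t0) W {1..r}" if "i \<in> W" for i using that unfolding zvar_def
      by (auto intro!: laurent_var laurent_inverse cox_var_in[OF laurent_sr])
    then show "zvar (B.u t0) ` W \<subseteq> laurent (B.u t0) {1..r + r} {1..r}" by auto
  qed
  also have "sp ` zvar (B.u t0) ` W = zvar u1 ` W" unfolding image_image by (rule image_cong[OF refl z])
  finally show "ext_ring r 0 S = gen_ring (zvar u1 ` W)" .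
qed

lemma algebra_eq_prin:
  assumes "prin_pattern r A F' S' t0"
  shows "ext_ring r 0 S = gen_ring (lower_point (u t0) (\<lambda>_. 1) ` coords 0 {})"
    "\<And>i. i \<in> {1..r} \<Longrightarrow> lower_point (u t0) (\<lambda>_. 1) (Xc' i) = u (tree_step i t0) i"
proof -
  interpret B: prin_pattern r A F' S' t0 by fact
  obtain sp where sp: "hom_on (laurent (B.u t0) {1..r + r} {1..r}) sp"
    "\<And>i. i \<in> {1..r} \<Longrightarrow> sp (B.u t0 (r + i)) = 1"
    "\<And>t i. t \<in> tree_vertices r \<Longrightarrow> i \<in> {1..r} \<Longrightarrow> sp (B.u t i) = u t i"
    "sp ` ext_ring r r S' = ext_ring r 0 S"
  proof (rule specialize_frozen[OF B.cluster_pattern_axioms cluster_pattern_axioms t0 B.full_rank_t0])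
    show "exmat (S' t0) i j = exmat (S t0) i j" if "i \<in> {1..r}" "j \<in> {1..r}" for i j
      using exmat_t0 B.b_t0[of i j] that by (auto simp: has_exmat_def)
  qed (rule that)
  let ?g = "lower_point (u t0) (\<lambda>_. 1)" and ?K = "coords 0 {1..r}" and ?D = "laurent (B.u t0) {1..r + r} {1..r}"
  have B0: "B.u t0 i \<noteq> 0" if "i \<in> {1..r}" for i by (rule B.u_neq_0[OF t0]) (use that in auto)
  have u0: "u t0 i \<noteq> 0" if "i \<in> {1..r}" for i by (rule u_neq_0[OF t0]) (use that in auto)
  have spB: "sp (B.u t0 i) = u t0 i" if "i \<in> {1..r}" for i by (rule sp(3)[OF t0 that])
  have spB0: "sp (B.u t0 i) \<noteq> 0" if "i \<in> {1..r}" for i using spB[OF that] u0[OF that] by simp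
  have BD: "B.u t0 i \<in> ?D" "inverse (B.u t0 i) \<in> ?D" "B.u t0 (r + i) \<in> ?D" if "i \<in> {1..r}" for i
    using that by (auto intro: laurent_var laurent_inverse)
  have g: "B.gens v \<in> ?D" "sp (B.gens v) = ?g v" if v: "v \<in> ?K" for v
  proof -
    show "B.gens v \<in> ?D" unfolding B.gens_def by (rule hom_lower_point(1)[OF sp(1) BD B0 spB0 subset_refl v])
    have "sp (B.gens v) = lower_point (\<lambda>i. sp (B.u t0 i)) (\<lambda>i. sp (B.u t0 (r + i))) v"
      unfolding B.gens_def by (rule hom_lower_point(2)[OF sp(1) BD B0 spB0 subset_refl v])
    also have "\<dots> = ?g v" by (rule lower_point_cong[OF v spB sp(2) subset_refl])
    finally show "sp (B.gens v) = ?g v" .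
  qed
  show "?g (Xc' i) = u (tree_step i t0) i" if "i \<in> {1..r}" for i
    using g(2)[of "Xc' i"] sp(3)[OF tree_step_in_vertices[OF t0 that] that] that
    by (simp add: B.gens_simps coords_def)
  have "ext_ring r 0 S = sp ` gen_ring (B.gens ` ?K)" unfolding sp(4)[symmetric] B.algebra_eq ..
  also have "\<dots> = gen_ring (sp ` B.gens ` ?K)" by (rule hom_on_gen_ring[OF sp(1)]) (use g(1) in auto)
  also have "sp ` B.gens ` ?K = ?g ` ?K" unfolding image_image by (rule image_cong[OF refl g(2)])
  also have "gen_ring (?g ` ?K) = gen_ring (?g ` coords 0 {})"
  proof
    have "?g v \<in> gen_ring (?g ` coords 0 {})" if "v \<in> ?K" for v
    proof (cases "v \<in> coords 0 {}")
      case True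
      then show ?thesis by (intro gr_incl imageI)
    next
      case False
      then show ?thesis using that by (auto simp: coords_def lower_point_def gr_closed(1))
    qed
    then show "gen_ring (?g ` ?K) \<subseteq> gen_ring (?g ` coords 0 {})"
      by (intro gen_ring_least[OF gen_ring_sr]) auto
    show "gen_ring (?g ` coords 0 {}) \<subseteq> gen_ring (?g ` ?K)" by (rule gen_ring_mono) (auto simp: coords_def)
  qed
  finally show "ext_ring r 0 S = gen_ring (?g ` coords 0 {})" .
qed

end

section \<open>Substitution of polynomials and explicit ideals\<close>

lemma is_subring_UNIV: "is_subring UNIV"
  by (simp add: is_subring_def)

lemma rhf_mconst: "rh_fun (mconst :: 'c::comm_ring_1 \<Rightarrow> ('v, 'c) mpol)"
  by (simp add: rh_fun_def mconst_def single_add mult_single)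

lemmas meval_mconst_simps [simp] = meval_simps[OF rhf_mconst]

lemma mconst_of_int: "mconst (of_int n) = (of_int n :: ('v, 'c::comm_ring_1) mpol)"
proof -
  have "hom_on UNIV (mconst :: 'c \<Rightarrow> ('v, 'c) mpol)"
    using rhf_mconst[where 'c = 'c and 'v = 'v] by (simp add: hom_on_def rh_fun_def is_subring_UNIV)
  then show ?thesis by (rule hom_on_of_int)
qed

lemma hom_on_meval_UNIV:
  assumes h: "rh_fun h"
  shows "hom_on UNIV (meval h w)"
  by (simp add: hom_on_def is_subring_UNIV meval_simps[OF h])

lemma meval_meval:
  assumes h: "rh_fun h"
  shows "meval h w (meval mconst s P) = meval h (\<lambda>i. meval h w (s i)) P"
proof (induction P rule: mpol_induct)
  case (single m c)
  have "meval h w (mconst c * monom_val s m) = h c * monom_val (\<lambda>i. meval h w (s i)) m"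
    by (simp add: monom_val_def meval_simps[OF h])
  then show ?case by (simp add: meval_single[OF rhf_mconst] meval_single[OF h])
qed (simp_all add: meval_simps[OF h])

lemma meval_mvar_self: "meval mconst mvar P = (P :: ('v, 'c::comm_ring_1) mpol)"
proof (induction P rule: mpol_induct)
  case (single m c)
  have "monom_val mvar m = (single m 1 :: ('v, 'c) mpol)"
  proof (induction m rule: mpol_induct)
    case (single i n)
    then show ?case by (simp add: mvar_power)
  qed (simp_all add: monom_val_add mult_single)
  then show ?case by (simp only: meval_single[OF rhf_mconst]) (simp add: mconst_def mult_single)
qed simp_all

lemma meval_mconst_in:
  assumes "P \<in> mpols I" "\<And>i. i \<in> I \<Longrightarrow> s i \<in> mpols K"
  shows "meval mconst s P \<in> mpols K"
  by (rule meval_in_subring[OF mpols_sr assms(1)]) (use assms in auto)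

lemma map_coeffs_meval:
  fixes h :: "int \<Rightarrow> 'c::comm_ring_1"
  assumes h: "h = of_int"
  shows "map_coeffs h (meval of_int s P) = meval mconst (\<lambda>i. map_coeffs h (s i)) (map_coeffs h P)"
proof -
  have rh: "rh_fun h" unfolding h by (rule rhf_of_int)
  obtain I where P: "P \<in> mpols I" using that[of UNIV] by (auto simp: mpols_def)
  have "map_coeffs h (meval of_int s P) = meval of_int (\<lambda>i. map_coeffs h (s i)) P"
    by (rule hom_on_meval[OF hom_on_map_coeffs[OF rh] P]) simp
  also have "\<dots> = meval mconst (\<lambda>i. map_coeffs h (s i)) (map_coeffs h P)"
    unfolding meval_map_coeffs[OF rh rhf_mconst] by (simp add: h mconst_of_int)
  finally show ?thesis .
qed

text \<open>For a subring \<open>M\<close> that contains the \<open>E i\<close>, the ideal generated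
  by them in \<open>M\<close>, with explicit coefficients so that it can be mapped along
  homomorphisms.\<close>

definition lincomb :: "'a::comm_ring_1 set \<Rightarrow> nat \<Rightarrow> (nat \<Rightarrow> 'a) \<Rightarrow> 'a set" where
  "lincomb M n E = {\<Sum>i=1..n. H i * E i | H. \<forall>i. H i \<in> M}"

context
  fixes M :: "'a::comm_ring_1 set" and n :: nat and E :: "nat \<Rightarrow> 'a"
  assumes M: "is_subring M"
begin

lemma lincomb_zero: "0 \<in> lincomb M n E"
  unfolding lincomb_def by (rule CollectI, rule exI[of _ "\<lambda>_. 0"]) (simp add: sr_zero[OF M])

lemma lincomb_add: "a \<in> lincomb M n E \<Longrightarrow> b \<in> lincomb M n E \<Longrightarrow> a + b \<in> lincomb M n E"
proof -
  assume "a \<in> lincomb M n E" "b \<in> lincomb M n E"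
  then obtain H H' where "\<And>i. H i \<in> M" "a = (\<Sum>i=1..n. H i * E i)" "\<And>i. H' i \<in> M" "b = (\<Sum>i=1..n. H' i * E i)"
    unfolding lincomb_def by auto
  then show "a + b \<in> lincomb M n E" unfolding lincomb_def
    by (intro CollectI exI[of _ "\<lambda>i. H i + H' i"]) (simp add: sr_add[OF M] sum.distrib algebra_simps)
qed

lemma lincomb_mult: "a \<in> M \<Longrightarrow> b \<in> lincomb M n E \<Longrightarrow> a * b \<in> lincomb M n E"
proof -
  assume a: "a \<in> M" and "b \<in> lincomb M n E"
  then obtain H where "\<And>i. H i \<in> M" "b = (\<Sum>i=1..n. H i * E i)" unfolding lincomb_def by auto
  then show "a * b \<in> lincomb M n E" unfolding lincomb_def using a
    by (intro CollectI exI[of _ "\<lambda>i. a * H i"]) (simp add: sr_mult[OF M] sum_distrib_left mult.assoc)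
qed

lemma lincomb_uminus: "a \<in> lincomb M n E \<Longrightarrow> - a \<in> lincomb M n E"
  using lincomb_mult[OF sr_uminus[OF M sr_one[OF M]], of a] by simp

lemma lincomb_diff: "a \<in> lincomb M n E \<Longrightarrow> b \<in> lincomb M n E \<Longrightarrow> a - b \<in> lincomb M n E"
  using lincomb_add[OF _ lincomb_uminus, of a b] by simp

lemma lincomb_sum: "(\<And>i. i \<in> A \<Longrightarrow> f i \<in> lincomb M n E) \<Longrightarrow> sum f A \<in> lincomb M n E"
  by (induction A rule: infinite_finite_induct) (auto intro: lincomb_add lincomb_zero)

lemma lincomb_gen: "i \<in> {1..n} \<Longrightarrow> E i \<in> lincomb M n E"
proof -
  assume i: "i \<in> {1..n}"
  have "(\<Sum>j=1..n. (if j = i then 1 else 0) * E j) = (\<Sum>j=1..n. if j = i then E j else 0)"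
    by (rule sum.cong) auto
  also have "\<dots> = E i" using i by simp
  finally show ?thesis unfolding lincomb_def
    by (intro CollectI exI[of _ "\<lambda>j. if j = i then 1 else 0"]) (auto simp: sr_one[OF M] sr_zero[OF M])
qed

lemma lincomb_subset: "(\<And>i. i \<in> {1..n} \<Longrightarrow> E i \<in> M) \<Longrightarrow> lincomb M n E \<subseteq> M"
  unfolding lincomb_def by (auto intro!: sr_sum[OF M] sr_mult[OF M])

lemma lincomb_cong_mult:
  assumes "a - a' \<in> lincomb M n E" "b - b' \<in> lincomb M n E" "a \<in> M" "b' \<in> M"
  shows "a * b - a' * b' \<in> lincomb M n E"
proof -
  have "a * b - a' * b' = a * (b - b') + b' * (a - a')" by (simp add: algebra_simps)
  then show ?thesis using assms by (auto intro: lincomb_add lincomb_mult)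
qed

lemma lincomb_cong_power:
  assumes "a - a' \<in> lincomb M n E" "a \<in> M" "a' \<in> M"
  shows "a ^ k - a' ^ k \<in> lincomb M n E"
proof (induction k)
  case 0
  then show ?case by (simp add: lincomb_zero)
next
  case (Suc k)
  show ?case unfolding power_Suc by (rule lincomb_cong_mult[OF assms(1) Suc assms(2)]) (rule sr_power[OF M assms(3)])
qed

lemma lincomb_cong_prod:
  assumes "\<And>i. i \<in> A \<Longrightarrow> f i - f' i \<in> lincomb M n E" "\<And>i. i \<in> A \<Longrightarrow> f i \<in> M" "\<And>i. i \<in> A \<Longrightarrow> f' i \<in> M"
  shows "prod f A - prod f' A \<in> lincomb M n E"
  using assms
proof (induction A rule: infinite_finite_induct)
  case (insert x A)
  have "f x * prod f A - f' x * prod f' A \<in> lincomb M n E"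
    by (rule lincomb_cong_mult) (use insert in \<open>auto intro!: sr_prod[OF M]\<close>)
  then show ?case using insert by simp
qed (simp_all add: lincomb_zero)

lemma lincomb_cong_meval:
  assumes P: "P \<in> mpols I" and h: "rh_fun h" "\<And>c. h c \<in> M"
    and w: "\<And>i. i \<in> I \<Longrightarrow> w i - w' i \<in> lincomb M n E" "\<And>i. i \<in> I \<Longrightarrow> w i \<in> M" "\<And>i. i \<in> I \<Longrightarrow> w' i \<in> M"
  shows "meval h w P - meval h w' P \<in> lincomb M n E"
  using P
proof (induction rule: mpols_induct)
  case zero
  then show ?case by (simp add: meval_simps[OF h(1)] lincomb_zero)
next
  case (single m c)
  have "monom_val w m - monom_val w' m \<in> lincomb M n E" unfolding monom_val_def
    by (intro lincomb_cong_prod lincomb_cong_power sr_power[OF M]) (use single w in auto)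
  then have "h c * (monom_val w m - monom_val w' m) \<in> lincomb M n E" by (rule lincomb_mult[OF h(2)])
  then show ?case by (simp add: meval_single[OF h(1)] algebra_simps)
next
  case (add p q)
  have "meval h w (p + q) - meval h w' (p + q) = (meval h w p - meval h w' p) + (meval h w q - meval h w' q)"
    by (simp add: meval_simps[OF h(1)])
  then show ?case using add by (auto intro: lincomb_add)
qed

end

lemma hom_lincomb:
  assumes f: "hom_on M f" and "\<And>i. i \<in> {1..n} \<Longrightarrow> E i \<in> M" and "f ` M \<subseteq> M'" and a: "a \<in> lincomb M n E"
  shows "f a \<in> lincomb M' n (\<lambda>i. f (E i))"
proof -
  have M: "is_subring M" by (rule hom_on_subring[OF f])
  obtain H where H: "\<And>i. H i \<in> M" "a = (\<Sum>i=1..n. H i * E i)" using a unfolding lincomb_def by auto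
  have "f a = (\<Sum>i=1..n. f (H i * E i))"
    unfolding H(2) by (rule hom_on_sum[OF f]) (use H assms in \<open>auto intro: sr_mult[OF M]\<close>)
  also have "\<dots> = (\<Sum>i=1..n. f (H i) * f (E i))"
    by (rule sum.cong[OF refl]) (use H assms in \<open>auto intro: hom_on_mult[OF f]\<close>)
  finally show ?thesis unfolding lincomb_def using H assms by (intro CollectI exI[of _ "\<lambda>i. f (H i)"]) auto
qed

lemma lincomb_vanish:
  assumes h: "rh_fun h" and "P \<in> lincomb M n E" "\<And>i. i \<in> {1..n} \<Longrightarrow> meval h z (E i) = 0"
  shows "meval h z P = 0"
  using assms(2,3) unfolding lincomb_def by (auto simp: meval_simps[OF h])

section \<open>Polynomial maps between the two models for trivial coefficients\<close>

context gcm
begin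

definition bfz_ideal :: "(nat, 'c::comm_ring_1) mpol set" where
  "bfz_ideal = lincomb (mpols W) r (\<lambda>i. bfz_p mvar i - 1)"

lemma bfz_p_in_mpols: "i \<in> {1..r} \<Longrightarrow> bfz_p mvar i \<in> mpols W"
  unfolding bfz_p_def
  by (intro mpols_closed later_in[OF mpols_sr] earlier_in[OF mpols_sr]) auto

lemma meval_bfz_p:
  assumes h: "rh_fun h"
  shows "meval h z (bfz_p s i) = bfz_p (\<lambda>i. meval h z (s i)) i"
  by (simp add: bfz_p_def later_def earlier_def meval_simps[OF h])

lemma meval_later:
  assumes h: "rh_fun h"
  shows "meval h z (later s i) = later (\<lambda>i. meval h z (s i)) i"
  by (simp add: later_def meval_simps[OF h])

lemma meval_earlier:
  assumes h: "rh_fun h"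
  shows "meval h z (earlier s i) = earlier (\<lambda>i. meval h z (s i)) i"
  by (simp add: earlier_def meval_simps[OF h])

lemma map_coeffs_bfz_p:
  assumes h: "rh_fun h"
  shows "map_coeffs h (bfz_p mvar i) = bfz_p mvar i"
proof -
  note hom = hom_on_map_coeffs[OF h]
  have "map_coeffs h (bfz_p mvar i) = map_coeffs h (mvar i) * map_coeffs h (mvar (r + i))
      - map_coeffs h (later mvar i) * map_coeffs h (earlier (\<lambda>j. mvar (r + j)) i)"
    unfolding bfz_p_def by (simp add: hom_on_diff[OF hom] hom_on_mult[OF hom])
  also have "map_coeffs h (later mvar i) = later (\<lambda>j. map_coeffs h (mvar j)) i"
    by (rule hom_later[OF hom]) simp
  also have "map_coeffs h (earlier (\<lambda>j. mvar (r + j)) i) = earlier (\<lambda>j. map_coeffs h (mvar (r + j))) i"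
    by (rule hom_earlier[OF hom]) simp
  finally show ?thesis by (simp add: map_coeffs_mvar[OF h] bfz_p_def)
qed

definition coord_subst :: "(nat \<Rightarrow> ('v, 'c::comm_ring_1) mpol) \<Rightarrow> (nat \<Rightarrow> ('v, 'c) mpol) \<Rightarrow> (nat \<Rightarrow> ('v, 'c) mpol) \<Rightarrow> coord \<Rightarrow> ('v, 'c) mpol" where
  "coord_subst s s' y v = (case v of Xc i \<Rightarrow> s i | Xc' i \<Rightarrow> s' i | Yc i \<Rightarrow> y i)"

lemma coord_subst_simps [simp]: "coord_subst s s' y (Xc i) = s i" "coord_subst s s' y (Xc' i) = s' i"
  "coord_subst s s' y (Yc i) = y i"
  by (simp_all add: coord_subst_def)

lemma lower_bound_polynomials_int:
  fixes w :: "nat \<Rightarrow> 'a::field_char_0"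
  assumes w: "aindep W w"
  obtains G :: "nat \<Rightarrow> (nat, int) mpol" and f :: "nat \<Rightarrow> (coord, int) mpol"
  where "\<And>k. k \<in> {1..r} \<Longrightarrow> G k \<in> mpols W"
    "\<And>k. k \<in> {1..r} \<Longrightarrow> f k \<in> mpols (coords 0 {})"
    "\<And>k. k \<in> {1..r} \<Longrightarrow> mvar k * G k - (earlier mvar k + later mvar k) \<in> bfz_ideal"
    "\<And>k. k \<in> {1..r} \<Longrightarrow> mvar (r + k) - meval of_int (coord_subst mvar G (\<lambda>_. 1)) (f k) \<in> bfz_ideal"
proof -
  let ?z = "zvar w" and ?J = "bfz_ideal :: (nat, int) mpol set" and ?M = "mpols W :: (nat, int) mpol set"
  note M = mpols_sr[of W, where 'c = int]
  have z: "aindep W ?z" by (rule aindep_zvar[OF w])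
  have w0: "w i \<noteq> 0" if "i \<in> W" for i by (rule aindep_neq_0[OF w that])
  have w0': "w i \<noteq> 0" if "i \<in> {1..r}" for i by (rule w0) (use that in auto)
  have p: "bfz_p ?z i = w (r + i)" if "i \<in> {1..r}" for i using bfz_p_zvar[of i w] w0'[of i] that by simp
  \<comment> \<open>Equalities of polynomials need only be checked in the field, as the
    \<open>?z i\<close> are independent.\<close>
  have lift: "P = Q" if "P \<in> ?M" "Q \<in> ?M" "meval of_int ?z P = meval of_int ?z Q" for P Q
  proof -
    have "P - Q = 0" by (rule aindepD[OF z]) (use that in \<open>auto intro: mpols_closed\<close>)
    then show ?thesis by simp
  qed
  have "\<exists>G. G \<in> ?M \<and> bfz_exchange w k = w k * meval of_int ?z G" if k: "k \<in> {1..r}" for k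
  proof -
    have "\<exists>g\<in>gen_ring (?z ` (W - {r + k})). bfz_exchange w k = w k * (cox_var w k * earlier w k + g)"
      by (rule bfz_exchange_decomp[OF _ k]) (rule w0')
    then obtain g where g: "g \<in> gen_ring (?z ` (W - {r + k}))" "bfz_exchange w k = w k * (cox_var w k * earlier w k + g)"
      by blast
    have zin: "?z i \<in> gen_ring (?z ` W)" if "i \<in> W" for i by (intro gr_incl imageI that)
    have win: "w i \<in> gen_ring (?z ` W)" if "i \<in> {1..r}" for i using zin[of i] that by (simp add: zvar_simps)
    have "cox_var w k \<in> gen_ring (?z ` W)" using zin[of "r + k"] k by (simp only: zvar_simps[OF k]) simp
    moreover have "earlier w k \<in> gen_ring (?z ` W)" by (rule earlier_in[OF gen_ring_sr win]) (use k in auto)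
    moreover have "g \<in> gen_ring (?z ` W)" using g(1) gen_ring_mono[of "?z ` (W - {r + k})" "?z ` W"] by blast
    ultimately have "cox_var w k * earlier w k + g \<in> gen_ring (?z ` W)" by (intro gr_closed)
    then obtain P where "P \<in> ?M" "cox_var w k * earlier w k + g = meval of_int ?z P"
      unfolding gen_ring_image_eq by blast
    then show ?thesis using g(2) by (intro exI[of _ P]) simp
  qed
  then obtain G :: "nat \<Rightarrow> (nat, int) mpol" where G: "\<And>k. k \<in> {1..r} \<Longrightarrow> G k \<in> ?M"
    "\<And>k. k \<in> {1..r} \<Longrightarrow> bfz_exchange w k = w k * meval of_int ?z (G k)" by metis
  have bp1: "bfz_p mvar i - 1 \<in> ?J" if "i \<in> {1..r}" for i
    unfolding bfz_ideal_def using lincomb_gen[OF M that, of "\<lambda>i. bfz_p mvar i - 1"] by simp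
  have bpM: "bfz_p mvar i \<in> ?M" if "i \<in> {1..r}" for i by (rule bfz_p_in_mpols[OF that])
  have eM: "earlier mvar k \<in> ?M" "later mvar k \<in> ?M" "earlier (bfz_p mvar) k \<in> ?M" if "k \<in> {1..r}" for k
    by (rule earlier_in[OF M] later_in[OF M]; use that bpM in auto)+
  have Gk: "mvar k * G k - (earlier mvar k + later mvar k) \<in> ?J" if k: "k \<in> {1..r}" for k
  proof -
    \<comment> \<open>The exact exchange relation with coefficients; its reduction modulo
      \<open>?J\<close> replaces each \<open>bfz_p mvar i\<close> by 1.\<close>
    have "mvar k * G k = bfz_p mvar k * earlier mvar k + later mvar k * earlier (bfz_p mvar) k"
    proof (rule lift)
      show "mvar k * G k \<in> ?M" using G(1)[OF k] k by (intro mpols_closed) auto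
      show "bfz_p mvar k * earlier mvar k + later mvar k * earlier (bfz_p mvar) k \<in> ?M"
        by (intro mpols_closed eM bpM k)
      have zw: "earlier ?z k = earlier w k" "later ?z k = later w k" "earlier (bfz_p ?z) k = earlier (\<lambda>j. w (r + j)) k"
        by (rule earlier_cong later_cong; use k p in \<open>auto simp: zvar_simps\<close>)+
      show "meval of_int ?z (mvar k * G k) = meval of_int ?z (bfz_p mvar k * earlier mvar k + later mvar k * earlier (bfz_p mvar) k)"
        using G(2)[OF k] p[OF k] k by (simp add: meval_bfz_p[OF rhf_of_int] meval_later[OF rhf_of_int]
            meval_earlier[OF rhf_of_int] zw bfz_exchange_def zvar_simps)
    qed
    then have "mvar k * G k - (earlier mvar k + later mvar k) =
        earlier mvar k * (bfz_p mvar k - 1) + later mvar k * (earlier (bfz_p mvar) k - 1)"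
      by (simp add: algebra_simps)
    moreover have "earlier (bfz_p mvar) k - (\<Prod>j=1..<k. 1 ^ c j k) \<in> ?J" unfolding earlier_def bfz_ideal_def
      by (intro lincomb_cong_prod[OF M] lincomb_cong_power[OF M] sr_power[OF M] sr_one[OF M])
        (use k bp1 bpM in \<open>auto simp: bfz_ideal_def\<close>)
    ultimately show ?thesis using lincomb_add[OF M lincomb_mult[OF M eM(1)[OF k] bp1[OF k, unfolded bfz_ideal_def]]
          lincomb_mult[OF M eM(2)[OF k], of "earlier (bfz_p mvar) k - 1"]] by (simp add: bfz_ideal_def)
  qed
  let ?sub = "coord_subst mvar G (bfz_p mvar)" and ?K = "coords 0 {1..r}"
  let ?gl = "\<lambda>v. meval of_int ?z (?sub v)"
  have gl: "?gl (Xc i) = w i" "?gl (Xc' i) = bfz_exchange w i / w i" "?gl (Yc i) = w (r + i)" if "i \<in> {1..r}" for i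
    using that G(2)[OF that] w0'[OF that] p[OF that] by (simp_all add: meval_bfz_p[OF rhf_of_int] zvar_simps)
  have "\<exists>f. f \<in> mpols (coords 0 {}) \<and> mvar (r + j) - meval of_int (coord_subst mvar G (\<lambda>_. 1)) f \<in> ?J"
    if j: "j \<in> {1..r}" for j
  proof -
    let ?D = "laurent ?gl ?K (Yc ` {1..r})"
    have D: "is_subring ?D" by (rule laurent_sr)
    have glD: "?gl v \<in> ?D" if "v \<in> ?K" for v by (rule laurent_var[OF that])
    have wD: "w i \<in> ?D" "bfz_exchange w i / w i \<in> ?D" "w (r + i) \<in> ?D" if "i \<in> {1..r}" for i
      using glD[of "Xc i"] glD[of "Xc' i"] glD[of "Yc i"] gl[OF that] that by (simp_all only: coords_def) auto
    have wD': "inverse (w (r + i)) \<in> ?D" if "i \<in> {1..r}" for i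
      using laurent_inverse[of "Yc i" "Yc ` {1..r}" ?gl ?K] gl(3)[OF that] that by simp
    have "cox_var w j \<in> ?D"
    proof (rule cox_var_in_lower_bound[OF D w0 _ wD' wD(2) j])
      fix i assume i: "i \<in> W"
      show "w i \<in> ?D"
      proof (cases "i \<le> r")
        case True
        then show ?thesis using wD(1)[of i] i by simp
      next
        case False
        then have "i - r \<in> {1..r}" "r + (i - r) = i" using i by auto
        then show ?thesis using wD(3)[of "i - r"] by simp
      qed
    qed
    then have "\<exists>P N. P \<in> mpols ?K \<and> cox_var w j * (\<Prod>v\<in>Yc ` {1..r}. ?gl v) ^ N = meval of_int ?gl P"
    proof (rule laurent_clear[rotated -1])
      show "?gl v \<noteq> 0" if v: "v \<in> Yc ` {1..r}" for v
      proof -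
        from v obtain i where i: "v = Yc i" "i \<in> {1..r}" by auto
        show ?thesis unfolding i(1) gl(3)[OF i(2)] by (rule w0) (use i in auto)
      qed
    qed (auto simp: coords_def)
    then obtain P N where P: "P \<in> mpols ?K" "cox_var w j * (\<Prod>v\<in>Yc ` {1..r}. ?gl v) ^ N = meval of_int ?gl P"
      by blast
    have "(\<Prod>v\<in>Yc ` {1..r}. ?gl v) = (\<Prod>i=1..r. w (r + i))"
      by (subst prod.reindex) (auto simp: inj_on_def p meval_bfz_p[OF rhf_of_int] intro!: prod.cong)
    with P(2) have P2: "cox_var w j * (\<Prod>i=1..r. w (r + i)) ^ N = meval of_int ?gl P" by simp
    have subM: "?sub v \<in> ?M" if "v \<in> ?K" for v using that G(1) bpM by (auto simp: coords_def)
    have subM1: "coord_subst mvar G (\<lambda>_. 1) v \<in> ?M" if "v \<in> ?K" for v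
      using that G(1) by (auto simp: coords_def mpols_closed)
    have rj: "r + j \<in> W" using j by auto
    have eq: "mvar (r + j) * (\<Prod>i=1..r. bfz_p mvar i) ^ N = meval of_int ?sub P"
    proof (rule lift)
      show "mvar (r + j) * (\<Prod>i=1..r. bfz_p mvar i) ^ N \<in> ?M" by (intro mpols_closed mvar_in_mpols rj bpM)
      show "meval of_int ?sub P \<in> ?M" by (rule meval_in_subring[OF M P(1) _ subM]) (rule mpols_closed(10))
      have "meval of_int ?z (meval of_int ?sub P) = meval of_int ?gl P"
        by (rule hom_on_meval[OF hom_on_meval_UNIV[OF rhf_of_int] P(1)]) simp
      moreover have "(\<Prod>i=1..r. meval of_int ?z (bfz_p mvar i)) = (\<Prod>i=1..r. w (r + i))"
        by (rule prod.cong) (simp_all add: p meval_bfz_p[OF rhf_of_int])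
      moreover have "meval of_int ?z (mvar (r + j) * (\<Prod>i=1..r. bfz_p mvar i) ^ N) =
          ?z (r + j) * (\<Prod>i=1..r. meval of_int ?z (bfz_p mvar i)) ^ N" by (simp only: meval_int_simps)
      ultimately show "meval of_int ?z (mvar (r + j) * (\<Prod>i=1..r. bfz_p mvar i) ^ N) = meval of_int ?z (meval of_int ?sub P)"
        by (simp only: zvar_simps(2)[OF j] P2)
    qed
    have "(\<Prod>i=1..r. bfz_p mvar i) - (\<Prod>i=1..r. 1) \<in> ?J" unfolding bfz_ideal_def
      by (intro lincomb_cong_prod[OF M]) (use bp1 bpM in \<open>auto simp: bfz_ideal_def mpols_closed\<close>)
    then have "(\<Prod>i=1..r. bfz_p mvar i) ^ N - 1 ^ N \<in> ?J"
      unfolding bfz_ideal_def by (intro lincomb_cong_power[OF M]) (auto intro!: mpols_closed bpM)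
    then have 1: "mvar (r + j) * ((\<Prod>i=1..r. bfz_p mvar i) ^ N - 1) \<in> ?J"
      unfolding bfz_ideal_def by (intro lincomb_mult[OF M mvar_in_mpols[OF rj]]) simp
    have 2: "meval of_int ?sub P - meval of_int (coord_subst mvar G (\<lambda>_. 1)) P \<in> ?J"
      unfolding bfz_ideal_def
    proof (rule lincomb_cong_meval[OF M P(1) rhf_of_int])
      fix v assume v: "v \<in> ?K"
      show "?sub v - coord_subst mvar G (\<lambda>_. 1) v \<in> lincomb ?M r (\<lambda>i. bfz_p mvar i - 1)"
        using v bp1 by (auto simp: coords_def bfz_ideal_def lincomb_zero[OF M])
    qed (use subM subM1 in \<open>auto intro: mpols_closed\<close>)
    \<comment> \<open>\<open>P\<close> with every coefficient y replaced by 1, which changes its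
      value under the substitution only by an element of \<open>?J\<close>.\<close>
    define f :: "(coord, int) mpol" where "f = meval of_int (coord_subst (\<lambda>i. mvar (Xc i)) (\<lambda>i. mvar (Xc' i)) (\<lambda>_. 1)) P"
    have f: "f \<in> mpols (coords 0 {})" unfolding f_def
      by (rule meval_in_subring[OF mpols_sr P(1)]) (auto simp: coords_def intro: mpols_closed)
    have "meval of_int (coord_subst mvar G (\<lambda>_. 1)) f = meval of_int
        (\<lambda>v. meval of_int (coord_subst mvar G (\<lambda>_. 1)) (coord_subst (\<lambda>i. mvar (Xc i)) (\<lambda>i. mvar (Xc' i)) (\<lambda>_. 1) v)) P"
      unfolding f_def by (rule hom_on_meval[OF hom_on_meval_UNIV[OF rhf_of_int] P(1)]) simp
    also have "\<dots> = meval of_int (coord_subst mvar G (\<lambda>_. 1)) P"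
      by (rule meval_cong[OF P(1)]) (auto simp: coords_def)
    finally have "mvar (r + j) - meval of_int (coord_subst mvar G (\<lambda>_. 1)) f =
        (meval of_int ?sub P - meval of_int (coord_subst mvar G (\<lambda>_. 1)) P)
        - mvar (r + j) * ((\<Prod>i=1..r. bfz_p mvar i) ^ N - 1)" unfolding eq[symmetric] by (simp add: algebra_simps)
    then have "mvar (r + j) - meval of_int (coord_subst mvar G (\<lambda>_. 1)) f \<in> ?J"
      using lincomb_diff[OF M 2[unfolded bfz_ideal_def] 1[unfolded bfz_ideal_def]] by (simp only: bfz_ideal_def)
    then show ?thesis using f by blast
  qed
  then obtain f :: "nat \<Rightarrow> (coord, int) mpol" where f: "\<And>k. k \<in> {1..r} \<Longrightarrow> f k \<in> mpols (coords 0 {})"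
    "\<And>k. k \<in> {1..r} \<Longrightarrow> mvar (r + k) - meval of_int (coord_subst mvar G (\<lambda>_. 1)) (f k) \<in> ?J" by metis
  show ?thesis by (rule that[OF G(1) f(1) Gk f(2)])
qed

lemma lower_bound_polynomials:
  fixes w :: "nat \<Rightarrow> 'a::field_char_0"
  assumes w: "aindep W w"
  obtains G :: "nat \<Rightarrow> (nat, complex) mpol" and f :: "nat \<Rightarrow> (coord, complex) mpol"
  where "\<And>k. k \<in> {1..r} \<Longrightarrow> G k \<in> mpols W"
    "\<And>k. k \<in> {1..r} \<Longrightarrow> f k \<in> mpols (coords 0 {})"
    "\<And>k. k \<in> {1..r} \<Longrightarrow> mvar k * G k - (earlier mvar k + later mvar k) \<in> bfz_ideal"
    "\<And>k. k \<in> {1..r} \<Longrightarrow> mvar (r + k) - meval mconst (coord_subst mvar G (\<lambda>_. 1)) (f k) \<in> bfz_ideal"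
proof -
  obtain G :: "nat \<Rightarrow> (nat, int) mpol" and f :: "nat \<Rightarrow> (coord, int) mpol"
    where Gf: "\<And>k. k \<in> {1..r} \<Longrightarrow> G k \<in> mpols W"
    "\<And>k. k \<in> {1..r} \<Longrightarrow> f k \<in> mpols (coords 0 {})"
    "\<And>k. k \<in> {1..r} \<Longrightarrow> mvar k * G k - (earlier mvar k + later mvar k) \<in> bfz_ideal"
    "\<And>k. k \<in> {1..r} \<Longrightarrow> mvar (r + k) - meval of_int (coord_subst mvar G (\<lambda>_. 1)) (f k) \<in> bfz_ideal"
    by (rule lower_bound_polynomials_int[OF w]) (rule that)
  let ?h = "map_coeffs (of_int :: int \<Rightarrow> complex)"
  note rh = rhf_of_int[where 'a = complex]
  have hom: "hom_on UNIV (?h :: ('v, int) mpol \<Rightarrow> ('v, complex) mpol)" by (rule hom_on_map_coeffs[OF rh])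
  have homW: "hom_on (mpols W) (?h :: (nat, int) mpol \<Rightarrow> (nat, complex) mpol)"
    by (rule hom_on_subset[OF hom mpols_sr]) simp
  have E: "(\<lambda>i. ?h (bfz_p mvar i - 1)) = (\<lambda>i. bfz_p mvar i - 1)"
    by (simp add: hom_on_diff[OF hom] map_coeffs_bfz_p[OF rh] map_coeffs_one[OF rh])
  have J: "?h a \<in> bfz_ideal" if "a \<in> bfz_ideal" for a
  proof -
    have "?h a \<in> lincomb (mpols W) r (\<lambda>i. ?h (bfz_p mvar i - 1))"
    proof (rule hom_lincomb[OF homW _ _ that[unfolded bfz_ideal_def]])
      show "bfz_p mvar i - 1 \<in> mpols W" if "i \<in> {1..r}" for i by (intro mpols_closed bfz_p_in_mpols that)
      show "?h ` mpols W \<subseteq> mpols W" using map_coeffs_in_mpols[OF rh] by blast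
    qed
    then show ?thesis unfolding E bfz_ideal_def .
  qed
  show ?thesis
  proof (rule that[of "\<lambda>k. ?h (G k)" "\<lambda>k. ?h (f k)"])
    fix k assume k: "k \<in> {1..r}"
    show "?h (G k) \<in> mpols W" "?h (f k) \<in> mpols (coords 0 {})"
      by (rule map_coeffs_in_mpols[OF rh Gf(1)[OF k]] map_coeffs_in_mpols[OF rh Gf(2)[OF k]])+
    have "?h (earlier mvar k) = earlier mvar k" "?h (later mvar k) = later mvar k"
      using hom_earlier[OF hom, of k mvar] hom_later[OF hom, of k mvar] by (simp_all add: map_coeffs_mvar[OF rh])
    then show "mvar k * ?h (G k) - (earlier mvar k + later mvar k) \<in> bfz_ideal" using J[OF Gf(3)[OF k]]
      by (simp add: hom_on_diff[OF hom] hom_on_mult[OF hom] hom_on_add[OF hom] map_coeffs_mvar[OF rh])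
    have "?h (meval of_int (coord_subst mvar G (\<lambda>_. 1)) (f k)) =
        meval mconst (\<lambda>v. ?h (coord_subst mvar G (\<lambda>_. 1) v)) (?h (f k))"
      by (rule map_coeffs_meval) simp
    also have "\<dots> = meval mconst (coord_subst mvar (\<lambda>k. ?h (G k)) (\<lambda>_. 1)) (?h (f k))"
      by (rule meval_cong[OF map_coeffs_in_mpols[OF rh Gf(2)[OF k]]]) (auto simp: coords_def map_coeffs_mvar[OF rh])
    finally show "mvar (r + k) - meval mconst (coord_subst mvar (\<lambda>k. ?h (G k)) (\<lambda>_. 1)) (?h (f k)) \<in> bfz_ideal"
      using J[OF Gf(4)[OF k]] by (simp add: hom_on_diff[OF hom] map_coeffs_mvar[OF rh])
  qed
qed

text \<open>Restricted to \<open>W\<close>, the point of \<open>V_triv r A\<close> with initial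
  cluster \<open>\<xi>\<close>, for positive \<open>\<xi>\<close>. In the coordinates x and x' it
  becomes a \<open>lower_point\<close> with all y equal to 1.\<close>

definition unit_point :: "(nat \<Rightarrow> real) \<Rightarrow> nat \<Rightarrow> complex" where
  "unit_point \<xi> = zvar (\<lambda>i. if i \<le> r then complex_of_real (\<xi> i) else 1)"

lemma unit_point:
  assumes "\<And>i. \<xi> i > 0" and i: "i \<in> {1..r}"
  shows "unit_point \<xi> i = complex_of_real (\<xi> i)" "bfz_p (unit_point \<xi>) i = 1"
proof -
  have "\<xi> i \<noteq> 0" using assms(1)[of i] by simp
  then show "unit_point \<xi> i = complex_of_real (\<xi> i)" "bfz_p (unit_point \<xi>) i = 1"
    using i bfz_p_zvar[OF i, of "\<lambda>i. if i \<le> r then complex_of_real (\<xi> i) else 1"]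
    by (simp_all add: unit_point_def zvar_def)
qed

lemma bfz_ideal_vanishes:
  assumes "P \<in> bfz_ideal" "\<And>i. i \<in> {1..r} \<Longrightarrow> bfz_p z i = 1"
  shows "ceval z P = 0"
  using assms(1) unfolding bfz_ideal_def
  by (rule lincomb_vanish[OF rhf_id]) (simp add: meval_bfz_p[OF rhf_id] assms(2))

lemma vanishing_on_lower_points:
  assumes P: "P \<in> mpols (coords 0 {})"
    and vanish: "\<And>\<xi>. (\<And>i. \<xi> i > 0) \<Longrightarrow> ceval (\<lambda>v. complex_of_real (lower_point \<xi> (\<lambda>_. 1) v)) P = 0"
  shows "P \<in> lincomb (mpols (coords 0 {})) r (eqn {})"
proof -
  have "\<exists>G. (\<forall>i. G i \<in> mpols (coords 0 {})) \<and> P = (\<Sum>i=1..r. G i * eqn {} i)"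
  proof (rule vanishing_on_pos_points[OF _ P])
    fix \<xi> \<eta> :: "nat \<Rightarrow> real"
    assume *: "\<And>i. \<xi> i > 0" "\<And>i. \<eta> i > 0" "\<And>i. i \<notin> {} \<Longrightarrow> \<eta> i = 1"
    have "\<eta> = (\<lambda>_. 1)" using *(3) by auto
    then show "ceval (\<lambda>v. complex_of_real (lower_point \<xi> \<eta> v)) P = 0" using vanish[OF *(1)] by simp
  qed simp
  then show ?thesis unfolding lincomb_def by blast
qed

lemma coords_eqs: "prin_coords r = coords 0 {1..r}" "W_triv_coords r = coords 0 {}"
  by (auto simp: prin_coords_def W_triv_coords_def coords_def)

lemma bfz_poly_eq: "bfz_poly r A i = bfz_p mvar i"
  by (simp add: bfz_poly_def bfz_monomial_def bfz_p_def later_def earlier_def)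

lemma model_eqs: "V_triv_eqs r A = (\<lambda>i. bfz_p mvar i - 1) ` {1..r}"
  "W_triv_eqs r A = eqn {} ` {1..r}" "V_prin_eqs r A = eqn {1..r} ` {1..r}"
proof -
  have "mvar i * mvar (r + i) - (1 + bfz_monomial r A i) = bfz_p mvar i - 1" for i
    by (simp add: bfz_monomial_def bfz_p_def later_def earlier_def)
  then show "V_triv_eqs r A = (\<lambda>i. bfz_p mvar i - 1) ` {1..r}"
    unfolding V_triv_eqs_def by (simp only: Setcompr_eq_image)
  show "W_triv_eqs r A = eqn {} ` {1..r}" unfolding W_triv_eqs_def Setcompr_eq_image
    by (rule image_cong[OF refl]) (simp add: eqn_def rhs_def later_def earlier_def)
  show "V_prin_eqs r A = eqn {1..r} ` {1..r}" unfolding V_prin_eqs_def Setcompr_eq_image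
    by (rule image_cong[OF refl]) (simp add: eqn_def rhs_def later_def earlier_def)
qed

lemma V_triv_iff: "v \<in> V_triv r A \<longleftrightarrow> v \<in> affine_space W \<and> (\<forall>i\<in>{1..r}. bfz_p v i = 1)"
  by (auto simp: V_triv_def zero_locus_def model_eqs meval_bfz_p[OF rhf_id] mult_2)

lemma W_triv_iff: "v \<in> W_triv r A \<longleftrightarrow> v \<in> affine_space (coords 0 {}) \<and> (\<forall>i\<in>{1..r}. ceval v (eqn {} i) = 0)"
  by (auto simp: W_triv_def zero_locus_def model_eqs coords_eqs)

end

text \<open>\<open>G\<close> and \<open>f\<close> give substitutions \<open>sub\<close>, which
  writes x and x' through the z, and \<open>zsub\<close>, which goes back. They are inverse to each
  other modulo the two ideals of relations.\<close>

locale lower_bound_polys = gcm r A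
  for r and A :: "nat \<Rightarrow> nat \<Rightarrow> int" +
  fixes G :: "nat \<Rightarrow> (nat, complex) mpol" and f :: "nat \<Rightarrow> (coord, complex) mpol"
  assumes G: "\<And>k. k \<in> {1..r} \<Longrightarrow> G k \<in> mpols W"
    and f: "\<And>k. k \<in> {1..r} \<Longrightarrow> f k \<in> mpols (coords 0 {})"
    and G_cong: "\<And>k. k \<in> {1..r} \<Longrightarrow> mvar k * G k - (earlier mvar k + later mvar k) \<in> bfz_ideal"
    and f_cong: "\<And>k. k \<in> {1..r} \<Longrightarrow> mvar (r + k) - meval mconst (coord_subst mvar G (\<lambda>_. 1)) (f k) \<in> bfz_ideal"
begin

definition sub :: "coord \<Rightarrow> (nat, complex) mpol" where
  "sub = coord_subst mvar G (\<lambda>_. 1)"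

definition zsub :: "nat \<Rightarrow> (coord, complex) mpol" where
  "zsub i = (if i \<le> r then mvar (Xc i) else f (i - r))"

lemma W_cases: "i \<in> W \<Longrightarrow> (i \<in> {1..r} \<Longrightarrow> Q) \<Longrightarrow> (\<And>j. j \<in> {1..r} \<Longrightarrow> i = r + j \<Longrightarrow> Q) \<Longrightarrow> Q"
proof -
  assume i: "i \<in> W" and 1: "i \<in> {1..r} \<Longrightarrow> Q" and 2: "\<And>j. j \<in> {1..r} \<Longrightarrow> i = r + j \<Longrightarrow> Q"
  show Q
  proof (cases "i \<le> r")
    case True
    then show ?thesis using i by (intro 1) auto
  next
    case False
    then show ?thesis using i by (intro 2[of "i - r"]) auto
  qed
qed

lemma sub_in: "v \<in> coords 0 {} \<Longrightarrow> sub v \<in> mpols W"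
  using G by (auto simp: coords_def sub_def)

lemma zsub_in: "i \<in> W \<Longrightarrow> zsub i \<in> mpols (coords 0 {})"
  by (erule W_cases) (use f in \<open>auto simp: zsub_def coords_def\<close>)

lemma sub_eqn: "i \<in> {1..r} \<Longrightarrow> meval mconst sub (eqn {} i) \<in> bfz_ideal"
  using G_cong[of i]
  by (simp add: eqn_def rhs_def sub_def meval_later[OF rhf_mconst] meval_earlier[OF rhf_mconst])

lemma sub_zsub: "i \<in> W \<Longrightarrow> mvar i - meval mconst sub (zsub i) \<in> bfz_ideal"
proof (erule W_cases)
  assume "i \<in> {1..r}"
  then show ?thesis by (simp add: zsub_def sub_def bfz_ideal_def lincomb_zero[OF mpols_sr])
next
  fix j assume "j \<in> {1..r}" "i = r + j"
  then show ?thesis using f_cong[of j] by (simp add: zsub_def sub_def)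
qed

lemma eval_sub:
  assumes \<xi>: "\<And>i. \<xi> i > 0" and v: "v \<in> coords 0 {}"
  shows "ceval (unit_point \<xi>) (sub v) = complex_of_real (lower_point \<xi> (\<lambda>_. 1) v)"
proof -
  have "\<exists>i\<in>{1..r}. v = Xc i \<or> v = Xc' i" using v by (auto simp: coords_def)
  then obtain i where i: "i \<in> {1..r}" "v = Xc i \<or> v = Xc' i" by blast
  have z: "unit_point \<xi> j = complex_of_real (\<xi> j)" if "j \<in> {1..r}" for j by (rule unit_point(1)[OF \<xi> that])
  have "ceval (unit_point \<xi>) (mvar i * G i - (earlier mvar i + later mvar i)) = 0"
    by (rule bfz_ideal_vanishes[OF G_cong[OF i(1)]]) (rule unit_point(2)[OF \<xi>])
  then have "unit_point \<xi> i * ceval (unit_point \<xi>) (G i) = earlier (unit_point \<xi>) i + later (unit_point \<xi>) i"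
    by (simp add: meval_later[OF rhf_id] meval_earlier[OF rhf_id])
  also have "earlier (unit_point \<xi>) i = earlier (\<lambda>j. complex_of_real (\<xi> j)) i"
    by (rule earlier_cong, rule z) (use i in auto)
  also have "later (unit_point \<xi>) i = later (\<lambda>j. complex_of_real (\<xi> j)) i"
    by (rule later_cong, rule z) (use i in auto)
  finally have "complex_of_real (\<xi> i) * ceval (unit_point \<xi>) (G i) = complex_of_real (earlier \<xi> i + later \<xi> i)"
    by (simp add: z[OF i(1)] earlier_def later_def)
  moreover have "\<xi> i \<noteq> 0" using \<xi>[of i] by simp
  ultimately have "ceval (unit_point \<xi>) (G i) = complex_of_real ((earlier \<xi> i + later \<xi> i) / \<xi> i)"
    by (simp add: field_simps)
  then show ?thesis using i(2) z[OF i(1)] by (auto simp: sub_def lower_point_def)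
qed

lemma eval_zsub:
  assumes \<xi>: "\<And>i. \<xi> i > 0" and i: "i \<in> W"
  shows "ceval (\<lambda>v. complex_of_real (lower_point \<xi> (\<lambda>_. 1) v)) (zsub i) = unit_point \<xi> i"
proof -
  have "ceval (unit_point \<xi>) (mvar i - meval mconst sub (zsub i)) = 0"
    by (rule bfz_ideal_vanishes[OF sub_zsub[OF i]]) (rule unit_point(2)[OF \<xi>])
  then have "unit_point \<xi> i = ceval (\<lambda>v. ceval (unit_point \<xi>) (sub v)) (zsub i)"
    by (simp add: meval_meval[OF rhf_id])
  also have "\<dots> = ceval (\<lambda>v. complex_of_real (lower_point \<xi> (\<lambda>_. 1) v)) (zsub i)"
    by (rule meval_cong[OF zsub_in[OF i]]) (rule eval_sub[OF \<xi>])
  finally show ?thesis ..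
qed

lemma eval_subst_zsub:
  assumes \<xi>: "\<And>i. \<xi> i > 0" and P: "P \<in> mpols W"
  shows "ceval (\<lambda>v. complex_of_real (lower_point \<xi> (\<lambda>_. 1) v)) (meval mconst zsub P) = ceval (unit_point \<xi>) P"
  unfolding meval_meval[OF rhf_id] by (rule meval_cong[OF P]) (rule eval_zsub[OF \<xi>])

text \<open>By \<open>vanishing_on_lower_points\<close> membership is tested at positive points,
  where substituting \<open>zsub\<close> amounts to evaluating at \<open>unit_point\<close>.\<close>

lemma zsub_ideal:
  assumes P: "P \<in> mpols W" and P0: "\<And>\<xi>. (\<And>i. \<xi> i > 0) \<Longrightarrow> ceval (unit_point \<xi>) P = 0"
  shows "meval mconst zsub P \<in> lincomb (mpols (coords 0 {})) r (eqn {})"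
  by (rule vanishing_on_lower_points) (auto intro: meval_mconst_in[OF P zsub_in] simp: eval_subst_zsub[OF _ P] P0)

lemma sub_ideal:
  assumes "P \<in> lincomb (mpols (coords 0 {})) r (eqn {})"
  shows "meval mconst sub P \<in> bfz_ideal"
proof -
  obtain H where H: "\<And>i. H i \<in> mpols (coords 0 {})" "P = (\<Sum>i=1..r. H i * eqn {} i)"
    using assms unfolding lincomb_def by auto
  have "meval mconst sub P = (\<Sum>i=1..r. meval mconst sub (H i) * meval mconst sub (eqn {} i))" by (simp add: H(2))
  also have "\<dots> \<in> bfz_ideal" using sub_eqn unfolding bfz_ideal_def
    by (intro lincomb_sum[OF mpols_sr] lincomb_mult[OF mpols_sr] meval_mconst_in[OF H(1) sub_in])
  finally show ?thesis .
qed

text \<open>\<open>Q\<close> is carried to the coordinates x and x', where standard monomials show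
  it to be a combination of the exchange relations, and is carried back. The round trip changes
  \<open>Q\<close> only by an element of the ideal.\<close>

theorem bfz_ideal_if_vanishing:
  assumes Q: "Q \<in> mpols W" and Q0: "\<And>\<xi>. (\<And>i. \<xi> i > 0) \<Longrightarrow> ceval (unit_point \<xi>) Q = 0"
  shows "Q \<in> bfz_ideal"
proof -
  have 1: "meval mconst sub (meval mconst zsub Q) \<in> bfz_ideal" by (rule sub_ideal[OF zsub_ideal[OF Q Q0]])
  have "meval mconst mvar Q - meval mconst (\<lambda>i. meval mconst sub (zsub i)) Q \<in> bfz_ideal"
    using sub_zsub unfolding bfz_ideal_def by (intro lincomb_cong_meval[OF mpols_sr Q rhf_mconst])
      (auto intro: meval_mconst_in[OF zsub_in sub_in])
  then have "Q - meval mconst sub (meval mconst zsub Q) \<in> bfz_ideal"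
    by (simp add: meval_mvar_self meval_meval[OF rhf_mconst])
  then show ?thesis using lincomb_add[OF mpols_sr _ 1[unfolded bfz_ideal_def], of "Q - meval mconst sub (meval mconst zsub Q)"]
    by (simp add: bfz_ideal_def)
qed

text \<open>On \<open>V_triv r A\<close> the round trip is the identity by \<open>sub_zsub\<close>.
  On \<open>W_triv r A\<close> it differs from the identity by polynomials that vanish at all
  positive lower points, hence lie in the ideal of the exchange relations.\<close>

theorem varieties_isomorphic_triv:
  "varieties_isomorphic {1..2*r} (V_triv r A) (W_triv_coords r) (W_triv r A)"
proof -
  let ?K = "coords 0 {}"
  have W: "{1..2*r} = W" by (simp add: mult_2)
  have to_W: "ceval (\<lambda>j\<in>?K. ceval v (sub j)) P = ceval v (meval mconst sub P)" if "P \<in> mpols ?K" for P v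
    unfolding meval_meval[OF rhf_id] by (rule meval_cong[OF that]) simp
  have to_V: "ceval (\<lambda>i\<in>W. ceval w (zsub i)) P = ceval w (meval mconst zsub P)" if "P \<in> mpols W" for P w
    unfolding meval_meval[OF rhf_id] by (rule meval_cong[OF that]) simp
  have V: "(\<lambda>j\<in>?K. ceval v (sub j)) \<in> W_triv r A \<and> (\<lambda>i\<in>W. ceval (\<lambda>j\<in>?K. ceval v (sub j)) (zsub i)) = v"
    if v: "v \<in> V_triv r A" for v
  proof
    have v0: "ceval v P = 0" if "P \<in> bfz_ideal" for P
      by (rule bfz_ideal_vanishes[OF that]) (use v in \<open>simp add: V_triv_iff\<close>)
    show "(\<lambda>j\<in>?K. ceval v (sub j)) \<in> W_triv r A" unfolding W_triv_iff
    proof (intro conjI ballI)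
      fix i assume "i \<in> {1..r}"
      then show "ceval (\<lambda>j\<in>?K. ceval v (sub j)) (eqn {} i) = 0"
        by (simp only: to_W[OF eqn_in] v0[OF sub_eqn])
    qed simp
    show "(\<lambda>i\<in>W. ceval (\<lambda>j\<in>?K. ceval v (sub j)) (zsub i)) = v"
    proof (rule extensionalityI[of _ W])
      fix i assume i: "i \<in> W"
      have "ceval v (mvar i - meval mconst sub (zsub i)) = 0" by (rule v0[OF sub_zsub[OF i]])
      then show "(\<lambda>i\<in>W. ceval (\<lambda>j\<in>?K. ceval v (sub j)) (zsub i)) i = v i"
        using i by (simp add: to_W[OF zsub_in[OF i]])
    qed (use v in \<open>auto simp: V_triv_iff PiE_def\<close>)
  qed
  have T: "(\<lambda>i\<in>W. ceval w (zsub i)) \<in> V_triv r A \<and> (\<lambda>j\<in>?K. ceval (\<lambda>i\<in>W. ceval w (zsub i)) (sub j)) = w"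
    if w: "w \<in> W_triv r A" for w
  proof
    have w0: "ceval w P = 0" if "P \<in> lincomb (mpols ?K) r (eqn {})" for P
      by (rule lincomb_vanish[OF rhf_id that]) (use w in \<open>simp add: W_triv_iff\<close>)
    show "(\<lambda>i\<in>W. ceval w (zsub i)) \<in> V_triv r A" unfolding V_triv_iff
    proof (intro conjI ballI)
      fix i assume i: "i \<in> {1..r}"
      have P: "bfz_p mvar i - 1 \<in> mpols W" by (intro mpols_closed bfz_p_in_mpols i)
      have "ceval (\<lambda>i\<in>W. ceval w (zsub i)) (bfz_p mvar i - 1) = 0" unfolding to_V[OF P]
        by (rule w0, rule zsub_ideal[OF P]) (simp add: meval_bfz_p[OF rhf_id] unit_point(2)[OF _ i])
      moreover have "ceval z (bfz_p mvar i - 1) = bfz_p z i - 1" for z by (simp add: meval_bfz_p[OF rhf_id])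
      ultimately show "bfz_p (\<lambda>i\<in>W. ceval w (zsub i)) i = 1" by (simp only: right_minus_eq)
    qed simp
    show "(\<lambda>j\<in>?K. ceval (\<lambda>i\<in>W. ceval w (zsub i)) (sub j)) = w"
    proof (rule extensionalityI[of _ ?K])
      fix j assume j: "j \<in> ?K"
      have "ceval w (meval mconst zsub (sub j) - mvar j) = 0"
      proof (rule w0, rule vanishing_on_lower_points)
        show "meval mconst zsub (sub j) - mvar j \<in> mpols ?K"
          by (intro mpols_closed(3) meval_mconst_in[OF sub_in[OF j] zsub_in] mvar_in_mpols j)
        show "ceval (\<lambda>v. complex_of_real (lower_point \<xi> (\<lambda>_. 1) v)) (meval mconst zsub (sub j) - mvar j) = 0"
          if "\<And>i. \<xi> i > 0" for \<xi> by (simp add: eval_subst_zsub[OF that sub_in[OF j]] eval_sub[OF that j])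
      qed
      then show "(\<lambda>j\<in>?K. ceval (\<lambda>i\<in>W. ceval w (zsub i)) (sub j)) j = w j"
        using j by (simp add: to_V[OF sub_in[OF j]])
    qed (use w in \<open>auto simp: W_triv_iff PiE_def\<close>)
  qed
  show ?thesis unfolding varieties_isomorphic_def W coords_eqs
    using sub_in zsub_in V T by (intro exI[of _ sub] exI[of _ zsub]) blast
qed

end

section \<open>Relations among the generators of the cluster algebras\<close>

context gcm
begin

text \<open>An integral relation among the generators persists under each specialization to positive
  reals. So it vanishes at all positive points, and \<open>vanishing_on_pos_points\<close> writes it
  as a complex combination of the exchange relations.\<close>

lemma lower_point_kernel:
  fixes w y :: "nat \<Rightarrow> 'a::field"
  assumes Y: "Y \<subseteq> {1..r}" and P: "P \<in> mpols (coords 0 Y)" and P0: "meval of_int (lower_point w y) P = 0"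
    and D: "\<And>i. i \<in> {1..r} \<Longrightarrow> w i \<in> D" "\<And>i. i \<in> {1..r} \<Longrightarrow> inverse (w i) \<in> D"
      "\<And>i. i \<in> {1..r} \<Longrightarrow> y i \<in> D" "\<And>i. i \<in> {1..r} \<Longrightarrow> w i \<noteq> 0"
    and spec: "\<And>\<xi> \<eta> :: nat \<Rightarrow> real. \<lbrakk>\<And>i. \<xi> i > 0; \<And>i. \<eta> i > 0; \<And>i. i \<notin> Y \<Longrightarrow> \<eta> i = 1\<rbrakk> \<Longrightarrow>
      \<exists>h. hom_on D h \<and> (\<forall>i\<in>{1..r}. h (w i) = \<xi> i \<and> h (y i) = \<eta> i)"
  shows "int_coeffs P \<in> lincomb (mpols (coords 0 Y)) r (eqn Y :: nat \<Rightarrow> (coord, complex) mpol)"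
proof -
  let ?h = "of_int :: int \<Rightarrow> complex"
  have "\<exists>G. (\<forall>i. G i \<in> mpols (coords 0 Y)) \<and> map_coeffs ?h P = (\<Sum>i=1..r. G i * eqn Y i)"
  proof (rule vanishing_on_pos_points[OF Y map_coeffs_in_mpols[OF rhf_of_int P]])
    fix \<xi> \<eta> :: "nat \<Rightarrow> real"
    assume *: "\<And>i. \<xi> i > 0" "\<And>i. \<eta> i > 0" "\<And>i. i \<notin> Y \<Longrightarrow> \<eta> i = 1"
    have "\<exists>h. hom_on D h \<and> (\<forall>i\<in>{1..r}. h (w i) = \<xi> i \<and> h (y i) = \<eta> i)"
      by (rule spec; rule *; assumption)
    then obtain h where h: "hom_on D h" "\<forall>i\<in>{1..r}. h (w i) = \<xi> i \<and> h (y i) = \<eta> i" by blast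
    have h0: "h (w i) \<noteq> 0" if "i \<in> {1..r}" for i using h(2) that *(1)[of i] by auto
    have g: "lower_point w y v \<in> D" "h (lower_point w y v) = lower_point \<xi> \<eta> v" if v: "v \<in> coords 0 Y" for v
    proof -
      show "lower_point w y v \<in> D" by (rule hom_lower_point(1)[OF h(1) D h0 Y v])
      have "h (lower_point w y v) = lower_point (\<lambda>i. h (w i)) (\<lambda>i. h (y i)) v"
        by (rule hom_lower_point(2)[OF h(1) D h0 Y v])
      also have "\<dots> = lower_point \<xi> \<eta> v" by (rule lower_point_cong[OF v _ _ Y]) (use h(2) in auto)
      finally show "h (lower_point w y v) = lower_point \<xi> \<eta> v" .
    qed
    have "meval of_int (lower_point \<xi> \<eta>) P = meval of_int (\<lambda>v. h (lower_point w y v)) P"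
      by (rule meval_cong[OF P]) (simp add: g(2))
    also have "\<dots> = h (meval of_int (lower_point w y) P)" by (rule hom_on_meval[OF h(1) P g(1), symmetric])
    also have "\<dots> = 0" unfolding P0 by (rule hom_on_zero[OF h(1)])
    finally have "complex_of_real (meval of_int (lower_point \<xi> \<eta>) P) = 0" by simp
    then show "ceval (\<lambda>v. complex_of_real (lower_point \<xi> \<eta> v)) (map_coeffs ?h P) = 0"
      unfolding meval_map_coeffs[OF rhf_of_int rhf_id] by (simp add: meval_def)
  qed
  then show ?thesis unfolding lincomb_def by blast
qed

end

lemma (in prin_pattern) kernel:
  assumes P: "P \<in> mpols (coords 0 {1..r})" and P0: "meval of_int gens P = 0"
  shows "int_coeffs P \<in> lincomb (mpols (coords 0 {1..r})) r (eqn {1..r} :: nat \<Rightarrow> (coord, complex) mpol)"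
proof (rule lower_point_kernel[OF subset_refl P P0[unfolded gens_def]])
  let ?D = "laurent (u t0) W {1..r}"
  show "u t0 i \<in> ?D" "inverse (u t0 i) \<in> ?D" "u t0 (r + i) \<in> ?D" "u t0 i \<noteq> 0" if "i \<in> {1..r}" for i
    using that u_neq_0[OF t0, of i] by (auto intro: laurent_var laurent_inverse)
  fix \<xi> \<eta> :: "nat \<Rightarrow> real"
  assume *: "\<And>i. \<xi> i > 0" "\<And>i. \<eta> i > 0" "\<And>i. i \<notin> {1..r} \<Longrightarrow> \<eta> i = 1"
  let ?o = "\<lambda>i. if i \<le> r then \<xi> i else \<eta> (i - r)"
  have o0: "?o j \<noteq> 0" for j using *(1)[of j] *(2)[of "j - r"] by (auto simp: less_imp_neq[THEN not_sym])
  obtain h where h: "hom_on ?D h" "\<And>i. i \<in> W \<Longrightarrow> h (u t0 i) = ?o i"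
  proof (rule specialize[OF aindep_u[OF t0], of "{1..r}" ?o])
    show "?o j \<noteq> 0" for j by (rule o0)
  qed auto
  have "h (u t0 i) = \<xi> i \<and> h (u t0 (r + i)) = \<eta> i" if "i \<in> {1..r}" for i
    using h(2)[of i] h(2)[of "r + i"] that by auto
  then show "\<exists>h. hom_on ?D h \<and> (\<forall>i\<in>{1..r}. h (u t0 i) = \<xi> i \<and> h (u t0 (r + i)) = \<eta> i)"
    using h(1) by blast
qed

context triv_pattern
begin

lemma specialize_u:
  fixes \<xi> :: "nat \<Rightarrow> 'b::field"
  assumes "\<And>i. i \<in> {1..r} \<Longrightarrow> \<xi> i \<noteq> 0"
  obtains h where "hom_on (laurent (u t0) {1..r} {1..r}) h" "\<And>i. i \<in> {1..r} \<Longrightarrow> h (u t0 i) = \<xi> i"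
proof -
  have "aindep {1..r} (u t0)" using aindep_u[OF t0] by simp
  then obtain h where "hom_on (laurent (u t0) {1..r} {1..r}) h" "\<And>i. i \<in> {1..r} \<Longrightarrow> h (u t0 i) = \<xi> i"
    by (rule specialize[of _ _ "{1..r}" \<xi>, OF _ _ subset_refl assms]) (rule finite_atLeastAtMost, assumption, blast)
  then show ?thesis by (rule that)
qed

lemma kernel_W:
  assumes P: "P \<in> mpols (coords 0 {})" and P0: "meval of_int (lower_point (u t0) (\<lambda>_. 1)) P = 0"
  shows "int_coeffs P \<in> lincomb (mpols (coords 0 {})) r (eqn {} :: nat \<Rightarrow> (coord, complex) mpol)"
proof (rule lower_point_kernel[OF _ P P0])
  let ?D = "laurent (u t0) {1..r} {1..r}"
  show "u t0 i \<in> ?D" "inverse (u t0 i) \<in> ?D" "1 \<in> ?D" "u t0 i \<noteq> 0" if "i \<in> {1..r}" for i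
    using that u_neq_0[OF t0, of i] by (auto intro: laurent_var laurent_inverse lr_closed)
  fix \<xi> \<eta> :: "nat \<Rightarrow> real"
  assume *: "\<And>i. \<xi> i > 0" "\<And>i. \<eta> i > 0" "\<And>i. i \<notin> {} \<Longrightarrow> \<eta> i = 1"
  have "\<xi> i \<noteq> 0" for i using *(1)[of i] by simp
  then obtain h where h: "hom_on ?D h" "\<And>i. i \<in> {1..r} \<Longrightarrow> h (u t0 i) = \<xi> i"
    by (rule specialize_u[of \<xi>]) (rule that)
  then show "\<exists>h. hom_on ?D h \<and> (\<forall>i\<in>{1..r}. h (u t0 i) = \<xi> i \<and> h 1 = \<eta> i)"
    using *(3) hom_on_one[OF h(1)] by (intro exI[of _ h]) auto
qed simp

text \<open>Specializing the initial cluster to positive reals sends the generators to the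
  coordinates of \<open>unit_point\<close>, where \<open>bfz_ideal_if_vanishing\<close> tests
  membership.\<close>

lemma kernel_V:
  assumes "lower_bound_polys r A G f" and P: "P \<in> mpols W" and P0: "meval of_int (zvar u1) P = 0"
  shows "int_coeffs P \<in> (bfz_ideal :: (nat, complex) mpol set)"
proof -
  interpret L: lower_bound_polys r A G f by fact
  show ?thesis
  proof (rule L.bfz_ideal_if_vanishing[OF map_coeffs_in_mpols[OF rhf_of_int P]])
    fix \<xi> :: "nat \<Rightarrow> real" assume \<xi>: "\<And>i. \<xi> i > 0"
    let ?D = "laurent (u t0) {1..r} {1..r}" and ?w = "\<lambda>i. if i \<le> r then complex_of_real (\<xi> i) else 1"
    have \<xi>0: "complex_of_real (\<xi> i) \<noteq> 0" for i using \<xi>[of i] by simp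
    obtain h where h: "hom_on ?D h" "\<And>i. i \<in> {1..r} \<Longrightarrow> h (u t0 i) = complex_of_real (\<xi> i)"
      by (rule specialize_u[of "\<lambda>i. complex_of_real (\<xi> i)"]) (use \<xi>0 in auto)
    have D: "is_subring ?D" by (rule laurent_sr)
    have u1D: "u1 i \<in> ?D" "h (u1 i) = ?w i" if "i \<in> W" for i
      using that h(2)[of i] by (auto simp: u1_def hom_on_one[OF h(1)] lr_closed(1) intro: laurent_var)
    have u1D': "inverse (u1 i) \<in> ?D" if "i \<in> {1..r}" for i
      using that by (auto simp: u1_def intro: laurent_inverse)
    have sub: "laurent u1 W {1..r} \<subseteq> ?D" by (rule laurent_least[OF D u1D(1) u1D'])
    have h': "hom_on (laurent u1 W {1..r}) h" by (rule hom_on_subset[OF h(1) laurent_sr sub])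
    have z: "zvar u1 i \<in> ?D \<and> h (zvar u1 i) = unit_point \<xi> i" if i: "i \<in> W" for i
    proof (cases "i \<le> r")
      case True
      then show ?thesis using u1D[OF i] i by (simp add: zvar_def unit_point_def)
    next
      case False
      then have j: "i - r \<in> {1..r}" using i by auto
      have "h (cox_var u1 (i - r)) = cox_var (\<lambda>j. h (u1 j)) (i - r)"
        by (rule hom_cox_var[OF h' _ _ j]) (use u1_simps(3) u1D(2) \<xi>0 in auto)
      also have "\<dots> = cox_var ?w (i - r)" by (rule cox_var_cong[OF _ j]) (rule u1D(2))
      finally have "h (cox_var u1 (i - r)) = cox_var ?w (i - r)" .
      moreover have "cox_var u1 (i - r) \<in> ?D" by (rule cox_var_in[OF D u1D(1) u1D' j])
      ultimately show ?thesis using False by (simp add: zvar_def unit_point_def)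
    qed
    have "meval of_int (unit_point \<xi>) P = meval of_int (\<lambda>i. h (zvar u1 i)) P"
      by (rule meval_cong[OF P]) (simp add: z)
    also have "\<dots> = h (meval of_int (zvar u1) P)" by (rule hom_on_meval[OF h(1) P, symmetric]) (simp add: z)
    also have "\<dots> = 0" unfolding P0 by (rule hom_on_zero[OF h(1)])
    finally show "ceval (unit_point \<xi>) (int_coeffs P) = 0" unfolding meval_map_coeffs[OF rhf_of_int rhf_id] .
  qed
qed

end

section \<open>Tensoring with the complex numbers\<close>

abbreviation type_ring :: "'a::comm_ring_1 ring" where
  "type_ring \<equiv> ring_of_type_algebra"

abbreviation sub_ring :: "'a::comm_ring_1 set \<Rightarrow> 'a ring" where
  "sub_ring D \<equiv> type_ring\<lparr>carrier := D\<rparr>"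

lemma type_ring_simps [simp]:
  "carrier (type_ring :: 'a::comm_ring_1 ring) = UNIV"
  "monoid.mult (type_ring :: 'a ring) = (*)" "monoid.one (type_ring :: 'a ring) = 1"
  "ring.zero (type_ring :: 'a ring) = 0" "ring.add (type_ring :: 'a ring) = (+)"
  by (simp_all add: ring_of_type_algebra_def)

lemma abelian_group_typeclass:
  fixes R :: "('a::ab_group_add, 'm) ring_scheme"
  assumes "ring.add R = (+)" "ring.zero R = 0" "\<And>x y. x \<in> carrier R \<Longrightarrow> y \<in> carrier R \<Longrightarrow> x + y \<in> carrier R"
    "0 \<in> carrier R" "\<And>x. x \<in> carrier R \<Longrightarrow> - x \<in> carrier R"
  shows "abelian_group R"
proof (rule abelian_groupI)
  show "\<exists>y\<in>carrier R. y \<oplus>\<^bsub>R\<^esub> x = \<zero>\<^bsub>R\<^esub>" if "x \<in> carrier R" for x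
    using assms(5)[OF that] by (intro bexI[of _ "- x"]) (simp_all add: assms(1,2))
qed (simp_all add: assms algebra_simps)

lemma a_inv_typeclass:
  fixes R :: "('a::ab_group_add, 'm) ring_scheme"
  assumes "ring R" "ring.add R = (+)" "ring.zero R = 0" "x \<in> carrier R" "- x \<in> carrier R"
  shows "\<ominus>\<^bsub>R\<^esub> x = - x"
proof -
  interpret ring R by fact
  show ?thesis by (rule minus_equality) (simp_all add: assms)
qed

lemma ideal_typeclass:
  fixes R :: "('a::ab_group_add, 'm) ring_scheme"
  assumes R: "ring R" "ring.add R = (+)" "ring.zero R = 0" "\<And>x. x \<in> carrier R \<Longrightarrow> - x \<in> carrier R"
    and J: "J \<subseteq> carrier R" "0 \<in> J" "\<And>a b. a \<in> J \<Longrightarrow> b \<in> J \<Longrightarrow> a + b \<in> J" "\<And>a. a \<in> J \<Longrightarrow> - a \<in> J"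
    "\<And>a x. a \<in> J \<Longrightarrow> x \<in> carrier R \<Longrightarrow> x \<otimes>\<^bsub>R\<^esub> a \<in> J" "\<And>a x. a \<in> J \<Longrightarrow> x \<in> carrier R \<Longrightarrow> a \<otimes>\<^bsub>R\<^esub> x \<in> J"
  shows "ideal J R"
proof (rule idealI[OF R(1)])
  show "subgroup J (add_monoid R)"
  proof
    fix x assume x: "x \<in> J"
    have "inv\<^bsub>add_monoid R\<^esub> x = - x"
      using a_inv_typeclass[OF R(1-3)] x J(1) R(4) by (auto simp: a_inv_def)
    then show "inv\<^bsub>add_monoid R\<^esub> x \<in> J" using J(4)[OF x] by simp
  qed (use J R in auto)
qed (use J in auto)

lemma cring_sub_ring:
  assumes D: "is_subring D"
  shows "cring (sub_ring D)"
proof (rule cringI)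
  show "abelian_group (sub_ring D)" by (rule abelian_group_typeclass) (simp_all add: sr_closed[OF D])
  show "Group.comm_monoid (sub_ring D)" by (rule comm_monoidI) (simp_all add: sr_closed[OF D] mult_ac)
qed (simp add: algebra_simps)

lemma ring_sub_ring: "is_subring D \<Longrightarrow> ring (sub_ring D)"
  using cring_sub_ring cring.axioms(1) by blast

lemma generate_ring_typeclass: "generate_ring type_ring G = gen_ring (G :: 'a::comm_ring_1 set)"
proof
  have R: "ring (type_ring :: 'a ring)" by (rule ring_from_type_algebra)
  have inv: "\<ominus>\<^bsub>type_ring\<^esub> x = - x" for x :: 'a by (rule a_inv_typeclass[OF R]) simp_all
  show "generate_ring type_ring G \<subseteq> gen_ring G"
  proof
    fix x assume "x \<in> generate_ring type_ring G"
    then show "x \<in> gen_ring G" by (induction rule: generate_ring.induct) (auto simp: inv intro: gr_closed gr_incl)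
  qed
  show "gen_ring G \<subseteq> generate_ring type_ring G"
  proof (rule gen_ring_least)
    show "is_subring (generate_ring type_ring G)"
    proof (rule is_subringI)
      show "1 \<in> generate_ring type_ring G" using generate_ring.one[of type_ring G] by simp
      fix a b assume ab: "a \<in> generate_ring type_ring G" "b \<in> generate_ring type_ring G"
      show "a * b \<in> generate_ring type_ring G" using generate_ring.eng_mult[OF ab] by simp
      show "a - b \<in> generate_ring type_ring G"
        using generate_ring.eng_add[OF ab(1) generate_ring.a_inv[OF ab(2)]] by (simp add: inv)
    qed
  qed (auto intro: generate_ring.incl)
qed

lemma cluster_algebra_Z_eq: "cluster_algebra_Z r l S = sub_ring (ext_ring r l S)"
  by (simp add: cluster_algebra_Z_def generate_ring_typeclass)

lemma mpol_ring_eq: "mpol_ring K = sub_ring (mpols K)"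
  by (simp add: mpol_ring_def)

text \<open>The multiplication of \<open>pair_ring\<close> detached from its record, so that its
  laws can be proved by induction on finitely supported functions.\<close>

definition pair_mult :: "('a::comm_ring_1 \<times> 'b::comm_ring_1 \<Rightarrow>\<^sub>0 int) \<Rightarrow> ('a \<times> 'b \<Rightarrow>\<^sub>0 int) \<Rightarrow> ('a \<times> 'b \<Rightarrow>\<^sub>0 int)" where
  "pair_mult f g = (\<Sum>x \<in> keys f. \<Sum>y \<in> keys g.
     single (fst x * fst y, snd x * snd y) (lookup f x * lookup g y))"

lemma pair_mult_superset:
  assumes "finite A" "keys f \<subseteq> A" "finite B" "keys g \<subseteq> B"
  shows "pair_mult f g = (\<Sum>x\<in>A. \<Sum>y\<in>B.
     single (fst x * fst y, snd x * snd y) (lookup f x * lookup g y))"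
proof -
  have "(\<Sum>y \<in> keys g. single (fst x * fst y, snd x * snd y) (lookup f x * lookup g y))
      = (\<Sum>y\<in>B. single (fst x * fst y, snd x * snd y) (lookup f x * lookup g y))" for x
    by (rule sum.mono_neutral_left) (use assms in \<open>auto simp: in_keys_iff\<close>)
  then show ?thesis unfolding pair_mult_def by (subst sum.mono_neutral_left[OF assms(1,2)]) (auto simp: in_keys_iff)
qed

lemma pair_mult_single: "pair_mult (single x m) (single y n) =
    single (fst x * fst y, snd x * snd y) (m * n)"
  by (subst pair_mult_superset[of "{x}" _ "{y}"]) auto

lemma pair_mult_comm: "pair_mult f g = pair_mult g f"
  unfolding pair_mult_def by (subst sum.swap) (simp add: mult.commute)

lemma pair_mult_add: "pair_mult (f + f') g = pair_mult f g + pair_mult f' g"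
proof -
  let ?A = "keys f \<union> keys f'" and ?B = "keys g"
  have "keys (f + f') \<subseteq> ?A" by (rule Poly_Mapping.keys_add)
  then show ?thesis by (subst (1 2 3) pair_mult_superset[of ?A _ ?B])
      (auto simp: lookup_add single_add distrib_right sum.distrib)
qed

lemma pair_mult_add_right: "pair_mult f (g + g') = pair_mult f g + pair_mult f g'"
  using pair_mult_add[of g g' f] by (simp add: pair_mult_comm[of f])

lemma pair_mult_zero [simp]: "pair_mult 0 g = 0" "pair_mult f 0 = 0"
  by (simp_all add: pair_mult_def)

lemma pair_mult_assoc: "pair_mult (pair_mult f g) h = pair_mult f (pair_mult g h)"
proof (induction f rule: mpol_induct)
  case (single x a)
  show ?case
  proof (induction g rule: mpol_induct)
    case (single y b)
    show ?case by (induction h rule: mpol_induct) (simp_all add: pair_mult_single pair_mult_add_right mult.assoc)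
  qed (simp_all add: pair_mult_add pair_mult_add_right)
qed (simp_all add: pair_mult_add)

lemma pair_mult_one: "pair_mult (single (1, 1) 1) f = f"
  by (induction f rule: mpol_induct) (simp_all add: pair_mult_single pair_mult_add_right)

lemma pair_ring_simps:
  "carrier (pair_ring (sub_ring A) (type_ring :: 'b::comm_ring_1 ring)) = {f. keys f \<subseteq> A \<times> UNIV}"
  "monoid.mult (pair_ring (sub_ring A) (type_ring :: 'b ring)) = pair_mult"
  "monoid.one (pair_ring (sub_ring A) (type_ring :: 'b ring)) = single (1, 1) 1"
  "ring.zero (pair_ring (sub_ring A) (type_ring :: 'b ring)) = 0"
  "ring.add (pair_ring (sub_ring A) (type_ring :: 'b ring)) = (+)"
  by (simp_all add: pair_ring_def pair_mult_def fun_eq_iff)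

text \<open>\<open>ker\<close> is the bridge from integral to complex coefficients: relations of the
  generators over the integers become complex combinations of the \<open>e i\<close>. It identifies
  the tensor product with complex polynomials modulo these combinations.\<close>

locale tensor_model =
  fixes A :: "'f::comm_ring_1 set" and K :: "'v set" and g :: "'v \<Rightarrow> 'f" and n :: nat and e :: "nat \<Rightarrow> ('v, int) mpol"
  assumes A_eq: "A = gen_ring (g ` K)"
    and e: "\<And>i. i \<in> {1..n} \<Longrightarrow> e i \<in> mpols K" "\<And>i. i \<in> {1..n} \<Longrightarrow> meval of_int g (e i) = 0"
    and ker: "\<And>P. P \<in> mpols K \<Longrightarrow> meval of_int g P = 0 \<Longrightarrow>
      int_coeffs P \<in> lincomb (mpols K) n (\<lambda>i. int_coeffs (e i) :: ('v, complex) mpol)"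
begin

abbreviation PR :: "('f \<times> complex \<Rightarrow>\<^sub>0 int) ring" where
  "PR \<equiv> pair_ring (sub_ring A) type_ring"

abbreviation CR :: "('f \<times> complex \<Rightarrow>\<^sub>0 int) set" where
  "CR \<equiv> {f. keys f \<subseteq> A \<times> UNIV}"

abbreviation B :: "('f \<times> complex \<Rightarrow>\<^sub>0 int) set" where
  "B \<equiv> bilinear_ideal (sub_ring A) type_ring"

abbreviation T :: "('f \<times> complex \<Rightarrow>\<^sub>0 int) set ring" where
  "T \<equiv> tensor_ring (sub_ring A) type_ring"

definition J :: "('v, complex) mpol set" where
  "J = lincomb (mpols K) n (\<lambda>i. int_coeffs (e i))"

abbreviation elt :: "'f \<Rightarrow> complex \<Rightarrow> 'f \<times> complex \<Rightarrow>\<^sub>0 int" where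
  "elt a c \<equiv> single (a, c) 1"

lemma A_sub: "is_subring A" unfolding A_eq by (rule gen_ring_sr)

lemmas A_closed = sr_closed[OF A_sub]

lemma A_meval: "a \<in> A \<longleftrightarrow> (\<exists>P\<in>mpols K. a = meval of_int g P)"
  unfolding A_eq gen_ring_image_eq by auto

lemma monom_in_A: "keys m \<subseteq> K \<Longrightarrow> monom_val g m \<in> A"
  unfolding monom_val_def A_eq by (intro gr_closed(7,9) gr_incl) auto

lemma CR_zero: "0 \<in> CR" and CR_add: "f \<in> CR \<Longrightarrow> h \<in> CR \<Longrightarrow> f + h \<in> CR"
  and CR_uminus: "f \<in> CR \<Longrightarrow> - f \<in> CR" and CR_single: "a \<in> A \<Longrightarrow> single (a, c) k \<in> CR"
proof -
  show "0 \<in> CR" by simp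
  show "f \<in> CR \<Longrightarrow> h \<in> CR \<Longrightarrow> f + h \<in> CR" using Poly_Mapping.keys_add[of f h] by blast
  have "keys (- f) = keys f" by (simp add: set_eq_iff in_keys_iff)
  then show "f \<in> CR \<Longrightarrow> - f \<in> CR" by simp
  show "a \<in> A \<Longrightarrow> single (a, c) k \<in> CR" by simp
qed

lemma CR_sum: "(\<And>i. i \<in> U \<Longrightarrow> f i \<in> CR) \<Longrightarrow> sum f U \<in> CR"
  by (induction U rule: infinite_finite_induct) (use CR_zero CR_add in auto)

lemma CR_diff: "f \<in> CR \<Longrightarrow> h \<in> CR \<Longrightarrow> f - h \<in> CR"
  using CR_add[OF _ CR_uminus, of f h] by simp

lemma CR_mult: "f \<in> CR \<Longrightarrow> h \<in> CR \<Longrightarrow> pair_mult f h \<in> CR"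
  unfolding pair_mult_def by (intro CR_sum CR_single A_closed) auto

lemma cring_PR: "cring PR"
proof (rule cringI)
  show "abelian_group PR"
    by (rule abelian_group_typeclass) (use CR_add CR_zero CR_uminus in \<open>simp_all add: pair_ring_simps\<close>)
  show "Group.comm_monoid PR"
  proof (rule comm_monoidI)
    show "\<one>\<^bsub>PR\<^esub> \<in> carrier PR" unfolding pair_ring_simps by (rule CR_single) (rule A_closed(1))
    show "x \<otimes>\<^bsub>PR\<^esub> y \<in> carrier PR" if "x \<in> carrier PR" "y \<in> carrier PR" for x y
      using that unfolding pair_ring_simps by (rule CR_mult)
    show "x \<otimes>\<^bsub>PR\<^esub> y = y \<otimes>\<^bsub>PR\<^esub> x" for x y unfolding pair_ring_simps by (rule pair_mult_comm)
  qed (simp_all only: pair_ring_simps pair_mult_assoc pair_mult_one)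
qed (simp only: pair_ring_simps pair_mult_add)

lemma ring_PR: "ring PR" using cring_PR cring.axioms(1) by blast

lemma rels_eq: "bilinear_rels (sub_ring A) type_ring =
    {elt (a + a') c - elt a c - elt a' c | a a' c. a \<in> A \<and> a' \<in> A} \<union>
    {elt a (c + c') - elt a c - elt a c' | a c c'. a \<in> A}"
  by (simp add: bilinear_rels_def)

lemma rels_in: "bilinear_rels (sub_ring A) type_ring \<subseteq> carrier PR"
proof
  fix f :: "'f \<times> complex \<Rightarrow>\<^sub>0 int" assume "f \<in> bilinear_rels (sub_ring A) type_ring"
  then show "f \<in> carrier PR" unfolding rels_eq pair_ring_simps
  proof (elim UnE CollectE exE conjE)
    fix a a' c assume *: "f = elt (a + a') c - elt a c - elt a' c" "a \<in> A" "a' \<in> A"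
    show "f \<in> CR" unfolding *(1) by (intro CR_diff CR_single A_closed(6) *)
  next
    fix a c c' assume *: "f = elt a (c + c') - elt a c - elt a c'" "a \<in> A"
    show "f \<in> CR" unfolding *(1) by (intro CR_diff CR_single *)
  qed
qed

lemma ideal_B: "ideal B PR"
  unfolding bilinear_ideal_def by (rule ring.genideal_ideal[OF ring_PR rels_in])

lemma B_rel: "a \<in> A \<Longrightarrow> a' \<in> A \<Longrightarrow> elt (a + a') c - elt a c - elt a' c \<in> B"
  "a \<in> A \<Longrightarrow> elt a (c + c') - elt a c - elt a c' \<in> B"
proof -
  have r: "bilinear_rels (sub_ring A) type_ring \<subseteq> B"
    unfolding bilinear_ideal_def by (rule ring.genideal_self[OF ring_PR rels_in])
  show "a \<in> A \<Longrightarrow> a' \<in> A \<Longrightarrow> elt (a + a') c - elt a c - elt a' c \<in> B"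
    by (rule subsetD[OF r]) (unfold rels_eq, blast)
  show "a \<in> A \<Longrightarrow> elt a (c + c') - elt a c - elt a c' \<in> B"
    by (rule subsetD[OF r]) (unfold rels_eq, blast)
qed

lemma B_sub: "f \<in> B \<Longrightarrow> f \<in> CR"
  using additive_subgroup.a_subset[OF ideal.axioms(1)[OF ideal_B]] unfolding pair_ring_simps by blast

lemma B_zero: "0 \<in> B"
  using additive_subgroup.zero_closed[OF ideal.axioms(1)[OF ideal_B]] unfolding pair_ring_simps .

lemma B_add: "f \<in> B \<Longrightarrow> h \<in> B \<Longrightarrow> f + h \<in> B"
  using additive_subgroup.a_closed[OF ideal.axioms(1)[OF ideal_B]] unfolding pair_ring_simps .

lemma B_uminus: "f \<in> B \<Longrightarrow> - f \<in> B"
proof -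
  assume f: "f \<in> B"
  have "\<ominus>\<^bsub>PR\<^esub> f \<in> B"
    by (rule additive_subgroup.a_inv_closed[OF ideal.axioms(1)[OF ideal_B] f])
  moreover have "\<ominus>\<^bsub>PR\<^esub> f = - f"
    by (rule a_inv_typeclass[OF ring_PR]) (use B_sub[OF f] CR_uminus in \<open>simp_all add: pair_ring_simps\<close>)
  ultimately show ?thesis by simp
qed

lemma B_mult: "f \<in> B \<Longrightarrow> h \<in> CR \<Longrightarrow> pair_mult h f \<in> B"
  using ideal.I_l_closed[OF ideal_B, of f h] unfolding pair_ring_simps .

lemma B_sum: "(\<And>i. i \<in> U \<Longrightarrow> f i \<in> B) \<Longrightarrow> sum f U \<in> B"
  by (induction U rule: infinite_finite_induct) (auto intro: B_zero B_add)

lemma B_zero_right: "a \<in> A \<Longrightarrow> elt a 0 \<in> B" and B_zero_left: "elt 0 c \<in> B"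
  using B_uminus[OF B_rel(2)[of a 0 0]] B_uminus[OF B_rel(1)[OF A_closed(2) A_closed(2), of c]] by simp_all

definition sim :: "('f \<times> complex \<Rightarrow>\<^sub>0 int) \<Rightarrow> ('f \<times> complex \<Rightarrow>\<^sub>0 int) \<Rightarrow> bool" where
  "sim f h \<longleftrightarrow> f - h \<in> B"

lemma sim_refl [simp]: "sim f f" by (simp add: sim_def B_zero)

lemma sim_sym: "sim f h \<Longrightarrow> sim h f" using B_uminus[of "f - h"] by (simp add: sim_def)

lemma sim_trans [trans]: "sim f h \<Longrightarrow> sim h k \<Longrightarrow> sim f k"
  using B_add[of "f - h" "h - k"] by (simp add: sim_def)

lemma sim_add: "sim f f' \<Longrightarrow> sim h h' \<Longrightarrow> sim (f + h) (f' + h')"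
  using B_add[of "f - f'" "h - h'"] by (simp add: sim_def algebra_simps)

lemma sim_sum: "(\<And>i. i \<in> U \<Longrightarrow> sim (f i) (f' i)) \<Longrightarrow> sim (sum f U) (sum f' U)"
  using B_sum[of U "\<lambda>i. f i - f' i"] by (simp add: sim_def sum_subtractf)

lemma sim_mult:
  assumes "sim f f'" "sim h h'" "f \<in> CR" "h' \<in> CR"
  shows "sim (pair_mult f h) (pair_mult f' h')"
proof -
  have dl: "pair_mult f h = pair_mult f (h - h') + pair_mult f h'" using pair_mult_add_right[of f "h - h'" h'] by simp
  have dr: "pair_mult f h' = pair_mult (f - f') h' + pair_mult f' h'" using pair_mult_add[of "f - f'" f' h'] by simp
  have "pair_mult f (h - h') + pair_mult h' (f - f') \<in> B" using assms unfolding sim_def by (intro B_add B_mult)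
  moreover have "pair_mult f (h - h') + pair_mult h' (f - f') = pair_mult f h - pair_mult f' h'"
    unfolding pair_mult_comm[of h' "f - f'"] dl dr by simp
  ultimately show ?thesis by (simp add: sim_def)
qed

lemma sim_add_right: "a \<in> A \<Longrightarrow> sim (elt a (c + c')) (elt a c + elt a c')"
  and sim_add_left: "a \<in> A \<Longrightarrow> a' \<in> A \<Longrightarrow> sim (elt (a + a') c) (elt a c + elt a' c)"
  using B_rel(2)[of a c c'] B_rel(1)[of a a' c] by (simp_all add: sim_def diff_diff_eq)

lemma sim_of_int_right:
  assumes a: "a \<in> A"
  shows "sim (elt a (of_int k * c)) (single (a, c) k)"
proof (induction k rule: int_induct[of _ 0])
  case base
  show ?case using B_zero_right[OF a] by (simp add: sim_def)
next
  case (step1 k)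
  have "sim (elt a (of_int (k + 1) * c)) (elt a (of_int k * c) + elt a c)"
    using sim_add_right[OF a, of "of_int k * c" c] by (simp add: algebra_simps)
  also have "sim \<dots> (single (a, c) k + elt a c)" by (rule sim_add[OF step1(2)]) simp
  finally show ?case by (simp add: single_add)
next
  case (step2 k)
  have "sim (elt a (of_int k * c)) (elt a (of_int (k - 1) * c) + elt a c)"
    using sim_add_right[OF a, of "of_int (k - 1) * c" c] by (simp add: algebra_simps)
  then have "sim (elt a (of_int (k - 1) * c) + elt a c) (single (a, c) k)" by (rule sim_trans[OF sim_sym step2(2)])
  then show ?case by (simp add: sim_def single_diff algebra_simps)
qed

lemma sim_of_int_left:
  assumes a: "a \<in> A"
  shows "sim (elt (of_int k * a) c) (single (a, c) k)"
proof (induction k rule: int_induct[of _ 0])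
  case base
  show ?case using B_zero_left by (simp add: sim_def)
next
  case (step1 k)
  have ka: "of_int k * a \<in> A" by (intro A_closed a)
  have "sim (elt (of_int (k + 1) * a) c) (elt (of_int k * a) c + elt a c)"
    using sim_add_left[OF ka a, of c] by (simp add: algebra_simps)
  also have "sim \<dots> (single (a, c) k + elt a c)" by (rule sim_add[OF step1(2)]) simp
  finally show ?case by (simp add: single_add)
next
  case (step2 k)
  have ka: "of_int (k - 1) * a \<in> A" by (intro A_closed a)
  have "sim (elt (of_int k * a) c) (elt (of_int (k - 1) * a) c + elt a c)"
    using sim_add_left[OF ka a, of c] by (simp add: algebra_simps)
  then have "sim (elt (of_int (k - 1) * a) c + elt a c) (single (a, c) k)" by (rule sim_trans[OF sim_sym step2(2)])
  then show ?case by (simp add: sim_def single_diff algebra_simps)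
qed

text \<open>A representative, in the free abelian group on pairs, of the element that
  \<open>P\<close> defines in the tensor product. It respects sums and products only up to
  \<open>sim\<close>, that is modulo the bilinear relations.\<close>

definition psi :: "('v, complex) mpol \<Rightarrow> ('f \<times> complex \<Rightarrow>\<^sub>0 int)" where
  "psi P = (\<Sum>m\<in>keys P. elt (monom_val g m) (lookup P m))"

lemma keys_in: "P \<in> mpols K \<Longrightarrow> m \<in> keys P \<Longrightarrow> keys m \<subseteq> K"
  by (auto simp: mpols_def)

lemma psi_in: "P \<in> mpols K \<Longrightarrow> psi P \<in> CR"
  unfolding psi_def by (intro CR_sum CR_single monom_in_A keys_in)

lemma psi_zero [simp]: "psi 0 = 0"
  by (simp add: psi_def)

lemma psi_superset:
  assumes "finite U" "keys P \<subseteq> U" "\<And>m. m \<in> U \<Longrightarrow> keys m \<subseteq> K"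
  shows "sim (psi P) (\<Sum>m\<in>U. elt (monom_val g m) (lookup P m))"
proof -
  have "(\<Sum>m\<in>U. elt (monom_val g m) (lookup P m)) - psi P =
      (\<Sum>m\<in>U - keys P. elt (monom_val g m) (lookup P m))"
    unfolding psi_def by (rule sum_diff[OF assms(1,2), symmetric])
  also have "\<dots> \<in> B"
    by (rule B_sum) (use assms(3) in \<open>auto simp: in_keys_iff intro!: B_zero_right monom_in_A\<close>)
  finally show ?thesis using sim_sym by (simp add: sim_def)
qed

lemma psi_single:
  assumes "keys m \<subseteq> K"
  shows "sim (psi (single m c)) (elt (monom_val g m) c)"
  using psi_superset[of "{m}" "single m c"] assms by simp

lemma psi_add:
  assumes "P \<in> mpols K" "Q \<in> mpols K"
  shows "sim (psi (P + Q)) (psi P + psi Q)"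
proof -
  let ?U = "keys P \<union> keys Q"
  have U: "finite ?U" "\<And>m. m \<in> ?U \<Longrightarrow> keys m \<subseteq> K" using assms keys_in by auto
  have "sim (psi (P + Q)) (\<Sum>m\<in>?U. elt (monom_val g m) (lookup (P + Q) m))"
    by (rule psi_superset[OF U(1) Poly_Mapping.keys_add U(2)])
  also have "sim \<dots> (\<Sum>m\<in>?U. elt (monom_val g m) (lookup P m) + elt (monom_val g m) (lookup Q m))"
    unfolding lookup_add by (intro sim_sum sim_add_right monom_in_A U(2))
  also have "sim \<dots> (psi P + psi Q)"
    unfolding sum.distrib by (intro sim_add sim_sym[OF psi_superset[OF U(1)]] U(2)) auto
  finally show ?thesis .
qed

lemma psi_mult:
  assumes "P \<in> mpols K" "Q \<in> mpols K"
  shows "sim (psi (P * Q)) (pair_mult (psi P) (psi Q))"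
  using assms(1)
proof (induction rule: mpols_induct)
  case (single m c)
  have sK: "single m c \<in> mpols K" by (rule single_in_mpols[OF single])
  show ?case using assms(2)
  proof (induction rule: mpols_induct)
    case (single m' c')
    have mm: "keys (m + m') \<subseteq> K"
      using single \<open>keys m \<subseteq> K\<close> by (simp add: keys_add_nat)
    have "sim (psi (single m c * single m' c')) (elt (monom_val g (m + m')) (c * c'))"
      unfolding mult_single by (rule psi_single[OF mm])
    also have "elt (monom_val g (m + m')) (c * c') = pair_mult (elt (monom_val g m) c) (elt (monom_val g m') c')"
      by (simp add: pair_mult_single monom_val_add)
    also have "sim \<dots> (pair_mult (psi (single m c)) (psi (single m' c')))"
      using \<open>keys m \<subseteq> K\<close> single
      by (intro sim_mult sim_sym[OF psi_single] CR_single monom_in_A psi_in single_in_mpols)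
    finally show ?case .
  next
    case (add p q)
    have "sim (psi (single m c * (p + q))) (psi (single m c * p) + psi (single m c * q))"
      unfolding distrib_left by (intro psi_add mpols_closed(4) sK add(1,2))
    also have "sim \<dots> (pair_mult (psi (single m c)) (psi p) + pair_mult (psi (single m c)) (psi q))"
      by (rule sim_add[OF add(3,4)])
    also have "\<dots> = pair_mult (psi (single m c)) (psi p + psi q)" by (simp only: pair_mult_add_right)
    also have "sim \<dots> (pair_mult (psi (single m c)) (psi (p + q)))"
      by (intro sim_mult sim_refl sim_sym[OF psi_add] psi_in sK mpols_closed(6) add(1,2))
    finally show ?case .
  qed simp
next
  case (add p q)
  have "sim (psi ((p + q) * Q)) (psi (p * Q) + psi (q * Q))"
    unfolding distrib_right by (intro psi_add mpols_closed(4) assms(2) add(1,2))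
  also have "sim \<dots> (pair_mult (psi p) (psi Q) + pair_mult (psi q) (psi Q))" by (rule sim_add[OF add(3,4)])
  also have "\<dots> = pair_mult (psi p + psi q) (psi Q)" by (simp only: pair_mult_add)
  also have "sim \<dots> (pair_mult (psi (p + q)) (psi Q))"
    by (intro sim_mult sim_refl sim_sym[OF psi_add] psi_in CR_add assms(2) mpols_closed(6) add(1,2))
  finally show ?case .
qed simp

lemma psi_mconst: "sim (psi (mconst c)) (elt 1 c)"
  using psi_single[of 0 c] by (simp add: mconst_def)

lemma psi_map_coeffs:
  assumes "P \<in> mpols K"
  shows "sim (psi (int_coeffs P)) (elt (meval of_int g P) 1)"
  using assms
proof (induction rule: mpols_induct)
  case zero
  then show ?case using B_uminus[OF B_zero_left] by (simp add: map_coeffs_zero[OF rhf_of_int] sim_def)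
next
  case (single m k)
  have mA: "monom_val g m \<in> A" by (rule monom_in_A[OF single])
  have "sim (psi (int_coeffs (single m k))) (elt (monom_val g m) (of_int k * 1))"
    unfolding map_coeffs_single[OF rhf_of_int] using psi_single[OF single, of "of_int k"] by simp
  also have "sim \<dots> (single (monom_val g m, 1) k)" by (rule sim_of_int_right[OF mA])
  also have "sim \<dots> (elt (of_int k * monom_val g m) 1)" by (rule sim_sym[OF sim_of_int_left[OF mA]])
  finally show ?case by (simp add: meval_single[OF rhf_of_int])
next
  case (add p q)
  have pqA: "meval of_int g p \<in> A" "meval of_int g q \<in> A" using A_meval add(1,2) by auto
  have "sim (psi (int_coeffs (p + q))) (psi (int_coeffs p) + psi (int_coeffs q))"
    unfolding map_coeffs_add[OF rhf_of_int] by (intro psi_add map_coeffs_in_mpols[OF rhf_of_int] add(1,2))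
  also have "sim \<dots> (elt (meval of_int g p) 1 + elt (meval of_int g q) 1)" by (rule sim_add[OF add(3,4)])
  also have "sim \<dots> (elt (meval of_int g (p + q)) 1)" using sim_sym[OF sim_add_left[OF pqA]] by simp
  finally show ?case .
qed

definition lift :: "'f \<Rightarrow> ('v, int) mpol" where
  "lift a = (SOME P. P \<in> mpols K \<and> meval of_int g P = a)"

lemma lift: "a \<in> A \<Longrightarrow> lift a \<in> mpols K" "a \<in> A \<Longrightarrow> meval of_int g (lift a) = a"
  using someI_ex[of "\<lambda>P. P \<in> mpols K \<and> meval of_int g P = a"] A_meval[of a] unfolding lift_def by blast+

text \<open>\<open>theta\<close> is a left inverse of \<open>psi\<close> modulo \<open>J\<close>, independent of the choice of the lifts by \<open>ker\<close>.\<close>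

definition theta :: "('f \<times> complex \<Rightarrow>\<^sub>0 int) \<Rightarrow> ('v, complex) mpol" where
  "theta f = (\<Sum>x\<in>keys f. of_int (lookup f x) * (mconst (snd x) * int_coeffs (lift (fst x))))"

lemma theta_superset: "finite U \<Longrightarrow> keys f \<subseteq> U \<Longrightarrow>
    theta f = (\<Sum>x\<in>U. of_int (lookup f x) * (mconst (snd x) * int_coeffs (lift (fst x))))"
  unfolding theta_def by (rule sum.mono_neutral_left) (auto simp: in_keys_iff)

lemma theta_add: "theta (f + h) = theta f + theta h"
proof -
  let ?U = "keys f \<union> keys h"
  have "keys (f + h) \<subseteq> ?U" by (rule Poly_Mapping.keys_add)
  then show ?thesis by (subst (1 2 3) theta_superset[of ?U]) (auto simp: lookup_add distrib_right sum.distrib)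
qed

lemma theta_zero [simp]: "theta 0 = 0" by (simp add: theta_def)

lemma theta_uminus: "theta (- f) = - theta f"
  using theta_add[of f "- f"] by (simp add: eq_neg_iff_add_eq_0 add.commute)

lemma theta_diff: "theta (f - h) = theta f - theta h"
  using theta_add[of f "- h"] by (simp add: theta_uminus)

lemma theta_sum: "theta (sum f U) = (\<Sum>i\<in>U. theta (f i))"
  by (induction U rule: infinite_finite_induct) (auto simp: theta_add)

lemma theta_single: "theta (single (a, c) k) = of_int k * (mconst c * int_coeffs (lift a))"
  by (subst theta_superset[of "{(a, c)}"]) auto

lemma theta_in: "f \<in> CR \<Longrightarrow> theta f \<in> mpols K"
  unfolding theta_def
  by (intro mpols_closed(8,4,10) mconst_in_mpols map_coeffs_in_mpols[OF rhf_of_int] lift) auto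

lemma J_closed: "0 \<in> J" "P \<in> J \<Longrightarrow> Q \<in> J \<Longrightarrow> P + Q \<in> J" "P \<in> J \<Longrightarrow> - P \<in> J"
  "P \<in> mpols K \<Longrightarrow> Q \<in> J \<Longrightarrow> P * Q \<in> J" "(\<And>i. i \<in> U \<Longrightarrow> F i \<in> J) \<Longrightarrow> sum F U \<in> J"
proof -
  note M = mpols_sr
  show "0 \<in> J" unfolding J_def by (rule lincomb_zero[OF M])
  show "P \<in> J \<Longrightarrow> Q \<in> J \<Longrightarrow> P + Q \<in> J" unfolding J_def by (rule lincomb_add[OF M])
  show "P \<in> J \<Longrightarrow> - P \<in> J" unfolding J_def by (rule lincomb_uminus[OF M])
  show "P \<in> mpols K \<Longrightarrow> Q \<in> J \<Longrightarrow> P * Q \<in> J" unfolding J_def by (rule lincomb_mult[OF M])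
  show "sum F U \<in> J" if "\<And>i. i \<in> U \<Longrightarrow> F i \<in> J"
    using that unfolding J_def by (rule lincomb_sum[OF M])
qed

lemma J_sub: "J \<subseteq> mpols K"
  unfolding J_def by (rule lincomb_subset[OF mpols_sr]) (intro map_coeffs_in_mpols[OF rhf_of_int] e)

lemma map_coeffs_hom: "hom_on UNIV (int_coeffs :: ('v, int) mpol \<Rightarrow> ('v, complex) mpol)"
  by (rule hom_on_map_coeffs[OF rhf_of_int])

lemma lift_mult: "a \<in> A \<Longrightarrow> b \<in> A \<Longrightarrow> int_coeffs (lift (a * b)) - int_coeffs (lift a) * int_coeffs (lift b) \<in> J"
  and lift_add: "a \<in> A \<Longrightarrow> b \<in> A \<Longrightarrow> int_coeffs (lift (a + b)) - int_coeffs (lift a) - int_coeffs (lift b) \<in> J"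
proof -
  assume ab: "a \<in> A" "b \<in> A"
  have "int_coeffs (lift (a * b) - lift a * lift b) \<in> J"
    unfolding J_def by (rule ker) (auto intro!: mpols_closed lift ab A_closed simp: lift(2)[OF ab(1)] lift(2)[OF ab(2)] lift(2)[OF A_closed(4)[OF ab]])
  then show "int_coeffs (lift (a * b)) - int_coeffs (lift a) * int_coeffs (lift b) \<in> J"
    by (simp add: hom_on_diff[OF map_coeffs_hom] hom_on_mult[OF map_coeffs_hom])
  have "int_coeffs (lift (a + b) - lift a - lift b) \<in> J"
    unfolding J_def by (rule ker) (auto intro!: mpols_closed lift ab A_closed simp: lift(2)[OF ab(1)] lift(2)[OF ab(2)] lift(2)[OF A_closed(6)[OF ab]])
  then show "int_coeffs (lift (a + b)) - int_coeffs (lift a) - int_coeffs (lift b) \<in> J"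
    by (simp add: hom_on_diff[OF map_coeffs_hom])
qed

lemma theta_mult:
  assumes "f \<in> CR" "h \<in> CR"
  shows "theta (pair_mult f h) - theta f * theta h \<in> J"
proof -
  let ?l = "\<lambda>a. int_coeffs (lift a) :: ('v, complex) mpol"
  have "theta (pair_mult f h) - theta f * theta h = (\<Sum>x\<in>keys f. \<Sum>y\<in>keys h.
      (of_int (lookup f x * lookup h y) * (mconst (snd x) * mconst (snd y))) *
      (?l (fst x * fst y) - ?l (fst x) * ?l (fst y)))"
    unfolding pair_mult_def theta_sum theta_single theta_def[of f] theta_def[of h] sum_product sum_subtractf[symmetric]
    by (intro sum.cong refl) (simp add: rhf_mult[OF rhf_mconst] algebra_simps)
  also have "\<dots> \<in> J"
  proof (intro J_closed(5) J_closed(4))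
    fix x y assume "x \<in> keys f" "y \<in> keys h"
    then have "fst x \<in> A" "fst y \<in> A" using assms by auto
    then show "?l (fst x * fst y) - ?l (fst x) * ?l (fst y) \<in> J" by (rule lift_mult)
  qed (intro mpols_closed mconst_in_mpols)
  finally show ?thesis .
qed

text \<open>The elements sent into \<open>J\<close> by \<open>theta\<close> form an ideal of the
  pair ring, and this ideal contains the bilinear relations.\<close>

lemma theta_B: "f \<in> B \<Longrightarrow> theta f \<in> J"
proof -
  let ?I = "{f \<in> CR. theta f \<in> J}"
  have m: "pair_mult x a \<in> ?I" if "a \<in> ?I" "x \<in> CR" for a x
  proof -
    have "theta (pair_mult x a) - theta x * theta a + theta x * theta a \<in> J"
      by (intro J_closed(2) theta_mult J_closed(4) theta_in) (use that in auto)
    then show ?thesis using CR_mult[of x a] that by simp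
  qed
  have "ideal ?I PR"
  proof (rule ideal_typeclass[OF ring_PR])
    show "x \<otimes>\<^bsub>PR\<^esub> a \<in> ?I" if "a \<in> ?I" "x \<in> carrier PR" for a x
      using m[OF that(1)] that(2) unfolding pair_ring_simps .
    show "a \<otimes>\<^bsub>PR\<^esub> x \<in> ?I" if "a \<in> ?I" "x \<in> carrier PR" for a x
      using m[OF that(1)] that(2) unfolding pair_ring_simps pair_mult_comm[of a] .
    show "a + b \<in> ?I" if "a \<in> ?I" "b \<in> ?I" for a b
      using that CR_add[of a b] J_closed(2) by (simp add: theta_add)
    show "- a \<in> ?I" if "a \<in> ?I" for a using that CR_uminus[of a] J_closed(3) by (simp add: theta_uminus)
  qed (use CR_zero CR_uminus J_closed(1) in \<open>auto simp: pair_ring_simps\<close>)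
  moreover have "bilinear_rels (sub_ring A) type_ring \<subseteq> ?I"
  proof
    fix f :: "'f \<times> complex \<Rightarrow>\<^sub>0 int" assume f: "f \<in> bilinear_rels (sub_ring A) type_ring"
    have fC: "f \<in> CR" using f rels_in unfolding pair_ring_simps by blast
    have "theta f \<in> J" using f unfolding rels_eq
    proof (elim UnE CollectE exE conjE)
      fix a a' c assume *: "f = elt (a + a') c - elt a c - elt a' c" "a \<in> A" "a' \<in> A"
      have "mconst c * (int_coeffs (lift (a + a')) - int_coeffs (lift a) - int_coeffs (lift a')) \<in> J"
        by (intro J_closed(4) mconst_in_mpols lift_add *)
      then show "theta f \<in> J" unfolding *(1) by (simp add: theta_diff theta_single right_diff_distrib)
    next
      fix a c c' assume *: "f = elt a (c + c') - elt a c - elt a c'" "a \<in> A"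
      show "theta f \<in> J" unfolding *(1)
        using J_closed(1) by (simp add: theta_diff theta_single rhf_add[OF rhf_mconst] distrib_right)
    qed
    with fC show "f \<in> ?I" by simp
  qed
  ultimately have "B \<subseteq> ?I" unfolding bilinear_ideal_def by (rule ring.genideal_minimal[OF ring_PR])
  then show "f \<in> B \<Longrightarrow> theta f \<in> J" by auto
qed

text \<open>In one direction \<open>theta\<close> is applied, which inverts \<open>psi\<close>
  modulo \<open>J\<close>. In the other, \<open>psi\<close> sends each \<open>e i\<close> to the
  class of 0 tensored with 1.\<close>

lemma psi_B_iff:
  assumes P: "P \<in> mpols K"
  shows "psi P \<in> B \<longleftrightarrow> P \<in> J"
proof
  assume "psi P \<in> B"
  then have 1: "theta (psi P) \<in> J" by (rule theta_B)
  \<comment> \<open>The deviation of \<open>theta (psi P)\<close> from \<open>P\<close>, caused by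
    the chosen lifts of monomials; a lift differs from its monomial by an integral relation.\<close>
  let ?d = "\<Sum>m\<in>keys P. mconst (lookup P m) *
      (int_coeffs (lift (monom_val g m)) - int_coeffs (single m 1))"
  have "P = (\<Sum>m\<in>keys P. mconst (lookup P m) * int_coeffs (single m 1))"
    by (subst mpol_expand[of P]) (simp add: map_coeffs_single[OF rhf_of_int] mconst_def mult_single)
  then have eqP: "theta (psi P) - ?d = P"
    by (simp add: psi_def theta_sum theta_single right_diff_distrib sum_subtractf)
  have dJ: "?d \<in> J"
  proof (intro J_closed(5) J_closed(4) mconst_in_mpols)
    fix m assume "m \<in> keys P"
    then have m: "keys m \<subseteq> K" by (rule keys_in[OF P])
    have "int_coeffs (lift (monom_val g m) - single m 1) \<in> J" unfolding J_def
    proof (rule ker)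
      show "lift (monom_val g m) - single m 1 \<in> mpols K" by (intro mpols_closed lift monom_in_A single_in_mpols m)
      show "meval of_int g (lift (monom_val g m) - single m 1) = 0"
        by (simp add: lift(2)[OF monom_in_A[OF m]] meval_single[OF rhf_of_int])
    qed
    then show "int_coeffs (lift (monom_val g m)) - int_coeffs (single m 1) \<in> J"
      by (simp add: hom_on_diff[OF map_coeffs_hom])
  qed
  have "theta (psi P) + - ?d \<in> J" by (rule J_closed(2)[OF 1 J_closed(3)[OF dJ]])
  then show "P \<in> J" unfolding diff_conv_add_uminus[symmetric] eqP .
next
  assume "P \<in> J"
  then obtain H where H: "\<And>i. H i \<in> mpols K" "P = (\<Sum>i=1..n. H i * int_coeffs (e i))"
    unfolding J_def lincomb_def by auto
  have He: "H i * int_coeffs (e i) \<in> mpols K \<and> psi (H i * int_coeffs (e i)) \<in> B" if i: "i \<in> {1..n}" for i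
  proof
    have E: "int_coeffs (e i) \<in> mpols K" by (intro map_coeffs_in_mpols[OF rhf_of_int] e i)
    show "H i * int_coeffs (e i) \<in> mpols K" by (intro mpols_closed H E)
    have "sim (psi (int_coeffs (e i))) (elt 0 1)" using psi_map_coeffs[OF e(1)[OF i]] e(2)[OF i] by simp
    then have "psi (int_coeffs (e i)) \<in> B" using B_add[OF _ B_zero_left[of 1]] by (fastforce simp: sim_def)
    then have "pair_mult (psi (H i)) (psi (int_coeffs (e i))) \<in> B" by (intro B_mult psi_in H)
    moreover have "sim (psi (H i * int_coeffs (e i))) (pair_mult (psi (H i)) (psi (int_coeffs (e i))))"
      by (rule psi_mult[OF H(1) E])
    ultimately show "psi (H i * int_coeffs (e i)) \<in> B" unfolding sim_def using B_add by fastforce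
  qed
  have "psi (\<Sum>i\<in>U. H i * int_coeffs (e i)) \<in> B" if "finite U" "U \<subseteq> {1..n}" for U using that
  proof (induction U rule: finite_induct)
    case (insert i U)
    have "sim (psi (H i * int_coeffs (e i) + (\<Sum>i\<in>U. H i * int_coeffs (e i))))
        (psi (H i * int_coeffs (e i)) + psi (\<Sum>i\<in>U. H i * int_coeffs (e i)))"
      by (intro psi_add mpols_closed(8)) (use He insert in auto)
    moreover have "psi (H i * int_coeffs (e i)) + psi (\<Sum>i\<in>U. H i * int_coeffs (e i)) \<in> B"
      by (intro B_add) (use He insert in auto)
    ultimately show ?case unfolding sim_def using B_add insert by fastforce
  qed (simp add: B_zero)
  then show "psi P \<in> B" unfolding H(2) by blast
qed

definition phi :: "('v, complex) mpol \<Rightarrow> ('f \<times> complex \<Rightarrow>\<^sub>0 int) set" where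
  "phi P = B +>\<^bsub>PR\<^esub> psi P"

lemma coset_eq_iff:
  assumes "f \<in> CR" "h \<in> CR"
  shows "B +>\<^bsub>PR\<^esub> f = B +>\<^bsub>PR\<^esub> h \<longleftrightarrow> sim f h"
proof -
  have "\<ominus>\<^bsub>PR\<^esub> h = - h"
    by (rule a_inv_typeclass[OF ring_PR]) (use assms CR_uminus in \<open>simp_all add: pair_ring_simps\<close>)
  then have "f \<ominus>\<^bsub>PR\<^esub> h = f - h" by (simp add: a_minus_def pair_ring_simps)
  then show ?thesis
    using ring.quotient_eq_iff_same_a_r_cos[OF ring_PR ideal_B, of f h] assms by (simp add: pair_ring_simps sim_def)
qed

lemma phi_mconst: "phi (mconst c) = pure_tensor (sub_ring A) type_ring 1 c"
  unfolding phi_def pure_tensor_def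
  by (subst coset_eq_iff) (auto intro!: psi_in psi_mconst CR_single A_closed(1) simp del: mem_Collect_eq)

lemma phi_map_coeffs: "P \<in> mpols K \<Longrightarrow> phi (int_coeffs P) = pure_tensor (sub_ring A) type_ring (meval of_int g P) 1"
  unfolding phi_def pure_tensor_def
  by (subst coset_eq_iff)
    (auto intro!: psi_in map_coeffs_in_mpols[OF rhf_of_int] psi_map_coeffs CR_single simp: A_meval simp del: mem_Collect_eq)

lemma ring_T: "ring T"
  unfolding tensor_ring_def by (rule ideal.quotient_is_ring[OF ideal_B])

lemma phi_hom: "phi \<in> ring_hom (mpol_ring K) T"
proof -
  have h: "a_r_coset PR B \<in> ring_hom PR T" unfolding tensor_ring_def by (rule ideal.rcos_ring_hom[OF ideal_B])
  show ?thesis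
  proof (rule ring_hom_memI)
    fix P Q assume "P \<in> carrier (mpol_ring K)" "Q \<in> carrier (mpol_ring K)"
    then have P: "P \<in> mpols K" and Q: "Q \<in> mpols K" by (simp_all add: mpol_ring_eq)
    note PC = psi_in[OF P] and QC = psi_in[OF Q]
    show "phi P \<in> carrier T"
      unfolding phi_def by (rule ring_hom_closed[OF h]) (use PC in \<open>simp add: pair_ring_simps\<close>)
    have "phi (P * Q) = B +>\<^bsub>PR\<^esub> (psi P \<otimes>\<^bsub>PR\<^esub> psi Q)"
      unfolding phi_def pair_ring_simps by (subst coset_eq_iff) (intro psi_in mpols_closed P Q CR_mult psi_mult)+
    also have "\<dots> = phi P \<otimes>\<^bsub>T\<^esub> phi Q"
      unfolding phi_def by (rule ring_hom_mult[OF h]) (use PC QC in \<open>simp_all add: pair_ring_simps\<close>)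
    finally show "phi (P \<otimes>\<^bsub>mpol_ring K\<^esub> Q) = phi P \<otimes>\<^bsub>T\<^esub> phi Q" by (simp add: mpol_ring_eq)
    have "phi (P + Q) = B +>\<^bsub>PR\<^esub> (psi P \<oplus>\<^bsub>PR\<^esub> psi Q)"
      unfolding phi_def pair_ring_simps by (subst coset_eq_iff) (intro psi_in mpols_closed P Q CR_add psi_add)+
    also have "\<dots> = phi P \<oplus>\<^bsub>T\<^esub> phi Q"
      unfolding phi_def by (rule ring_hom_add[OF h]) (use PC QC in \<open>simp_all add: pair_ring_simps\<close>)
    finally show "phi (P \<oplus>\<^bsub>mpol_ring K\<^esub> Q) = phi P \<oplus>\<^bsub>T\<^esub> phi Q" by (simp add: mpol_ring_eq)
  next
    have "phi 1 = B +>\<^bsub>PR\<^esub> \<one>\<^bsub>PR\<^esub>"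
      using phi_mconst[of 1] rhf_one[OF rhf_mconst[where 'c = complex and 'v = 'v]]
      by (simp add: pure_tensor_def pair_ring_simps)
    also have "\<dots> = \<one>\<^bsub>T\<^esub>" by (rule ring_hom_one[OF h])
    finally show "phi \<one>\<^bsub>mpol_ring K\<^esub> = \<one>\<^bsub>T\<^esub>" by (simp add: mpol_ring_eq)
  qed
qed

lemma phi_surj: "phi ` carrier (mpol_ring K) = carrier T"
proof
  show "phi ` carrier (mpol_ring K) \<subseteq> carrier T" using ring_hom_closed[OF phi_hom] by blast
  have main: "\<exists>P\<in>mpols K. sim f (psi P)" if f: "f \<in> CR" for f
  proof -
    \<comment> \<open>Preimage of the term of \<open>f\<close> at the pair \<open>x\<close>: a
      constant for the complex entry times a lift of the algebra entry.\<close>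
    define Q where "Q x = of_int (lookup f x) * mconst (snd x) * int_coeffs (lift (fst x))" for x
    have Q: "Q x \<in> mpols K \<and> sim (single x (lookup f x)) (psi (Q x))"
      if x: "x \<in> keys f" for x
    proof
      obtain a c where ac: "x = (a, c)" by (cases x)
      have a: "a \<in> A" using f x ac by auto
      let ?k = "lookup f x"
      have Lx: "int_coeffs (lift a) \<in> mpols K" by (intro map_coeffs_in_mpols[OF rhf_of_int] lift a)
      show "Q x \<in> mpols K" unfolding Q_def ac by (intro mpols_closed mconst_in_mpols) (use Lx in simp)
      have kc: "of_int ?k * mconst c = mconst (of_int ?k * c)" by (simp add: rhf_mult[OF rhf_mconst] mconst_of_int)
      have "sim (psi (Q x)) (pair_mult (psi (mconst (of_int ?k * c))) (psi (int_coeffs (lift a))))"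
        unfolding Q_def ac fst_conv snd_conv kc[unfolded ac] by (rule psi_mult[OF mconst_in_mpols Lx])
      also have "sim \<dots> (pair_mult (elt 1 (of_int ?k * c)) (elt a 1))"
        using psi_map_coeffs[OF lift(1)[OF a]] lift(2)[OF a]
        by (intro sim_mult psi_mconst psi_in mconst_in_mpols CR_single a) simp
      also have "\<dots> = elt a (of_int ?k * c)" by (simp add: pair_mult_single)
      also have "sim \<dots> (single (a, c) ?k)" by (rule sim_of_int_right[OF a])
      finally show "sim (single x ?k) (psi (Q x))" unfolding ac by (rule sim_sym)
    qed
    have "\<exists>P\<in>mpols K. sim (\<Sum>x\<in>U. single x (lookup f x)) (psi P)"
      if "finite U" "U \<subseteq> keys f" for U using that
    proof (induction U rule: finite_induct)
      case empty
      then show ?case by (intro bexI[of _ 0]) (auto intro: mpols_closed)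
    next
      case (insert x U)
      then obtain P where P: "P \<in> mpols K" "sim (\<Sum>x\<in>U. single x (lookup f x)) (psi P)" by auto
      have Qx: "Q x \<in> mpols K" "sim (single x (lookup f x)) (psi (Q x))" using Q[of x] insert.prems by auto
      have "sim (\<Sum>x\<in>insert x U. single x (lookup f x)) (psi (Q x) + psi P)"
        using insert.hyps by (simp add: sim_add[OF Qx(2) P(2)])
      also have "sim \<dots> (psi (Q x + P))" by (rule sim_sym[OF psi_add[OF Qx(1) P(1)]])
      finally show ?case by (intro bexI[of _ "Q x + P"]) (auto intro: mpols_closed Qx P)
    qed
    from this[of "keys f"] show ?thesis using mpol_expand[of f] by simp
  qed
  show "carrier T \<subseteq> phi ` carrier (mpol_ring K)"
  proof
    fix t assume "t \<in> carrier T"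
    then obtain f where f: "f \<in> carrier PR" "t = B +>\<^bsub>PR\<^esub> f"
      by (auto simp: tensor_ring_def FactRing_def A_RCOSETS_def' )
    have fC: "f \<in> CR" using f(1) unfolding pair_ring_simps .
    from main[OF fC] obtain P where P: "P \<in> mpols K" "sim f (psi P)" by blast
    have "t = phi P" unfolding f(2) phi_def by (subst coset_eq_iff[OF fC psi_in[OF P(1)]]) (rule P(2))
    then show "t \<in> phi ` carrier (mpol_ring K)" using P(1) by (simp add: mpol_ring_eq)
  qed
qed

lemma phi_ring_hom_ring: "ring_hom_ring (mpol_ring K) T phi"
  by (rule ring_hom_ringI2[OF _ ring_T phi_hom]) (simp add: mpol_ring_eq ring_sub_ring mpols_sr)

lemma phi_kernel: "a_kernel (mpol_ring K) T phi = J"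
proof -
  have "phi P = \<zero>\<^bsub>T\<^esub> \<longleftrightarrow> P \<in> J" if P: "P \<in> mpols K" for P
  proof -
    have "\<zero>\<^bsub>T\<^esub> = phi 0"
      using ring_hom_zero[OF phi_hom _ ring_T] by (simp add: mpol_ring_eq ring_sub_ring mpols_sr)
    also have "phi P = phi 0 \<longleftrightarrow> sim (psi P) (psi 0)"
      unfolding phi_def by (rule coset_eq_iff[OF psi_in[OF P] psi_in]) (rule mpols_closed(2))
    finally show ?thesis using psi_B_iff[OF P] by (simp add: sim_def)
  qed
  then show ?thesis using J_sub by (auto simp: a_kernel_def' mpol_ring_eq)
qed

end

context tensor_model
begin

lemma ring_mpol_ring: "ring (mpol_ring K)"
  by (simp add: mpol_ring_eq ring_sub_ring mpols_sr)

lemma ideal_J: "ideal J (mpol_ring K)"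
proof (rule ideal_typeclass[OF ring_mpol_ring])
  show "x \<otimes>\<^bsub>mpol_ring K\<^esub> a \<in> J" if "a \<in> J" "x \<in> carrier (mpol_ring K)" for a x
    using J_closed(4)[of x a] that by (simp add: mpol_ring_eq)
  show "a \<otimes>\<^bsub>mpol_ring K\<^esub> x \<in> J" if "a \<in> J" "x \<in> carrier (mpol_ring K)" for a x
    using J_closed(4)[of x a] that by (simp add: mpol_ring_eq mult.commute)
qed (use J_closed J_sub mpols_closed(5) in \<open>auto simp: mpol_ring_eq\<close>)

lemma genideal_eq: "Idl\<^bsub>mpol_ring K\<^esub> ((\<lambda>i. int_coeffs (e i)) ` {1..n}) = J"
proof
  let ?E = "\<lambda>i. int_coeffs (e i) :: ('v, complex) mpol"
  have E: "?E i \<in> mpols K" if "i \<in> {1..n}" for i by (intro map_coeffs_in_mpols[OF rhf_of_int] e that)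
  have EJ: "?E i \<in> J" if "i \<in> {1..n}" for i unfolding J_def using lincomb_gen[OF mpols_sr that, of ?E] by simp
  show "Idl\<^bsub>mpol_ring K\<^esub> (?E ` {1..n}) \<subseteq> J"
    by (rule ring.genideal_minimal[OF ring_mpol_ring ideal_J]) (use EJ in blast)
  have sub: "?E ` {1..n} \<subseteq> carrier (mpol_ring K)" using E by (auto simp: mpol_ring_eq)
  note I = ring.genideal_ideal[OF ring_mpol_ring sub] and self = ring.genideal_self[OF ring_mpol_ring sub]
  have step: "H * ?E i \<in> Idl\<^bsub>mpol_ring K\<^esub> (?E ` {1..n})" if "H \<in> mpols K" "i \<in> {1..n}" for H i
    using ideal.I_l_closed[OF I, of "?E i" H] self that by (simp add: mpol_ring_eq image_subset_iff)
  show "J \<subseteq> Idl\<^bsub>mpol_ring K\<^esub> (?E ` {1..n})"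
  proof
    fix P assume "P \<in> J"
    then obtain H where H: "\<And>i. H i \<in> mpols K" "P = (\<Sum>i=1..n. H i * ?E i)"
      unfolding J_def lincomb_def by auto
    have "(\<Sum>i\<in>U. H i * ?E i) \<in> Idl\<^bsub>mpol_ring K\<^esub> (?E ` {1..n})" if "finite U" "U \<subseteq> {1..n}" for U
      using that
    proof (induction U rule: finite_induct)
      case empty
      then show ?case using additive_subgroup.zero_closed[OF ideal.axioms(1)[OF I]] by (simp add: mpol_ring_eq)
    next
      case (insert i U)
      then show ?case
        using additive_subgroup.a_closed[OF ideal.axioms(1)[OF I] step[OF H(1), of i]] by (simp add: mpol_ring_eq)
    qed
    then show "P \<in> Idl\<^bsub>mpol_ring K\<^esub> (?E ` {1..n})" unfolding H(2) by blast
  qed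
qed

definition Phi :: "('v, complex) mpol set \<Rightarrow> ('f \<times> complex \<Rightarrow>\<^sub>0 int) set" where
  "Phi U = the_elem (phi ` U)"

text \<open>The first isomorphism theorem for \<open>phi\<close>; equality of \<open>J\<close> with
  the vanishing ideal makes the coordinate ring the quotient by the kernel.\<close>

lemma Phi_iso:
  assumes "vanishing_ideal K V = J"
  shows "Phi \<in> calg_iso (coord_ring K V) (\<lambda>c. restr K V (mconst c)) T (pure_tensor (sub_ring A) type_ring 1)"
    "\<And>P. P \<in> mpols K \<Longrightarrow> Phi (restr K V P) = phi P"
proof -
  have iso: "Phi \<in> ring_iso (coord_ring K V) T"
    using ring_hom_ring.FactRing_iso_set[OF phi_ring_hom_ring phi_surj]
    unfolding Phi_def[abs_def] coord_ring_def phi_kernel assms .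
  show P: "Phi (restr K V P) = phi P" if "P \<in> mpols K" for P
    using ring_hom_ring.the_elem_simp[OF phi_ring_hom_ring, of P] that
    unfolding Phi_def restr_def phi_kernel assms by (simp add: mpol_ring_eq)
  show "Phi \<in> calg_iso (coord_ring K V) (\<lambda>c. restr K V (mconst c)) T (pure_tensor (sub_ring A) type_ring 1)"
    unfolding calg_iso_def using iso by (simp add: P phi_mconst)
qed

lemma phi_iso:
  assumes "J = {0}"
  shows "phi \<in> calg_iso (mpol_ring K) mconst T (pure_tensor (sub_ring A) type_ring 1)"
proof -
  have "inj_on phi (carrier (mpol_ring K))"
    by (rule ring_hom_ring.trivial_ker_imp_inj[OF phi_ring_hom_ring], unfold phi_kernel assms)
      (simp add: mpol_ring_eq)
  then have "phi \<in> ring_iso (mpol_ring K) T" using phi_hom phi_surj by (simp add: ring_iso_def bij_betw_def)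
  then show ?thesis by (simp add: calg_iso_def phi_mconst)
qed

lemma phi_eq_iff:
  assumes "P \<in> mpols K" "Q \<in> mpols K"
  shows "phi P = phi Q \<longleftrightarrow> P - Q \<in> J"
proof -
  have PQ: "P - Q \<in> mpols K" by (intro mpols_closed assms)
  have s: "sim (psi P) (psi (P - Q) + psi Q)" using psi_add[OF PQ assms(2)] by simp
  have "phi P = phi Q \<longleftrightarrow> sim (psi P) (psi Q)"
    unfolding phi_def by (rule coset_eq_iff[OF psi_in[OF assms(1)] psi_in[OF assms(2)]])
  also have "\<dots> \<longleftrightarrow> sim (psi (P - Q) + psi Q) (psi Q)" using sim_trans[OF s] sim_trans[OF sim_sym[OF s]] by blast
  also have "\<dots> \<longleftrightarrow> psi (P - Q) \<in> B" by (simp add: sim_def)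
  finally show ?thesis using psi_B_iff[OF PQ] by simp
qed

end

section \<open>Frieze points in terms of coordinates\<close>

lemma hom_on_ceval:
  assumes f: "hom_on (mpols K) f" and c: "\<And>c. f (mconst c) = (c::complex)" and P: "P \<in> mpols K"
  shows "f P = ceval (\<lambda>i. f (mvar i)) P"
  using P
proof (induction rule: mpols_induct)
  case zero
  then show ?case by (simp add: hom_on_zero[OF f])
next
  case (single m c)
  have v: "mvar i \<in> mpols K" if "i \<in> keys m" for i using single that by auto
  have "f (monom_val mvar m) = (\<Prod>i\<in>keys m. f (mvar i ^ lookup m i))"
    unfolding monom_val_def by (rule hom_on_prod[OF f]) (intro mpols_closed(7) v)
  also have "\<dots> = monom_val (\<lambda>i. f (mvar i)) m"
    unfolding monom_val_def by (intro prod.cong refl hom_on_power[OF f] v)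
  finally have m: "f (monom_val mvar m) = monom_val (\<lambda>i. f (mvar i)) m" .
  have mK: "monom_val mvar m \<in> mpols K" unfolding monom_val_def by (intro mpols_closed(7,9) v)
  have "single m c = mconst c * monom_val mvar m"
    using meval_mvar_self[of "single m c"] by (simp add: meval_single[OF rhf_mconst])
  then have "f (single m c) = c * monom_val (\<lambda>i. f (mvar i)) m"
    by (simp only: hom_on_mult[OF f mconst_in_mpols mK] m assms(2))
  then show ?case by (simp only: meval_single[OF rhf_id])
next
  case (add p q)
  then show ?case by (simp add: hom_on_add[OF f])
qed

lemma (in cluster_pattern) hom_positive:
  fixes k :: "'f \<Rightarrow> int"
  assumes k: "hom_on (ext_ring r l S) k" and t0: "t0 \<in> V"
    and pos: "\<And>i. i \<in> I \<Longrightarrow> k (u t0 i) > 0" and t: "t \<in> V" and i: "i \<in> I"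
  shows "k (u t i) > 0"
proof -
  have in_A: "u t i \<in> ext_ring r l S" if "t \<in> V" "i \<in> I" for t i
    by (rule ext_var_mem[OF cluster_pattern_axioms that])
  have "\<forall>i\<in>I. k (u t i) > 0" using t t0
  proof (induction t rule: tree_vertices_induct)
    case base
    then show ?case using pos by blast
  next
    case (step t j)
    note t = step(1) and j = step(2) and IH = step(3)
    have t': "tree_step j t \<in> V" by (rule tree_step_in_vertices[OF t j])
    have jI: "j \<in> I" using j by auto
    have mono: "k (\<Prod>i\<in>I. u t i ^ n i) > 0" for n :: "nat \<Rightarrow> nat"
    proof -
      have "k (\<Prod>i\<in>I. u t i ^ n i) = (\<Prod>i\<in>I. k (u t i ^ n i))"
        by (rule hom_on_prod[OF k]) (intro gr_closed(7) in_A t)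
      also have "\<dots> = (\<Prod>i\<in>I. k (u t i) ^ n i)" by (intro prod.cong refl hom_on_power[OF k] in_A t)
      also have "\<dots> > 0" by (intro prod_pos ballI zero_less_power) (use IH in blast)
      finally show ?thesis .
    qed
    have mono_in: "(\<Prod>i\<in>I. u t i ^ n i) \<in> ext_ring r l S" for n :: "nat \<Rightarrow> nat"
      by (intro gr_closed(7,9) in_A t)
    have "k (u t j) * k (u (tree_step j t) j) = k (u t j * u (tree_step j t) j)"
      by (rule hom_on_mult[OF k in_A[OF t jI] in_A[OF t' jI], symmetric])
    also have "\<dots> > 0"
      unfolding exchange[OF t j] using mono by (simp add: hom_on_add[OF k mono_in mono_in] add_pos_pos)
    finally have "k (u (tree_step j t) j) > 0" using IH jI zero_less_mult_pos by blast
    then show ?case using IH u_other[OF t j] by (metis (full_types))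
  qed
  then show ?thesis using i by blast
qed

locale cluster_model = cluster_pattern r l F S + tensor_model "ext_ring r l S" K g n e
  for r l and F :: "'f::field_char_0 set" and S and K :: "'v set" and g n e +
  fixes t0 and q :: "nat \<Rightarrow> ('v, int) mpol"
  assumes t0: "t0 \<in> tree_vertices r"
    and q: "\<And>i. i \<in> {1..r + l} \<Longrightarrow> q i \<in> mpols K"
      "\<And>i. i \<in> {1..r + l} \<Longrightarrow> meval of_int g (q i) = cluster_pattern.u r S t0 i"
    and g: "\<And>i. i \<in> K \<Longrightarrow> g i \<in> ext_cluster_vars r l S"
begin

lemma T_eq: "cluster_algebra_C r l S = T"
  by (simp add: cluster_algebra_C_def cluster_algebra_Z_eq)

lemma scalar_eq: "scalar_C r l S = pure_tensor (sub_ring (ext_ring r l S)) type_ring 1"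
  by (simp add: scalar_C_def cluster_algebra_Z_eq fun_eq_iff)

lemma elem_eq: "P \<in> mpols K \<Longrightarrow> elem_C r l S (meval of_int g P) = phi (int_coeffs P)"
  by (simp add: elem_C_def cluster_algebra_Z_eq phi_map_coeffs)

lemma phi_mvar: "i \<in> K \<Longrightarrow> phi (mvar i) = elem_C r l S (g i)"
  using elem_eq[of "mvar i"] by (simp add: map_coeffs_mvar[OF rhf_of_int])

lemma model_point:
  assumes v: "v \<in> spec_points (cluster_algebra_C r l S) (scalar_C r l S)" and P: "P \<in> mpols K"
  shows "v (phi P) = ceval (\<lambda>i\<in>K. v (phi (mvar i))) P"
proof -
  have vh: "v \<in> ring_hom T type_ring" and vc: "\<And>c. v (phi (mconst c)) = c"
    using v by (auto simp: spec_points_def T_eq scalar_eq phi_mconst)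
  have h: "v \<circ> phi \<in> ring_hom (mpol_ring K) type_ring" by (rule ring_hom_trans[OF phi_hom vh])
  have f: "hom_on (mpols K) (\<lambda>P. v (phi P))" unfolding hom_on_def
    using ring_hom_one[OF h] ring_hom_mult[OF h] ring_hom_add[OF h] mpols_sr by (simp add: mpol_ring_eq)
  have "v (phi P) = ceval (\<lambda>i. v (phi (mvar i))) P" by (rule hom_on_ceval[OF f vc P])
  also have "\<dots> = ceval (\<lambda>i\<in>K. v (phi (mvar i))) P" by (rule meval_cong[OF P]) simp
  finally show ?thesis .
qed

lemma phi_J: "P \<in> J \<Longrightarrow> phi P = \<zero>\<^bsub>T\<^esub>"
  using phi_kernel by (auto simp: a_kernel_def')

lemma frieze_point_conditions:
  assumes v: "v \<in> frieze_points r l S"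
  defines "z \<equiv> \<lambda>i\<in>K. v (phi (mvar i))"
  shows "z \<in> K \<rightarrow>\<^sub>E pos_ints" "P \<in> J \<Longrightarrow> ceval z P = 0"
    "i \<in> {1..r + l} \<Longrightarrow> 0 < Re (ceval z (int_coeffs (q i)))"
proof -
  have vs: "v \<in> spec_points (cluster_algebra_C r l S) (scalar_C r l S)"
    and vp: "\<And>x. x \<in> ext_cluster_vars r l S \<Longrightarrow> v (elem_C r l S x) \<in> pos_ints"
    using v by (auto simp: frieze_points_def)
  have vz: "v (phi P) = ceval z P" if "P \<in> mpols K" for P unfolding z_def by (rule model_point[OF vs that])
  show "z \<in> K \<rightarrow>\<^sub>E pos_ints" unfolding z_def using vp g by (auto simp: phi_mvar)
  have "v \<in> ring_hom T type_ring" using vs by (simp add: spec_points_def T_eq)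
  then have "v \<zero>\<^bsub>T\<^esub> = 0" using ring_hom_zero[OF _ ring_T ring_from_type_algebra] by fastforce
  then show "P \<in> J \<Longrightarrow> ceval z P = 0" using vz[of P] phi_J[of P] J_sub by auto
  assume i: "i \<in> {1..r + l}"
  have "u t0 i \<in> ext_cluster_vars r l S" unfolding ext_cluster_vars_eq using t0 i by blast
  then have "v (elem_C r l S (meval of_int g (q i))) \<in> pos_ints" using vp q(2)[OF i] by simp
  then show "0 < Re (ceval z (int_coeffs (q i)))"
    unfolding elem_eq[OF q(1)[OF i]] vz[OF map_coeffs_in_mpols[OF rhf_of_int q(1)[OF i]]] by (auto simp: pos_ints_def)
qed

lemma ceval_z_eq:
  assumes z0: "\<And>P. P \<in> J \<Longrightarrow> ceval z P = 0" and P: "P \<in> mpols K" "Q \<in> mpols K"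
    and eq: "meval of_int g P = meval of_int g Q"
  shows "ceval z (int_coeffs P) = ceval z (int_coeffs Q)"
proof -
  have "int_coeffs (P - Q) \<in> J"
    unfolding J_def by (rule ker) (use P eq in \<open>auto intro: mpols_closed\<close>)
  then have "ceval z (int_coeffs (P - Q)) = 0" by (rule z0)
  then show ?thesis by (simp add: hom_on_diff[OF map_coeffs_hom])
qed

text \<open>A point with integer coordinates that satisfies the relations defines, besides the
  complex point \<open>v\<close>, an integer-valued homomorphism \<open>k\<close> on the integral
  algebra. Positivity of \<open>k\<close> on the initial seed spreads over the tree by
  \<open>hom_positive\<close>, and \<open>v\<close> agrees with \<open>k\<close> on the extended
  cluster variables.\<close>

lemma frieze_point_of_conditions:
  assumes z: "z \<in> K \<rightarrow>\<^sub>E pos_ints" and z0: "\<And>P. P \<in> J \<Longrightarrow> ceval z P = 0"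
    and zq: "\<And>i. i \<in> {1..r + l} \<Longrightarrow> 0 < Re (ceval z (int_coeffs (q i)))"
  shows "\<exists>v\<in>frieze_points r l S. z = (\<lambda>i\<in>K. v (phi (mvar i)))"
proof -
  \<comment> \<open>Any polynomial representing the class may be evaluated, since elements of
    \<open>J\<close> vanish at \<open>z\<close>.\<close>
  define v where "v = (\<lambda>t\<in>carrier T. ceval z (SOME P. P \<in> mpols K \<and> phi P = t))"
  have phi_T: "phi P \<in> carrier T" if "P \<in> mpols K" for P
    using ring_hom_closed[OF phi_hom, of P] that by (simp add: mpol_ring_eq)
  have vphi: "v (phi P) = ceval z P" if P: "P \<in> mpols K" for P
  proof -
    define P' where "P' = (SOME Q. Q \<in> mpols K \<and> phi Q = phi P)"
    have "P' \<in> mpols K \<and> phi P' = phi P" unfolding P'_def by (rule someI[of _ P]) (simp add: P)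
    then have "ceval z (P' - P) = 0" using phi_eq_iff[OF _ P] z0 by blast
    then show ?thesis using phi_T[OF P] by (simp add: v_def P'_def)
  qed
  have rep: "\<exists>P\<in>mpols K. t = phi P" if "t \<in> carrier T" for t
    using that unfolding phi_surj[symmetric] by (auto simp: mpol_ring_eq)
  have hom: "phi (P * Q) = phi P \<otimes>\<^bsub>T\<^esub> phi Q" "phi (P + Q) = phi P \<oplus>\<^bsub>T\<^esub> phi Q"
    if "P \<in> mpols K" "Q \<in> mpols K" for P Q
    using ring_hom_mult[OF phi_hom, of P Q] ring_hom_add[OF phi_hom, of P Q] that by (simp_all add: mpol_ring_eq)
  have v_hom: "v \<in> ring_hom T type_ring"
  proof (rule ring_hom_memI)
    fix s t assume "s \<in> carrier T" "t \<in> carrier T"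
    then obtain P Q where P: "P \<in> mpols K" "s = phi P" and Q: "Q \<in> mpols K" "t = phi Q" using rep by meson
    show "v (s \<otimes>\<^bsub>T\<^esub> t) = v s \<otimes>\<^bsub>type_ring\<^esub> v t"
      unfolding P(2) Q(2) hom(1)[OF P(1) Q(1), symmetric]
      by (simp add: vphi[OF mpols_closed(4)[OF P(1) Q(1)]] vphi[OF P(1)] vphi[OF Q(1)])
    show "v (s \<oplus>\<^bsub>T\<^esub> t) = v s \<oplus>\<^bsub>type_ring\<^esub> v t"
      unfolding P(2) Q(2) hom(2)[OF P(1) Q(1), symmetric]
      by (simp add: vphi[OF mpols_closed(6)[OF P(1) Q(1)]] vphi[OF P(1)] vphi[OF Q(1)])
  next
    have "phi 1 = \<one>\<^bsub>T\<^esub>" using ring_hom_one[OF phi_hom] by (simp add: mpol_ring_eq)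
    then show "v \<one>\<^bsub>T\<^esub> = \<one>\<^bsub>type_ring\<^esub>" using vphi[OF mpols_closed(1)] by simp
  qed simp
  have v_spec: "v \<in> spec_points (cluster_algebra_C r l S) (scalar_C r l S)"
    unfolding spec_points_def T_eq scalar_eq using v_hom vphi[OF mconst_in_mpols] by (auto simp: v_def phi_mconst)
  have "\<forall>i\<in>K. \<exists>k::int. k > 0 \<and> z i = of_int k" using z by (auto simp: pos_ints_def PiE_iff)
  then obtain zi :: "'v \<Rightarrow> int" where zi: "\<And>i. i \<in> K \<Longrightarrow> z i = of_int (zi i)" by metis
  \<comment> \<open>The value does not depend on the lift, as relations vanish at \<open>z\<close>;
    this independence is what makes \<open>k\<close> a homomorphism.\<close>
  define k where "k a = meval (\<lambda>c. c) zi (lift a)" for a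
  have k: "of_int (k a) = ceval z (int_coeffs (lift a))" if "a \<in> ext_ring r l S" for a
  proof -
    have "of_int (k a) = meval of_int (\<lambda>i. of_int (zi i)) (lift a)" by (simp add: k_def meval_def)
    also have "\<dots> = meval of_int z (lift a)" by (rule meval_cong[OF lift(1)[OF that]]) (simp add: zi)
    finally show ?thesis unfolding meval_map_coeffs[OF rhf_of_int rhf_id] .
  qed
  have kP: "of_int (k a) = ceval z (int_coeffs P)" if "P \<in> mpols K" "meval of_int g P = a" for P a
  proof -
    have a: "a \<in> ext_ring r l S" using A_meval that by blast
    show ?thesis unfolding k[OF a] by (rule ceval_z_eq[OF z0 lift(1)[OF a] that(1)]) (simp_all add: lift(2)[OF a] that(2))
  qed
  have k_hom: "hom_on (ext_ring r l S) k" unfolding hom_on_def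
  proof (intro conjI ballI)
    show "is_subring (ext_ring r l S)" by (rule gen_ring_sr)
    have "of_int (k 1) = (1 :: complex)"
      using kP[OF mpols_closed(1), of 1] by (simp add: map_coeffs_one[OF rhf_of_int])
    then show "k 1 = 1" by simp
    fix a b assume a: "a \<in> ext_ring r l S" and b: "b \<in> ext_ring r l S"
    have "of_int (k (a + b)) = (of_int (k a + k b) :: complex)"
      using kP[OF mpols_closed(6)[OF lift(1)[OF a] lift(1)[OF b]], of "a + b"] lift(2)[OF a] lift(2)[OF b] k[OF a] k[OF b]
      by (simp add: hom_on_add[OF map_coeffs_hom])
    then show "k (a + b) = k a + k b" by (simp only: of_int_eq_iff)
    have "of_int (k (a * b)) = (of_int (k a * k b) :: complex)"
      using kP[OF mpols_closed(4)[OF lift(1)[OF a] lift(1)[OF b]], of "a * b"] lift(2)[OF a] lift(2)[OF b] k[OF a] k[OF b]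
      by (simp add: hom_on_mult[OF map_coeffs_hom])
    then show "k (a * b) = k a * k b" by (simp only: of_int_eq_iff)
  qed
  have k_pos: "k (u t0 i) > 0" if i: "i \<in> I" for i
  proof -
    have "Re (of_int (k (u t0 i))) > 0" unfolding kP[OF q[OF i]] by (rule zq[OF i])
    then show ?thesis by simp
  qed
  have "v (elem_C r l S x) \<in> pos_ints" if x_ext: "x \<in> ext_cluster_vars r l S" for x
  proof -
    have x: "x \<in> ext_ring r l S" by (rule gr_incl[OF x_ext])
    obtain t i where ti: "x = u t i" "t \<in> V" "i \<in> I" using x_ext unfolding ext_cluster_vars_eq by blast
    have "k x > 0" unfolding ti(1) by (rule hom_positive[OF k_hom t0 k_pos ti(2,3)])
    moreover have "v (elem_C r l S x) = of_int (k x)"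
      using elem_eq[OF lift(1)[OF x]] vphi[OF map_coeffs_in_mpols[OF rhf_of_int lift(1)[OF x]]]
      by (simp add: lift(2)[OF x] k[OF x])
    ultimately show ?thesis by (auto simp: pos_ints_def)
  qed
  then have "v \<in> frieze_points r l S" using v_spec by (simp add: frieze_points_def)
  moreover have "z = (\<lambda>i\<in>K. v (phi (mvar i)))"
  proof (rule extensionalityI[of _ K])
    show "z \<in> extensional K" using z by (simp add: PiE_def)
    show "z i = (\<lambda>i\<in>K. v (phi (mvar i))) i" if "i \<in> K" for i using that by (simp add: vphi)
  qed simp
  ultimately show ?thesis by blast
qed

theorem frieze_points_eq:
  assumes crd: "\<And>i. i \<in> K \<Longrightarrow> h (crd i) = phi (mvar i)"
  shows "frieze_points_in_model r l S K crd h =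
    {z \<in> K \<rightarrow>\<^sub>E pos_ints. (\<forall>P\<in>J. ceval z P = 0) \<and> (\<forall>i\<in>{1..r + l}. 0 < Re (ceval z (int_coeffs (q i))))}"
proof -
  have eq: "(\<lambda>v. \<lambda>i\<in>K. v (h (crd i))) = (\<lambda>v. \<lambda>i\<in>K. v (phi (mvar i)))"
    by (intro ext) (simp add: restrict_def crd)
  show ?thesis unfolding frieze_points_in_model_def eq
  proof (intro equalityI subsetI)
    fix z assume "z \<in> (\<lambda>v. \<lambda>i\<in>K. v (phi (mvar i))) ` frieze_points r l S"
    then obtain v where v: "v \<in> frieze_points r l S" "z = (\<lambda>i\<in>K. v (phi (mvar i)))" by blast
    show "z \<in> {z \<in> K \<rightarrow>\<^sub>E pos_ints. (\<forall>P\<in>J. ceval z P = 0) \<and> (\<forall>i\<in>{1..r + l}. 0 < Re (ceval z (int_coeffs (q i))))}"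
      unfolding v(2) using frieze_point_conditions[OF v(1)] by blast
  next
    fix z assume "z \<in> {z \<in> K \<rightarrow>\<^sub>E pos_ints. (\<forall>P\<in>J. ceval z P = 0) \<and> (\<forall>i\<in>{1..r + l}. 0 < Re (ceval z (int_coeffs (q i))))}"
    then have "\<exists>v\<in>frieze_points r l S. z = (\<lambda>i\<in>K. v (phi (mvar i)))"
      by (intro frieze_point_of_conditions) auto
    then show "z \<in> (\<lambda>v. \<lambda>i\<in>K. v (phi (mvar i))) ` frieze_points r l S" by blast
  qed
qed

lemma J_vanishes_iff: "(\<forall>P\<in>J. ceval z P = 0) \<longleftrightarrow> (\<forall>i\<in>{1..n}. ceval z (int_coeffs (e i)) = 0)"
proof
  assume "\<forall>P\<in>J. ceval z P = 0"
  moreover have "int_coeffs (e i) \<in> J" if "i \<in> {1..n}" for i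
    unfolding J_def using lincomb_gen[OF mpols_sr that, of "\<lambda>i. int_coeffs (e i)" K] by simp
  ultimately show "\<forall>i\<in>{1..n}. ceval z (int_coeffs (e i)) = 0" by blast
next
  assume *: "\<forall>i\<in>{1..n}. ceval z (int_coeffs (e i)) = 0"
  show "\<forall>P\<in>J. ceval z P = 0"
  proof
    fix P assume "P \<in> J"
    then show "ceval z P = 0" unfolding J_def by (rule lincomb_vanish[OF rhf_id]) (rule bspec[OF *])
  qed
qed

text \<open>\<open>JV\<close> expresses that the ring presented by the \<open>e i\<close> is
  reduced; the opposite inclusion holds because \<open>J\<close> is generated by the equations. When
  all initial variables are coordinates, positive integer coordinates already include positivity of
  the initial seed.\<close>

theorem coordinate_model:
  assumes Va: "Va = zero_locus K ((\<lambda>i. int_coeffs (e i)) ` {1..n})" and JV: "vanishing_ideal K Va \<subseteq> J"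
    and q_var: "\<forall>i\<in>{1..r + l}. \<exists>j\<in>K. q i = mvar j"
  shows "vanishing_ideal K Va = Idl\<^bsub>mpol_ring K\<^esub> ((\<lambda>i. int_coeffs (e i)) ` {1..n})"
    "Phi \<in> calg_iso (coord_ring K Va) (\<lambda>c. restr K Va (mconst c)) (cluster_algebra_C r l S) (scalar_C r l S)"
    "\<And>i. i \<in> K \<Longrightarrow> Phi (restr K Va (mvar i)) = elem_C r l S (g i)"
    "frieze_points_in_model r l S K (\<lambda>i. restr K Va (mvar i)) Phi = Va \<inter> (K \<rightarrow>\<^sub>E pos_ints)"
proof -
  have "J \<subseteq> vanishing_ideal K Va"
    using J_sub J_vanishes_iff unfolding vanishing_ideal_def Va zero_locus_def by blast
  then have eq: "vanishing_ideal K Va = J" using JV by blast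
  show "vanishing_ideal K Va = Idl\<^bsub>mpol_ring K\<^esub> ((\<lambda>i. int_coeffs (e i)) ` {1..n})"
    by (simp only: eq genideal_eq)
  show "Phi \<in> calg_iso (coord_ring K Va) (\<lambda>c. restr K Va (mconst c)) (cluster_algebra_C r l S) (scalar_C r l S)"
    unfolding T_eq scalar_eq by (rule Phi_iso(1)[OF eq])
  have P: "Phi (restr K Va (mvar i)) = phi (mvar i)" if "i \<in> K" for i by (rule Phi_iso(2)[OF eq]) (simp add: that)
  then show "Phi (restr K Va (mvar i)) = elem_C r l S (g i)" if "i \<in> K" for i using that by (simp add: phi_mvar)
  have qpos: "0 < Re (ceval z (int_coeffs (q i)))" if z: "z \<in> K \<rightarrow>\<^sub>E pos_ints" and i: "i \<in> {1..r + l}" for z i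
  proof -
    obtain j where j: "j \<in> K" "q i = mvar j" using q_var i by blast
    have "z j \<in> pos_ints" using z j(1) by (rule PiE_mem)
    then show ?thesis by (auto simp: j(2) map_coeffs_mvar[OF rhf_of_int] pos_ints_def)
  qed
  have V_iff: "z \<in> Va \<longleftrightarrow> (\<forall>P\<in>J. ceval z P = 0)" if "z \<in> K \<rightarrow>\<^sub>E pos_ints" for z
    unfolding J_vanishes_iff Va zero_locus_def using that by (auto simp: PiE_iff)
  show "frieze_points_in_model r l S K (\<lambda>i. restr K Va (mvar i)) Phi = Va \<inter> (K \<rightarrow>\<^sub>E pos_ints)"
  proof -
    have "frieze_points_in_model r l S K (\<lambda>i. restr K Va (mvar i)) Phi =
        {z \<in> K \<rightarrow>\<^sub>E pos_ints. (\<forall>P\<in>J. ceval z P = 0) \<and> (\<forall>i\<in>{1..r + l}. 0 < Re (ceval z (int_coeffs (q i))))}"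
      by (rule frieze_points_eq) (rule P)
    also have "\<dots> = Va \<inter> (K \<rightarrow>\<^sub>E pos_ints)" using qpos V_iff by blast
    finally show ?thesis .
  qed
qed

end

context gcm
begin

lemma map_coeffs_eqn:
  assumes h: "rh_fun h"
  shows "map_coeffs h (eqn Y i) = eqn Y i"
proof -
  note hom = hom_on_map_coeffs[OF h]
  have "map_coeffs h (earlier (\<lambda>j. mvar (Xc j)) i) = earlier (\<lambda>j. map_coeffs h (mvar (Xc j))) i"
    by (rule hom_earlier[OF hom]) simp
  moreover have "map_coeffs h (later (\<lambda>j. mvar (Xc j)) i) = later (\<lambda>j. map_coeffs h (mvar (Xc j))) i"
    by (rule hom_later[OF hom]) simp
  ultimately show ?thesis
    by (simp add: eqn_def rhs_def hom_on_diff[OF hom] hom_on_mult[OF hom] hom_on_add[OF hom] map_coeffs_mvar[OF h]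
        map_coeffs_one[OF h])
qed

text \<open>The locus contains the lower points with positive real coordinates, and these already
  detect the ideal of the exchange relations.\<close>

lemma vanishing_ideal_lower_bound:
  assumes Y: "Y \<subseteq> {1..r}"
  shows "vanishing_ideal (coords 0 Y) (zero_locus (coords 0 Y) (eqn Y ` {1..r})) \<subseteq>
    lincomb (mpols (coords 0 Y)) r (eqn Y)"
proof
  fix P :: "(coord, complex) mpol"
  assume "P \<in> vanishing_ideal (coords 0 Y) (zero_locus (coords 0 Y) (eqn Y ` {1..r}))"
  then have P: "P \<in> mpols (coords 0 Y)" "\<And>v. v \<in> zero_locus (coords 0 Y) (eqn Y ` {1..r}) \<Longrightarrow> ceval v P = 0"
    by (auto simp: vanishing_ideal_def)
  have "\<exists>G. (\<forall>i. G i \<in> mpols (coords 0 Y)) \<and> P = (\<Sum>i=1..r. G i * eqn Y i)"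
  proof (rule vanishing_on_pos_points[OF Y P(1)])
    fix \<xi> \<eta> :: "nat \<Rightarrow> real"
    assume *: "\<And>i. \<xi> i > 0" "\<And>i. \<eta> i > 0" "\<And>i. i \<notin> Y \<Longrightarrow> \<eta> i = 1"
    let ?z = "\<lambda>v. complex_of_real (lower_point \<xi> \<eta> v)"
    have r: "ceval (restrict ?z (coords 0 Y)) Q = ceval ?z Q" if "Q \<in> mpols (coords 0 Y)" for Q
      by (rule meval_cong[OF that]) simp
    have "restrict ?z (coords 0 Y) \<in> zero_locus (coords 0 Y) (eqn Y ` {1..r})" unfolding zero_locus_def
    proof (intro CollectI conjI ballI)
      fix Q assume "Q \<in> (eqn Y ` {1..r} :: (coord, complex) mpol set)"
      then obtain i where i: "i \<in> {1..r}" "Q = eqn Y i" by blast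
      have "\<xi> i \<noteq> 0" using *(1)[of i] by simp
      then show "ceval (restrict ?z (coords 0 Y)) Q = 0"
        unfolding i(2) r[OF eqn_in[OF i(1)]] using *(3)[of i] by (intro eqn_vanishes i(1)) blast+
    qed simp
    then show "ceval ?z P = 0" using P(2) r[OF P(1)] by metis
  qed
  then show "P \<in> lincomb (mpols (coords 0 Y)) r (eqn Y)" unfolding lincomb_def by blast
qed

end

lemma (in lower_bound_polys) vanishing_ideal_V_triv: "vanishing_ideal W (V_triv r A) \<subseteq> bfz_ideal"
proof
  fix P assume "P \<in> vanishing_ideal W (V_triv r A)"
  then have P: "P \<in> mpols W" "\<And>v. v \<in> V_triv r A \<Longrightarrow> ceval v P = 0" by (auto simp: vanishing_ideal_def)
  show "P \<in> bfz_ideal"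
  proof (rule bfz_ideal_if_vanishing[OF P(1)])
    fix \<xi> :: "nat \<Rightarrow> real" assume \<xi>: "\<And>i. \<xi> i > 0"
    have r: "ceval (restrict (unit_point \<xi>) W) Q = ceval (unit_point \<xi>) Q" if "Q \<in> mpols W" for Q
      by (rule meval_cong[OF that]) simp
    have "restrict (unit_point \<xi>) W \<in> V_triv r A" unfolding V_triv_iff
    proof (intro conjI ballI)
      fix i assume i: "i \<in> {1..r}"
      have "bfz_p (restrict (unit_point \<xi>) W) i = ceval (restrict (unit_point \<xi>) W) (bfz_p mvar i)"
        by (simp only: meval_bfz_p[OF rhf_id] meval_id_simps)
      also have "\<dots> = bfz_p (unit_point \<xi>) i"
        unfolding r[OF bfz_p_in_mpols[OF i]] by (simp only: meval_bfz_p[OF rhf_id] meval_id_simps)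
      finally show "bfz_p (restrict (unit_point \<xi>) W) i = 1" using unit_point(2)[OF \<xi> i] by simp
    qed simp
    then show "ceval (unit_point \<xi>) P = 0" using P(2) r[OF P(1)] by metis
  qed
qed

section \<open>The models of the spectra\<close>

lemma Index_cases:
  fixes i r :: nat
  assumes "i \<in> {1..r + r}"
  obtains "i \<in> {1..r}" | j where "j \<in> {1..r}" "i = r + j"
proof (cases "i \<le> r")
  case True
  then show ?thesis using assms that(1) by simp
next
  case False
  then show ?thesis using assms by (intro that(2)[of "i - r"]) auto
qed

lemma (in cluster_pattern) ext_var_in: "t \<in> V \<Longrightarrow> i \<in> I \<Longrightarrow> u t i \<in> ext_cluster_vars r l S"
  unfolding ext_cluster_vars_eq by blast

theorem (in bfz_pattern) bfz_model:
  "\<exists>\<Phi> \<in> calg_iso (mpol_ring W) mconst (cluster_algebra_C r r S) (scalar_C r r S).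
     (\<forall>i\<in>{1..r}. \<Phi> (mvar i) = elem_C r r S (cluster (S t0) i) \<and>
        \<Phi> (mvar (r + i)) = elem_C r r S (cluster (S (coxeter_vertex r t0)) i) \<and>
        \<Phi> (bfz_poly r A i) = elem_C r r S (frozen (S t0) i)) \<and>
     frieze_points_in_model r r S W mvar \<Phi> =
       {z \<in> W \<rightarrow>\<^sub>E pos_ints. \<forall>i\<in>{1..r}. 0 < Re (ceval z (bfz_poly r A i))}"
proof -
  let ?z = "zvar (u t0)"
  define q :: "nat \<Rightarrow> (nat, int) mpol" where "q i = (if i \<le> r then mvar i else bfz_p mvar (i - r))" for i
  have w: "aindep W (u t0)" by (rule aindep_u[OF t0])
  have p: "bfz_p ?z i = u t0 (r + i)" if "i \<in> {1..r}" for i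
    by (rule bfz_p_zvar[OF that]) (use u_neq_0[OF t0, of i] that in auto)
  have zr: "?z i = u t0 i" "?z (r + i) = u (coxeter_vertex r t0) i" if "i \<in> {1..r}" for i
    using that by (simp_all only: zvar_simps cluster_coxeter_vertex)
  \<comment> \<open>The generators z are independent, so the list of relations is empty and
    \<open>J\<close> is trivial.\<close>
  interpret M: cluster_model r r F S W ?z 0 "\<lambda>_. 0" t0 q
  proof
    show "ext_ring r r S = gen_ring (?z ` W)" by (rule algebra_eq)
    show "int_coeffs P \<in> lincomb (mpols W) 0 (\<lambda>i. int_coeffs 0 :: (nat, complex) mpol)"
      if "P \<in> mpols W" "meval of_int ?z P = 0" for P
    proof -
      have "P = 0" by (rule aindepD[OF aindep_zvar[OF w] that])
      then show ?thesis by (simp add: map_coeffs_zero[OF rhf_of_int] lincomb_zero[OF mpols_sr])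
    qed
    show "t0 \<in> tree_vertices r" by (rule t0)
    show "q i \<in> mpols W" "meval of_int ?z (q i) = u t0 i" if "i \<in> W" for i
      by (rule Index_cases[OF that]; simp add: q_def bfz_p_in_mpols meval_bfz_p[OF rhf_of_int] p zr(1))+
    show "?z i \<in> ext_cluster_vars r r S" if "i \<in> W" for i
      using that by (rule Index_cases) (auto simp: zr t0 coxeter_vertex_in intro!: ext_var_in)
  qed (simp_all add: mpols_closed)
  have J0: "M.J = {0}" unfolding M.J_def lincomb_def by (auto intro!: exI[of _ "\<lambda>_. 0"] mpols_closed(2))
  have q_eq: "int_coeffs (q i) = (if i \<le> r then mvar i else bfz_poly r A (i - r))" for i
    by (simp add: q_def map_coeffs_mvar[OF rhf_of_int] map_coeffs_bfz_p[OF rhf_of_int] bfz_poly_eq)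
  show ?thesis
  proof (intro bexI[of _ M.phi] conjI ballI)
    show "M.phi \<in> calg_iso (mpol_ring W) mconst (cluster_algebra_C r r S) (scalar_C r r S)"
      unfolding M.T_eq M.scalar_eq by (rule M.phi_iso[OF J0])
    fix i assume i: "i \<in> {1..r}"
    then have iW: "i \<in> W" "r + i \<in> W" by auto
    show "M.phi (mvar i) = elem_C r r S (cluster (S t0) i)"
      unfolding M.phi_mvar[OF iW(1)] zr(1)[OF i] cluster_eq[OF i] ..
    show "M.phi (mvar (r + i)) = elem_C r r S (cluster (S (coxeter_vertex r t0)) i)"
      unfolding M.phi_mvar[OF iW(2)] zr(2)[OF i] cluster_eq[OF i] ..
    have "elem_C r r S (meval of_int ?z (q (r + i))) = M.phi (int_coeffs (q (r + i)))"
      by (rule M.elem_eq[OF M.q(1)[OF iW(2)]])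
    then show "M.phi (bfz_poly r A i) = elem_C r r S (frozen (S t0) i)"
      unfolding M.q(2)[OF iW(2)] q_eq frozen_eq[OF i] using i by simp
  next
    have qpos: "(\<forall>i\<in>W. 0 < Re (ceval z (int_coeffs (q i)))) \<longleftrightarrow> (\<forall>i\<in>{1..r}. 0 < Re (ceval z (bfz_poly r A i)))"
      if z: "z \<in> W \<rightarrow>\<^sub>E pos_ints" for z
    proof (intro iffI ballI)
      fix i assume *: "\<forall>i\<in>W. 0 < Re (ceval z (int_coeffs (q i)))" and i: "i \<in> {1..r}"
      then have "r + i \<in> W" by auto
      with * have "0 < Re (ceval z (int_coeffs (q (r + i))))" by blast
      then show "0 < Re (ceval z (bfz_poly r A i))" unfolding q_eq using i by simp
    next
      fix i assume *: "\<forall>i\<in>{1..r}. 0 < Re (ceval z (bfz_poly r A i))" and i: "i \<in> W"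
      have "z i \<in> pos_ints" by (rule PiE_mem[OF z i])
      then have zi: "0 < Re (z i)" by (auto simp: pos_ints_def)
      show "0 < Re (ceval z (int_coeffs (q i)))"
        using i by (rule Index_cases) (use * zi in \<open>simp_all add: q_eq\<close>)
    qed
    show "frieze_points_in_model r r S W mvar M.phi =
       {z \<in> W \<rightarrow>\<^sub>E pos_ints. \<forall>i\<in>{1..r}. 0 < Re (ceval z (bfz_poly r A i))}"
      unfolding M.frieze_points_eq[of M.phi mvar, OF refl] J0 using qpos by auto
  qed
qed

theorem (in prin_pattern) prin_model:
  "vanishing_ideal (prin_coords r) (V_prin r A) = Idl\<^bsub>mpol_ring (prin_coords r)\<^esub> (V_prin_eqs r A) \<and>
   (\<exists>\<Phi> \<in> calg_iso (coord_ring (prin_coords r) (V_prin r A)) (\<lambda>c. restr (prin_coords r) (V_prin r A) (mconst c))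
       (cluster_algebra_C r r S) (scalar_C r r S).
     (\<forall>i\<in>{1..r}. \<Phi> (restr (prin_coords r) (V_prin r A) (mvar (Xc i))) = elem_C r r S (cluster (S t0) i) \<and>
        \<Phi> (restr (prin_coords r) (V_prin r A) (mvar (Xc' i))) = elem_C r r S (cluster (S (tree_step i t0)) i) \<and>
        \<Phi> (restr (prin_coords r) (V_prin r A) (mvar (Yc i))) = elem_C r r S (frozen (S t0) i)) \<and>
     frieze_points_in_model r r S (prin_coords r) (\<lambda>i. restr (prin_coords r) (V_prin r A) (mvar i)) \<Phi> =
       V_prin r A \<inter> (prin_coords r \<rightarrow>\<^sub>E pos_ints))"
proof -
  let ?K = "coords 0 {1..r}" and ?e = "eqn {1..r} :: nat \<Rightarrow> (coord, int) mpol"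
  define q :: "nat \<Rightarrow> (coord, int) mpol" where "q i = mvar (if i \<le> r then Xc i else Yc (i - r))" for i
  have me: "int_coeffs (?e i) = (eqn {1..r} i :: (coord, complex) mpol)" for i by (rule map_coeffs_eqn[OF rhf_of_int])
  have K: "Xc i \<in> ?K" "Xc' i \<in> ?K" "Yc i \<in> ?K" if "i \<in> {1..r}" for i using that by (auto simp: coords_def)
  have q_var: "\<forall>i\<in>W. \<exists>j\<in>?K. q i = mvar j"
  proof
    fix i assume "i \<in> W"
    then show "\<exists>j\<in>?K. q i = mvar j" by (rule Index_cases) (auto simp: q_def intro!: K)
  qed
  interpret M: cluster_model r r F S ?K gens r ?e t0 q
  proof
    show "ext_ring r r S = gen_ring (gens ` ?K)" by (rule algebra_eq)
    show "?e i \<in> mpols ?K" if "i \<in> {1..r}" for i by (rule eqn_in[OF that])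
    show "meval of_int gens (?e i) = 0" if "i \<in> {1..r}" for i
      unfolding gens_def by (rule lower_point_eqn[OF that]) (use u_neq_0[OF t0, of i] that in auto)
    show "int_coeffs P \<in> lincomb (mpols ?K) r (\<lambda>i. int_coeffs (?e i) :: (coord, complex) mpol)"
      if "P \<in> mpols ?K" "meval of_int gens P = 0" for P unfolding me by (rule kernel[OF that])
    show "t0 \<in> tree_vertices r" by (rule t0)
    show "q i \<in> mpols ?K" if "i \<in> W" for i using bspec[OF q_var that] by auto
    show "meval of_int gens (q i) = u t0 i" if "i \<in> W" for i
      using that by (rule Index_cases) (simp_all add: q_def gens_simps)
    show "gens v \<in> ext_cluster_vars r r S" if "v \<in> ?K" for v
      using that t0 tree_step_in_vertices[OF t0] by (auto simp: coords_def gens_simps intro!: ext_var_in)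
  qed
  have JV: "vanishing_ideal ?K (V_prin r A) \<subseteq> M.J"
    unfolding V_prin_def coords_eqs model_eqs M.J_def me by (rule vanishing_ideal_lower_bound[OF subset_refl])
  have V: "V_prin r A = zero_locus ?K ((\<lambda>i. int_coeffs (?e i)) ` {1..r})"
    unfolding V_prin_def coords_eqs model_eqs me ..
  note model = M.coordinate_model[OF V JV q_var, unfolded me, folded model_eqs, folded coords_eqs]
  show ?thesis
  proof (intro conjI bexI[of _ M.Phi] ballI)
    fix i assume i: "i \<in> {1..r}"
    note Ki = K[OF i, folded coords_eqs]
    show "M.Phi (restr (prin_coords r) (V_prin r A) (mvar (Xc i))) = elem_C r r S (cluster (S t0) i)"
      unfolding model(3)[OF Ki(1)] gens_simps cluster_eq[OF i] ..
    show "M.Phi (restr (prin_coords r) (V_prin r A) (mvar (Xc' i))) = elem_C r r S (cluster (S (tree_step i t0)) i)"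
      unfolding model(3)[OF Ki(2)] gens_simps(3)[OF i] cluster_eq[OF i] ..
    show "M.Phi (restr (prin_coords r) (V_prin r A) (mvar (Yc i))) = elem_C r r S (frozen (S t0) i)"
      unfolding model(3)[OF Ki(3)] gens_simps frozen_eq[OF i] ..
  qed (rule model(1) model(2) model(4))+
qed

context triv_pattern
begin

theorem W_triv_model:
  assumes prin: "prin_pattern r A F' S' t0"
  shows "vanishing_ideal (W_triv_coords r) (W_triv r A) = Idl\<^bsub>mpol_ring (W_triv_coords r)\<^esub> (W_triv_eqs r A) \<and>
   (\<exists>\<Phi> \<in> calg_iso (coord_ring (W_triv_coords r) (W_triv r A)) (\<lambda>c. restr (W_triv_coords r) (W_triv r A) (mconst c))
       (cluster_algebra_C r 0 S) (scalar_C r 0 S).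
     (\<forall>i\<in>{1..r}. \<Phi> (restr (W_triv_coords r) (W_triv r A) (mvar (Xc i))) = elem_C r 0 S (cluster (S t0) i) \<and>
        \<Phi> (restr (W_triv_coords r) (W_triv r A) (mvar (Xc' i))) = elem_C r 0 S (cluster (S (tree_step i t0)) i)) \<and>
     frieze_points_in_model r 0 S (W_triv_coords r) (\<lambda>i. restr (W_triv_coords r) (W_triv r A) (mvar i)) \<Phi> =
       W_triv r A \<inter> (W_triv_coords r \<rightarrow>\<^sub>E pos_ints))"
proof -
  let ?K = "coords 0 {}" and ?e = "eqn {} :: nat \<Rightarrow> (coord, int) mpol" and ?g = "lower_point (u t0) (\<lambda>_. 1)"
  define q :: "nat \<Rightarrow> (coord, int) mpol" where "q i = mvar (Xc i)" for i
  have me: "int_coeffs (?e i) = (eqn {} i :: (coord, complex) mpol)" for i by (rule map_coeffs_eqn[OF rhf_of_int])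
  have K: "Xc i \<in> ?K" "Xc' i \<in> ?K" if "i \<in> {1..r}" for i using that by (auto simp: coords_def)
  have gX: "?g (Xc i) = u t0 i" for i by (simp add: lower_point_def)
  note gX' = algebra_eq_prin(2)[OF prin]
  have q_var: "\<forall>i\<in>{1..r + 0}. \<exists>j\<in>?K. q i = mvar j" by (auto simp: q_def intro!: K)
  interpret M: cluster_model r 0 F S ?K ?g r ?e t0 q
  proof
    show "ext_ring r 0 S = gen_ring (?g ` ?K)" by (rule algebra_eq_prin(1)[OF prin])
    show "?e i \<in> mpols ?K" if "i \<in> {1..r}" for i by (rule eqn_in[OF that])
    show "meval of_int ?g (?e i) = 0" if "i \<in> {1..r}" for i
      by (rule lower_point_eqn[OF that]) (use u_neq_0[OF t0, of i] that in auto)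
    show "int_coeffs P \<in> lincomb (mpols ?K) r (\<lambda>i. int_coeffs (?e i) :: (coord, complex) mpol)"
      if "P \<in> mpols ?K" "meval of_int ?g P = 0" for P unfolding me by (rule kernel_W[OF that])
    show "t0 \<in> tree_vertices r" by (rule t0)
    show "q i \<in> mpols ?K" if "i \<in> {1..r + 0}" for i using bspec[OF q_var that] by auto
    show "meval of_int ?g (q i) = u t0 i" if "i \<in> {1..r + 0}" for i by (simp add: q_def gX)
    show "?g v \<in> ext_cluster_vars r 0 S" if "v \<in> ?K" for v
      using that t0 tree_step_in_vertices[OF t0] by (auto simp: coords_def gX gX' intro!: ext_var_in)
  qed
  have JV: "vanishing_ideal ?K (W_triv r A) \<subseteq> M.J"
    unfolding W_triv_def coords_eqs model_eqs M.J_def me by (rule vanishing_ideal_lower_bound) simp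
  have V: "W_triv r A = zero_locus ?K ((\<lambda>i. int_coeffs (?e i)) ` {1..r})"
    unfolding W_triv_def coords_eqs model_eqs me ..
  note model = M.coordinate_model[OF V JV q_var, unfolded me, folded model_eqs, folded coords_eqs]
  show ?thesis
  proof (intro conjI bexI[of _ M.Phi] ballI)
    fix i assume i: "i \<in> {1..r}"
    note Ki = K[OF i, folded coords_eqs]
    show "M.Phi (restr (W_triv_coords r) (W_triv r A) (mvar (Xc i))) = elem_C r 0 S (cluster (S t0) i)"
      unfolding model(3)[OF Ki(1)] gX cluster_eq[OF i] ..
    show "M.Phi (restr (W_triv_coords r) (W_triv r A) (mvar (Xc' i))) = elem_C r 0 S (cluster (S (tree_step i t0)) i)"
      unfolding model(3)[OF Ki(2)] gX'[OF i] cluster_eq[OF i] ..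
  qed (rule model(1) model(2) model(4))+
qed

theorem V_triv_model:
  assumes bfz: "bfz_pattern r A F' S' t0" and L: "lower_bound_polys r A G f"
  shows "vanishing_ideal W (V_triv r A) = Idl\<^bsub>mpol_ring W\<^esub> (V_triv_eqs r A) \<and>
   (\<exists>\<Phi> \<in> calg_iso (coord_ring W (V_triv r A)) (\<lambda>c. restr W (V_triv r A) (mconst c))
       (cluster_algebra_C r 0 S) (scalar_C r 0 S).
     (\<forall>i\<in>{1..r}. \<Phi> (restr W (V_triv r A) (mvar i)) = elem_C r 0 S (cluster (S t0) i) \<and>
        \<Phi> (restr W (V_triv r A) (mvar (r + i))) = elem_C r 0 S (cluster (S (coxeter_vertex r t0)) i)) \<and>
     frieze_points_in_model r 0 S W (\<lambda>i. restr W (V_triv r A) (mvar i)) \<Phi> =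
       V_triv r A \<inter> (W \<rightarrow>\<^sub>E pos_ints))"
proof -
  let ?e = "\<lambda>i. bfz_p mvar i - 1 :: (nat, int) mpol" and ?g = "zvar u1"
  have me: "int_coeffs (?e i) = (bfz_p mvar i - 1 :: (nat, complex) mpol)" for i
    by (simp add: hom_on_diff[OF hom_on_map_coeffs[OF rhf_of_int]] map_coeffs_bfz_p[OF rhf_of_int]
        map_coeffs_one[OF rhf_of_int])
  have g1: "?g i = u t0 i" if "i \<in> {1..r}" for i using that by (simp add: zvar_simps u1_simps)
  note g2 = algebra_eq_bfz(2)[OF bfz]
  have cox: "coxeter_vertex r t0 \<in> tree_vertices r" by (rule bfz_pattern.coxeter_vertex_in[OF bfz])
  have q_var: "\<forall>i\<in>{1..r + 0}. \<exists>j\<in>W. mvar i = (mvar j :: (nat, int) mpol)"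
  proof
    fix i assume "i \<in> {1..r + 0}"
    then show "\<exists>j\<in>W. mvar i = (mvar j :: (nat, int) mpol)" by (intro bexI[of _ i]) auto
  qed
  interpret M: cluster_model r 0 F S W ?g r ?e t0 mvar
  proof
    show "ext_ring r 0 S = gen_ring (?g ` W)" by (rule algebra_eq_bfz(1)[OF bfz])
    show "?e i \<in> mpols W" if "i \<in> {1..r}" for i by (intro mpols_closed bfz_p_in_mpols that)
    show "meval of_int ?g (?e i) = 0" if "i \<in> {1..r}" for i
    proof -
      have "u1 i \<noteq> 0" by (rule u1_simps(3)) (use that in auto)
      then have "bfz_p ?g i = 1" using bfz_p_zvar[OF that, of u1] u1_simps(2)[OF that] by simp
      then show ?thesis by (simp add: meval_bfz_p[OF rhf_of_int])
    qed
    show "int_coeffs P \<in> lincomb (mpols W) r (\<lambda>i. int_coeffs (?e i) :: (nat, complex) mpol)"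
      if "P \<in> mpols W" "meval of_int ?g P = 0" for P
      unfolding me using kernel_V[OF L that] unfolding bfz_ideal_def .
    show "t0 \<in> tree_vertices r" by (rule t0)
    show "mvar i \<in> mpols W" if "i \<in> {1..r + 0}" for i by (rule mvar_in_mpols) (use that in auto)
    show "meval of_int ?g (mvar i) = u t0 i" if "i \<in> {1..r + 0}" for i using g1[of i] that by simp
    show "?g i \<in> ext_cluster_vars r 0 S" if "i \<in> W" for i
      using that by (rule Index_cases) (auto simp: g1 g2 t0 cox intro!: ext_var_in)
  qed
  have V: "V_triv r A = zero_locus W ((\<lambda>i. int_coeffs (?e i)) ` {1..r})"
    unfolding V_triv_def model_eqs mult_2 me ..
  have JV: "vanishing_ideal W (V_triv r A) \<subseteq> M.J"
    using lower_bound_polys.vanishing_ideal_V_triv[OF L] unfolding M.J_def me bfz_ideal_def .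
  note model = M.coordinate_model[OF V JV q_var, unfolded me, folded model_eqs]
  show ?thesis
  proof (intro conjI bexI[of _ M.Phi] ballI)
    fix i assume i: "i \<in> {1..r}"
    then have iW: "i \<in> W" "r + i \<in> W" by auto
    show "M.Phi (restr W (V_triv r A) (mvar i)) = elem_C r 0 S (cluster (S t0) i)"
      unfolding model(3)[OF iW(1)] g1[OF i] cluster_eq[OF i] ..
    show "M.Phi (restr W (V_triv r A) (mvar (r + i))) = elem_C r 0 S (cluster (S (coxeter_vertex r t0)) i)"
      unfolding model(3)[OF iW(2)] g2[OF i] cluster_eq[OF i] ..
  qed (rule model(1) model(2) model(4))+
qed

end

theorem theorem1p4:
  fixes r :: nat and A :: "nat \<Rightarrow> nat \<Rightarrow> int" and t0 :: "nat list"
    and F\<^sub>B :: "'f::field_char_0 set" and S\<^sub>B :: "nat list \<Rightarrow> 'f seed"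
    and F\<^sub>P :: "'g::field_char_0 set" and S\<^sub>P :: "nat list \<Rightarrow> 'g seed"
    and F\<^sub>T :: "'h::field_char_0 set" and S\<^sub>T :: "nat list \<Rightarrow> 'h seed"
  assumes A: "symmetrizable_GCM r A" and t0: "t0 \<in> tree_vertices r"
    and BFZ: "seed_pattern r r F\<^sub>B S\<^sub>B" "has_exmat r r (S\<^sub>B t0) (stack_mat r (B_mat A) (U_mat A))"
    and prin: "seed_pattern r r F\<^sub>P S\<^sub>P" "has_exmat r r (S\<^sub>P t0) (stack_mat r (B_mat A) I_mat)"
    and triv: "seed_pattern r 0 F\<^sub>T S\<^sub>T" "has_exmat r 0 (S\<^sub>T t0) (B_mat A)"
  shows "(\<exists>\<Phi> \<in> calg_iso (mpol_ring {1..2*r}) mconst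
              (cluster_algebra_C r r S\<^sub>B) (scalar_C r r S\<^sub>B).
        (\<forall>i\<in>{1..r}.
           \<Phi> (mvar i) = elem_C r r S\<^sub>B (cluster (S\<^sub>B t0) i) \<and>
           \<Phi> (mvar (r + i)) = elem_C r r S\<^sub>B (cluster (S\<^sub>B (coxeter_vertex r t0)) i) \<and>
           \<Phi> (bfz_poly r A i) = elem_C r r S\<^sub>B (frozen (S\<^sub>B t0) i)) \<and>
        frieze_points_in_model r r S\<^sub>B {1..2*r} mvar \<Phi> =
          {z \<in> {1..2*r} \<rightarrow>\<^sub>E pos_ints. \<forall>i\<in>{1..r}. 0 < Re (ceval z (bfz_poly r A i))}) \<and>
     (vanishing_ideal (prin_coords r) (V_prin r A) = Idl\<^bsub>mpol_ring (prin_coords r)\<^esub> (V_prin_eqs r A) \<and>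
     (\<exists>\<Phi> \<in> calg_iso (coord_ring (prin_coords r) (V_prin r A))
              (\<lambda>c. restr (prin_coords r) (V_prin r A) (mconst c))
              (cluster_algebra_C r r S\<^sub>P) (scalar_C r r S\<^sub>P).
        (\<forall>i\<in>{1..r}.
           \<Phi> (restr (prin_coords r) (V_prin r A) (mvar (Xc i)))
             = elem_C r r S\<^sub>P (cluster (S\<^sub>P t0) i) \<and>
           \<Phi> (restr (prin_coords r) (V_prin r A) (mvar (Xc' i)))
             = elem_C r r S\<^sub>P (cluster (S\<^sub>P (tree_step i t0)) i) \<and>
           \<Phi> (restr (prin_coords r) (V_prin r A) (mvar (Yc i)))
             = elem_C r r S\<^sub>P (frozen (S\<^sub>P t0) i)) \<and>
        frieze_points_in_model r r S\<^sub>P (prin_coords r)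
            (\<lambda>i. restr (prin_coords r) (V_prin r A) (mvar i)) \<Phi> =
          V_prin r A \<inter> (prin_coords r \<rightarrow>\<^sub>E pos_ints))) \<and>
     (vanishing_ideal {1..2*r} (V_triv r A) = Idl\<^bsub>mpol_ring {1..2*r}\<^esub> (V_triv_eqs r A) \<and>
     (\<exists>\<Phi> \<in> calg_iso (coord_ring {1..2*r} (V_triv r A))
              (\<lambda>c. restr {1..2*r} (V_triv r A) (mconst c))
              (cluster_algebra_C r 0 S\<^sub>T) (scalar_C r 0 S\<^sub>T).
        (\<forall>i\<in>{1..r}.
           \<Phi> (restr {1..2*r} (V_triv r A) (mvar i))
             = elem_C r 0 S\<^sub>T (cluster (S\<^sub>T t0) i) \<and>
           \<Phi> (restr {1..2*r} (V_triv r A) (mvar (r + i)))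
             = elem_C r 0 S\<^sub>T (cluster (S\<^sub>T (coxeter_vertex r t0)) i)) \<and>
        frieze_points_in_model r 0 S\<^sub>T {1..2*r}
            (\<lambda>i. restr {1..2*r} (V_triv r A) (mvar i)) \<Phi> =
          V_triv r A \<inter> ({1..2*r} \<rightarrow>\<^sub>E pos_ints))) \<and>
     (vanishing_ideal (W_triv_coords r) (W_triv r A)
       = Idl\<^bsub>mpol_ring (W_triv_coords r)\<^esub> (W_triv_eqs r A) \<and>
     (\<exists>\<Phi> \<in> calg_iso (coord_ring (W_triv_coords r) (W_triv r A))
              (\<lambda>c. restr (W_triv_coords r) (W_triv r A) (mconst c))
              (cluster_algebra_C r 0 S\<^sub>T) (scalar_C r 0 S\<^sub>T).
        (\<forall>i\<in>{1..r}.
           \<Phi> (restr (W_triv_coords r) (W_triv r A) (mvar (Xc i)))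
             = elem_C r 0 S\<^sub>T (cluster (S\<^sub>T t0) i) \<and>
           \<Phi> (restr (W_triv_coords r) (W_triv r A) (mvar (Xc' i)))
             = elem_C r 0 S\<^sub>T (cluster (S\<^sub>T (tree_step i t0)) i)) \<and>
        frieze_points_in_model r 0 S\<^sub>T (W_triv_coords r)
            (\<lambda>i. restr (W_triv_coords r) (W_triv r A) (mvar i)) \<Phi> =
          W_triv r A \<inter> (W_triv_coords r \<rightarrow>\<^sub>E pos_ints))) \<and>
     varieties_isomorphic {1..2*r} (V_triv r A) (W_triv_coords r) (W_triv r A)"
proof -
  interpret gcm r A by unfold_locales (rule A)
  have bfz: "bfz_pattern r A F\<^sub>B S\<^sub>B t0" by unfold_locales (rule BFZ t0)+
  have prn: "prin_pattern r A F\<^sub>P S\<^sub>P t0" by unfold_locales (rule prin t0)+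
  have trv: "triv_pattern r A F\<^sub>T S\<^sub>T t0" by unfold_locales (rule triv t0)+
  \<comment> \<open>The maps between \<open>V_triv\<close> and \<open>W_triv\<close> are built from
    an independent family of size \<open>2 * r\<close>, which the initial seed of the BFZ pattern
    supplies.\<close>
  have w: "aindep W (cluster_pattern.u r S\<^sub>B t0)"
    by (rule cluster_pattern.aindep_u[OF _ t0]) (unfold_locales, rule BFZ(1))
  obtain G f where Gf: "lower_bound_polys r A G f"
  proof (rule lower_bound_polynomials[OF w])
    fix G :: "nat \<Rightarrow> (nat, complex) mpol" and f :: "nat \<Rightarrow> (coord, complex) mpol"
    assume *: "\<And>k. k \<in> {1..r} \<Longrightarrow> G k \<in> mpols W"
      "\<And>k. k \<in> {1..r} \<Longrightarrow> f k \<in> mpols (coords 0 {})"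
      "\<And>k. k \<in> {1..r} \<Longrightarrow> mvar k * G k - (earlier mvar k + later mvar k) \<in> bfz_ideal"
      "\<And>k. k \<in> {1..r} \<Longrightarrow> mvar (r + k) - meval mconst (coord_subst mvar G (\<lambda>_. 1)) (f k) \<in> bfz_ideal"
    show ?thesis by (rule that[of G f]) (unfold_locales, (rule *, assumption)+)
  qed
  note triv_models = triv_pattern.V_triv_model[OF trv bfz Gf] triv_pattern.W_triv_model[OF trv prn]
    lower_bound_polys.varieties_isomorphic_triv[OF Gf, unfolded mult_2]
  show ?thesis unfolding mult_2
    by (rule conjI[OF bfz_pattern.bfz_model[OF bfz] conjI[OF prin_pattern.prin_model[OF prn]
          conjI[OF triv_models(1) conjI[OF triv_models(2,3)]]]])
qed

end
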